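(* Assume that $A$, $Q$ and $f$ satisfy conditions (A), (A'), (Q) and $(f_0)$–$(f_4)$ listed in the context. Then there exists $\bar\mu\in(0,1]$ (depending on $N,A,Q,f$ and the constants in these conditions) such that, for every $\mu_0\in(0,\bar\mu)$, if conditions (Q') and $(f_5)$ hold with this value of $\mu_0$, then the equation $$-\mathrm{div}\left(A(|x|)|\nabla u|^{N-2}\nabla u\right)=C_N\left(\log\frac1{|x|}\ast Q(|x|)F(u)\right)Q(|x|)f(u)\quad\text{in }\mathbb R^N$$ has a positive radially symmetric weak solution $u\in E_{\rm rad}$ such that $$\left|\int_{\mathbb R^N}\left(\log\frac1{|\cdot|}\ast QF(u)\right)QF(u)\,dx\right|<+\infty.$$
   Context: $N\ge2$ is an integer; $C_N^{-1}:=2^{N-1}\pi^{N/2}\Gamma(N/2)$; $\omega_{N-1}$ is the measure of the unit sphere of $\mathbb R^N$; $B_r(0)$ is the ball of radius $r$ centred at $0$. $A,Q$ are functions on $(0,\infty)$ and $A(x):=A(|x|)$, $Q(x):=Q(|x|)$ for $x\in\mathbb R^N$. $f:\mathbb R\to\mathbb R$ is continuous, differentiable on $(0,\infty)$, and $F(s):=\int_0^sf(t)\,dt$. Conditions on the weights: (A) $A:(0,\infty)\to\mathbb R$ is continuous, $\liminf_{r\to0^+}A(r)>0$, and there are $A_0,\ell>0$ with $A(r)\ge A_0r^\ell$ for all $r>0$. (A') There exist $r_0>0$ and $L>0$ with $A_0(1+|x|^\ell)\le A(|x|)\le A_0(1+|x|^L)$ for all $x\in B_{r_0}(0)$, with $A_0,\ell$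 as in (A). (Q) $Q:(0,\infty)\to(0,\infty)$ is continuous and there are $b_0,b>-N$ with $\limsup_{r\to0^+}Q(r)/r^{b_0}<+\infty$ and $\limsup_{r\to+\infty}Q(r)/r^{b}<+\infty$. (Q') $\liminf_{r\to0^+}Q(r)/r^{\tilde b_0}=C_Q>0$, where $\tilde b_0:=\max\{b_0,\,b_0(1-\frac{\mu_0}{2N})\}$. Set $\gamma:=\max\{N,\frac{(b-\ell+N)(N+1)}{\ell}+N\}$. Conditions on $f$: $(f_0)$ $f(t)>0$ for $t>0$ and $f(t)=0$ for $t\le0$. $(f_1)$ There is $\alpha_0>0$ such that $\lim_{t\to+\infty}f(t)e^{-\alpha t^{N/(N-1)}}$ equals $0$ for $\alpha>\alpha_0$ and $+\infty$ for $\alpha<\alpha_0$. $(f_2)$ There is $\tilde p>\gamma$ with $f(t)=o(t^{\tilde p-1})$ as $t\to0^+$. $(f_3)$ There are $\tau\in(1-\frac2N,1)$ and $C>0$ with $\tau\le\frac{F(t)f'(t)}{f^2(t)}\le C$ for all $t>0$. $(f_4)$ $\lim_{t\to+\infty}\frac{F(t)f'(t)}{f^2(t)}=1$ (equivalently $\lim_{t\to+\infty}\frac{d}{dt}\frac{F(t)}{f(t)}=0$). $(f_5)$ There are $\beta>0$ and $\lambda\in(0,1+\frac N{N-1}]$ with $\lim_{t\to+\infty}t^\lambda f(t)F(t)e^{-2\alpha_0t^{N/(N-1)}}\ge\beta>\beta_0$, where $\beta_0=0$ if $\lambda<1+\frac N{N-1}$, while if $\lambda=1+\frac N{N-1}$,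 $$\beta_0:=\frac{A_0}{\omega_{N-1}}\,\frac{2(\tilde b_0+N)^{N+2}}{\alpha_0^NC_NC_Q^2\,\rho^{2(\tilde b_0+N)}}\,e^{\frac{2(\tilde b_0+N)\rho^L}{(N-1)L}},\qquad\rho:=\min\{\tfrac14,r_0,r_Q\},$$ with $r_Q>0$ a radius such that $Q(x)\ge C_Q|x|^{\tilde b_0}$ for $0<|x|<r_Q$. Function space: $E$ is the space of all (weakly differentiable) $u\in L^N_{loc}(\mathbb R^N)$ with $\int_{\mathbb R^N}A(|x|)|\nabla u|^N\,dx<+\infty$ that are limits (in $L^N_{loc}$ and in the norm below) of functions in $C_0^\infty(\mathbb R^N)$, with norm $\|u\|:=\left(\int_{\mathbb R^N}A(|x|)|\nabla u|^N\,dx\right)^{1/N}$; $E_{\rm rad}$ is its subspace of radially symmetric functions. A weak solution of the equation is $u\in E$ such that for all $\varphi\in E$ $$\int_{\mathbb R^N}A(x)|\nabla u|^{N-2}\nabla u\cdot\nabla\varphi\,dx=C_N\int_{\mathbb R^N}\left(\int_{\mathbb R^N}\log\frac1{|x-y|}Q(y)F(u(y))\,dy\right)Q(x)f(u(x))\varphi(x)\,dx.$$ *)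

theory Defs
  imports "HOL-Analysis.Analysis" "HOL-Library.Landau_Symbols"
begin

text \<open>
  The ambient space \<open>\<real>\<^sup>N\<close> is \<^typ>\<open>real^'n\<close>, with \<open>N = CARD('n)\<close>. Functions on
  \<open>(0,\<infinity>)\<close> are total functions whose values outside \<open>(0,\<infinity>)\<close> are never used, except on
  Lebesgue null sets (the origin) inside integrals.
\<close>

definition C_N :: "nat \<Rightarrow> real" where
  "C_N N = inverse (2 ^ (N - 1) * pi powr (real N / 2) * Gamma (real N / 2))"

text \<open>
  Surface measure on the unit sphere, as the cone measure: a subset \<open>S\<close> of the sphere has \<open>N\<close>
  times the volume of the cone that joins it to the origin (integration in polar coordinates).
\<close>
definition sphere_measure :: "(real^'n) set \<Rightarrow> real" where
  "sphere_measure S =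
     real CARD('n) * measure lebesgue {t *\<^sub>R x | t x. 0 \<le> t \<and> t \<le> 1 \<and> x \<in> S}"

primrec Ck :: "nat \<Rightarrow> (real^'n \<Rightarrow> real) \<Rightarrow> bool" where
  "Ck 0 g \<longleftrightarrow> continuous_on UNIV g"
| "Ck (Suc k) g \<longleftrightarrow> (\<forall>x. g differentiable (at x)) \<and>
     (\<forall>v. Ck k (\<lambda>x. frechet_derivative g (at x) v))"

definition test_fun :: "(real^'n \<Rightarrow> real) \<Rightarrow> bool" where
  "test_fun \<phi> \<longleftrightarrow> (\<forall>k. Ck k \<phi>) \<and> compact (closure {x. \<phi> x \<noteq> 0})"

definition locally_integrable :: "(real^'n \<Rightarrow> 'b::euclidean_space) \<Rightarrow> bool" where
  "locally_integrable g \<longleftrightarrow> (\<forall>K. compact K \<longrightarrow> set_integrable lebesgue K g)"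

definition has_weak_gradient :: "(real^'n \<Rightarrow> real) \<Rightarrow> (real^'n \<Rightarrow> real^'n) \<Rightarrow> bool" where
  "has_weak_gradient u v \<longleftrightarrow> locally_integrable u \<and> locally_integrable v \<and>
     (\<forall>\<phi> i. test_fun \<phi> \<longrightarrow>
        (\<integral>x. u x * frechet_derivative \<phi> (at x) (axis i 1) \<partial>lebesgue)
          = - (\<integral>x. v x $ i * \<phi> x \<partial>lebesgue))"

definition weakly_differentiable :: "(real^'n \<Rightarrow> real) \<Rightarrow> bool" where
  "weakly_differentiable u \<longleftrightarrow> (\<exists>v. has_weak_gradient u v)"

text \<open>Weak gradients are unique up to null sets; this picks a representative.\<close>
definition weak_gradient :: "(real^'n \<Rightarrow> real) \<Rightarrow> real^'n \<Rightarrow> real^'n" where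
  "weak_gradient u = (SOME v. has_weak_gradient u v)"

definition LN_loc :: "(real^'n \<Rightarrow> real) set" where
  "LN_loc = {u \<in> borel_measurable lebesgue.
     \<forall>K. compact K \<longrightarrow> set_integrable lebesgue K (\<lambda>x. \<bar>u x\<bar> ^ CARD('n))}"

definition finite_energy :: "(real \<Rightarrow> real) \<Rightarrow> (real^'n \<Rightarrow> real) \<Rightarrow> bool" where
  "finite_energy A u \<longleftrightarrow> weakly_differentiable u \<and>
     integrable lebesgue (\<lambda>x. A (norm x) * norm (weak_gradient u x) ^ CARD('n))"

definition E_norm :: "(real \<Rightarrow> real) \<Rightarrow> (real^'n \<Rightarrow> real) \<Rightarrow> real" where
  "E_norm A u =
     (\<integral>x. A (norm x) * norm (weak_gradient u x) ^ CARD('n) \<partial>lebesgue) powr (1 / real CARD('n))"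

definition E_space :: "(real \<Rightarrow> real) \<Rightarrow> (real^'n \<Rightarrow> real) set" where
  "E_space A = {u \<in> LN_loc. finite_energy A u \<and>
     (\<exists>\<phi> :: nat \<Rightarrow> real^'n \<Rightarrow> real.
        (\<forall>k. test_fun (\<phi> k) \<and> finite_energy A (\<phi> k)) \<and>
        (\<forall>K. compact K \<longrightarrow>
           (\<lambda>k. LINT x:K|lebesgue. \<bar>\<phi> k x - u x\<bar> ^ CARD('n)) \<longlonglongrightarrow> 0) \<and>
        (\<lambda>k. E_norm A (\<lambda>x. \<phi> k x - u x)) \<longlonglongrightarrow> 0)}"

text \<open>
  Elements of \<^term>\<open>E_space A\<close> are representatives of classes modulo null sets; radial symmetry
  is required pointwise, which selects a radial representative of the class.
\<close>
definition E_rad :: "(real \<Rightarrow> real) \<Rightarrow> (real^'n \<Rightarrow> real) set" where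
  "E_rad A = {u \<in> E_space A. \<forall>x y. norm x = norm y \<longrightarrow> u x = u y}"

definition primitive :: "(real \<Rightarrow> real) \<Rightarrow> real \<Rightarrow> real" where
  "primitive f s = (LBINT t=0..ereal s. f t)"

definition log_conv :: "(real^'n \<Rightarrow> real) \<Rightarrow> real^'n \<Rightarrow> real" where
  "log_conv h x = (\<integral>y. ln (1 / norm (x - y)) * h y \<partial>lebesgue)"

text \<open>
  Bochner integrals of non-integrable functions are \<open>0\<close> by convention, so the existence
  of every integral has to be stated separately.
\<close>
definition log_conv_exists :: "(real^'n \<Rightarrow> real) \<Rightarrow> bool" where
  "log_conv_exists h \<longleftrightarrow>
     (AE x in lebesgue. integrable lebesgue (\<lambda>y. ln (1 / norm (x - y)) * h y))"

definition weak_solution ::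
    "(real \<Rightarrow> real) \<Rightarrow> (real \<Rightarrow> real) \<Rightarrow> (real \<Rightarrow> real) \<Rightarrow> (real^'n \<Rightarrow> real) \<Rightarrow> bool" where
  "weak_solution A Q f u \<longleftrightarrow> u \<in> E_space A \<and>
     (let h = (\<lambda>y. Q (norm y) * primitive f (u y));
          lhs = (\<lambda>\<phi> x. A (norm x) * norm (weak_gradient u x) ^ (CARD('n) - 2)
                        * (weak_gradient u x \<bullet> weak_gradient \<phi> x));
          rhs = (\<lambda>\<phi> x. log_conv h x * Q (norm x) * f (u x) * \<phi> x)
      in log_conv_exists h \<and>
         (\<forall>\<phi> \<in> E_space A. integrable lebesgue (lhs \<phi>) \<and> integrable lebesgue (rhs \<phi>) \<and>
            (\<integral>x. lhs \<phi> x \<partial>lebesgue) = C_N CARD('n) * (\<integral>x. rhs \<phi> x \<partial>lebesgue)))"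

definition cond_A :: "(real \<Rightarrow> real) \<Rightarrow> real \<Rightarrow> real \<Rightarrow> bool" where
  "cond_A A A0 l \<longleftrightarrow> continuous_on {0<..} A \<and>
     Liminf (at_right 0) (\<lambda>r. ereal (A r)) > 0 \<and>
     A0 > 0 \<and> l > 0 \<and> (\<forall>r>0. A r \<ge> A0 * r powr l)"

definition cond_A' :: "(real \<Rightarrow> real) \<Rightarrow> real \<Rightarrow> real \<Rightarrow> real \<Rightarrow> real \<Rightarrow> bool" where
  "cond_A' A A0 l r0 L \<longleftrightarrow> r0 > 0 \<and> L > 0 \<and>
     (\<forall>r\<in>{0<..<r0}. A0 * (1 + r powr l) \<le> A r \<and> A r \<le> A0 * (1 + r powr L))"

definition cond_Q :: "nat \<Rightarrow> (real \<Rightarrow> real) \<Rightarrow> real \<Rightarrow> real \<Rightarrow> bool" where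
  "cond_Q N Q b0 b \<longleftrightarrow> continuous_on {0<..} Q \<and> (\<forall>r>0. Q r > 0) \<and>
     b0 > - real N \<and> b > - real N \<and>
     Limsup (at_right 0) (\<lambda>r. ereal (Q r / r powr b0)) < \<infinity> \<and>
     Limsup at_top (\<lambda>r. ereal (Q r / r powr b)) < \<infinity>"

definition b0_tilde :: "nat \<Rightarrow> real \<Rightarrow> real \<Rightarrow> real" where
  "b0_tilde N b0 \<mu>0 = max b0 (b0 * (1 - \<mu>0 / (2 * real N)))"

definition cond_Q' :: "nat \<Rightarrow> (real \<Rightarrow> real) \<Rightarrow> real \<Rightarrow> real \<Rightarrow> real \<Rightarrow> bool" where
  "cond_Q' N Q b0 \<mu>0 CQ \<longleftrightarrow> CQ > 0 \<and>
     Liminf (at_right 0) (\<lambda>r. ereal (Q r / r powr b0_tilde N b0 \<mu>0)) = ereal CQ"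

definition gamma_exp :: "nat \<Rightarrow> real \<Rightarrow> real \<Rightarrow> real" where
  "gamma_exp N b l =
     max (real N) ((b - l + real N) * (real N + 1) / l + real N)"

definition crit_exp :: "nat \<Rightarrow> real" where
  "crit_exp N = real N / (real N - 1)"

definition cond_f0 :: "(real \<Rightarrow> real) \<Rightarrow> bool" where
  "cond_f0 f \<longleftrightarrow> (\<forall>t>0. f t > 0) \<and> (\<forall>t\<le>0. f t = 0)"

definition cond_f1 :: "nat \<Rightarrow> (real \<Rightarrow> real) \<Rightarrow> real \<Rightarrow> bool" where
  "cond_f1 N f \<alpha>0 \<longleftrightarrow> \<alpha>0 > 0 \<and>
     (\<forall>\<alpha>>\<alpha>0. ((\<lambda>t. f t * exp (- \<alpha> * t powr crit_exp N)) \<longlongrightarrow> 0) at_top) \<and>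
     (\<forall>\<alpha><\<alpha>0. filterlim (\<lambda>t. f t * exp (- \<alpha> * t powr crit_exp N)) at_top at_top)"

definition cond_f2 :: "nat \<Rightarrow> (real \<Rightarrow> real) \<Rightarrow> real \<Rightarrow> real \<Rightarrow> real \<Rightarrow> bool" where
  "cond_f2 N f b l p \<longleftrightarrow> p > gamma_exp N b l \<and> f \<in> o[at_right 0](\<lambda>t. t powr (p - 1))"

definition cond_f3 :: "nat \<Rightarrow> (real \<Rightarrow> real) \<Rightarrow> real \<Rightarrow> real \<Rightarrow> bool" where
  "cond_f3 N f \<tau> C \<longleftrightarrow> 1 - 2 / real N < \<tau> \<and> \<tau> < 1 \<and> C > 0 \<and>
     (\<forall>t>0. \<tau> \<le> primitive f t * deriv f t / (f t)\<^sup>2 \<and>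
            primitive f t * deriv f t / (f t)\<^sup>2 \<le> C)"

definition cond_f4 :: "(real \<Rightarrow> real) \<Rightarrow> bool" where
  "cond_f4 f \<longleftrightarrow> ((\<lambda>t. primitive f t * deriv f t / (f t)\<^sup>2) \<longlongrightarrow> 1) at_top"

definition beta0_crit ::
    "nat \<Rightarrow> real \<Rightarrow> real \<Rightarrow> real \<Rightarrow> real \<Rightarrow> real \<Rightarrow> real \<Rightarrow> real \<Rightarrow> real" where
  "beta0_crit N \<omega> A0 \<alpha>0 CQ L bt \<rho> =
     A0 / \<omega> * (2 * (bt + real N) ^ (N + 2)
        / (\<alpha>0 ^ N * C_N N * CQ\<^sup>2 * \<rho> powr (2 * (bt + real N))))
      * exp (2 * (bt + real N) * \<rho> powr L / ((real N - 1) * L))"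

text \<open>
  \<open>\<omega>\<close> is the measure of the unit sphere and \<open>bt\<close> the exponent \<open>b0_tilde N b0 \<mu>0\<close>. The limit \<open>\<kappa>\<close>
  may be \<open>+\<infinity>\<close>. The radius \<open>rQ\<close> only enters the threshold for \<open>\<beta>\<close> in the borderline
  case \<open>lam = 1 + N/(N-1)\<close>, and need not exist otherwise.
\<close>
definition cond_f5 ::
    "nat \<Rightarrow> real \<Rightarrow> (real \<Rightarrow> real) \<Rightarrow> (real \<Rightarrow> real) \<Rightarrow> real \<Rightarrow> real \<Rightarrow> real \<Rightarrow> real \<Rightarrow> real \<Rightarrow> real \<Rightarrow> bool"
  where
  "cond_f5 N \<omega> Q f \<alpha>0 A0 r0 L bt CQ \<longleftrightarrow>
     (\<exists>\<beta>>0. \<exists>lam. \<exists>\<kappa> :: ereal. 0 < lam \<and> lam \<le> 1 + crit_exp N \<and>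
        ((\<lambda>t. ereal (t powr lam * f t * primitive f t * exp (- 2 * \<alpha>0 * t powr crit_exp N)))
           \<longlongrightarrow> \<kappa>) at_top \<and>
        \<kappa> \<ge> ereal \<beta> \<and>
        (lam = 1 + crit_exp N \<longrightarrow>
           (\<exists>rQ>0. (\<forall>r\<in>{0<..<rQ}. Q r \<ge> CQ * r powr bt) \<and>
              \<beta> > beta0_crit N \<omega> A0 \<alpha>0 CQ L bt (min (1/4) (min r0 rQ)))))"

end

(* If b0 < 0, the exponent of (Q') is strictly increasing in mu0, so (Q') determines mu0 and a smaller
   mu-bar makes the claim vacuous. Let b0 >= 0. In the variable
   t(r) = int_r^oo (om A(s) s^(N-1))^(-1/(N-1)) ds the energy of a radial function is int |U'(t)|^N dt,
   and Hoelder's inequality bounds |U(t)| by |U'|_N t^(1-1/N). Restricting U' to step functions on a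
   finite grid turns the functional into one on R^n, whose mountain pass geometry yields almost
   critical points by steepest descent; by (f5), tested with Moser functions, their level stays below
   the critical one. Testing with F/f, (f3) and (f4) bound the energy of (U - T)^+ by N times that
   level, so that Q f(u) has an integrable majorant and the nonlocal terms converge when the grid
   is refined. The limit satisfies |U'|^(N-2) U' = q with q the flux of the right-hand side through
   spheres; at a zero of U >= 0 the flux vanishes, hence U = 0 nearby, so U > 0. For an arbitrary
   test function the weak equation follows from Fubini's theorem along rays. *)
theory Submission
  imports Defs "HOL-Computational_Algebra.Polynomial"
begin

text \<open>The critical level \<open>mstar\<close> expresses one balance. In the variable
  \<open>tt\<close>, the mass of Q inside the ball \<open>tt\<close> >= t is at most of order
  exp(-ka (b0 + N) t), while U <= T + c t^(1/N') makes f(U) at most of order exp(alpha c^N' t) for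
  each alpha > al0; so al0 c^N' < ka (b0 + N) is the condition for a majorant. The constant T costs
  nothing in the exponent, and this is why only the truncation of U at T must have small energy. The
  slope 1 - F f'/f^2 of F/f explains how testing gives that: it is at most 1 - tau < 2/N everywhere,
  which bounds the whole energy, and it is arbitrarily small beyond a large T, which brings the
  truncated energy close to N times the level. One-dimensional Hoelder estimates thus take the place
  of a Trudinger-Moser inequality, and no functional on E is ever differentiated. The logarithm
  changes sign and is unbounded below at infinity; it is dominated by |z|^(-e) + |z|^e, and strict
  inequalities among the exponents leave room for these powers. For b0 >= 0 the exponent in (Q') is
  b0 whatever mu0 is, so mu-bar = 1 serves there.\<close>

abbreviation iB :: "real => 'a::real_normed_vector => 'b::zero_neq_one" where "iB R == indicator (cball 0 R)"
abbreviation ind :: "'a set => 'a => 'b::zero_neq_one" where "ind == indicator"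
abbreviation "IB == integrable lborel"
abbreviation "IL == integrable lebesgue"
abbreviation "BM == borel_measurable borel"
abbreviation "LM == borel_measurable lebesgue"
abbreviation lk :: "'a::real_normed_vector => 'a => real" where "lk x y == ln (1 / norm (x - y))"
abbreviation integral_lebesgue :: "('a::euclidean_space => 'b::{banach,second_countable_topology}) => 'b"
 (binder "LL " 60) where "integral_lebesgue f == integral\<^sup>L lebesgue f"
abbreviation nn_integral_lebesgue :: "('a::euclidean_space => ennreal) => ennreal"
 (binder "NL " 60) where "nn_integral_lebesgue f == nn_integral lebesgue f"
abbreviation nn_integral_lborel :: "('a::euclidean_space => ennreal) => ennreal"
 (binder "NB " 60) where "nn_integral_lborel f == nn_integral lborel f"
abbreviation tends_to :: "(nat => 'a::topological_space) => 'a => bool" (infix "---->" 60)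
 where "X ----> L == X \<longlonglongrightarrow> L"
abbreviation ev_seq :: "(nat => bool) => bool" (binder "EV " 10)
 where "ev_seq P == eventually P sequentially"
abbreviation "SL == integral\<^sup>L lebesgue"
abbreviation "SB == integral\<^sup>L lborel"
abbreviation scale_by :: "real => 'a::real_vector => 'a" (infixr "*R" 75) where "c *R x == c *\<^sub>R x"
abbreviation has_deriv :: "(real => real) => real => real filter => bool" (infix "hasd" 50)
 where "(f hasd d) F == (f has_real_derivative d) F"
abbreviation ev_top :: "(real => bool) => bool" (binder "EVT " 10) where "ev_top P == eventually P at_top"
lemma cball_borel [measurable]: "cball (a::'a::euclidean_space) r : sets borel" by simp
abbreviation inner_prod :: "'a::real_inner => 'a => real" (infixl ".*" 70) where "x .* y == x \<bullet> y"
lemmas ibound = Bochner_Integration.integrable_bound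
lemmas integrable_sum2 = Bochner_Integration.integrable_add
lemmas integral_sum2 = Bochner_Integration.integral_add
lemmas integrable_sub = Bochner_Integration.integrable_diff
lemmas integral_sub = Bochner_Integration.integral_diff

section \<open>Radial integrals and orthogonal invariance of Lebesgue measure\<close>

text \<open>Continuity is available at positive radii only; the remaining point, the origin, does
  not affect measurability.\<close>

lemma borel_measurable_restrict_pos:
 fixes g :: "real => real"
 assumes "continuous_on {0<..} g"
 shows "(%x::'a::euclidean_space. g (norm x)) : BM"
proof -
 have g: "set_borel_measurable borel {0<..} g"
  using assms unfolding set_borel_measurable_def by (intro borel_measurable_continuous_on_indicator) auto
 have "(%x::'a. ind {0<..} (norm x) *R g (norm x) + ind {0} x * g 0) : BM"
  using g unfolding set_borel_measurable_def by measurable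
 also have "(%x::'a. ind {0<..} (norm x) *R g (norm x) + ind {0} x * g 0) = (%x. g (norm x))"
  by (auto simp: fun_eq_iff indicator_def)
 finally show ?thesis .
qed

definition sph :: "'n::finite itself => real" where
 "sph _ = real CARD('n) * unit_ball_vol (real CARD('n))"

lemma sph_pos: "sph TYPE('n::finite) > 0"
 by (simp add: sph_def)

lemma sphere_measure_eq_sph: "sphere_measure (sphere (0::real^'n) 1) = sph TYPE('n)"
proof -
 have "{t *R x | t x. 0 <= t & t <= 1 & x : sphere (0::real^'n) 1} = cball 0 1"
 proof (intro equalityI subsetI)
  fix y :: "real^'n" assume y: "y : cball 0 1"
  show "y : {t *R x | t x. 0 <= t & t <= 1 & x : sphere (0::real^'n) 1}"
  proof (cases "y = 0")
   case True
   obtain x :: "real^'n" where "norm x = 1" using vector_choose_size[of 1] by auto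
   thus ?thesis using True by (intro CollectI exI[of _ 0] exI[of _ x]) auto
  next
   case False
   thus ?thesis using y
    by (intro CollectI exI[of _ "norm y"] exI[of _ "y /\<^sub>R norm y"]) auto
  qed
 qed auto
 thus ?thesis
  by (simp add: sphere_measure_def sph_def content_cball)
qed

lemma nn_integral_power_Icc:
 assumes "0 <= a" "0 < n" and that: "0 <= c"
 shows "(NB r. ennreal (real n * c * r ^ (n - 1)) * ind {0..a} r) = ennreal (c * a ^ n)"
proof -
 have "(NB r. ennreal (real n * c * r ^ (n - 1)) * ind {0..a} r) = ennreal (c * a ^ n - c * 0 ^ n)"
  using assms that
  by (intro nn_integral_FTC_Icc) (auto intro!: derivative_eq_intros)
 thus ?thesis using assms by (simp add: power_0_left)
qed

text \<open>The two measures agree on half-lines: a ball of radius a has a^N times the volume of the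
  unit ball, and the density is the derivative of that in a. This law of the norm is all that is
  needed of polar coordinates; no measure on the sphere enters.\<close>

lemma distr_norm_lborel:
 "distr (lborel :: (real^'n) measure) borel norm
  = density lborel (%r. ennreal (sph TYPE('n) * r ^ (CARD('n) - 1)) * ind {0..} r)" (is "?M = ?D")
proof (rule measure_eqI_generator_eq[where E="range (%a::real. {..a})" and \<Omega>=UNIV and A="%n. {..real n}"])
 show "Int_stable (range (%a::real. {..a}))"
  by (auto simp: Int_stable_def)
 fix X assume "X : range (%a::real. {..a})"
 then obtain a where X: "X = {..a}" by auto
 have 1: "norm -` {..a} = cball (0::real^'n) a" by auto
 show "emeasure ?M X = emeasure ?D X"
 proof (cases "a >= 0")
  case True
  have "emeasure ?D X = (NB r. ennreal (real CARD('n) * unit_ball_vol (real CARD('n)) * r ^ (CARD('n) - 1)) * ind {0..a} r)"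
   unfolding X by (subst emeasure_density) (auto intro!: nn_integral_cong simp: sph_def split: split_indicator)
  also have "... = ennreal (unit_ball_vol (real CARD('n)) * a ^ CARD('n))"
   using True by (intro nn_integral_power_Icc) auto
  finally show ?thesis using True unfolding X
   by (subst emeasure_distr) (auto simp: 1 emeasure_cball)
 next
  case False
  hence "emeasure ?D X = 0" unfolding X
   by (subst emeasure_density) (auto simp: nn_integral_0_iff_AE split: split_indicator)
  with False show ?thesis unfolding X by (subst emeasure_distr) (auto simp: 1)
 qed
next
 show "emeasure ?M {..real n} ~= \<infinity>" for n
  using emeasure_lborel_cball_finite[of "0::real^'n" "real n"]
  by (subst emeasure_distr) (auto simp: vimage_def cball_def)
 show "(\<Union>n. {..real n}) = (UNIV::real set)"
  using real_arch_simple by auto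
 show "sets ?M = sigma_sets UNIV (range (%a::real. {..a}))"
  by (simp add: borel_eq_atMost)
 show "sets ?D = sigma_sets UNIV (range (%a::real. {..a}))"
  by (simp add: borel_eq_atMost)
qed auto

lemma nn_integral_radial:
 fixes g :: "real => ennreal"
 assumes [measurable]: "g : BM"
 shows "(NB x. g (norm (x::real^'n)))
  = (NB r. ennreal (sph TYPE('n) * r ^ (CARD('n) - 1)) * g r * ind {0..} r)"
proof -
 have "(NB x. g (norm (x::real^'n))) = (\<integral>\<^sup>+r. g r \<partial>distr (lborel::(real^'n) measure) borel norm)"
  by (subst nn_integral_distr) auto
 also have "... = (NB r. ennreal (sph TYPE('n) * r ^ (CARD('n) - 1)) * g r * ind {0..} r)"
  unfolding distr_norm_lborel by (subst nn_integral_density) (auto intro!: nn_integral_cong simp: mult_ac)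
 finally show ?thesis .
qed

lemma
 fixes g :: "real => real"
 assumes [measurable]: "g : BM"
 shows integrable_radial: "IB (%x::real^'n. g (norm x)) \<longleftrightarrow>
   IB (%r. ind {0..} r * (sph TYPE('n) * r ^ (CARD('n) - 1) * g r))" (is ?th1)
  and integral_radial: "(LBINT x. g (norm (x::real^'n)))
  = (LBINT r. ind {0..} r * (sph TYPE('n) * r ^ (CARD('n) - 1) * g r))" (is ?th2)
proof -
 have D: "density lborel (%r. ennreal (sph TYPE('n) * r ^ (CARD('n) - 1)) * ind {0..} r) =
    density lborel (%r. ennreal (sph TYPE('n) * r ^ (CARD('n) - 1) * ind {0..} r))"
  by (intro arg_cong[where f="density lborel"] ext) (auto split: split_indicator)
 have 1: "AE r in lborel. 0 <= sph TYPE('n) * r ^ (CARD('n) - 1) * ind {0..} r"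
  using sph_pos[where 'n='n] by (intro AE_I2) (auto split: split_indicator)
 have "IB (%x::real^'n. g (norm x)) \<longleftrightarrow> integrable (distr (lborel::(real^'n) measure) borel norm) g"
  by (subst integrable_distr_eq) auto
 also have "... \<longleftrightarrow> IB (%r. ind {0..} r * (sph TYPE('n) * r ^ (CARD('n) - 1) * g r))"
  unfolding distr_norm_lborel D using 1
  by (subst integrable_density) (auto simp: mult_ac)
 finally show ?th1 .
 have "(LBINT x. g (norm (x::real^'n))) = integral\<^sup>L (distr (lborel::(real^'n) measure) borel norm) g"
  by (subst integral_distr) auto
 also have "... = (LBINT r. ind {0..} r * (sph TYPE('n) * r ^ (CARD('n) - 1) * g r))"
  unfolding distr_norm_lborel D using 1
  by (subst integral_density) (auto simp: mult_ac)
 finally show ?th2 .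
qed

text \<open>The uniqueness argument for Haar measure: by Fubini,
 \<open>vol (f\<^sup>-\<^sup>1 S) vol B = vol S vol (f\<^sup>-\<^sup>1 B)\<close> for all Borel \<open>S\<close> and \<open>B\<close>; take for \<open>B\<close> the unit ball.\<close>
lemma distr_lborel_orthogonal:
 fixes f :: "'a::euclidean_space => 'a"
 assumes "orthogonal_transformation f"
 shows "distr lborel borel f = lborel"
proof (rule measure_eqI)
 have lin: "linear f" and bij: "bij f" using assms
  by (auto simp: orthogonal_transformation_linear orthogonal_transformation_bij)
 have fm[measurable]: "f : BM"
  using lin by (intro borel_measurable_continuous_onI linear_continuous_on linear_conv_bounded_linear[THEN iffD1])
 define g where "g = inv f"
 have fg: "f (g y) = y" for y using bij by (simp add: g_def bij_is_surj surj_f_inv_f)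
 have shift: "(NB x. h (x + c)) = (NB x. h x)"
  if [measurable]: "h : BM" for h :: "'a => ennreal" and c
 proof -
  have "(NB x. h x) = (\<integral>\<^sup>+x. h x \<partial>distr lborel borel ((+) c))"
   by (simp add: lborel_distr_plus)
  also have "... = (NB x. h (c + x))" by (subst nn_integral_distr) auto
  finally show ?thesis by (simp add: add.commute)
 qed
 have refl: "(NB x. h (- x)) = (NB x. h x)"
  if [measurable]: "h : BM" for h :: "'a => ennreal"
 proof -
  have "(NB x. h x) = (\<integral>\<^sup>+x. h x \<partial>density (distr lborel borel (%x. 0 + (-1) *R x)) (%_. 1))"
   using lborel_affine[of "-1" "0::'a"] by simp
  also have "... = (NB x. h (- x))" by (simp add: density_1 nn_integral_distr)
  finally show ?thesis by simp
 qed
 interpret P: pair_sigma_finite "lborel::'a measure" "lborel::'a measure" ..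
 show "sets (distr lborel borel f) = sets lborel" by simp
 fix S assume "S : sets (distr lborel borel f)"
 hence S[measurable]: "S : sets borel" by simp
 define B :: "'a set" where "B = cball 0 1"
 have B[measurable]: "B : sets borel" by (simp add: B_def)
 let ?I = "NB x. (NB y. ind S (f x) * ind B (f x + y))" and ?m = "distr lborel borel f"
 have "?I
   = (\<integral>\<^sup>+x. ind S (f x) * emeasure lborel B \<partial>(lborel::'a measure))"
 proof (rule nn_integral_cong)
  fix x
  have "(NB y. ind B (f x + y)) = emeasure lborel B"
   using shift[of "ind B" "f x"] by (simp add: add.commute)
  thus "(NB y. ind S (f x) * ind B (f x + y)) = ind S (f x) * emeasure lborel B"
   by (subst nn_integral_cmult) auto
 qed
 also have "... = emeasure ?m S * emeasure lborel B"
  by (subst nn_integral_multc) (auto simp: nn_integral_distr[symmetric, of f lborel borel "ind S"])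
 finally have 1: "?I = emeasure ?m S * emeasure lborel B" .
 have "?I
   = (NB y. (NB x. ind S (f x) * ind B (f x + y)))"
  by (subst lborel_pair.Fubini') auto
 also have "... = (NB y. (NB x. ind S (f x - y) * ind B (f x)))"
 proof (rule nn_integral_cong)
  fix y
  have "f (x - g y) = f x - y" for x using lin by (simp add: linear_diff fg)
  thus "(NB x. ind S (f x) * ind B (f x + y)) = (NB x. ind S (f x - y) * ind B (f x))"
   using shift[of "%x. ind S (f x) * ind B (f x + y)" "- g y"] by simp
 qed
 also have "... = (NB x. (NB y. ind S (f x - y) * ind B (f x)))"
  by (subst lborel_pair.Fubini') auto
 also have "... = (\<integral>\<^sup>+x. ind B (f x) * emeasure lborel S \<partial>(lborel::'a measure))"
 proof (rule nn_integral_cong)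
  fix x
  have "(NB y. ind S (f x - y)) = emeasure lborel S"
   using shift[of "%y. ind S (- y)" "- f x"] refl[of "ind S"] by simp
  thus "(NB y. ind S (f x - y) * ind B (f x)) = ind B (f x) * emeasure lborel S"
   by (subst nn_integral_multc) (auto simp: mult.commute)
 qed
 also have "... = emeasure ?m B * emeasure lborel S"
  by (subst nn_integral_multc) (auto simp: nn_integral_distr[symmetric, of f lborel borel "ind B"])
 finally have 2: "emeasure ?m S * emeasure lborel B = emeasure ?m B * emeasure lborel S"
  using 1 by simp
 have "f -` B = B" unfolding B_def using assms by (auto simp: orthogonal_transformation_norm)
 hence 3: "emeasure ?m B = emeasure lborel B"
  by (subst emeasure_distr) auto
 have "emeasure lborel B ~= 0" "emeasure lborel B ~= \<infinity>"
  using unit_ball_vol_pos[of "real DIM('a)"] by (auto simp: B_def emeasure_cball ennreal_eq_0_iff not_le)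
 with 2 3 show "emeasure ?m S = emeasure lborel S"
  by (metis (no_types, lifting) ennreal_mult_cancel_left infinity_ennreal_def mult.commute top.not_eq_extremum)
qed

text \<open>For nonnegative functions the gauge integral and the Lebesgue integral agree, which
  makes explicit power integrals available.\<close>

lemma has_bochner_integral_lborel_nonneg:
 fixes f :: "real => real"
 assumes "(f has_integral I) S" "S : sets borel" "f : BM"
  and nn: "!!x. x : S ==> 0 <= f x"
 shows "has_bochner_integral lborel (%x. ind S x * f x) I"
proof (rule has_bochner_integral_nn_integral)
 have I: "((%x. ind S x * f x) has_integral I) UNIV"
 proof -
  have "(%x. ind S x * f x) = (%x. if x : S then f x else 0)" by (auto simp: indicator_def)
  thus ?thesis using assms(1) has_integral_restrict_UNIV[of S f I] by simp
 qed
 show "0 <= I" using assms by (intro has_integral_nonneg[OF assms(1)]) auto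
 show "(NB x. ennreal (ind S x * f x)) = ennreal I"
  using assms I by (intro nn_integral_has_integral_lborel) (auto split: split_indicator)
qed (use assms in "auto split: split_indicator")

section \<open>Power weights and the logarithmic potential\<close>

text \<open>The radial density r^(N-1) turns |x|^(s-N) into r^(s-1), which is integrable at 0 for s
  > 0.\<close>

lemma
 fixes R s :: real
 assumes "0 < s" "0 <= R"
 shows integrable_powr_cball: "IB (%x::real^'n. iB R x * norm x powr (s - real CARD('n)))"
  and integral_powr_cball: "(LBINT x. iB R x * norm (x::real^'n) powr (s - real CARD('n))) = sph TYPE('n) * R powr s / s"
proof -
 let ?n = "CARD('n)"
 let ?g = "%r. ind {..R} r * r powr (s - real ?n)"
 have 1: "(%x::real^'n. iB R x * norm x powr (s - real ?n)) = (%x. ?g (norm x))"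
  by (auto simp: fun_eq_iff split: split_indicator)
 have "((%r. r powr (s - 1)) has_integral (R powr s / s)) {0..R}"
  using has_integral_powr_from_0[of "s - 1" R] assms by simp
 from has_bochner_integral_lborel_nonneg[OF this]
 have 2: "has_bochner_integral lborel (%r. sph TYPE('n) * (ind {0..R} r * r powr (s - 1))) (sph TYPE('n) * (R powr s / s))"
  by (intro has_bochner_integral_mult_right) auto
 have "(%r. sph TYPE('n) * (ind {0..R} r * r powr (s - 1))) = (%r. ind {0..} r * (sph TYPE('n) * r ^ (?n - 1) * ?g r))"
 proof
  fix r :: real
  have "r powr (s - 1) = r ^ (?n - 1) * r powr (s - real ?n)" if "r > 0"
   using that by (subst powr_realpow[symmetric]) (auto simp: powr_add[symmetric] of_nat_diff)
  thus "sph TYPE('n) * (ind {0..R} r * r powr (s - 1)) = ind {0..} r * (sph TYPE('n) * r ^ (?n - 1) * ?g r)"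
   by (cases "r > 0"; cases "r = 0") (auto split: split_indicator)
 qed
 with 2 have "has_bochner_integral lborel (%r. ind {0..} r * (sph TYPE('n) * r ^ (?n - 1) * ?g r)) (sph TYPE('n) * (R powr s / s))"
  by simp
 thus "IB (%x::real^'n. iB R x * norm x powr (s - real ?n))"
  and "(LBINT x. iB R x * norm (x::real^'n) powr (s - real ?n)) = sph TYPE('n) * R powr s / s"
  unfolding 1 using integrable_radial[of ?g, where 'n='n] integral_radial[of ?g, where 'n='n]
  by (auto simp: has_bochner_integral_iff)
qed

lemma integrable_powr_outside:
 assumes "s < 0" "0 < R"
 shows "IB (%x::real^'n. ind (- ball 0 R) x * norm x powr (s - real CARD('n)))"
proof -
 let ?n = "CARD('n)"
 let ?g = "%r. ind {R..} r * r powr (s - real ?n)"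
 have 1: "(%x::real^'n. ind (- ball 0 R) x * norm x powr (s - real ?n)) = (%x. ?g (norm x))"
  by (auto simp: fun_eq_iff split: split_indicator)
 have "((%r. r powr (s - 1)) has_integral (- (R powr s) / s)) {R..}"
  using has_integral_powr_to_inf[of "s - 1" R] assms by simp
 from has_bochner_integral_lborel_nonneg[OF this]
 have 2: "IB (%r. sph TYPE('n) * (ind {R..} r * r powr (s - 1)))"
  by (auto simp: has_bochner_integral_iff)
 have "(%r. sph TYPE('n) * (ind {R..} r * r powr (s - 1))) = (%r. ind {0..} r * (sph TYPE('n) * r ^ (?n - 1) * ?g r))"
 proof
  fix r :: real
  have "r powr (s - 1) = r ^ (?n - 1) * r powr (s - real ?n)" if "r > 0"
   using that by (subst powr_realpow[symmetric]) (auto simp: powr_add[symmetric] of_nat_diff)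
  thus "sph TYPE('n) * (ind {R..} r * r powr (s - 1)) = ind {0..} r * (sph TYPE('n) * r ^ (?n - 1) * ?g r)"
   using assms by (cases "r > 0") (auto split: split_indicator)
 qed
 with 2 show ?thesis
  unfolding 1 by (subst integrable_radial) auto
qed

text \<open>Shifting both exponents by N makes their signs decide integrability: s1 > 0 at the
  origin, s2 < 0 at infinity. The majorants of the proof are stated with this weight.\<close>

definition pw :: "real => real => real^'n => real" where
 "pw s1 s2 x = (if norm x <= 1 then norm x powr (s1 - real CARD('n)) else norm x powr (s2 - real CARD('n)))"

lemma pw_nonneg [simp]: "0 <= pw s1 s2 x" by (simp add: pw_def)

lemma pw_minus [simp]: "pw s1 s2 (- x) = pw s1 s2 x" by (simp add: pw_def)

lemma pw_measurable [measurable]: "pw s1 s2 : BM"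
 unfolding pw_def by measurable

lemma pw_mono:
 assumes "s1' <= s1" "s2 <= s2'"
 shows "pw s1 s2 x <= pw s1' s2' x"
proof (cases "norm x <= 1")
 case True
 thus ?thesis using assms by (auto simp: pw_def intro: powr_mono')
next
 case False
 thus ?thesis using assms by (auto simp: pw_def intro: powr_mono)
qed

lemma integrable_pw:
 assumes "0 < s1" "s2 < 0"
 shows "IB (pw s1 s2 :: real^'n => real)"
proof (rule ibound)
 show "IB (%x::real^'n. iB 1 x * norm x powr (s1 - real CARD('n))
   + ind (- ball 0 1) x * norm x powr (s2 - real CARD('n)))"
  using assms by (intro integrable_sum2 integrable_powr_cball integrable_powr_outside) auto
qed (auto simp: pw_def split: split_indicator)

lemma integral_pw_cball_le:
 assumes "0 < s1" "0 < e" "0 <= R"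
 shows "IB (%x::real^'n. iB R x * pw s1 e x)"
  and "(LBINT x. iB R x * pw s1 e (x::real^'n))
   <= (if R <= 1 then sph TYPE('n) * R powr s1 / s1 else sph TYPE('n) * (1 / s1 + 1 / e) * R powr e)"
proof -
 let ?h = "%x::real^'n. iB 1 x * norm x powr (s1 - real CARD('n))
   + iB R x * norm x powr (e - real CARD('n))"
 have h: "IB ?h"
  using assms by (intro integrable_sum2 integrable_powr_cball) auto
 show i: "IB (%x::real^'n. iB R x * pw s1 e x)"
  by (rule ibound[OF h]) (measurable, auto simp: pw_def split: split_indicator)
 show "(LBINT x. iB R x * pw s1 e (x::real^'n))
   <= (if R <= 1 then sph TYPE('n) * R powr s1 / s1 else sph TYPE('n) * (1 / s1 + 1 / e) * R powr e)"
 proof (cases "R <= 1")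
  case True
  have "(%x::real^'n. iB R x * pw s1 e x) = (%x. iB R x * norm x powr (s1 - real CARD('n)))"
   using True by (auto simp: fun_eq_iff pw_def split: split_indicator)
  thus ?thesis using True assms by (simp add: integral_powr_cball)
 next
  case False
  have "(LBINT x. iB R x * pw s1 e (x::real^'n)) <= SB ?h"
   by (intro integral_mono i h) (auto simp: pw_def split: split_indicator)
  also have "... = sph TYPE('n) * 1 powr s1 / s1 + sph TYPE('n) * R powr e / e"
   using assms by (subst integral_sum2) (auto intro!: integrable_powr_cball simp: integral_powr_cball)
  also have "... <= sph TYPE('n) * (1 / s1 + 1 / e) * R powr e"
   using assms False sph_pos[where 'n='n] ge_one_powr_ge_zero[of R e]
   by (auto simp: field_simps intro!: mult_left_mono)
  finally show ?thesis using False by simp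
 qed
qed

text \<open>The bound ln w <= w^ep / ep for w >= 1, applied to |z| or to 1/|z|.\<close>

lemma abs_ln_le_powr:
 assumes "0 < ep"
 shows "abs (ln (1 / norm z)) <= (norm z powr (-ep) + norm z powr ep) / ep"
proof (cases "norm z = 0")
 case False
 hence z: "norm z > 0" by simp
 show ?thesis
 proof (cases "norm z >= 1")
  case True
  have "abs (ln (1 / norm z)) = ln (norm z)" using True z by (simp add: ln_div)
  also have "... <= norm z powr ep / ep" using ln_powr_bound[OF True assms] .
  also have "... <= (norm z powr (-ep) + norm z powr ep) / ep" using assms by (intro divide_right_mono) auto
  finally show ?thesis .
 next
  case False
  have "abs (ln (1 / norm z)) = ln (1 / norm z)" using False z by (simp add: ln_div)
  also have "... <= (1 / norm z) powr ep / ep" using False z assms by (intro ln_powr_bound) auto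
  also have "(1 / norm z) powr ep = norm z powr (-ep)" using z by (simp add: powr_minus powr_divide inverse_eq_divide)
  also have "norm z powr (-ep) / ep <= (norm z powr (-ep) + norm z powr ep) / ep" using assms by (intro divide_right_mono) auto
  finally show ?thesis .
 qed
qed simp

text \<open>A product of two singular powers is split without a convolution inequality: where |z|
  and |y| are both small, it is at most the power s1 - ep - N of the smaller one. Each term on the
  right is a weight in y, a translate of a weight, or a weight times a power of 1 + |x|, and so has
  an explicit integral in y.\<close>

lemma log_kernel_pw_le:
 fixes x y :: "real^'n"
 assumes s1: "0 < s1" "s1 <= real CARD('n) / 2" and e: "0 < ep" "ep <= 1" and s2: "s2 <= 0"
 shows "abs (lk x y) * pw s1 s2 y <=
  (2 * (1 + norm x) powr ep * pw s1 (s2 + ep) y + pw s1 s2 y + pw (s1 - ep) s2 (x - y) + pw (s1 - ep) s2 y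
   + pw (s1 - ep) s2 (x - y)) / ep"
proof -
 let ?n = "CARD('n)"
 define z where "z = x - y"
 have n2: "1 <= real ?n" by (simp add: Suc_leI)
 let ?p = "pw s1 s2 y" and ?pz = "pw (s1 - ep) s2 z" and ?py = "pw (s1 - ep) s2 y"
 note nn = pw_nonneg[of s1 s2 y] pw_nonneg[of "s1 - ep" s2 z] pw_nonneg[of "s1 - ep" s2 y]
 have A: "norm z powr ep * ?p <= 2 * (1 + norm x) powr ep * pw s1 (s2 + ep) y"
 proof -
  have "norm z <= norm x + norm y" unfolding z_def by (rule norm_triangle_ineq4)
  also have "... <= (1 + norm x) * (1 + norm y)" by (simp add: algebra_simps)
  finally have "norm z powr ep <= ((1 + norm x) * (1 + norm y)) powr ep" using e by (intro powr_mono2) auto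
  also have "... = (1 + norm x) powr ep * (1 + norm y) powr ep" by (simp add: powr_mult)
  finally have 1: "norm z powr ep * ?p <= (1 + norm x) powr ep * ((1 + norm y) powr ep * ?p)"
   by (simp add: mult_right_mono mult.assoc[symmetric])
  have two: "2 powr ep <= 2" using powr_mono[of ep 1 "2::real"] e by simp
  have "(1 + norm y) powr ep * ?p <= 2 * pw s1 (s2 + ep) y"
  proof (cases "norm y <= 1")
   case True
   have "(1 + norm y) powr ep <= 2 powr ep" using True e by (intro powr_mono2) auto
   thus ?thesis using True two by (auto simp: pw_def intro!: mult_right_mono)
  next
   case False
   have "(1 + norm y) powr ep <= (2 * norm y) powr ep" using False e by (intro powr_mono2) auto
   also have "... = 2 powr ep * norm y powr ep" by (simp add: powr_mult)
   also have "... <= 2 * norm y powr ep" using two by (intro mult_right_mono) auto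
   finally have "(1 + norm y) powr ep * ?p <= 2 * norm y powr ep * ?p" by (intro mult_right_mono) auto
   also have "... = 2 * pw s1 (s2 + ep) y" using False
    by (auto simp: pw_def powr_add[symmetric] algebra_simps)
   finally show ?thesis .
  qed
  hence "(1 + norm x) powr ep * ((1 + norm y) powr ep * ?p) <= (1 + norm x) powr ep * (2 * pw s1 (s2 + ep) y)"
   by (intro mult_left_mono) auto
  with 1 show ?thesis by (simp add: mult_ac)
 qed
 have B: "norm z powr (-ep) * ?p <= ?p + ?pz + ?py + ?pz"
 proof (cases "norm z >= 1")
  case True
  have "norm z powr (-ep) <= 1" using True e powr_mono[of "-ep" 0 "norm z"] by (auto split: if_splits)
  hence "norm z powr (-ep) * ?p <= ?p" by (intro mult_left_le_one_le) auto
  thus ?thesis using nn by linarith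
 next
  case z1: False
  show ?thesis
  proof (cases "z = 0 | y = 0")
   case True
   have "norm z powr (-ep) * ?p = 0" using True by (auto simp: pw_def)
   thus ?thesis using nn by linarith
  next
   case False
   hence zy: "0 < norm z" "0 < norm y" by auto
   have ex: "s1 - real ?n <= 0" using s1 n2 by linarith
   have pwz: "?pz = norm z powr (s1 - ep - real ?n)" using z1 by (simp add: pw_def)
   show ?thesis
   proof (cases "norm y <= 1")
    case True
    have pwy: "?py = norm y powr (s1 - ep - real ?n)" using True by (simp add: pw_def)
    have "norm z powr (-ep) * ?p = norm z powr (-ep) * norm y powr (s1 - real ?n)"
     using True by (simp add: pw_def)
    also have "... <= ?pz + ?py"
    proof (cases "norm z <= norm y")
     case True
     have "norm z powr (-ep) * norm y powr (s1 - real ?n) <= norm z powr (-ep) * norm z powr (s1 - real ?n)"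
      using True zy ex by (intro mult_left_mono powr_mono2') auto
     also have "... = ?pz" using pwz zy by (simp add: powr_add[symmetric] algebra_simps)
     finally show ?thesis by (simp add: add_increasing2)
    next
     case False
     have "norm z powr (-ep) * norm y powr (s1 - real ?n) <= norm y powr (-ep) * norm y powr (s1 - real ?n)"
      using False zy e by (intro mult_right_mono powr_mono2') auto
     also have "... = ?py" using pwy zy by (simp add: powr_add[symmetric] algebra_simps)
     finally show ?thesis by (simp add: add_increasing)
    qed
    finally show ?thesis using nn by linarith
   next
    case False
    have "norm y powr (s2 - real ?n) <= norm y powr 0" using False s2 by (intro powr_mono) auto
    hence "?p <= 1" using False zy by (simp add: pw_def)
    hence "norm z powr (-ep) * ?p <= norm z powr (-ep)" by (intro mult_right_le_one_le) auto
    also have "... <= norm z powr (s1 - ep - real ?n)" using zy z1 ex by (intro powr_mono') auto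
    finally show ?thesis using pwz nn by linarith
   qed
  qed
 qed
 have "abs (ln (1 / norm z)) * ?p <= (norm z powr (-ep) + norm z powr ep) / ep * ?p"
  using abs_ln_le_powr[OF e(1), of z] by (intro mult_right_mono) auto
 also have "... = (norm z powr (-ep) * ?p + norm z powr ep * ?p) / ep"
  by (simp add: field_simps)
 also have "... <= (2 * (1 + norm x) powr ep * pw s1 (s2 + ep) y + ?p + ?pz + ?py
   + ?pz) / ep"
  using A B e by (intro divide_right_mono) auto
 finally show ?thesis unfolding z_def .
qed

lemma log_potential_bound:
 assumes "0 < s1" "s2 < 0" "0 < ep"
 obtains K where "0 <= K"
  "!!x::real^'n. IB (%y. abs (lk x y) * pw s1 s2 y)"
  "!!x::real^'n. (LBINT y. abs (lk x y) * pw s1 s2 y) <= K * (1 + norm x) powr ep"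
proof -
 define s where "s = min s1 (real CARD('n) / 2)"
 \<comment> \<open>Small enough that \<open>s - e\<close> > 0 and \<open>s2 + e\<close> < 0, so that
   every weight in \<open>?B\<close> is integrable.\<close>
 define e where "e = Min {ep, 1, s / 2, - s2 / 2}"
 have s: "0 < s" "s <= s1" "s <= real CARD('n) / 2" using assms by (auto simp: s_def)
 have e: "0 < e" "e <= ep" "e <= 1" "e <= s / 2" "e <= - s2 / 2" using assms s by (auto simp: e_def)
 let ?B = "%x y::real^'n. (2 * (1 + norm x) powr e * pw s (s2 + e) y + pw s s2 y + pw (s - e) s2 (x - y) + pw (s - e) s2 y
   + pw (s - e) s2 (x - y)) / e"
 have I: "IB (pw s (s2 + e) :: real^'n => real)" "IB (pw s s2 :: real^'n => real)"
   "IB (pw (s - e) s2 :: real^'n => real)"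
  using s e assms by (auto intro!: integrable_pw)
 have T: "IB (%y. pw (s - e) s2 (x - y))" "(LBINT y. pw (s - e) s2 (x - y)) = (LBINT y. pw (s - e) s2 (y::real^'n))" for x :: "real^'n"
 proof -
  have L: "(lborel :: (real^'n) measure) = distr lborel borel (%y. - x + y)"
   by (simp only: lborel_distr_plus)
  have sw: "pw (s - e) s2 (x - y) = pw (s - e) s2 (- x + y)" for y
   by (subst pw_minus[symmetric]) (simp del: pw_minus)
  show "IB (%y. pw (s - e) s2 (x - y))"
   unfolding sw using I(3) by (subst (asm) L) (simp add: integrable_distr_eq)
  show "(LBINT y. pw (s - e) s2 (x - y)) = (LBINT y. pw (s - e) s2 (y::real^'n))"
   unfolding sw by (subst (2) L) (simp add: integral_distr)
 qed
 have IBB: "IB (?B x)" for x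
  using I T by (intro integrable_divide integrable_sum2 integrable_mult_right) auto
 have le: "abs (lk x y) * pw s1 s2 y <= ?B x y" for x y :: "real^'n"
 proof -
  have "abs (lk x y) * pw s1 s2 y <= abs (lk x y) * pw s s2 y"
   using s by (intro mult_left_mono pw_mono) auto
  also have "... <= ?B x y" using log_kernel_pw_le[of s e s2 x y] s e assms by auto
  finally show ?thesis .
 qed
 define K where "K = (2 * (LBINT y. pw s (s2 + e) (y::real^'n)) + (LBINT y. pw s s2 (y::real^'n))
  + 3 * (LBINT y. pw (s - e) s2 (y::real^'n))) / e"
 have K0: "0 <= K" unfolding K_def using e by (intro divide_nonneg_pos add_nonneg_nonneg mult_nonneg_nonneg integral_nonneg) auto
 have i: "IB (%y. abs (lk x y) * pw s1 s2 y)" for x :: "real^'n"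
 proof (rule ibound[OF IBB[of x]])
  show "AE y in lborel. norm (abs (lk x y) * pw s1 s2 y) <= norm (?B x y)"
   using le[of x] e by (intro AE_I2) auto
 qed measurable
 show ?thesis
 proof (rule that[OF K0 i])
  fix x :: "real^'n"
  let ?P = "(1 + norm x) powr e"
  have P1: "1 <= ?P" using e by (intro ge_one_powr_ge_zero) auto
  have "(LBINT y. abs (lk x y) * pw s1 s2 y) <= (LBINT y. ?B x y)"
   by (intro integral_mono i IBB le)
  also have "... = (2 * ?P * (LBINT y. pw s (s2 + e) (y::real^'n)) + (LBINT y. pw s s2 (y::real^'n))
  + 3 * (LBINT y. pw (s - e) s2 (y::real^'n))) / e"
   using I T by (simp add: integral_sum2)
  also have "... <= (2 * ?P * (LBINT y. pw s (s2 + e) (y::real^'n)) + ?P * (LBINT y. pw s s2 (y::real^'n))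
  + ?P * (3 * (LBINT y. pw (s - e) s2 (y::real^'n)))) / e"
  proof -
   have "c <= ?P * c" if "0 <= c" for c using mult_right_mono[OF P1 that] by simp
   thus ?thesis using e
    by (intro divide_right_mono add_mono order_refl) (auto intro!: integral_nonneg)
  qed
  also have "... = K * ?P" using e by (simp add: K_def field_simps)
  also have "... <= K * (1 + norm x) powr ep" using e K0 by (intro mult_left_mono powr_mono) auto
  finally show "(LBINT y. abs (lk x y) * pw s1 s2 y) <= K * (1 + norm x) powr ep" .
 qed
qed

lemma pw_mult_powr_le:
 assumes "0 <= ep"
 shows "(1 + norm x) powr ep * pw s1 s2 x <= 2 powr ep * pw s1 (s2 + ep) x"
proof (cases "norm x <= 1")
 case True
 thus ?thesis using assms by (auto simp: pw_def intro!: mult_right_mono powr_mono2)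
next
 case False
 have "(1 + norm x) powr ep <= (2 * norm x) powr ep" using False assms by (intro powr_mono2) auto
 also have "... = 2 powr ep * norm x powr ep" by (simp add: powr_mult)
 finally have "(1 + norm x) powr ep * pw s1 s2 x <= 2 powr ep * norm x powr ep * pw s1 s2 x" by (intro mult_right_mono) auto
 also have "... = 2 powr ep * pw s1 (s2 + ep) x" using False
  by (auto simp: pw_def powr_add[symmetric] algebra_simps)
 finally show ?thesis .
qed

lemma log_conv_lborel:
 assumes [measurable]: "h : BM"
 shows "log_conv h x = (LBINT y. lk x y * h y)"
 unfolding log_conv_def by (rule integral_completion) measurable

lemma log_conv_measurable [measurable]:
 fixes h :: "real^'n => real"
 assumes [measurable]: "h : BM"
 shows "log_conv h : BM"
proof -
 have "(%x. (LBINT y. lk x y * h y)) : BM"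
  by measurable
 thus ?thesis by (simp add: log_conv_lborel cong: measurable_cong)
qed

text \<open>An orthogonal map taking a to b preserves Lebesgue measure, distances and the radial h,
  and so carries one convolution integral into the other.\<close>

lemma log_conv_radial:
 fixes h :: "real^'n => real"
 assumes h[measurable]: "h : BM"
  and rad: "!!x y. norm x = norm y ==> h x = h y" and "norm a = norm b"
 shows "log_conv h a = log_conv h b"
proof -
 obtain f where f: "orthogonal_transformation f" "f a = b"
  using orthogonal_transformation_exists[OF assms(3)] by blast
 have lin: "linear f" using f by (simp add: orthogonal_transformation_linear)
 hence [measurable]: "f : BM"
  by (intro borel_measurable_continuous_onI linear_continuous_on linear_conv_bounded_linear[THEN iffD1])
 have "log_conv h b = (\<integral>y. ln (1 / norm (b - y)) * h y \<partial>distr lborel borel f)"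
  by (simp add: log_conv_lborel distr_lborel_orthogonal[OF f(1)])
 also have "... = (LBINT y. ln (1 / norm (b - f y)) * h (f y))"
  by (subst integral_distr) auto
 also have "... = (LBINT y. ln (1 / norm (a - y)) * h y)"
 proof (rule Bochner_Integration.integral_cong[OF refl])
  fix y
  have "b - f y = f (a - y)" using f lin by (simp add: linear_diff)
  hence "norm (b - f y) = norm (a - y)" using f by (simp add: orthogonal_transformation_norm)
  moreover have "h (f y) = h y" using f by (intro rad) (simp add: orthogonal_transformation_norm)
  ultimately show "ln (1 / norm (b - f y)) * h (f y) = ln (1 / norm (a - y)) * h y" by simp
 qed
 finally show ?thesis by (simp add: log_conv_lborel)
qed

section \<open>Dilations and integration along rays\<close>

lemma nn_integral_scale:
 fixes h :: "'a::euclidean_space => ennreal"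
 assumes [measurable]: "h : BM" and "0 < c"
 shows "(NB x. h x) = ennreal (c ^ DIM('a)) * (NB x. h (c *R x))"
proof -
 have "(NB x. h x) = (\<integral>\<^sup>+x. h x \<partial>density (distr lborel borel (%x. 0 + c *R x)) (%_. ennreal (abs c^DIM('a))))"
  using lborel_affine[of c "0::'a"] assms by simp
 also have "... = (NB x. ennreal (c ^ DIM('a)) * h (c *R x))"
  using assms by (simp add: nn_integral_density nn_integral_distr)
 finally show ?thesis by (simp add: nn_integral_cmult)
qed

lemma integral_scale:
 fixes h :: "'a::euclidean_space => real"
 assumes [measurable]: "h : BM" and "0 < c"
 shows "(LBINT x. h x) = c ^ DIM('a) * (LBINT x. h (c *R x))"
proof -
 have "(LBINT x. h x) = (\<integral>x. h x \<partial>density (distr lborel borel (%x. 0 + c *R x)) (%_. ennreal (abs c^DIM('a))))"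
  using lborel_affine[of c "0::'a"] assms by simp
 also have "... = (LBINT x. c ^ DIM('a) * h (c *R x))"
  using assms by (simp add: integral_density integral_distr)
 finally show ?thesis by simp
qed

text \<open>With t = |x| / R the ball integral becomes an integral over [0, 1], the form in which it
  arises when rays are parametrised by dilations.\<close>

lemma nn_integral_radial_dilation:
 fixes G :: "real => real"
 assumes [measurable]: "G : BM" and R: "0 < R" and nn: "!!r. 0 <= G r"
 shows "(NB x. ennreal (iB R x * G (norm (x::real^'n))))
  = ennreal (sph TYPE('n) * R ^ CARD('n)) * (NB t. ennreal (ind {0..1} t * (t ^ (CARD('n) - 1) * G (t * R))))"
proof -
 let ?n = "CARD('n)"
 let ?g = "%r. ennreal (ind {..R} r * G r)"
 let ?f = "%r. ennreal (sph TYPE('n) * r ^ (?n - 1)) * ?g r * ind {0..} r"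
 have "(NB x. ennreal (iB R x * G (norm (x::real^'n)))) = (NB x. ?g (norm (x::real^'n)))"
  by (intro nn_integral_cong) (auto split: split_indicator)
 also have "... = (NB r. ?f r)"
  by (rule nn_integral_radial) measurable
 also have "... = ennreal R * (NB t. ?f (R *R t))"
  using nn_integral_scale[of ?f R] R by simp
 also have "(NB t. ?f (R *R t)) = (NB t. ennreal (sph TYPE('n) * R ^ (?n - 1)) * ennreal (ind {0..1} t * (t ^ (?n - 1) * G (t * R))))"
 proof (intro nn_integral_cong)
  fix t :: real
  show "?f (R *R t) = ennreal (sph TYPE('n) * R ^ (?n - 1)) * ennreal (ind {0..1} t * (t ^ (?n - 1) * G (t * R)))"
   using R sph_pos[where 'n='n] nn[of "t * R"]
   by (auto simp: ennreal_mult[symmetric] power_mult_distrib mult_ac zero_le_mult_iff split: split_indicator)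
 qed
 also have "ennreal R * ... = ennreal R * (ennreal (sph TYPE('n) * R ^ (?n - 1)) * (NB t. ennreal (ind {0..1} t * (t ^ (?n - 1) * G (t * R)))))"
  by (subst nn_integral_cmult) auto
 also have "... = ennreal (sph TYPE('n) * R ^ ?n) * (NB t. ennreal (ind {0..1} t * (t ^ (?n - 1) * G (t * R))))"
 proof -
  have "R * (sph TYPE('n) * R ^ (?n - 1)) = sph TYPE('n) * R ^ ?n"
   by (simp add: power_eq_if[of R ?n])
  thus ?thesis
   using R sph_pos[where 'n='n] by (simp only: mult.assoc[symmetric] ennreal_mult[symmetric] less_imp_le zero_le_power mult_nonneg_nonneg)
 qed
 finally show ?thesis .
qed

lemma integral_radial_dilation:
 fixes G :: "real => real"
 assumes [measurable]: "G : BM" and R: "0 < R"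
 shows "(LBINT x. iB R x * G (norm (x::real^'n)))
  = sph TYPE('n) * R ^ CARD('n) * (LBINT t. ind {0..1} t * (t ^ (CARD('n) - 1) * G (t * R)))"
proof -
 let ?n = "CARD('n)"
 let ?g = "%r. ind {..R} r * G r"
 let ?f = "%r. ind {0..} r * (sph TYPE('n) * r ^ (?n - 1) * ?g r)"
 have "(LBINT x. iB R x * G (norm (x::real^'n))) = (LBINT x. ?g (norm (x::real^'n)))"
  by (intro Bochner_Integration.integral_cong) (auto split: split_indicator)
 also have "... = (LBINT r. ?f r)"
  by (rule integral_radial) measurable
 also have "... = R * (LBINT t. ?f (R *R t))"
  using integral_scale[of ?f R] R by simp
 also have "(LBINT t. ?f (R *R t)) = (LBINT t. (sph TYPE('n) * R ^ (?n - 1)) * (ind {0..1} t * (t ^ (?n - 1) * G (t * R))))"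
  using R by (intro Bochner_Integration.integral_cong)
   (auto simp: power_mult_distrib mult_ac zero_le_mult_iff split: split_indicator)
 also have "R * ... = sph TYPE('n) * R ^ ?n * (LBINT t. ind {0..1} t * (t ^ (?n - 1) * G (t * R)))"
  by (simp add: power_eq_if[of R ?n])
 finally show ?thesis .
qed

text \<open>Writing \<open>ph(x)\<close> as the integral of its radial derivative over the ray from \<open>x\<close> to infinity and
 interchanging the integrals solves \<open>div w = G\<close> for radial \<open>G\<close> without polar coordinates. Here
 \<open>g(y)\<close> stands for the derivative of \<open>ph\<close> at \<open>y\<close> in the direction \<open>y\<close>, and \<open>t\<close> is the reciprocal of
 the dilation factor.\<close>

lemma
 fixes G :: "real => real" and g ph :: "real^'n => real"
 defines "V y == sph TYPE('n) * norm y ^ CARD('n)" and "Ma y == (LBINT x. iB (norm y) x * abs (G (norm (x::real^'n))))" and "M y == (LBINT x. iB (norm y) x * G (norm (x::real^'n)))"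
 assumes N: "2 <= CARD('n)"
  and G[measurable]: "G : BM" and g[measurable]: "g : BM"
  and g0: "g 0 = 0" and phi[measurable]: "ph : BM"
  and ray: "!!x. x ~= 0 ==> ph x = - (LBINT t. ind {0..1} t * (g (x /\<^sub>R t) / t))"
   "!!x. x ~= 0 ==> IB (%t. ind {0..1} t * (g (x /\<^sub>R t) / t))"
  and Gloc: "!!R. 0 < R ==> IB (%x::real^'n. iB R x * abs (G (norm x)))"
  and int: "IB (%y. abs (g y) * Ma y / V y)"
 shows ray_integrable: "IB (%x. abs (G (norm x)) * abs (ph x))"
  and ray_bound: "(LBINT x. abs (G (norm x)) * abs (ph x))
   <= (LBINT y. abs (g y) * Ma y / V y)"
  and ray_identity: "(LBINT x. G (norm x) * ph x)
   = - (LBINT y. g y * M y / V y)"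
proof -
 let ?n = "CARD('n)"
 \<comment> \<open>H is the integrand along the ray through x. Substituting x = t y turns it into K,
   with Jacobian t^N. In K the point y enters through g(y) and a radial factor only, so the
   t-integral of K is g(y) times a multiple of the integral of G over the ball of radius
   |y|.\<close>
 define H where "H = (%(x::real^'n) t. G (norm x) * (ind {0..1} t * (g (x /\<^sub>R t) / t)))"
 define K where "K = (%(y::real^'n) t. g y * (ind {0..1} t * (t ^ (?n - 1) * G (t * norm y))))"
 have bm[measurable]: "M : borel_measurable (lborel::(real^'n) measure)"
 proof -
  have "(%y. (LBINT x. (if norm x <= norm y then G (norm (x::real^'n)) else 0))) : borel_measurable (lborel::(real^'n) measure)"
   by measurable
  thus ?thesis unfolding M_def[abs_def] by (simp add: indicator_def if_distrib[where f="%c. c * _"] of_bool_def cong: if_cong)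
 qed
 have [measurable]: "V : borel_measurable (lborel::(real^'n) measure)" unfolding V_def[abs_def] by measurable
 have Hm[measurable]: "case_prod H : borel_measurable (lborel \<Otimes>\<^sub>M lborel)" unfolding H_def by measurable
 have Km[measurable]: "case_prod K : borel_measurable (lborel \<Otimes>\<^sub>M lborel)" unfolding K_def by measurable
 have HK: "H (t *R y) t * t ^ ?n = K y t" if "t ~= 0" for y t
  using that by (auto simp: H_def K_def power_eq_if[of t ?n] field_simps split: split_indicator)
 have K0: "K y 0 = 0" and H0: "H x 0 = 0" for x y using N by (auto simp: K_def H_def)
 have HK0: "H x t = 0" "K x t = 0" if "~ 0 < t" for x t using that H0 K0 by (cases "t = 0"; auto simp: H_def K_def)+
 define E where "E = (%y::real^'n. abs (g y) * Ma y / V y)"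
 have E0: "0 <= E y" for y unfolding E_def Ma_def V_def using sph_pos[where 'n='n]
  by (intro divide_nonneg_nonneg mult_nonneg_nonneg integral_nonneg) auto
 have Kint: "(NB t. ennreal (abs (K y t))) = ennreal (E y)" for y
 proof (cases "y = 0")
  case True
  thus ?thesis by (simp add: K_def E_def g0)
 next
  case False
  hence y: "0 < norm y" by simp
  let ?I = "(NB t. ennreal (ind {0..1} t * (t ^ (?n - 1) * abs (G (t * norm y)))))"
  have "ennreal (Ma y) = ennreal (V y) * ?I"
   using nn_integral_radial_dilation[of "%r. abs (G r)", OF _ y, where 'n='n, folded V_def] nn_integral_eq_integral[OF Gloc[OF y]]
   by (simp add: Ma_def)
  moreover have p: "0 < V y" using y sph_pos[where 'n='n] by (simp add: V_def)
  ultimately have Ie: "?I = ennreal (Ma y / V y)"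
  proof -
   assume *: "ennreal (Ma y) = ennreal (V y) * ?I"
   have "?I = ennreal (1 / V y) * ennreal (V y) * ?I"
   proof -
    have "1 / V y * V y = 1" using p by (metis less_irrefl nonzero_eq_divide_eq)
    thus ?thesis using p by (subst ennreal_mult[symmetric]) (simp_all del: times_divide_eq_left)
   qed
   also have "... = ennreal (1 / V y) * ennreal (Ma y)"
    unfolding * by (simp add: mult.assoc)
   also have "... = ennreal (Ma y / V y)"
    using p by (subst ennreal_mult[symmetric]) (auto simp: Ma_def intro!: integral_nonneg)
   finally show ?thesis .
  qed
  moreover have "(NB t. ennreal (abs (K y t))) = ennreal (abs (g y)) * ?I"
  proof -
   have "ennreal (abs (K y t)) = ennreal (abs (g y)) * ennreal (ind {0..1} t * (t ^ (?n - 1) * abs (G (t * norm y))))" for t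
    unfolding K_def by (subst ennreal_mult[symmetric]) (auto simp: abs_mult split: split_indicator)
   thus ?thesis by (simp only:) (rule nn_integral_cmult, measurable)
  qed
  moreover have "E y = abs (g y) * (Ma y / V y)" by (simp add: E_def)
  moreover have "0 <= Ma y / V y"
   unfolding Ma_def using p by (intro divide_nonneg_nonneg integral_nonneg) auto
  ultimately show ?thesis by (simp only: ennreal_mult abs_ge_zero)
 qed
 have HKn: "(NB x. ennreal (abs (H x t))) = (NB y. ennreal (abs (K y t)))" for t
 proof (cases "0 < t")
  case True
  have "(NB x. ennreal (abs (H x t))) = ennreal (t ^ ?n) * (NB y. ennreal (abs (H (t *R y) t)))"
   using nn_integral_scale[of "%x. ennreal (abs (H x t))" t] True by simp
  also have "... = (NB y. ennreal (abs (K y t)))"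
  proof -
   have "ennreal (abs (K y t)) = ennreal (t ^ ?n) * ennreal (abs (H (t *R y) t))" for y
    using True by (subst HK[symmetric]) (auto simp: abs_mult ennreal_mult mult.commute)
   thus ?thesis by (simp only:) (rule nn_integral_cmult[symmetric], measurable)
  qed
  finally show ?thesis .
 next
  case False
  thus ?thesis by (simp add: HK0)
 qed
 have HKi: "(LBINT x. H x t) = (LBINT y. K y t)" for t
 proof (cases "0 < t")
  case True
  have "(LBINT x. H x t) = t ^ ?n * (LBINT y. H (t *R y) t)"
   using integral_scale[of "%x. H x t" t] True by simp
  also have "... = (LBINT y. K y t)"
  proof -
   have "K y t = t ^ ?n * H (t *R y) t" for y
    using True by (subst HK[symmetric]) (auto simp: mult.commute)
   thus ?thesis by simp
  qed
  finally show ?thesis .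
 next
  case False
  thus ?thesis by (simp add: HK0)
 qed
 have Eint: "IB E" using int unfolding E_def .
 have nnK: "(NB y. (NB t. ennreal (abs (K y t)))) = ennreal (SB E)"
  unfolding Kint using Eint E0 by (intro nn_integral_eq_integral) auto
 have "(NB x. (NB t. ennreal (abs (H x t)))) = (NB t. (NB x. ennreal (abs (H x t))))"
  by (rule lborel_pair.Fubini') measurable
 also have "... = (NB t. (NB y. ennreal (abs (K y t))))" unfolding HKn ..
 also have "... = (NB y. (NB t. ennreal (abs (K y t))))"
  by (rule lborel_pair.Fubini'[symmetric]) measurable
 finally have nnH: "(NB x. (NB t. ennreal (abs (H x t)))) = ennreal (SB E)" using nnK by simp
 have pair: "integrable (lborel \<Otimes>\<^sub>M lborel) (case_prod L)"
  if [measurable]: "case_prod L : borel_measurable (lborel \<Otimes>\<^sub>M lborel)"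
   and e: "(NB x. (NB t. ennreal (abs (L x t)))) = ennreal r" for L :: "real^'n => real => real" and r
 proof (rule integrableI_bounded)
  show "(\<integral>\<^sup>+z. ennreal (norm (case_prod L z)) \<partial>(lborel \<Otimes>\<^sub>M lborel)) < \<infinity>"
   using e by (subst lborel.nn_integral_fst[symmetric]) auto
 qed (rule that)
 note Hi = pair[OF Hm nnH] and Ki = pair[OF Km nnK]
 have Hphi: "(LBINT t. H x t) = - (G (norm x) * ph x)" if "x ~= 0" for x
  unfolding H_def using ray(1)[OF that] by (subst integral_mult_right_zero) simp
 have le: "ennreal (abs (G (norm x)) * abs (ph x)) <= (NB t. ennreal (abs (H x t)))" if "x ~= 0" for x
 proof -
  have i: "IB (H x)" unfolding H_def using ray(2)[OF that] by (intro integrable_mult_right) auto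
  have "abs (G (norm x)) * abs (ph x) = abs (LBINT t. H x t)" using Hphi[OF that] by (simp add: abs_mult)
  also have "... <= (LBINT t. abs (H x t))" by (rule integral_abs_bound)
  also have "ennreal ... = (NB t. ennreal (abs (H x t)))"
   using i by (intro nn_integral_eq_integral[symmetric]) auto
  finally show ?thesis by (simp add: ennreal_leI)
 qed
 have ae0: "AE x in lborel. x ~= (0::real^'n)" by (rule AE_lborel_singleton)
 have nb: "(NB x. ennreal (abs (G (norm x)) * abs (ph x))) <= ennreal (SB E)"
  unfolding nnH[symmetric] using ae0 by (intro nn_integral_mono_AE) (auto elim!: eventually_mono intro: le)
 show "IB (%x. abs (G (norm x)) * abs (ph x))"
  using nb by (intro integrableI_bounded) (auto simp: abs_mult intro: le_less_trans)
 thus "(LBINT x. abs (G (norm x)) * abs (ph x))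
   <= (LBINT y. abs (g y) * Ma y / V y)"
  using nb E0 unfolding E_def[symmetric] by (subst (asm) nn_integral_eq_integral) (auto simp: integral_nonneg)
 have "(LBINT x. G (norm x) * ph x) = (LBINT x. - (LBINT t. H x t))"
  using ae0 by (intro integral_cong_AE) (auto elim!: eventually_mono simp: Hphi)
 also have "... = - (LBINT x. (LBINT t. H x t))" by simp
 also have "(LBINT x. (LBINT t. H x t)) = (LBINT t. (LBINT x. H x t))"
  by (rule lborel_pair.Fubini_integral[OF Hi, symmetric])
 also have "... = (LBINT t. (LBINT y. K y t))" unfolding HKi ..
 also have "... = (LBINT y. (LBINT t. K y t))"
  by (rule lborel_pair.Fubini_integral[OF Ki])
 also have "... = (LBINT y. g y * M y / V y)"
 proof (intro integral_cong_AE)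
  show "AE y in lborel. (LBINT t. K y t) = g y * M y / V y"
   using ae0
  proof eventually_elim
   case (elim y)
   have y: "0 < norm y" using elim by simp
   have p: "0 < V y" using y sph_pos[where 'n='n] by (simp add: V_def)
   have "(LBINT t. K y t) = g y * (LBINT t. ind {0..1} t * (t ^ (?n - 1) * G (t * norm y)))"
    unfolding K_def by simp
   also have "... = g y * (M y / V y)"
    unfolding M_def integral_radial_dilation[OF G y, where 'n='n] using sph_pos[where 'n='n] elim by (simp add: V_def)
   finally show ?case by simp
  qed
 qed measurable
 finally show "(LBINT x. G (norm x) * ph x)
   = - (LBINT y. g y * M y / V y)" .
qed

section \<open>Smooth functions of one variable\<close>

primrec Dk :: "nat => (real => real) => bool" where
 "Dk 0 f \<longleftrightarrow> continuous_on UNIV f"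
| "Dk (Suc k) f \<longleftrightarrow> (EX f'. (ALL s. (f hasd f' s) (at s)) & Dk k f')"

lemma Dk_Suc_imp: "Dk (Suc k) f ==> Dk k f"
proof (induction k arbitrary: f)
 case 0
 then obtain f' where "!!s. (f hasd f' s) (at s)" by auto
 thus ?case by (auto intro: DERIV_isCont continuous_at_imp_continuous_on)
next
 case (Suc k)
 then obtain f' where "ALL s. (f hasd f' s) (at s)" "Dk (Suc k) f'" by (subst (asm) Dk.simps) blast
 with Suc.IH show ?case by auto
qed

lemma Dk_add: "Dk k f ==> Dk k g ==> Dk k (%x. f x + g x)"
proof (induction k arbitrary: f g)
 case (Suc k)
 then obtain f' g' where "ALL s. (f hasd f' s) (at s)" "Dk k f'"
   "ALL s. (g hasd g' s) (at s)" "Dk k g'" by auto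
 with Suc.IH show ?case by (auto intro!: exI[of _ "%x. f' x + g' x"] derivative_intros)
qed (auto intro: continuous_intros)

lemma Dk_mult: "Dk k f ==> Dk k g ==> Dk k (%x. f x * g x)"
proof (induction k arbitrary: f g)
 case (Suc k)
 then obtain f' g' where d: "ALL s. (f hasd f' s) (at s)" "Dk k f'"
   "ALL s. (g hasd g' s) (at s)" "Dk k g'" by auto
 have "Dk k f" "Dk k g" using Suc.prems Dk_Suc_imp by auto
 with d Suc.IH have "Dk k (%x. f x * g' x + f' x * g x)" by (intro Dk_add) auto
 with d show ?case by (auto intro!: exI[of _ "%x. f x * g' x + f' x * g x"] derivative_eq_intros)
qed (auto intro: continuous_intros)

lemma Dk_const: "Dk k (%x. c)"
proof (induction k arbitrary: c)
 case (Suc k)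
 thus ?case by (auto intro!: exI[of _ "%x. 0"] derivative_eq_intros)
qed auto

lemma Dk_affine: "Dk k (%x. c + d * x)"
proof (cases k)
 case (Suc k)
 thus ?thesis by (auto intro!: exI[of _ "%x. d"] derivative_eq_intros Dk_const)
qed (auto intro: continuous_intros)

lemma Dk_compose_affine: "Dk k f ==> Dk k (%x. f (c + d * x))"
proof (induction k arbitrary: f)
 case 0
 thus ?case by (auto intro!: continuous_on_compose2[of UNIV f] continuous_intros)
next
 case (Suc k)
 then obtain f' where f': "!!s. (f hasd f' s) (at s)" "Dk k f'" by auto
 have "((%x. f (c + d * x)) hasd d * f' (c + d * s)) (at s)" for s
 proof -
  have "((%x. c + d * x) hasd d) (at s)" by (auto intro!: derivative_eq_intros)
  from DERIV_chain2[OF f'(1) this] show ?thesis by (simp add: mult.commute)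
 qed
 with Suc.IH[OF f'(2)] Dk_mult[OF Dk_const[of _ d]] show ?case
  by (auto intro!: exI[of _ "%s. d * f' (c + d * s)"])
qed

lemma poly_exp_tendsto_0: "((%x. poly p x * exp (- x)) \<longlongrightarrow> 0) at_top" for p :: "real poly"
proof -
 have "((%x. SUM i<=degree p. coeff p i * (x ^ i / exp x)) \<longlongrightarrow> (SUM i<=degree p. coeff p i * 0)) at_top"
  by (intro tendsto_intros tendsto_power_div_exp_0)
 moreover have "(SUM i<=degree p. coeff p i * (x ^ i / exp x)) = poly p x * exp (- x)" for x
  by (simp add: poly_altdef sum_distrib_right exp_minus divide_inverse mult.assoc)
 ultimately show ?thesis by simp
qed

text \<open>Functions q(1/s) exp(-1/s) on s > 0 are closed under differentiation, with q replaced by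
  X^2 (q - q'); the difference quotient at 0 tends to 0 because the exponential beats every
  polynomial. Quantifying over q makes the induction on k possible.\<close>

lemma Dk_flat: "Dk k (%s. if 0 < s then poly q (1 / s) * exp (- (1 / s)) else 0)"
proof (induction k arbitrary: q)
 have lim: "((%s. poly q (1 / s) * exp (- (1 / s))) \<longlongrightarrow> 0) (at_right 0)" for q :: "real poly"
  using filterlim_compose[OF poly_exp_tendsto_0[of q] filterlim_inverse_at_top_right]
  by (simp add: inverse_eq_divide)
 have d: "((%s. if 0 < s then poly q (1 / s) * exp (- (1 / s)) else 0) hasd
   (if 0 < s then poly ([:0, 0, 1:] * (q - pderiv q)) (1 / s) * exp (- (1 / s)) else 0)) (at s)" for q :: "real poly" and s
 proof -
  consider "0 < s" | "s < 0" | "s = 0" by linarith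
  thus ?thesis
  proof cases
   case 1
   have "((%s. poly q (1 / s) * exp (- (1 / s))) hasd
     poly ([:0, 0, 1:] * (q - pderiv q)) (1 / s) * exp (- (1 / s))) (at s)"
   proof -
    have i: "((%s. 1 / s) hasd - (1 / s * (1 / s))) (at s)"
     using 1 by (auto intro!: derivative_eq_intros)
    have "((%s. poly q (1 / s) * exp (- (1 / s))) hasd
      (poly (pderiv q) (1 / s) * - (1 / s * (1 / s))) * exp (- (1 / s)) + exp (- (1 / s)) * - (- (1 / s * (1 / s))) * poly q (1 / s)) (at s)"
     by (intro DERIV_mult DERIV_chain2[OF poly_DERIV i] DERIV_chain2[OF DERIV_exp] DERIV_minus i)
    thus ?thesis by (rule DERIV_cong) (simp add: algebra_simps)
   qed
   hence "((%s. if 0 < s then poly q (1 / s) * exp (- (1 / s)) else 0) hasd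
     poly ([:0, 0, 1:] * (q - pderiv q)) (1 / s) * exp (- (1 / s))) (at s)"
    by (rule has_field_derivative_transform_within_open[where S="{0<..}"]) (use 1 in auto)
   with 1 show ?thesis by simp
  next
   case 2
   have "((%s. if 0 < s then poly q (1 / s) * exp (- (1 / s)) else 0) hasd 0) (at s)"
    by (rule has_field_derivative_transform_within_open[where S="{..<0}" and f="%s. 0"]) (use 2 in auto)
   with 2 show ?thesis by simp
  next
   case 3
   have "((%h. (if 0 < h then poly q (1 / h) * exp (- (1 / h)) else 0) / h) \<longlongrightarrow> 0) (at 0)"
   proof (rule filterlim_split_at_real)
    show "((%h. (if 0 < h then poly q (1 / h) * exp (- (1 / h)) else 0) / h) \<longlongrightarrow> 0) (at_left 0)"
     by (rule tendsto_eventually) (auto simp: eventually_at_left_field intro: exI[of _ "-1"])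
    show "((%h. (if 0 < h then poly q (1 / h) * exp (- (1 / h)) else 0) / h) \<longlongrightarrow> 0) (at_right 0)"
     using lim[of "[:0, 1:] * q"]
     by (rule Lim_transform_eventually) (auto simp: eventually_at_right_field intro: exI[of _ 1])
   qed
   thus ?thesis using 3 by (simp only: DERIV_def add_0) simp
  qed
 qed
 {
  case 0
  show ?case unfolding Dk.simps using d[of q]
   by (intro differentiable_imp_continuous_on) (auto simp: differentiable_on_def real_differentiable_def)
 next
  case (Suc k)
  show ?case unfolding Dk.simps
   by (rule exI[of _ "%s. if 0 < s then poly ([:0, 0, 1:] * (q - pderiv q)) (1 / s) * exp (- (1 / s)) else 0"])
    (intro conjI allI d Suc)
 }
qed

lemma smooth_step_exists:
 obtains et :: "real => real" where "!!k. Dk k et" "!!s. s <= 0 ==> et s = 0" "!!s. 1 <= s ==> et s = 1"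
  "!!s. 0 <= et s" "!!s. et s <= 1"
proof -
 define e where "e = (%s::real. if 0 < s then poly 1 (1 / s) * exp (- (1 / s)) else 0)"
 \<comment> \<open>A smooth bump that is positive exactly on (0, 1); its normalised antiderivative
   is the step.\<close>
 define b where "b = (%s. e s * e (1 + (-1) * s))"
 have sb: "Dk k b" for k unfolding b_def e_def by (intro Dk_mult Dk_compose_affine[where f="%s. if 0 < s then poly 1 (1 / s) * exp (- (1 / s)) else 0"] Dk_flat)
 have cb: "continuous_on UNIV b" using sb[of 0] by simp
 have b0: "0 <= b s" for s by (simp add: b_def e_def)
 define F where "F = (%s. integral {0..s} b - integral {s..0} b)"
 obtain F where F: "!!s. (F hasd b s) (at s)" "F 0 = 0"
 proof -
  have "EX G. ALL x. (G hasd b x) (at x)"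
  proof -
   have "isCont b x" for x using cb by (simp add: continuous_on_eq_continuous_at)
   hence "EX G. ALL x. - \<infinity> < ereal x --> ereal x < \<infinity> --> (G has_vector_derivative b x) (at x)"
    by (intro einterval_antiderivative) auto
   thus ?thesis by (simp add: has_real_derivative_iff_has_vector_derivative)
  qed
  then obtain G where "!!x. (G hasd b x) (at x)" by auto
  thus ?thesis by (intro that[of "%x. G x - G 0"]) (auto intro!: derivative_eq_intros)
 qed
 have mono: "F x <= F y" if "x <= y" for x y
 proof (rule DERIV_nonneg_imp_nondecreasing[OF that])
  fix z show "EX y. (F hasd y) (at z) & 0 <= y" using F(1)[of z] b0[of z] by blast
 qed
 have c0': "b x = 0" if "x < 0" for x using that by (simp add: b_def e_def)
 have c0: "F s = 0" if "s <= 0" for s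
 proof (cases "s = 0")
  case False
  have "F 0 = F s"
  proof (rule DERIV_isconst_end[of s 0 F])
   fix x :: real assume "s < x" "x < 0"
   have "b x = 0" by (rule c0') fact
   thus "(F hasd 0) (at x)" using F(1)[of x] by simp
  next
   show "continuous_on {s..0} F" using F(1) by (intro DERIV_continuous_on) (auto intro: has_field_derivative_at_within)
  qed (use that False in auto)
  thus ?thesis using F by simp
 qed (use F in auto)
 have c1: "F s = F 1" if "1 <= s" for s
 proof (cases "s = 1")
  case False
  show "F s = F 1"
  proof (rule DERIV_isconst_end[of 1 s F])
   fix x :: real assume "1 < x" "x < s"
   hence "b x = 0" by (simp add: b_def e_def)
   thus "(F hasd 0) (at x)" using F(1)[of x] by simp
  next
   show "continuous_on {1..s} F" using F(1) by (intro DERIV_continuous_on) (auto intro: has_field_derivative_at_within)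
  qed (use that False in auto)
 qed auto
 have pos: "F 1 > 0"
 proof -
  obtain z where "0 < z" "z < 1" "F 1 - F 0 = (1 - 0) * b z"
   using MVT2[of 0 1 F b] F(1) by auto
  thus ?thesis using F(2) by (auto simp: b_def e_def)
 qed
 have sF: "Dk k F" for k
 proof -
  have "Dk (Suc k) F" using F(1) sb by auto
  thus ?thesis by (rule Dk_Suc_imp)
 qed
 show ?thesis
 proof (rule that[of "%s. (1 / F 1) * F s"])
  show "Dk k (%s. (1 / F 1) * F s)" for k by (intro Dk_mult Dk_const sF)
  show "0 <= (1 / F 1) * F s" for s
   using pos c0[of s] mono[of 0 s] F(2) by (cases "s <= 0") auto
  show "(1 / F 1) * F s <= 1" for s
  proof (cases "s <= 1")
   case True
   thus ?thesis using mono[OF True] pos by simp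
  next
   case False
   hence "F s = F 1" by (intro c1) simp
   thus ?thesis using pos by simp
  qed
  show "(1 / F 1) * F s = 0" if "s <= 0" for s using c0[OF that] by simp
  show "(1 / F 1) * F s = 1" if "1 <= s" for s using c1[OF that] pos by simp
 qed
qed

section \<open>Test functions and weak gradients\<close>

lemma Ck_Suc_imp: "Ck (Suc k) g ==> Ck k g"
proof (induction k arbitrary: g)
 case 0
 thus ?case by (auto intro!: continuous_at_imp_continuous_on differentiable_imp_continuous_within)
next
 case (Suc k)
 hence "ALL x. g differentiable (at x)" "!!v. Ck (Suc k) (%x. frechet_derivative g (at x) v)" by (subst (asm) Ck.simps, blast)+
 with Suc.IH show ?case by auto
qed

lemma Ck_continuous: "Ck k g ==> continuous_on UNIV g"
 by (induction k) (use Ck_Suc_imp in auto)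

lemma Ck_SucI:
 assumes "!!x. (g has_derivative g' x) (at x)" "!!v. Ck k (%x. g' x v)"
 shows "Ck (Suc k) g"
proof -
 have "frechet_derivative g (at x) = g' x" for x using assms(1) by (metis frechet_derivative_at)
 thus ?thesis using assms by (auto simp: differentiable_def)
qed

lemma Ck_SucD:
 assumes "Ck (Suc k) g"
 shows "(g has_derivative frechet_derivative g (at x)) (at x)" "Ck k (%x. frechet_derivative g (at x) v)"
 using assms by (auto simp: frechet_derivative_works[symmetric])

lemma Ck_const: "Ck k (%x. c)"
proof (induction k arbitrary: c)
 case (Suc k)
 show ?case by (rule Ck_SucI[where g'="%_ _. 0"]) (use Suc in auto)
qed auto

lemma Ck_add: "Ck k g ==> Ck k h ==> Ck k (%x. g x + h x)"
proof (induction k arbitrary: g h)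
 case (Suc k)
 show ?case
  by (rule Ck_SucI[OF has_derivative_add[OF Ck_SucD(1)[OF Suc.prems(1)] Ck_SucD(1)[OF Suc.prems(2)]]])
    (intro Suc.IH Ck_SucD(2)[OF Suc.prems(1)] Ck_SucD(2)[OF Suc.prems(2)])
qed (auto intro: continuous_intros)

lemma Ck_mult: "Ck k g ==> Ck k h ==> Ck k (%x. g x * h x)"
proof (induction k arbitrary: g h)
 case (Suc k)
 show ?case
  by (rule Ck_SucI[OF has_derivative_mult[OF Ck_SucD(1)[OF Suc.prems(1)] Ck_SucD(1)[OF Suc.prems(2)]]])
    (intro Ck_add Suc.IH Ck_SucD(2)[OF Suc.prems(1)] Ck_SucD(2)[OF Suc.prems(2)] Ck_Suc_imp[OF Suc.prems(1)] Ck_Suc_imp[OF Suc.prems(2)])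
qed (auto intro: continuous_intros)

lemma Ck_sum: "(!!i. i : I ==> Ck k (g i)) ==> Ck k (%x. SUM i:I. g i x)"
 by (induction I rule: infinite_finite_induct) (auto intro: Ck_add Ck_const)

lemma Ck_prod: "(!!i. i : I ==> Ck k (g i)) ==> Ck k (%x. \<Prod>i\<in>I. g i x)"
 by (induction I rule: infinite_finite_induct) (auto intro: Ck_mult Ck_const)

lemma Ck_linear: "bounded_linear g ==> Ck k g"
proof (cases k)
 case (Suc k)
 assume "bounded_linear g"
 thus ?thesis unfolding Suc
  by (intro Ck_SucI[where g'="%_. g"] bounded_linear_imp_has_derivative Ck_const)
qed (auto intro: linear_continuous_on)

lemma Ck_compose:
 assumes "Dk k f" "!!j. Ck j g"
 shows "Ck k (%x. f (g x))"
 using assms(1)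
proof (induction k arbitrary: f)
 case 0
 thus ?case using Ck_continuous[OF assms(2)[of 0]] by (auto intro: continuous_on_compose2)
next
 case (Suc k)
 then obtain f' where f': "!!s. (f hasd f' s) (at s)" "Dk k f'" by auto
 have "((%x. f (g x)) has_derivative (%v. f' (g x) * frechet_derivative g (at x) v)) (at x)" for x
  using has_derivative_compose[OF Ck_SucD(1)[OF assms(2)[of "Suc 0"]] f'(1)[unfolded has_field_derivative_def]] by simp
 thus ?case
  by (rule Ck_SucI) (intro Ck_mult Suc.IH[OF f'(2)] Ck_SucD(2)[OF assms(2)])
qed

definition grad :: "(real^'n => real) => real^'n => real^'n" where
 "grad ph x = (\<chi> i. frechet_derivative ph (at x) (axis i 1))"

lemma frechet_derivative_eq_grad:
 assumes "ph differentiable (at x)"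
 shows "frechet_derivative ph (at x) v = grad ph x .* v"
proof -
 have l: "linear (frechet_derivative ph (at x))" using assms by (rule linear_frechet_derivative)
 have "frechet_derivative ph (at x) v = frechet_derivative ph (at x) (SUM i:UNIV. v $ i *R axis i 1)"
  by (subst basis_expansion[symmetric, of v]) (simp add: scalar_mult_eq_scaleR)
 also have "... = grad ph x .* v"
  using l by (simp add: linear_sum linear_scale grad_def inner_vec_def mult.commute)
 finally show ?thesis .
qed

lemma test_funI:
 assumes "!!k. Ck k ph" "!!x. norm x > R ==> ph x = 0"
 shows "test_fun ph"
proof -
 have "{x. ph x ~= 0} \<subseteq> cball 0 R" using assms(2) by (auto simp: not_less[symmetric])
 hence "bounded {x. ph x ~= 0}" using bounded_subset bounded_cball by blast
 thus ?thesis using assms(1) by (simp add: test_fun_def)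
qed

lemma test_fun_Ck: "test_fun ph ==> Ck k ph" by (simp add: test_fun_def)

lemma test_fun_continuous: "test_fun ph ==> continuous_on UNIV ph"
 using Ck_continuous test_fun_Ck by blast

lemma test_fun_measurable: "test_fun ph ==> ph : BM"
 using test_fun_continuous by (rule borel_measurable_continuous_onI)

lemma test_fun_has_derivative:
 "test_fun ph ==> (ph has_derivative (%v. grad ph x .* v)) (at x)"
proof -
 assume "test_fun ph"
 hence d: "ph differentiable (at x)" using test_fun_Ck[of ph "Suc 0"] by simp
 have "frechet_derivative ph (at x) = (%v. grad ph x .* v)" using frechet_derivative_eq_grad[OF d] by (rule ext)
 with d show ?thesis by (simp add: frechet_derivative_works)
qed

lemma test_fun_grad_continuous: "test_fun ph ==> continuous_on UNIV (grad ph)"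
proof (subst continuous_on_componentwise, safe)
 assume t: "test_fun ph"
 fix i :: "real^'a" assume "i : Basis"
 then obtain j where i: "i = axis j 1" by (auto simp: Basis_vec_def)
 have "grad ph x .* i = frechet_derivative ph (at x) (axis j 1)" for x
  unfolding i by (simp add: inner_axis grad_def)
 thus "continuous_on UNIV (%x. grad ph x .* i)"
  using Ck_continuous[OF Ck_SucD(2)[OF test_fun_Ck[OF t], of 0 "axis j 1"]] by simp
qed

lemma test_fun_grad_measurable: "test_fun ph ==> grad ph : BM"
 using test_fun_grad_continuous by (rule borel_measurable_continuous_onI)

lemma test_fun_bounded_support:
 assumes "test_fun ph"
 obtains R M where "0 < R" "0 <= M" "!!x. R <= norm x ==> ph x = 0" "!!x. R <= norm x ==> grad ph x = 0"
  "!!x. abs (ph x) <= M" "!!x. norm (grad ph x) <= M"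
proof -
 have "bounded (closure {x. ph x ~= 0})" using assms compact_imp_bounded by (auto simp: test_fun_def)
 then obtain R where R: "!!x. x : closure {x. ph x ~= 0} ==> norm x <= R" by (auto simp: bounded_iff)
 have 1: "ph x = 0" if "R < norm x" for x using R[of x] that closure_subset[of "{x. ph x ~= 0}"] by force
 have 2: "grad ph x = 0" if "R < norm x" for x
 proof -
  have "((%x. 0) has_derivative (%v. grad ph x .* v)) (at x)"
  proof (rule has_derivative_transform_within_open[OF test_fun_has_derivative[OF assms]])
   show "open {x. R < norm x}" by (intro open_Collect_less continuous_intros)
  qed (use that 1 in auto)
  hence "(%v. grad ph x .* v) = (%v. 0)"
   by (metis has_derivative_const has_derivative_unique)
  hence "grad ph x .* grad ph x = 0" by meson
  thus ?thesis by simp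
 qed
 have "compact (ph ` cball 0 (abs R + 1))" "compact (grad ph ` cball 0 (abs R + 1))"
  using test_fun_continuous[OF assms] test_fun_grad_continuous[OF assms]
  by (auto intro!: compact_continuous_image intro: continuous_on_subset)
 hence "bounded (ph ` cball 0 (abs R + 1))" "bounded (grad ph ` cball 0 (abs R + 1))"
  by (auto dest!: compact_imp_bounded)
 then obtain M1 M2 where "ALL x:cball 0 (abs R + 1). abs (ph x) <= M1" "ALL x:cball 0 (abs R + 1). norm (grad ph x) <= M2"
  unfolding bounded_iff by auto
 hence M: "!!x. norm x <= abs R + 1 ==> abs (ph x) <= M1" "!!x. norm x <= abs R + 1 ==> norm (grad ph x) <= M2"
  by auto
 show ?thesis
 proof (rule that[of "abs R + 1" "abs M1 + abs M2"])
  show "abs (ph x) <= abs M1 + abs M2" for x using M(1)[of x] 1[of x] by (cases "norm x <= abs R + 1") auto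
  show "norm (grad ph x) <= abs M1 + abs M2" for x using M(2)[of x] 2[of x] by (cases "norm x <= abs R + 1") auto
 qed (use 1 2 in auto)
qed

lemma test_fun_support:
 assumes "test_fun ph"
 shows "EX R>0. ALL x. R <= norm x --> ph x = 0 & grad ph x = 0"
 by (rule test_fun_bounded_support[OF assms]) auto

lemma test_fun_bound:
 assumes "test_fun ph"
 shows "EX M>=0. ALL x. abs (ph x) <= M & norm (grad ph x) <= M"
 by (rule test_fun_bounded_support[OF assms]) auto

lemma test_fun_mult: "test_fun ph ==> test_fun ps ==> test_fun (%x. ph x * ps x)"
proof -
 assume t: "test_fun ph" "test_fun ps"
 obtain R where R: "!!x. R <= norm x ==> ph x = 0" using test_fun_support[OF t(1)] by blast
 have "Ck k (%x. ph x * ps x)" for k using t by (intro Ck_mult test_fun_Ck)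
 thus ?thesis using R by (intro test_funI[where R=R]) auto
qed

lemma test_fun_diff: "test_fun ph ==> test_fun ps ==> test_fun (%x. ph x - ps x)"
proof -
 assume t: "test_fun ph" "test_fun ps"
 obtain R1 where R1: "!!x. R1 <= norm x ==> ph x = 0" using test_fun_support[OF t(1)] by blast
 obtain R2 where R2: "!!x. R2 <= norm x ==> ps x = 0" using test_fun_support[OF t(2)] by blast
 have "Ck k (%x. ph x + (-1) * ps x)" for k using t by (intro Ck_add Ck_mult Ck_const test_fun_Ck)
 thus ?thesis using R1 R2 by (intro test_funI[where R="max R1 R2"]) auto
qed

lemma grad_diff: "test_fun ph ==> test_fun ps ==> grad (%x. ph x - ps x) x = grad ph x - grad ps x"
proof -
 assume t: "test_fun ph" "test_fun ps"
 have "((%x. ph x - ps x) has_derivative (%v. grad ph x .* v - grad ps x .* v)) (at x)"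
  using t by (intro has_derivative_diff test_fun_has_derivative)
 from has_derivative_unique[OF this test_fun_has_derivative[OF test_fun_diff[OF t]]]
 have "(%v. grad ph x .* v - grad ps x .* v) = (%v. grad (%x. ph x - ps x) x .* v)" .
 hence "grad (%x. ph x - ps x) x .* v = (grad ph x - grad ps x) .* v" for v
  by (metis inner_diff_left)
 thus ?thesis by (meson vector_eq_rdot)
qed

lemma grad_mult: "test_fun ph ==> test_fun ps ==> grad (%x. ph x * ps x) x = ph x *R grad ps x + ps x *R grad ph x"
proof -
 assume t: "test_fun ph" "test_fun ps"
 have "((%x. ph x * ps x) has_derivative (%v. ph x * (grad ps x .* v) + (grad ph x .* v) * ps x)) (at x)"
  using t by (intro has_derivative_mult test_fun_has_derivative)
 from has_derivative_unique[OF this test_fun_has_derivative[OF test_fun_mult[OF t]]]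
 have "(%v. ph x * (grad ps x .* v) + (grad ph x .* v) * ps x) = (%v. grad (%x. ph x * ps x) x .* v)" .
 from fun_cong[OF this] have "grad (%x. ph x * ps x) x .* v = (ph x *R grad ps x + ps x *R grad ph x) .* v" for v
  by (simp add: inner_add_left mult.commute)
 thus ?thesis by (meson vector_eq_rdot)
qed

lemma integrable_compact_support:
 fixes g :: "'a::euclidean_space => 'b::euclidean_space"
 assumes "continuous_on UNIV g" "!!x. R <= norm x ==> g x = 0"
 shows "IB g"
proof -
 have "IB (%x. iB R x *R g x)"
  using assms(1) by (intro borel_integrable_compact) (auto intro: continuous_on_subset)
 also have "(%x. iB R x *R g x) = g"
  using assms(2) by (auto simp: fun_eq_iff indicator_def not_le[symmetric])
 finally show ?thesis .
qed

lemma locally_integrable_continuous: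
 assumes "continuous_on UNIV g"
 shows "locally_integrable g"
 unfolding locally_integrable_def set_integrable_def
proof safe
 fix K :: "(real^'a) set" assume "compact K"
 hence "IB (%x. ind K x *R g x)"
  using assms by (intro borel_integrable_compact) (auto intro: continuous_on_subset)
 thus "IL (%x. ind K x *R g x)"
  by (subst integrable_completion) auto
qed

text \<open>Difference quotients of a test function have integral 0 by translation invariance. They
  are uniformly bounded, supported in one ball, and converge to the directional derivative.\<close>

lemma integral_test_fun_derivative:
 fixes ph :: "real^'n => real"
 assumes t: "test_fun ph"
 shows "(LBINT x. grad ph x .* v) = 0"
proof -
 obtain R M where RM: "0 < R" "0 <= M" "!!x. R <= norm x ==> ph x = 0" "!!x. R <= norm x ==> grad ph x = 0"
  "!!x. abs (ph x) <= M" "!!x. norm (grad ph x) <= M"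
  by (rule test_fun_bounded_support[OF t]) (rule that)
 define d where "d = (%n x. real (Suc n) * (ph (x + (1 / real (Suc n)) *R v) - ph x))"
 have [measurable]: "ph : BM" using t by (rule test_fun_measurable)
 have ip: "IB ph" using test_fun_continuous[OF t] RM by (intro integrable_compact_support) auto
 have d0: "(LBINT x. d n x) = 0" for n
 proof -
  let ?c = "(1 / real (Suc n)) *R v"
  have L: "(lborel::(real^'n) measure) = distr lborel borel ((+) ?c)" by (simp only: lborel_distr_plus)
  have "IB (%x. ph (?c + x))" using ip by (subst (asm) L) (simp add: integrable_distr_eq)
  moreover have "(LBINT x. ph x) = (LBINT x. ph (?c + x))" by (subst L) (simp add: integral_distr)
  ultimately show ?thesis using ip by (simp add: d_def add.commute)
 qed
 have lip: "abs (ph y - ph x) <= M * norm (y - x)" for x y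
 proof -
  have "norm (ph y - ph x) <= M * norm (y - x)"
  proof (rule differentiable_bound[of UNIV ph "%x v. grad ph x .* v"])
   fix x :: "real^'n"
   show "(ph has_derivative (.*) (grad ph x)) (at x)" using test_fun_has_derivative[OF t] by simp
   show "onorm ((.*) (grad ph x)) <= M"
    using RM by (intro onorm_bound) (auto intro!: order_trans[OF Cauchy_Schwarz_ineq2] mult_right_mono)
  qed auto
  thus ?thesis by simp
 qed
 let ?B = "%x::real^'n. M * norm v * ind (cball 0 (R + norm v)) x"
 have db: "norm (d n x) <= ?B x" for n x
 proof (cases "x : cball 0 (R + norm v)")
  case True
  have "norm (d n x) <= real (Suc n) * (M * norm ((1 / real (Suc n)) *R v))"
   using mult_left_mono[OF lip[of "x + (1 / real (Suc n)) *R v" x], of "real (Suc n)"]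
   by (simp add: d_def abs_mult del: of_nat_Suc)
  thus ?thesis using True by simp
 next
  case False
  hence 1: "R + norm v < norm x" by simp
  have "norm x <= norm (x + (1 / real (Suc n)) *R v) + norm ((1 / real (Suc n)) *R v)"
   by (metis add_diff_cancel norm_triangle_ineq4)
  moreover have "norm ((1 / real (Suc n)) *R v) <= norm v" by (simp add: divide_le_eq mult_le_cancel_left1)
  ultimately have "R <= norm (x + (1 / real (Suc n)) *R v)" using 1 by linarith
  moreover have "R <= norm x" using 1 norm_ge_zero[of v] by linarith
  ultimately show ?thesis using RM False by (simp add: d_def)
 qed
 have lim: "(%n. d n x) ----> grad ph x .* v" for x
 proof -
  have "((%h. ph (x + h *R v)) hasd (grad ph x .* v)) (at 0)"
  proof -
   have "((%h. x + h *R v) has_derivative (%h. h *R v)) (at 0)" by (auto intro!: derivative_eq_intros)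
   moreover have "(ph has_derivative (%v. grad ph x .* v)) (at (x + 0 *R v))" using test_fun_has_derivative[OF t, of x] by simp
   ultimately have "((%h. ph (x + h *R v)) has_derivative (%h. grad ph x .* (h *R v))) (at 0)"
    by (rule has_derivative_compose)
   hence "((%h. ph (x + h *R v)) has_derivative (%h. grad ph x .* (h *R v))) (at 0)" by simp
   thus ?thesis unfolding has_field_derivative_def by (rule has_derivative_eq_rhs) (simp add: fun_eq_iff)
  qed
  hence "((%h. (ph (x + h *R v) - ph x) / h) \<longlongrightarrow> grad ph x .* v) (at 0)" by (simp add: DERIV_def)
  moreover have "filterlim (%n. 1 / real (Suc n)) (at 0) sequentially"
   using LIMSEQ_Suc[OF lim_1_over_n] by (simp add: filterlim_at)
  ultimately have "(%n. (ph (x + (1 / real (Suc n)) *R v) - ph x) / (1 / real (Suc n))) ----> grad ph x .* v"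
   by (rule filterlim_compose)
  thus ?thesis by (simp add: d_def mult.commute)
 qed
 have [measurable]: "grad ph : BM" using t by (rule test_fun_grad_measurable)
 have [measurable]: "d n : borel_measurable lborel" for n unfolding d_def by measurable
 have "(%n. (LBINT x. d n x)) ----> (LBINT x. grad ph x .* v)"
 proof (rule integral_dominated_convergence[where w="?B"])
  show "IB ?B"
   by (intro integrable_mult_right integrable_real_indicator emeasure_lborel_cball_finite) simp
  show "AE x in lborel. (%n. d n x) ----> grad ph x .* v" by (intro AE_I2 lim)
  show "AE x in lborel. norm (d n x) <= ?B x" for n by (intro AE_I2 db)
 qed measurable
 thus ?thesis using d0 by (simp add: LIMSEQ_const_iff)
qed

text \<open>Integration by parts: the gradient of the product of two test functions has integral
  0.\<close>

lemma test_fun_weak_gradient: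
 assumes t: "test_fun ph"
 shows "has_weak_gradient ph (grad ph)"
 unfolding has_weak_gradient_def
proof safe
 show "locally_integrable ph" "locally_integrable (grad ph)"
  using t by (auto intro!: locally_integrable_continuous test_fun_continuous test_fun_grad_continuous)
 fix ps :: "real^'a => real" and i assume p: "test_fun ps"
 note meas[measurable] = test_fun_measurable[OF t] test_fun_measurable[OF p] test_fun_grad_measurable[OF t] test_fun_grad_measurable[OF p]
 note c = test_fun_continuous[OF t] test_fun_continuous[OF p] test_fun_grad_continuous[OF t] test_fun_grad_continuous[OF p]
 obtain R where RM: "!!x. R <= norm x ==> ph x = 0" "!!x. R <= norm x ==> grad ph x = 0"
  using test_fun_support[OF t] by blast
 have fr: "frechet_derivative ps (at x) (axis i 1) = grad ps x $ i" for x by (simp add: grad_def)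
 have i1: "IB (%x. ph x * grad ps x $ i)" "IB (%x. grad ph x $ i * ps x)"
  using RM c by (auto intro!: integrable_compact_support[where R=R] continuous_intros)
 have "grad (%x. ph x * ps x) x .* axis i 1 = ph x * grad ps x $ i + grad ph x $ i * ps x" for x
  using t p by (simp add: grad_mult inner_axis inner_add_left)
 hence "(LBINT x. ph x * grad ps x $ i + grad ph x $ i * ps x) = 0"
  using integral_test_fun_derivative[OF test_fun_mult[OF t p], of "axis i 1"] by simp
 hence "(LBINT x. ph x * grad ps x $ i) = - (LBINT x. grad ph x $ i * ps x)"
  using i1 by simp
 thus "(LL x. ph x * frechet_derivative ps (at x) (axis i 1)) = - (LL x. grad ph x $ i * ps x)"
  unfolding fr using c by (subst (1 2) integral_completion) (auto intro!: borel_measurable_continuous_onI continuous_intros)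
qed

text \<open>Boxes generate the Borel sets and are stable under intersection, so the integral of g
  vanishes over every Borel set, in particular where g > 0 and where g < 0.\<close>

lemma zero_on_boxes_imp_AE_zero:
 fixes g :: "'a::euclidean_space => real"
 assumes g: "IB g" and g0: "SB g = 0"
  and box: "!!a b. (LBINT x. ind (box a b) x * g x) = 0"
 shows "AE x in lborel. g x = 0"
proof -
 have [measurable]: "g : BM" using g by auto
 have P: "(LBINT x. ind S x * g x) = 0" if "S : sets borel" for S
 proof -
  have sb: "T : sets borel" if "T : sigma_sets UNIV (range (%(a, b). box a b))" for T :: "'a set"
   using that unfolding borel_eq_box by simp
  have "Int_stable (range (%(a, b). box a b :: 'a set))" by (auto simp: Int_stable_def box_Int_box)
  moreover have "range (%(a, b). box a b :: 'a set) \<subseteq> Pow UNIV" by simp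
  moreover have "S : sigma_sets UNIV (range (%(a, b). box a b))"
   using that unfolding borel_eq_box by simp
  ultimately show ?thesis
  proof (induction S rule: sigma_sets_induct_disjoint)
   case (basic T)
   thus ?case using box by auto
  next
   case empty
   show ?case by simp
  next
   case (compl T)
   have [measurable]: "T : sets borel" using compl sb by auto
   have "(LBINT x. ind (UNIV - T) x * g x) = (LBINT x. g x - ind T x * g x)"
    by (intro Bochner_Integration.integral_cong) (auto split: split_indicator)
   also have "... = 0" using g integrable_mult_indicator[of T lborel g] compl g0
    by (subst integral_sub) auto
   finally show ?case .
  next
   case (union T)
   have [measurable]: "T i : sets borel" for i using union sb by auto
   have "set_integrable lborel (\<Union>i. T i) g" using g
    by (auto simp: set_integrable_def intro!: integrable_mult_indicator[of _ lborel g, unfolded real_scaleR_def])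
   hence "(LINT x:(\<Union>i. T i)|lborel. g x) = (\<Sum>i. LINT x:T i|lborel. g x)"
    using union by (intro lebesgue_integral_countable_add) (auto simp: disjoint_family_on_def)
   thus ?case using union by (simp add: set_lebesgue_integral_def)
  qed
 qed
 have "AE x in lborel. ind {x. 0 < g x} x * g x = 0"
  using P[of "{x. 0 < g x}"] integrable_mult_indicator[of "{x. 0 < g x}" lborel g] g
  by (intro integral_nonneg_eq_0_iff_AE[THEN iffD1]) (auto split: split_indicator)
 moreover have "AE x in lborel. - (ind {x. g x < 0} x * g x) = 0"
  using P[of "{x. g x < 0}"] integrable_mult_indicator[of "{x. g x < 0}" lborel g] g
  by (intro integral_nonneg_eq_0_iff_AE[THEN iffD1]) (auto split: split_indicator)
 ultimately show ?thesis
  by eventually_elim (auto simp: indicator_def split: if_splits)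
qed

text \<open>A product over the coordinates of smooth steps at the two opposite faces, made steeper
  by the factor k.\<close>

lemma test_fun_box_approx:
 fixes a b :: "real^'n"
 obtains ph :: "nat => real^'n => real"
 where "!!k. test_fun (ph k)" "!!k x. 0 <= ph k x" "!!k x. ph k x <= ind (box a b) x"
  "!!x. (%k. ph k x) ----> ind (box a b) x"
proof -
 obtain et where et: "!!k. Dk k et" "!!s. s <= 0 ==> et s = 0" "!!s. 1 <= s ==> et s = 1"
  "!!s. 0 <= et s" "!!s. et s <= 1" using smooth_step_exists by metis
 define ph where "ph = (%k (x::real^'n). \<Prod>i\<in>UNIV. et (- real k * a $ i + real k * x $ i) * et (real k * b $ i + (- real k) * x $ i))"
 have box: "x : box a b \<longleftrightarrow> (ALL i. a $ i < x $ i & x $ i < b $ i)" for x by (simp add: mem_box_cart)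
 have z: "ph k x = 0" if "x ~: box a b" for k x
 proof -
  obtain i where "x $ i <= a $ i | b $ i <= x $ i" using \<open>x ~: box a b\<close> box by (auto simp: not_less)
  hence "et (- real k * a $ i + real k * x $ i) * et (real k * b $ i + (- real k) * x $ i) = 0"
   using mult_left_mono[of "x $ i" "a $ i" "real k"] mult_left_mono[of "b $ i" "x $ i" "real k"] by (auto intro!: et(2))
  thus ?thesis unfolding ph_def by (intro prod_zero) auto
 qed
 have le1: "ph k x <= 1" for k x unfolding ph_def
  by (intro prod_le_1 conjI mult_nonneg_nonneg mult_le_one et)
 have ge0: "0 <= ph k x" for k x unfolding ph_def by (intro prod_nonneg ballI mult_nonneg_nonneg et)
 have "bounded (box a b)" by simp
 then obtain R where R: "!!x. x : box a b ==> norm x <= R" by (auto simp: bounded_iff)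
 show ?thesis
 proof (rule that[of ph])
  show "test_fun (ph k)" for k
  proof (rule test_funI[where R=R])
   show "Ck j (ph k)" for j unfolding ph_def
    by (intro Ck_prod Ck_mult Ck_compose[where f="%y. et (- real k * a $ _ + real k * y)"] Ck_compose[where f="%y. et (real k * b $ _ + (- real k) * y)"]
      Dk_compose_affine et Ck_linear bounded_linear_vec_nth)
   show "ph k x = 0" if "R < norm x" for x using R[of x] that by (intro z) auto
  qed
  show "0 <= ph k x" for k x by (rule ge0)
  show "ph k x <= ind (box a b) x" for k x using z le1 by (auto split: split_indicator)
  show "(%k. ph k x) ----> ind (box a b) x" for x
  proof (cases "x : box a b")
   case False
   thus ?thesis using z by simp
  next
   case True
   have ev: "EV k. 1 <= real k * c" if "0 < c" for c
    using eventually_ge_at_top[of "nat \<lceil>1 / c\<rceil>"] by eventually_elim (use that in "auto simp: field_simps nat_le_iff ceiling_le_iff")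
   have "EV k. ALL i. 1 <= real k * (x $ i - a $ i) & 1 <= real k * (b $ i - x $ i)"
    using True box by (intro eventually_all_finite eventually_conj ev) auto
   hence "EV k. ph k x = 1"
   proof eventually_elim
    case (elim k)
    have "et (- real k * a $ i + real k * x $ i) = 1" "et (real k * b $ i + (- real k) * x $ i) = 1" for i
     using elim[rule_format, of i] by (auto intro!: et(3) simp: algebra_simps)
    thus ?case by (simp only: ph_def mult_1 prod.neutral_const)
   qed
   thus ?thesis using True by (auto intro: tendsto_eventually)
  qed
 qed
qed

text \<open>Approximating indicators of boxes by test functions makes the integral of g vanish over
  boxes. On each large box g is replaced by a Borel version, since the generation of sets by boxes
  is an argument about Borel sets.\<close>

lemma test_zero_imp_AE_zero:
 fixes g :: "real^'n => real"
 assumes g: "locally_integrable g"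
  and t: "!!ph. test_fun ph ==> (LL x. g x * ph x) = 0"
 shows "AE x in lebesgue. g x = 0"
proof -
 have Z: "IL (%x. ind (box a b) x * g x) & (LL x. ind (box a b) x * g x) = 0" for a b
 proof -
  have i: "IL (%x. ind (cbox a b) x * g x)"
   using g by (auto simp: locally_integrable_def set_integrable_def)
  have "IL (%x. ind (box a b) x *R (ind (cbox a b) x * g x))"
   by (intro integrable_mult_indicator i) auto
  also have "(%x. ind (box a b) x *R (ind (cbox a b) x * g x)) = (%x. ind (box a b) x * g x)"
   using box_subset_cbox[of a b] by (auto simp: fun_eq_iff split: split_indicator)
  finally have ib: "IL (%x. ind (box a b) x * g x)" .
  obtain ph :: "nat => real^'n => real" where p: "!!k. test_fun (ph k)" "!!k x. 0 <= ph k x" "!!k x. ph k x <= ind (box a b) x"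
   "!!x. (%k. ph k x) ----> ind (box a b) x" using test_fun_box_approx[of a b] by metis
  have eq: "g x * ph k x = (ind (box a b) x * g x) * ph k x" for k x
   using p(2,3)[of k x] by (auto split: split_indicator_asm split_indicator)
  have m: "(%x. (ind (box a b) x * g x) * ph k x) : LM" for k
   using test_fun_measurable[OF p(1), of k]
   by (intro borel_measurable_times[OF borel_measurable_integrable[OF ib]] measurable_completion) simp
  have "(%k. (LL x. (ind (box a b) x * g x) * ph k x)) ----> (LL x. ind (box a b) x * g x)"
  proof (rule integral_dominated_convergence[where w="%x. norm (ind (box a b) x * g x)"])
   show "IL (%x. norm (ind (box a b) x * g x))" using ib by (rule integrable_norm)
   show "AE x in lebesgue. (%k. (ind (box a b) x * g x) * ph k x) ----> ind (box a b) x * g x"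
    using tendsto_mult_left[OF p(4)] by (intro AE_I2) (auto simp: indicator_def intro!: tendsto_eq_intros p(4) split: if_splits)
   show "AE x in lebesgue. norm (ind (box a b) x * g x * ph k x) <= norm (ind (box a b) x * g x)" for k
   proof (intro AE_I2)
    fix x
    show "norm (ind (box a b) x * g x * ph k x) <= norm (ind (box a b) x * g x)"
     using p(2,3)[of k x] by (cases "x : box a b") (auto simp: abs_mult intro!: mult_left_le)
   qed
  qed (use m ib in auto)
  thus ?thesis using t[OF p(1)] ib by (simp add: eq[symmetric] LIMSEQ_const_iff)
 qed
 have B: "AE x in lebesgue. x : box (- (\<chi> i. real m)) (\<chi> i. real m) --> g x = 0" for m
 proof -
  let ?B = "box (- (\<chi> i. real m)) (\<chi> i. real m) :: (real^'n) set"
  have "(%x. ind ?B x * g x) : LM" using Z by auto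
  then obtain h where h: "h : borel_measurable lborel" "AE x in lborel. ind ?B x * g x = h x"
   using completion_ex_borel_measurable_real by blast
  have h': "AE x in lebesgue. ind ?B x * g x = h x" using h by (simp add: AE_completion)
  have [measurable]: "h : BM" using h by simp
  have hm: "h : LM" using h by (simp add: measurable_completion)
  have gm: "(%x. ind ?B x * g x) : LM" using Z by auto
  have hi: "IL h"
   using Z[of "- (\<chi> i. real m)" "\<chi> i. real m"] h' hm gm by (subst integrable_cong_AE[of _ _ "%x. ind ?B x * g x"]) (auto elim: eventually_mono)
  have "AE x in lborel. h x = 0"
  proof (rule zero_on_boxes_imp_AE_zero)
   show "IB h" using hi h by (simp add: integrable_completion)
   have "SB h = SL h" using h by (simp add: integral_completion)
   also have "... = (LL x. ind ?B x * g x)" using h' hm gm by (intro integral_cong_AE) (auto elim: eventually_mono)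
   finally show "SB h = 0" using Z by simp
   fix a b :: "real^'n"
   have "(LBINT x. ind (box a b) x * h x) = (LL x. ind (box a b) x * h x)"
    by (subst integral_completion) auto
   also have "... = (LL x. ind (box a b Int ?B) x * g x)"
   proof (rule integral_cong_AE)
    show "AE x in lebesgue. ind (box a b) x * h x = ind (box a b Int ?B) x * g x"
     using h' by eventually_elim (auto simp: indicator_def split: if_splits)
    show "(%x. ind (box a b Int ?B) x * g x) : LM"
     unfolding box_Int_box using Z by (intro borel_measurable_integrable) blast
   qed (use hm in "auto intro!: borel_measurable_times intro: measurable_completion")
   also have "... = 0" unfolding box_Int_box using Z by blast
   finally show "(LBINT x. ind (box a b) x * h x) = 0" .
  qed
  hence "AE x in lebesgue. h x = 0" by (simp add: AE_completion)
  with h' show ?thesis by eventually_elim (auto simp: indicator_def split: if_splits)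
 qed
 have "AE x in lebesgue. ALL m. x : box (- (\<chi> i. real m)) (\<chi> i. real m) --> g x = 0"
  using B by (subst AE_all_countable) auto
 thus ?thesis
 proof eventually_elim
  case (elim x)
  obtain m where m: "norm x < real m" using reals_Archimedean2 by blast
  have "x : box (- (\<chi> i. real m)) (\<chi> i. real m)"
  proof -
   have "abs (x $ i) < real m" for i using component_le_norm_cart[of x i] m by linarith
   thus ?thesis by (auto simp: mem_box_cart abs_less_iff minus_less_iff)
  qed
  with elim show ?case by blast
 qed
qed

lemma has_weak_gradient_unique:
 assumes "has_weak_gradient u v" "has_weak_gradient u w"
 shows "AE x in lebesgue. v x = w x"
proof -
 have L: "locally_integrable v" "locally_integrable w" using assms by (auto simp: has_weak_gradient_def)
 have Li: "locally_integrable (%x. v x $ i)" if "locally_integrable v" for v :: "real^'a => real^'a" and i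
  unfolding locally_integrable_def set_integrable_def
 proof safe
  fix K :: "(real^'a) set" assume "compact K"
  hence "IL (%x. ind K x *R v x)" using that by (auto simp: locally_integrable_def set_integrable_def)
  from integrable_bounded_linear[OF bounded_linear_vec_nth this, of i]
  show "IL (%x. ind K x *R v x $ i)" by simp
 qed
 have "AE x in lebesgue. v x $ i - w x $ i = 0" for i
 proof (rule test_zero_imp_AE_zero)
  show "locally_integrable (%x. v x $ i - w x $ i)"
   using Li[OF L(1), of i] Li[OF L(2), of i] unfolding locally_integrable_def by (auto intro: set_integral_diff(1))
  fix ph :: "real^'a => real" assume t: "test_fun ph"
  obtain R where R: "!!x. R <= norm x ==> ph x = 0" using test_fun_support[OF t] by blast
  obtain M where "!!x. abs (ph x) <= M" using test_fun_bound[OF t] by blast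
  note RM = R this
  have im: "IL (%x. v x $ i * ph x)" if "locally_integrable v" for v :: "real^'a => real^'a"
  proof -
   have 1: "IL (%x. iB R x *R (v x $ i))" using Li[OF that, of i] by (auto simp: locally_integrable_def set_integrable_def)
   have "IL (%x. (iB R x *R (v x $ i)) * ph x)"
   proof (rule ibound[OF integrable_mult_left[OF 1, of M]])
    show "AE x in lebesgue. norm ((iB R x *R (v x $ i)) * ph x) <= norm ((iB R x *R (v x $ i)) * M)"
     using RM(2) by (intro AE_I2) (auto simp: abs_mult intro!: mult_left_mono intro: order_trans[OF _ abs_ge_self])
    show "(%x. (iB R x *R (v x $ i)) * ph x) : LM"
     using test_fun_measurable[OF t]
     by (intro borel_measurable_times[OF borel_measurable_integrable[OF 1]] measurable_completion) simp
   qed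
   also have "(%x. (iB R x *R (v x $ i)) * ph x) = (%x. v x $ i * ph x)"
    using RM(1) by (auto simp: fun_eq_iff indicator_def not_le[symmetric])
   finally show ?thesis .
  qed
  have "(LL x. v x $ i * ph x) = (LL x. w x $ i * ph x)"
  proof -
   have e: "(LL x. u x * frechet_derivative ph (at x) (axis i 1)) = - (LL x. v x $ i * ph x)"
    if "has_weak_gradient u v" for v using that t unfolding has_weak_gradient_def by blast
   show ?thesis using e[OF assms(1)] e[OF assms(2)] by linarith
  qed
  thus "(LL x. (v x $ i - w x $ i) * ph x) = 0"
   using im[OF L(1)] im[OF L(2)] by (simp add: left_diff_distrib)
 qed
 hence "AE x in lebesgue. ALL i. v x $ i - w x $ i = 0" by (subst AE_all_countable) auto
 thus ?thesis by eventually_elim (simp add: vec_eq_iff)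
qed

lemma weak_gradient_works: "weakly_differentiable u ==> has_weak_gradient u (weak_gradient u)"
 unfolding weakly_differentiable_def weak_gradient_def by (elim someI_ex)

lemma weak_gradient_AE: "has_weak_gradient u v ==> AE x in lebesgue. weak_gradient u x = v x"
 by (rule has_weak_gradient_unique[OF weak_gradient_works]) (auto simp: weakly_differentiable_def)

text \<open>The fundamental theorem of calculus for s -> ph(x/s) on [e, 1], with e so small that x/e
  lies outside the support; below e the integrand vanishes.\<close>

lemma test_fun_ray:
 fixes ph :: "real^'n => real"
 assumes t: "test_fun ph" and x: "x ~= 0"
 shows "ph x = - (LBINT t. ind {0..1} t * ((grad ph (x /\<^sub>R t) .* (x /\<^sub>R t)) / t))"
  and "IB (%t. ind {0..1} t * ((grad ph (x /\<^sub>R t) .* (x /\<^sub>R t)) / t))"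
proof -
 obtain R where R: "0 < R" "!!x. R <= norm x ==> ph x = 0" "!!x. R <= norm x ==> grad ph x = 0"
  using test_fun_support[OF t] by blast
 define e where "e = min 1 (norm x / R)"
 have e: "0 < e" "e <= 1" using x R by (auto simp: e_def)
 have big: "R <= norm (x /\<^sub>R s)" if "0 < s" "s <= norm x / R" for s
  using that R by (simp add: field_simps)
 let ?f = "%s. - ((grad ph (x /\<^sub>R s) .* (x /\<^sub>R s)) / s)"
 have d: "((%s. ph (x /\<^sub>R s)) has_vector_derivative ?f s) (at s within {e..1})" if "e <= s" "s <= 1" for s
 proof -
  have s: "0 < s" using that e by simp
  have 1: "((%s. x /\<^sub>R s) has_derivative (%h. - (h / s^2) *R x)) (at s within {e..1})"
   using s by (auto intro!: derivative_eq_intros simp: power2_eq_square field_simps)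
  have "((%s. ph (x /\<^sub>R s)) has_derivative (%h. grad ph (x /\<^sub>R s) .* (- (h / s^2) *R x))) (at s within {e..1})"
   using has_derivative_compose[OF 1 test_fun_has_derivative[OF t]] .
  thus ?thesis unfolding has_vector_derivative_def
   by (rule has_derivative_eq_rhs) (use s in "auto simp: fun_eq_iff power2_eq_square field_simps")
 qed
 have c: "continuous_on {e..1} ?f"
  using e test_fun_grad_continuous[OF t]
  by (intro continuous_intros continuous_on_compose2[where f="%s. x /\<^sub>R s" and g="grad ph"]) auto
 have hb: "has_bochner_integral lborel (%s. ind {e..1} s *R ?f s) (ph (x /\<^sub>R 1) - ph (x /\<^sub>R e))"
  using e d c by (intro has_bochner_integral_FTC_Icc) auto
 have "e <= norm x / R" by (simp add: e_def)
 hence z: "ph (x /\<^sub>R e) = 0" using e big by (intro R(2)) auto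
 let ?h = "%s. ind {0..1} s * ((grad ph (x /\<^sub>R s) .* (x /\<^sub>R s)) / s)"
 have eq: "ind {e..1} s *R ?f s = - ?h s" if "s ~= e" for s
 proof (cases "0 < s & s < e")
  case True
  hence "grad ph (x /\<^sub>R s) = 0" using big[of s] R(3) by (auto simp: e_def)
  thus ?thesis by simp
 qed (use e that in "auto simp: indicator_def")
 note [measurable] = test_fun_grad_measurable[OF t]
 have hb': "has_bochner_integral lborel (%s. ind {e..1} s *R ?f s) (ph x)"
  using hb unfolding z by (simp only: diff_zero inverse_1 scaleR_one)
 have "has_bochner_integral lborel (%s. - ?h s) (ph x)"
 proof (rule has_bochner_integral_cong_AE[THEN iffD1, OF _ _ _ hb'])
  show "AE s in lborel. ind {e..1} s *R ?f s = - ?h s"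
   using AE_lborel_singleton[of e] by eventually_elim (rule eq)
 qed measurable
 from has_bochner_integral_minus[OF this] have "has_bochner_integral lborel ?h (- ph x)" by simp
 thus "ph x = - (LBINT t. ?h t)" and "IB ?h"
  by (auto simp: has_bochner_integral_iff)
qed

text \<open>Composing with the squared norm instead of the norm keeps the function smooth at the
  origin.\<close>

lemma radial_test_fun:
 assumes "!!k. Dk k Ph" "!!s. R <= s ==> Ph s = 0" and d: "!!s. (Ph hasd w s) (at s)"
 shows "test_fun (%x::real^'n. Ph (x .* x))" "grad (%x::real^'n. Ph (x .* x)) x = (2 * w (x .* x)) *R x"
proof -
 have C: "Ck k (%x::real^'n. x .* x)" for k
 proof -
  have "(%x::real^'n. x .* x) = (%x. SUM i:UNIV. x $ i * x $ i)" by (simp add: inner_vec_def)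
  moreover have "Ck k (%x::real^'n. SUM i:UNIV. x $ i * x $ i)"
   by (rule Ck_sum, rule Ck_mult; rule Ck_linear; rule bounded_linear_vec_nth)
  ultimately show ?thesis by simp
 qed
 show t: "test_fun (%x::real^'n. Ph (x .* x))"
 proof (rule test_funI[where R="abs R + 1"])
  show "Ck k (%x::real^'n. Ph (x .* x))" for k by (rule Ck_compose[OF assms(1) C])
  fix x :: "real^'n" assume "abs R + 1 < norm x"
  hence "R <= norm x * 1" "1 <= norm x" by auto
  moreover have "norm x * 1 <= norm x * norm x" using calculation by (intro mult_left_mono) auto
  ultimately have "R <= norm x * norm x" by linarith
  thus "Ph (x .* x) = 0" by (intro assms) (simp add: power2_norm_eq_inner[symmetric] power2_eq_square)
 qed
 have "((%x::real^'n. x .* x) has_derivative (%h. x .* h + h .* x)) (at x)" by (auto intro!: derivative_eq_intros)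
 from has_derivative_compose[OF this d[unfolded has_field_derivative_def]]
 have "((%x. Ph (x .* x)) has_derivative (%h. w (x .* x) * (x .* h + h .* x))) (at x)" .
 note fun_cong[OF has_derivative_unique[OF test_fun_has_derivative[OF t] this]]
 hence "grad (%x. Ph (x .* x)) x .* h = ((2 * w (x .* x)) *R x) .* h" for h
  by (simp add: inner_commute)
 thus "grad (%x::real^'n. Ph (x .* x)) x = (2 * w (x .* x)) *R x" by (meson vector_eq_rdot)
qed

lemma locally_integrableD: "locally_integrable g ==> IL (%x. iB R x *R g x)"
 by (auto simp: locally_integrable_def set_integrable_def)

lemma locally_integrableI:
 assumes "!!R. IL (%x. iB R x *R g x)"
 shows "locally_integrable g"
 unfolding locally_integrable_def set_integrable_def
proof safe
 fix K :: "(real^'a) set" assume K: "compact K"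
 obtain R where "ALL x:K. norm x <= R" using compact_imp_bounded[OF K] unfolding bounded_iff by blast
 hence R: "K \<subseteq> cball 0 R" by auto
 have "IL (%x. ind K x *R (iB R x *R g x))"
  using borel_compact[OF K] by (intro integrable_mult_indicator[OF _ assms]) (auto intro: sets_completionI_sets)
 also have "(%x. ind K x *R (iB R x *R g x)) = (%x. ind K x *R g x)"
  using R by (auto simp: fun_eq_iff split: split_indicator)
 finally show "IL (%x. ind K x *R g x)" .
qed

lemma locally_integrable_diff:
 "locally_integrable g ==> locally_integrable h ==> locally_integrable (%x. g x - h x)"
 unfolding locally_integrable_def by (auto intro: set_integral_diff(1))

lemma integrable_mult_test_fun:
 fixes g :: "real^'n => real"
 assumes g: "locally_integrable g" and c: "continuous_on UNIV ph" and R: "!!x. R <= norm x ==> ph x = 0"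
  and M: "!!x. abs (ph x) <= M"
 shows "IL (%x. g x * ph x)"
  and "abs (LL x. g x * ph x) <= M * (LL x. iB R x * abs (g x))"
proof -
 have M0: "0 <= M" using M[of 0] by linarith
 have 1: "IL (%x. iB R x *R g x)" using g by (rule locally_integrableD)
 have eq: "(iB R x *R g x) * ph x = g x * ph x" for x
  using R[of x] by (cases "norm x <= R") auto
 have cm: "ph : LM" using borel_measurable_continuous_onI[OF c] by (intro measurable_completion) simp
 have ii: "IL (%x. (iB R x *R g x) * ph x)"
 proof (rule ibound[OF integrable_mult_left[OF 1, of M]])
  show "AE x in lebesgue. norm ((iB R x *R g x) * ph x) <= norm ((iB R x *R g x) * M)"
   using M M0 by (intro AE_I2) (auto simp: abs_mult intro!: mult_left_mono)
 qed (intro borel_measurable_times borel_measurable_integrable[OF 1] cm)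
 thus i: "IL (%x. g x * ph x)" unfolding eq .
 have i2: "IL (%x. iB R x * abs (g x))"
  using integrable_norm[OF 1] by (simp add: abs_mult)
 have "abs (LL x. g x * ph x) <= (LL x. abs (g x * ph x))" by (rule integral_abs_bound)
 also have "... <= (LL x. M * (iB R x * abs (g x)))"
 proof (intro integral_mono integrable_abs i integrable_mult_right i2)
  fix x
  show "abs (g x * ph x) <= M * (iB R x * abs (g x))"
   using M[of x] M0 R[of x] by (cases "norm x <= R") (auto simp: abs_mult mult.commute[of M] intro!: mult_left_mono)
 qed
 finally show "abs (LL x. g x * ph x) <= M * (LL x. iB R x * abs (g x))" by simp
qed

lemma locally_integrable_component: "locally_integrable v ==> locally_integrable (%x. v x $ i)"
 for v :: "real^'n => real^'n"
 unfolding locally_integrable_def set_integrable_def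
proof safe
 fix K :: "(real^'n) set" assume "compact K" "ALL K. compact K --> IL (%x. indicat_real K x *R v x)"
 hence "IL (%x. ind K x *R v x)" by blast
 from integrable_bounded_linear[OF bounded_linear_vec_nth this, of i]
 show "IL (%x. ind K x *R v x $ i)" by simp
qed

lemma has_weak_gradient_diff:
 assumes 1: "has_weak_gradient u1 v1" and 2: "has_weak_gradient u2 v2"
 shows "has_weak_gradient (%x. u1 x - u2 x) (%x. v1 x - v2 x)"
 unfolding has_weak_gradient_def
proof (intro conjI allI impI)
 note L = 1[unfolded has_weak_gradient_def] 2[unfolded has_weak_gradient_def]
 show "locally_integrable (%x. u1 x - u2 x)" "locally_integrable (%x. v1 x - v2 x)"
  using L by (blast intro: locally_integrable_diff)+
 fix ph :: "real^'a => real" and i assume t: "test_fun ph"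
 obtain R where R: "!!x. R <= norm x ==> ph x = 0" "!!x. R <= norm x ==> grad ph x = 0" using test_fun_support[OF t] by blast
 obtain M where M: "!!x. abs (ph x) <= M" "!!x. norm (grad ph x) <= M" using test_fun_bound[OF t] by blast
 have fr: "frechet_derivative ph (at x) (axis i 1) = grad ph x $ i" for x by (simp add: grad_def)
 have a: "IL (%x. u x * grad ph x $ i)" "IL (%x. v x $ i * ph x)"
  if "has_weak_gradient u v" for u v
 proof -
  note l = that[unfolded has_weak_gradient_def]
  show "IL (%x. u x * grad ph x $ i)"
  proof (rule integrable_mult_test_fun(1)[where R=R and M=M])
   show "locally_integrable u" using l by blast
   show "continuous_on UNIV (%x. grad ph x $ i)" by (intro continuous_intros test_fun_grad_continuous[OF t])
   show "abs (grad ph x $ i) <= M" for x using component_le_norm_cart[of "grad ph x" i] M(2)[of x] by linarith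
  qed (use R in auto)
  show "IL (%x. v x $ i * ph x)"
   by (rule integrable_mult_test_fun(1)[OF locally_integrable_component test_fun_continuous[OF t] R(1) M(1)]) (use l in blast)
 qed
 have e: "(LL x. u x * grad ph x $ i) = - (LL x. v x $ i * ph x)" if "has_weak_gradient u v" for u v
  using that t unfolding has_weak_gradient_def fr[symmetric] by blast
 show "(LL x. (u1 x - u2 x) * frechet_derivative ph (at x) (axis i 1)) = - (LL x. (v1 x - v2 x) $ i * ph x)"
  unfolding fr using a[OF 1] a[OF 2] e[OF 1] e[OF 2] by (simp add: left_diff_distrib)
qed

text \<open>In the defining identity the function and its gradient are integrated against bounded
  functions of compact support, so both sides pass to limits in local L^1.\<close>

lemma has_weak_gradient_limit:
 fixes u :: "real^'n => real"
 assumes u: "locally_integrable u" and v: "locally_integrable v"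
  and W: "!!k::nat. has_weak_gradient (ps k) (w k)"
  and Lu: "!!R. (%k. (LL x. iB R x * abs (ps k x - u x))) ----> 0"
  and Lv: "!!R. (%k. (LL x. iB R x * norm (w k x - v x))) ----> 0"
 shows "has_weak_gradient u v"
 unfolding has_weak_gradient_def
proof (intro conjI allI impI u v)
 fix ph :: "real^'n => real" and i assume t: "test_fun ph"
 obtain R where R: "!!x. R <= norm x ==> ph x = 0" "!!x. R <= norm x ==> grad ph x = 0" using test_fun_support[OF t] by blast
 obtain M where M: "!!x. abs (ph x) <= M" "!!x. norm (grad ph x) <= M" using test_fun_bound[OF t] by blast
 have fr: "frechet_derivative ph (at x) (axis i 1) = grad ph x $ i" for x by (simp add: grad_def)
 have gc: "continuous_on UNIV (%x. grad ph x $ i)" by (intro continuous_intros test_fun_grad_continuous[OF t])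
 have gR: "grad ph x $ i = 0" if "R <= norm x" for x using R(2)[OF that] by simp
 have gM: "abs (grad ph x $ i) <= M" for x using component_le_norm_cart[of "grad ph x" i] M(2)[of x] by linarith
 have lck: "locally_integrable (ps k)" "locally_integrable (w k)" for k using W[of k] by (auto simp: has_weak_gradient_def)
 have tc: "continuous_on UNIV ph" using t by (rule test_fun_continuous)
 have l1: "(%k. (LL x. ps k x * grad ph x $ i)) ----> (LL x. u x * grad ph x $ i)"
 proof (rule LIM_zero_cancel, rule Lim_null_comparison)
  show "EV k. norm ((LL x. ps k x * grad ph x $ i) - (LL x. u x * grad ph x $ i))
    <= M * (LL x. iB R x * abs (ps k x - u x))"
  proof (intro always_eventually allI)
   fix k
   have "(LL x. ps k x * grad ph x $ i) - (LL x. u x * grad ph x $ i) = (LL x. (ps k x - u x) * grad ph x $ i)"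
    using integrable_mult_test_fun(1)[OF lck(1) gc gR gM] integrable_mult_test_fun(1)[OF u gc gR gM]
    by (simp add: left_diff_distrib)
   thus "norm ((LL x. ps k x * grad ph x $ i) - (LL x. u x * grad ph x $ i))
    <= M * (LL x. iB R x * abs (ps k x - u x))"
    using integrable_mult_test_fun(2)[OF locally_integrable_diff[OF lck(1) u] gc gR gM] by simp
  qed
  show "(%k. M * (LL x. iB R x * abs (ps k x - u x))) ----> 0"
   using tendsto_mult_right_zero[OF Lu] .
 qed
 have l2: "(%k. (LL x. w k x $ i * ph x)) ----> (LL x. v x $ i * ph x)"
 proof (rule LIM_zero_cancel, rule Lim_null_comparison)
  show "EV k. norm ((LL x. w k x $ i * ph x) - (LL x. v x $ i * ph x))
    <= M * (LL x. iB R x * norm (w k x - v x))"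
  proof (intro always_eventually allI)
   fix k
   note lc = locally_integrable_component[OF locally_integrable_diff[OF lck(2) v], of k i]
   have "(LL x. w k x $ i * ph x) - (LL x. v x $ i * ph x) = (LL x. (w k x - v x) $ i * ph x)"
    using integrable_mult_test_fun(1)[OF locally_integrable_component[OF lck(2)] tc R(1) M(1)]
     integrable_mult_test_fun(1)[OF locally_integrable_component[OF v] tc R(1) M(1)]
    by (simp add: left_diff_distrib)
   hence "norm ((LL x. w k x $ i * ph x) - (LL x. v x $ i * ph x))
     <= M * (LL x. iB R x * abs ((w k x - v x) $ i))"
    using integrable_mult_test_fun(2)[OF lc tc R(1) M(1)] by simp
   also have "... <= M * (LL x. iB R x * norm (w k x - v x))"
   proof (rule mult_left_mono, rule integral_mono)
    show "IL (%x. iB R x * abs ((w k x - v x) $ i))"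
     using integrable_norm[OF locally_integrableD[OF lc, of R]] by (simp add: abs_mult)
    show "IL (%x. iB R x * norm (w k x - v x))"
     using integrable_norm[OF locally_integrableD[OF locally_integrable_diff[OF lck(2)[of k] v], of R]] by simp
    show "iB R x * abs ((w k x - v x) $ i) <= iB R x * norm (w k x - v x)" for x
     by (intro mult_left_mono component_le_norm_cart) simp
    show "0 <= M" using M(1)[of 0] by linarith
   qed
   finally show "norm ((LL x. w k x $ i * ph x) - (LL x. v x $ i * ph x))
    <= M * (LL x. iB R x * norm (w k x - v x))" .
  qed
  show "(%k. M * (LL x. iB R x * norm (w k x - v x))) ----> 0"
   using tendsto_mult_right_zero[OF Lv] .
 qed
 have "(LL x. ps k x * grad ph x $ i) = - (LL x. w k x $ i * ph x)" for k
  using W[of k] t unfolding has_weak_gradient_def fr[symmetric] by blast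
 hence "(%k. - (LL x. w k x $ i * ph x)) ----> (LL x. u x * grad ph x $ i)"
  using l1 by simp
 from LIMSEQ_unique[OF this tendsto_minus[OF l2]]
 show "(LL x. u x * frechet_derivative ph (at x) (axis i 1)) = - (LL x. v x $ i * ph x)"
  unfolding fr .
qed

section \<open>Radial functions of finite energy as limits of test functions\<close>

lemma Dk_real_polynomial_function: "real_polynomial_function p ==> Dk k p" for p :: "real => real"
proof (induction rule: real_polynomial_function.induct)
 case (linear f)
 then obtain c where "f = (%x. x * c)" using real_bounded_linear by auto
 thus ?case using Dk_affine[of k 0 c] by (simp add: mult.commute)
qed (auto intro: Dk_const Dk_add Dk_mult)

lemma Dk_antiderivative:
 assumes "!!k. Dk k w"
 obtains F where "!!s. (F hasd w s) (at s)" "!!k. Dk k F"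
proof -
 have "isCont w x" for x using assms[of 0] by (simp add: continuous_on_eq_continuous_at)
 hence "EX G. ALL x. - \<infinity> < ereal x --> ereal x < \<infinity> --> (G has_vector_derivative w x) (at x)"
  by (intro einterval_antiderivative) auto
 then obtain F where F: "!!x. (F hasd w x) (at x)"
  by (auto simp: has_real_derivative_iff_has_vector_derivative)
 have "Dk k F" for k
 proof -
  have "Dk (Suc k) F" using F assms by auto
  thus ?thesis by (rule Dk_Suc_imp)
 qed
 with F show ?thesis by (rule that)
qed

text \<open>The function z is replaced by a Weierstrass polynomial on [1/(2K), 2K] times a smooth
  cutoff that is 1 on [1/K, K]. The first term of the error comes from the polynomial, the second
  from the cutoff. \<open>Ph\<close> is the antiderivative that vanishes from 2K on.\<close>

lemma smooth_compact_approx: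
 fixes z :: "real => real"
 assumes z: "continuous_on {0<..} z" and K: "1 <= K" and e: "0 < e"
 obtains w Ph where "!!k. Dk k w" "!!k. Dk k Ph" "!!s. (Ph hasd w s) (at s)"
  "!!s. 2 * K <= s ==> Ph s = 0"
  "!!s. 0 < s ==> Ph s = - (LBINT t. ind {s<..} t * w t)"
  "!!s. 0 < s ==> IB (%t. ind {s<..} t * w t)"
  "!!s. 0 < s ==> abs (w s - z s) <= e * ind {1 / (2 * K)..2 * K} s + abs (z s) * (1 - ind {1 / K..K} s)"
proof -
 obtain et where et: "!!k. Dk k et" "!!s. s <= 0 ==> et s = 0" "!!s. 1 <= s ==> et s = 1"
  "!!s. 0 <= et s" "!!s. et s <= 1" by (rule smooth_step_exists) (rule that)
 have "continuous_on {1 / (2 * K)..2 * K} z"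
  using K by (intro continuous_on_subset[OF z]) (auto intro: less_le_trans[of 0 "1 / (2 * K)"])
 then obtain p where p: "real_polynomial_function p" "!!s. s : {1 / (2 * K)..2 * K} ==> abs (z s - p s) < e"
  using Stone_Weierstrass_real_polynomial_function[OF compact_Icc _ e, of "1 / (2 * K)" "2 * K" z] by blast
 define c where "c = (%s. et (-1 + (2 * K) * s) * et (2 + (- (1 / K)) * s))"
 have c01: "0 <= c s" "c s <= 1" for s unfolding c_def by (auto intro!: mult_nonneg_nonneg mult_le_one et)
 have c0: "c s = 0" if "s <= 1 / (2 * K) | 2 * K <= s" for s
 proof -
  have "et (-1 + (2 * K) * s) = 0 | et (2 + (- (1 / K)) * s) = 0"
   using that K by (auto intro!: et(2) simp: field_simps)
  thus ?thesis by (auto simp: c_def)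
 qed
 have c1: "c s = 1" if "1 / K <= s" "s <= K" for s
 proof -
  have "et (-1 + (2 * K) * s) = 1" "et (2 + (- (1 / K)) * s) = 1"
   using that K by (auto intro!: et(3) simp: field_simps)
  thus ?thesis by (simp add: c_def)
 qed
 define w where "w = (%s. c s * p s)"
 have sw: "Dk k w" for k unfolding w_def c_def
  by (intro Dk_mult Dk_compose_affine[where f=et] et Dk_real_polynomial_function p)
 obtain F where F: "!!s. (F hasd w s) (at s)" "!!k. Dk k F"
  by (rule Dk_antiderivative[OF sw]) (rule that)
 define Ph where "Ph = (%s. F s + (- F (2 * K)))"
 have d: "(Ph hasd w s) (at s)" for s
  unfolding Ph_def using F(1)[of s] by (auto intro!: derivative_eq_intros)
 have w0: "w s = 0" if "2 * K <= s" for s using c0[of s] that by (simp add: w_def)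
 have wm[measurable]: "w : BM"
  using sw[of 0] by (intro borel_measurable_continuous_onI) simp
 have P0: "Ph s = 0" if "2 * K <= s" for s
 proof (cases "s = 2 * K")
  case False
  have "Ph s = Ph (2 * K)"
  proof (rule DERIV_isconst_end[of "2 * K" s Ph])
   show "continuous_on {2 * K..s} Ph" using d by (intro DERIV_continuous_on) (auto intro: has_field_derivative_at_within)
   fix x assume "2 * K < x" "x < s"
   hence "w x = 0" by (intro w0) simp
   thus "(Ph hasd 0) (at x)" using d[of x] by simp
  qed (use False that in auto)
  thus ?thesis by (simp add: Ph_def)
 qed (simp add: Ph_def)
 have hb: "has_bochner_integral lborel (%t. ind {s<..} t * w t) (- Ph s)" if "0 < s" for s
 proof -
  define b where "b = max s (2 * K)"
  have "has_bochner_integral lborel (%t. ind {s..b} t *R w t) (Ph b - Ph s)"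
  proof (rule has_bochner_integral_FTC_Icc)
   show "(Ph has_vector_derivative w x) (at x within {s..b})" for x
    using d[of x] by (simp add: has_real_derivative_iff_has_vector_derivative has_vector_derivative_at_within)
   show "continuous_on {s..b} w" using sw[of 0] by (auto intro: continuous_on_subset)
  qed (simp add: b_def)
  moreover have "Ph b = 0" by (rule P0) (simp add: b_def)
  ultimately have "has_bochner_integral lborel (%t. ind {s..b} t *R w t) (- Ph s)" by simp
  thus ?thesis
  proof (rule has_bochner_integral_cong_AE[THEN iffD1, rotated 3])
   show "AE t in lborel. ind {s..b} t *R w t = ind {s<..} t * w t"
    using AE_lborel_singleton[of s]
   proof eventually_elim
    case (elim t)
    show ?case
    proof (cases "t <= b")
     case True thus ?thesis using elim by (auto simp: indicator_def)
    next
     case False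
     hence "w t = 0" by (intro w0) (simp add: b_def)
     thus ?thesis by simp
    qed
   qed
  qed measurable
 qed
 show ?thesis
 proof (rule that[of w Ph])
  show "Dk k Ph" for k unfolding Ph_def by (intro Dk_add F Dk_const)
  show "Ph s = - (LBINT t. ind {s<..} t * w t)" "IB (%t. ind {s<..} t * w t)" if "0 < s" for s
   using hb[OF that] by (auto simp: has_bochner_integral_iff)
  fix s :: real assume s: "0 < s"
  have eq: "w s - z s = c s * (p s - z s) - (1 - c s) * z s" by (simp add: w_def algebra_simps)
  have 1: "abs (c s * (p s - z s)) <= e * ind {1 / (2 * K)..2 * K} s"
  proof (cases "s : {1 / (2 * K)..2 * K}")
   case True
   have "abs (c s * (p s - z s)) <= 1 * e"
    unfolding abs_mult using c01[of s] p(2)[OF True] by (intro mult_mono) auto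
   thus ?thesis using True by simp
  next
   case False
   hence "c s = 0" by (intro c0) auto
   with False show ?thesis by simp
  qed
  have 2: "abs ((1 - c s) * z s) <= abs (z s) * (1 - ind {1 / K..K} s)"
  proof (cases "s : {1 / K..K}")
   case True thus ?thesis using c1[of s] by simp
  next
   case False
   have "abs ((1 - c s) * z s) <= 1 * abs (z s)" unfolding abs_mult using c01[of s] by (intro mult_right_mono) auto
   thus ?thesis using False by simp
  qed
  show "abs (w s - z s) <= e * ind {1 / (2 * K)..2 * K} s + abs (z s) * (1 - ind {1 / K..K} s)"
   unfolding eq using 1 2 by linarith
 qed (use sw d P0 in blast)+
qed

text \<open>Substitute for Hoelder's inequality on sets of finite measure: integrated, it bounds an
  L^1 norm by d times the measure plus a multiple of the integral of the n-th power, with d at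
  choice.\<close>

lemma le_add_power_div:
 fixes a d :: real
 assumes "0 <= a" "0 < d" "0 < n"
 shows "a <= d + d * (a / d) ^ n"
proof (cases "a <= d")
 case True
 moreover have "0 <= d * (a / d) ^ n" using assms by simp
 ultimately show ?thesis by linarith
next
 case False
 hence "a / d <= (a / d) ^ n" using assms by (intro self_le_power) auto
 hence "d * (a / d) <= d * (a / d) ^ n" using assms by (intro mult_left_mono) auto
 thus ?thesis using assms by simp
qed

lemma power_add_le:
 fixes a b :: real
 assumes "0 <= a" "0 <= b"
 shows "(a + b) ^ n <= 2 ^ n * (a ^ n + b ^ n)"
proof -
 have "(a + b) ^ n <= (2 * max a b) ^ n" using assms by (intro power_mono) auto
 also have "... = 2 ^ n * (max a b) ^ n" by (rule power_mult_distrib)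
 also have "(max a b) ^ n <= a ^ n + b ^ n" using assms by (auto simp: max_def)
 finally show ?thesis by simp
qed

lemma borel_measurable_inner_self:
 fixes z :: "real => real"
 assumes "continuous_on {0<..} z"
 shows "(%x::real^'n. z (x .* x)) : BM"
proof -
 have "continuous_on {0<..} (%r. z (r^2))"
  by (intro continuous_on_compose2[OF assms]) (auto intro!: continuous_intros)
 from borel_measurable_restrict_pos[OF this] show ?thesis by (simp add: power2_norm_eq_inner)
qed

text \<open>Convergence in energy implies convergence of the gradients in \<open>L\<^sup>1\<^sub>l\<^sub>o\<^sub>c\<close> because the weight is
 bounded below on balls.\<close>
lemma L1_loc_of_energy:
 fixes w :: "nat => real^'n => real^'n"
 assumes c: "0 < c" "!!x. x ~= 0 ==> norm x <= R ==> c <= B x"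
  and [measurable]: "!!k. w k : LM"
  and B0: "!!x. x ~= 0 ==> 0 <= B x"
  and i: "!!k. IL (%x. B x * norm (w k x) ^ CARD('n))"
  and lim: "(%k. (LL x. B x * norm (w k x) ^ CARD('n))) ----> 0"
 shows "IL (%x. iB R x * norm (w k x))"
  and "(%k. (LL x. iB R x * norm (w k x))) ----> 0"
proof -
 let ?n = "CARD('n)"
 have ae: "AE x in lebesgue. x ~= (0::real^'n)" by (simp add: AE_completion AE_lborel_singleton)
 define D where "D = (%d k x. d * iB R x + d / (c * d ^ ?n) * (B x * norm (w k x) ^ ?n))"
 have fb: "emeasure lebesgue (cball (0::real^'n) R) < \<infinity>" by (simp add: emeasure_lborel_cball_finite[unfolded infinity_ennreal_def])
 have Di: "IL (D d k)" for d k
  unfolding D_def by (intro integrable_sum2 integrable_mult_right i integrable_real_indicator fb) simp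
 have le: "AE x in lebesgue. iB R x * norm (w k x) <= D d k x" if "0 < d" for d k
  using ae
 proof eventually_elim
  case (elim x)
  have nn: "0 <= d / (c * d ^ ?n) * (B x * norm (w k x) ^ ?n)"
   using that c B0[OF elim] by (intro mult_nonneg_nonneg divide_nonneg_nonneg) auto
  show ?case
  proof (cases "norm x <= R")
   case True
   have "norm (w k x) <= d + d * (norm (w k x) / d) ^ ?n" using that by (intro le_add_power_div) auto
   also have "d * (norm (w k x) / d) ^ ?n = d / (c * d ^ ?n) * (c * norm (w k x) ^ ?n)"
    using c that by (simp add: power_divide)
   also have "... <= d / (c * d ^ ?n) * (B x * norm (w k x) ^ ?n)"
    using c(2)[OF elim True] c(1) that by (intro mult_left_mono mult_right_mono) auto
   finally show ?thesis using True by (simp add: D_def)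
  qed (use nn that in "auto simp: D_def")
 qed
 have ii: "IL (%x. iB R x * norm (w k x))" for k
 proof (rule ibound[OF Di[of 1 k]])
  show "AE x in lebesgue. norm (iB R x * norm (w k x)) <= norm (D 1 k x)"
   using le[of 1 k, OF zero_less_one] by eventually_elim (auto simp: abs_mult)
 qed (intro borel_measurable_times borel_measurable_indicator measurable_compose[OF assms(3) borel_measurable_norm], simp)
 thus "IL (%x. iB R x * norm (w k x))" .
 have ub: "(LL x. iB R x * norm (w k x))
   <= d * measure lebesgue (cball (0::real^'n) R) + d / (c * d ^ ?n) * (LL x. B x * norm (w k x) ^ ?n)"
  if "0 < d" for d k
 proof -
  have "(LL x. iB R x * norm (w k x)) <= SL (D d k)"
   by (intro integral_mono_AE ii Di le that)
  also have "... = d * measure lebesgue (cball (0::real^'n) R) + d / (c * d ^ ?n) * (LL x. B x * norm (w k x) ^ ?n)"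
   unfolding D_def using fb
   by (subst integral_sum2) (auto intro!: integrable_mult_right i integrable_real_indicator)
  finally show ?thesis .
 qed
 show "(%k. (LL x. iB R x * norm (w k x))) ----> 0"
 proof (rule LIMSEQ_I)
  fix r :: real assume r: "0 < r"
  define m where "m = measure lebesgue (cball (0::real^'n) R)"
  define d where "d = r / (2 * (m + 1))"
  have m: "0 <= m" by (simp add: m_def)
  have d: "0 < d" "d * m < r / 2" "d * m <= r / 2" using r m by (auto simp: d_def field_simps)
  have "(%k. d / (c * d ^ ?n) * (LL x. B x * norm (w k x) ^ ?n)) ----> 0"
   using tendsto_mult_right_zero[OF lim] .
  then obtain k0 where k0: "!!k. k0 <= k ==> abs (d / (c * d ^ ?n) * (LL x. B x * norm (w k x) ^ ?n)) < r / 2"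
   using LIMSEQ_D[of _ 0 "r / 2"] r by fastforce
  have "norm ((LL x. iB R x * norm (w k x)) - 0) < r" if "k0 <= k" for k
  proof -
   have "0 <= (LL x. iB R x * norm (w k x))" by (intro integral_nonneg_AE) auto
   moreover have "(LL x. iB R x * norm (w k x)) < r"
    using ub[OF d(1), of k] k0[OF that] d unfolding m_def[symmetric] by linarith
   ultimately show ?thesis by simp
  qed
  thus "EX no. ALL k>=no. norm ((LL x. iB R x * norm (w k x)) - 0) < r" by blast
 qed
qed

lemma integrable_on_annulus:
 fixes g :: "real => real"
 assumes "continuous_on {0<..} g" "0 < a"
 shows "IB (%x::real^'n. ind {x. a <= x .* x & x .* x <= b} x * g (norm x))"
proof -
 have "compact {x::real^'n. a <= x .* x & x .* x <= b}"
 proof -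
  have "closed {x::real^'n. a <= x .* x & x .* x <= b}"
   by (intro closed_Collect_conj closed_Collect_le continuous_intros)
  moreover have "bounded {x::real^'n. a <= x .* x & x .* x <= b}"
   unfolding bounded_iff by (auto intro!: exI[of _ "sqrt b"] simp: norm_eq_sqrt_inner)
  ultimately show ?thesis by (simp add: compact_eq_bounded_closed)
 qed
 moreover have "continuous_on {x::real^'n. a <= x .* x & x .* x <= b} (%x. g (norm x))"
  using assms(2) by (intro continuous_on_compose2[OF assms(1)] continuous_intros) auto
 ultimately have "IB (%x::real^'n. ind {x. a <= x .* x & x .* x <= b} x *R g (norm x))"
  by (rule borel_integrable_compact)
 thus ?thesis by simp
qed

lemma locally_integrable_measurable:
 fixes w :: "real^'n => 'c::euclidean_space"
 assumes "locally_integrable w"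
 shows "w : LM"
proof (rule borel_measurable_LIMSEQ_metric)
 fix x :: "real^'n"
 obtain j0 :: nat where "norm x < real j0" using reals_Archimedean2 by blast
 thus "(%j. ind (cball 0 (real j)) x *R w x) ----> w x"
  by (intro tendsto_eventually) (auto simp: eventually_sequentially intro!: exI[of _ j0])
qed (use locally_integrableD[OF assms] in "auto dest: borel_measurable_integrable")

text \<open>Weak gradients agree almost everywhere, so the energy may be computed with any of them
  instead of the representative picked by \<open>weak_gradient\<close>.\<close>

lemma weak_energy:
 fixes z :: "real^'n => real"
 assumes [measurable]: "B : LM" and z: "has_weak_gradient z w"
 shows "IL (%x. B x * norm (weak_gradient z x) ^ m) = IL (%x. B x * norm (w x) ^ m)"
  "(LL x. B x * norm (weak_gradient z x) ^ m) = (LL x. (B x :: real) * norm (w x) ^ m)"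
proof -
 have "has_weak_gradient z (weak_gradient z)" using z by (intro weak_gradient_works) (auto simp: weakly_differentiable_def)
 hence [measurable]: "weak_gradient z : LM" "w : LM" using z by (auto simp: has_weak_gradient_def intro: locally_integrable_measurable)
 have a: "AE x in lebesgue. B x * norm (weak_gradient z x) ^ m = B x * norm (w x) ^ m"
  using weak_gradient_AE[OF z] by eventually_elim simp
 show "IL (%x. B x * norm (weak_gradient z x) ^ m) = IL (%x. B x * norm (w x) ^ m)" by (rule integrable_cong_AE[OF _ _ a]) measurable
 show "(LL x. B x * norm (weak_gradient z x) ^ m) = (LL x. B x * norm (w x) ^ m)" by (rule integral_cong_AE[OF _ _ a]) measurable
qed

lemma integrable_energy_add:
 assumes m: "(%x. B x * norm (a x) ^ n) : borel_measurable M"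
  and i: "integrable M (%x. B x * norm (b x) ^ n)" "integrable M (%x. B x * norm (c x) ^ n)"
  and ae: "AE x in M. 0 <= (B x :: real) & norm (a x) <= norm (b x) + norm (c x)"
 shows "integrable M (%x. B x * norm (a x) ^ n)"
proof (rule ibound[OF integrable_mult_right[OF integrable_sum2[OF i]] m])
 show "AE x in M. norm (B x * norm (a x) ^ n) <= norm (2 ^ n * (B x * norm (b x) ^ n + B x * norm (c x) ^ n))"
  using ae
 proof eventually_elim
  case (elim x)
  have "norm (a x) ^ n <= 2 ^ n * (norm (b x) ^ n + norm (c x) ^ n)"
   by (rule order_trans[OF power_mono power_add_le]) (use elim in auto)
  hence "B x * norm (a x) ^ n <= B x * (2 ^ n * (norm (b x) ^ n + norm (c x) ^ n))" using elim by (intro mult_left_mono) auto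
  also have "... = 2 ^ n * (B x * norm (b x) ^ n + B x * norm (c x) ^ n)" by (simp add: algebra_simps)
  finally show ?case using elim by (auto simp: abs_mult intro: order_trans[OF _ abs_ge_self])
 qed
qed

lemma integrable_cball_bounded:
 fixes g :: "real^'n => real"
 assumes [measurable]: "g : BM" and b: "!!x. x ~= 0 ==> abs (g x) <= c" and c: "0 <= c"
 shows "IL (%x. iB R x * g x)" "(LL x. iB R x * g x) <= c * measure lborel (cball (0::real^'n) R)"
proof -
 have i: "IB (%x::real^'n. c * iB R x)"
  by (intro integrable_mult_right integrable_real_indicator) (auto simp: emeasure_lborel_cball_finite[unfolded infinity_ennreal_def])
 have a: "AE x in lborel. abs (iB R x * g x) <= c * iB R x"
  using AE_lborel_singleton[of "0::real^'n"] by eventually_elim (use b c in "auto simp: abs_mult split: split_indicator")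
 have B: "IB (%x. iB R x * g x)"
  by (rule ibound[OF i]) (measurable, rule eventually_mono[OF a], auto)
 show "IL (%x. iB R x * g x)" using B by (simp add: integrable_completion)
 have "(LBINT x. iB R x * g x) <= (LBINT x. c * iB R (x::real^'n))"
  by (intro integral_mono_AE B i eventually_mono[OF a]) auto
 thus "(LL x. iB R x * g x) <= c * measure lborel (cball (0::real^'n) R)" using B by (simp add: integral_completion)
qed

text \<open>With the parameter s = |x|^2 the approximants Ph_k(|x|^2) are test functions with
  gradient 2 w_k(|x|^2) x. They converge to u uniformly off the origin and in energy; the positive
  lower bound of A on balls turns the latter into local L^1 convergence of the gradients, which
  identifies the weak gradient of u.\<close>

lemma radial_function_in_E_space:
 fixes A z :: "real => real" and u :: "real^'n => real"
 assumes A: "continuous_on {0<..} A" and Apos: "!!R. 0 < R ==> EX c>0. ALL r:{0<..R}. c <= A r"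
  and z: "continuous_on {0<..} z" and zi: "IB (%s. ind {0<..} s * z s)"
  and u: "!!x. x ~= 0 ==> u x = - (LBINT s. ind {x .* x<..} s * z s)"
  and um[measurable]: "u : BM"
  and E: "IB (%x::real^'n. A (norm x) * norm ((2 * z (x .* x)) *R x) ^ CARD('n))"
 shows "has_weak_gradient u (%x. (2 * z (x .* x)) *R x)" "u : E_space A"
proof -
 let ?n = "CARD('n)"
 define v where "v = (%x::real^'n. (2 * z (x .* x)) *R x)"
 define K where "K = (%k. real (Suc k))"
 have K: "1 <= K k" for k by (simp add: K_def)
 let ?a = "%k. ind {1 / (2 * K k)..2 * K k} :: real => real" and ?b = "%k s. 1 - ind {1 / K k..K k} s :: real"
 have A0: "0 <= A (norm x)" if "x ~= 0" for x :: "real^'n"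
 proof -
  have "0 < norm x" using that by simp
  then obtain c where "c > 0" "ALL r:{0<..norm x}. c <= A r" using Apos by blast
  thus ?thesis using \<open>0 < norm x\<close> by (auto dest!: bspec[of _ _ "norm x"])
 qed
 have [measurable]: "(%x::real^'n. A (norm x)) : BM" by (rule borel_measurable_restrict_pos[OF A])
 have [measurable]: "(%x::real^'n. z (x .* x)) : BM" by (rule borel_measurable_inner_self[OF z])
 have vm[measurable]: "v : BM" unfolding v_def by measurable
 define an where "an = (%k. {x::real^'n. 1 / (2 * K k) <= x .* x & x .* x <= 2 * K k})"
 define I where "I = (%k. (LBINT x. ind (an k) x * (A (norm x) * (2 * norm x) ^ ?n)))"
 have anm[measurable]: "an k : sets borel" for k unfolding an_def by measurable
 have Ii: "IB (%x. ind (an k) x * (A (norm x) * (2 * norm x) ^ ?n))" for k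
  unfolding an_def by (rule integrable_on_annulus[where g="%r. A r * (2 * r) ^ ?n"])
   (use K[of k] A in "auto intro!: continuous_intros")
 have I0: "0 <= I k" for k unfolding I_def using A0 AE_lborel_singleton[of "0::real^'n"]
  by (intro integral_nonneg_AE) (auto elim!: eventually_mono)
 \<comment> \<open>The two factors K k keep the polynomial error small after integration over an
   interval of length at most 2 K k, which gives uniform convergence; the factor 1 + I k keeps its
   energy on the annulus small.\<close>
 define e where "e = (%k. 1 / (2 * K k * K k * (1 + I k)))"
 have e: "0 < e k" "e k <= 1" "e k * (2 * K k) <= 1 / K k" "e k ^ ?n * I k <= 1 / K k" for k
 proof -
  have k: "1 <= K k" "0 <= I k" "1 <= K k * K k" using K[of k] I0[of k] mult_mono[of 1 "K k" 1 "K k"] by auto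
  have p: "1 <= 2 * K k * K k * (1 + I k)" using mult_mono[of 1 "2 * K k * K k" 1 "1 + I k"] k by auto
  show e0: "0 < e k" and e1: "e k <= 1" using p by (auto simp: e_def divide_le_eq)
  show "e k * (2 * K k) <= 1 / K k" using k p by (simp add: e_def field_simps)
  have "e k ^ ?n <= e k" using e0 e1 power_decreasing[of 1 ?n "e k"] by (simp add: Suc_leI)
  hence "e k ^ ?n * I k <= e k * I k" using k by (intro mult_right_mono) auto
  also have "... <= 1 / K k"
  proof -
   have "K k * I k <= 2 * K k * K k * (1 + I k)"
    using mult_mono[of "K k" "2 * K k * K k" "I k" "1 + I k"] k by auto
   thus ?thesis using p k by (simp add: e_def field_simps)
  qed
  finally show "e k ^ ?n * I k <= 1 / K k" .
 qed
 define ap where "ap = (%k w Ph. (ALL j. Dk j w) & (ALL j. Dk j Ph) & (ALL s. (Ph hasd w s) (at s)) & (ALL s>=2 * K k. Ph s = 0)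
  & (ALL s>0. Ph s = - (LBINT t. ind {s<..} t * w t) & IB (%t. ind {s<..} t * w t))
  & (ALL s>0. abs (w s - z s) <= e k * ?a k s + abs (z s) * ?b k s))"
 have "EX w Ph. ap k w Ph" for k
  unfolding ap_def by (rule smooth_compact_approx[OF z K e(1), of k k]) blast
 hence "EX w. ALL k. EX Ph. ap k (w k) Ph" by (intro choice allI)
 then obtain w where "ALL k. EX Ph. ap k (w k) Ph" by (elim exE)
 hence "EX Ph. ALL k. ap k (w k) (Ph k)" by (rule choice)
 then obtain Ph where "ALL k. ap k (w k) (Ph k)" by (elim exE)
 hence w: "!!k j. Dk j (w k)" and P: "!!k j. Dk j (Ph k)" and d: "!!k s. (Ph k hasd w k s) (at s)"
  and P0: "!!k s. 2 * K k <= s ==> Ph k s = 0"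
  and Pi: "!!k s. 0 < s ==> Ph k s = - (LBINT t. ind {s<..} t * w k t)"
  and wi: "!!k s. 0 < s ==> IB (%t. ind {s<..} t * w k t)"
  and wz: "!!k s. 0 < s ==> abs (w k s - z s) <= e k * ?a k s + abs (z s) * ?b k s"
  unfolding ap_def by blast+
 have wm[measurable]: "w k : BM" for k
  using w[of 0 k] by (intro borel_measurable_continuous_onI) simp
 define ps where "ps = (%k (x::real^'n). Ph k (x .* x))"
 have t: "test_fun (ps k)" and g: "grad (ps k) x = (2 * w k (x .* x)) *R x" for k x
  unfolding ps_def using radial_test_fun[OF P P0 d] by auto
 have lim01: "(%k. 1 - ind {1 / K k..K k} s :: real) ----> 0" if "0 < s" for s
 proof (rule tendsto_eventually)
  obtain k0 where k0: "max s (1 / s) <= real k0" using real_arch_simple by blast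
  show "EV k. 1 - ind {1 / K k..K k} s = (0::real)"
   using eventually_ge_at_top[of k0]
  proof eventually_elim
   case (elim k)
   have 1: "s <= K k" "1 / s <= K k" using k0 elim by (auto simp: K_def)
   hence "1 / K k <= s" using that K[of k] by (simp add: field_simps)
   with 1 show ?case by simp
  qed
 qed
 have KL: "(%k. 1 / K k) ----> 0" unfolding K_def using LIMSEQ_Suc[OF lim_1_over_n] by simp
 let ?zz = "%s. ind {0<..} s * z s"
 have [measurable]: "?zz : BM" using zi by auto
 have zai: "IB (%s. abs (?zz s) * ?b k s)" for k
  by (rule ibound[OF zi], measurable) (auto simp: abs_mult split: split_indicator)
 define ep where "ep = (%k. 1 / K k + (LBINT s. abs (?zz s) * ?b k s))"
 have eps0: "0 <= ep k" for k unfolding ep_def using K[of k]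
  by (intro add_nonneg_nonneg integral_nonneg_AE AE_I2) (auto split: split_indicator)
 have eps: "ep ----> 0"
 proof -
  have "(%k. (LBINT s. abs (?zz s) * ?b k s)) ----> (\<integral>s. 0 \<partial>(lborel::real measure))"
  proof (rule integral_dominated_convergence[where w="%s. abs (?zz s)"])
   show "AE s in lborel. (%k. abs (?zz s) * ?b k s) ----> 0"
   proof (intro AE_I2)
    fix s show "(%k. abs (?zz s) * ?b k s) ----> 0"
     using tendsto_mult_right_zero[OF lim01[of s], of "abs (?zz s)"] by (cases "0 < s") auto
   qed
  qed (use zi in "auto split: split_indicator")
  thus ?thesis unfolding ep_def using tendsto_add[OF KL] by fastforce
 qed
 have unif: "abs (ps k x - u x) <= ep k" if x: "x ~= 0" for k x
 proof -
  let ?s = "x .* x"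
  have s: "0 < ?s" using x by simp
  have zi': "IB (%t. ind {?s<..} t * z t)"
  proof -
   have "IB (%t. ind {?s<..} t *R ?zz t)" by (intro integrable_mult_indicator zi) simp
   also have "(%t. ind {?s<..} t *R ?zz t) = (%t. ind {?s<..} t * z t)"
    using less_trans[OF s] by (auto simp: fun_eq_iff indicator_def)
   finally show ?thesis .
  qed
  have "ps k x - u x = - (LBINT t. ind {?s<..} t * w k t - ind {?s<..} t * z t)"
   unfolding ps_def u[OF x] Pi[OF s] using wi[OF s] zi' by simp
  hence "abs (ps k x - u x) <= (LBINT t. abs (ind {?s<..} t * w k t - ind {?s<..} t * z t))"
   using integral_abs_bound[of lborel "%t. ind {?s<..} t * w k t - ind {?s<..} t * z t"] by simp
  also have "... <= (LBINT t. e k * ?a k t + abs (?zz t) * ?b k t)"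
  proof (rule integral_mono)
   show "IB (%t. abs (ind {?s<..} t * w k t - ind {?s<..} t * z t))"
    using wi[OF s] zi' by auto
   show "IB (%t. e k * ?a k t + abs (?zz t) * ?b k t)"
    by (intro integrable_sum2 zai integrable_mult_right integrable_real_indicator) (auto simp: emeasure_lborel_Icc_eq)
   fix t
   show "abs (ind {?s<..} t * w k t - ind {?s<..} t * z t) <= e k * ?a k t + abs (?zz t) * ?b k t"
   proof (cases "?s < t")
    case True
    hence "0 < t" using s by linarith
    with wz[OF this, of k] True show ?thesis by simp
   next
    case False
    have "0 <= e k * ?a k t + abs (?zz t) * ?b k t"
     using e(1)[of k] by (intro add_nonneg_nonneg mult_nonneg_nonneg) (auto split: split_indicator)
    with False show ?thesis by simp
   qed
  qed
  also have "... = e k * measure lborel {1 / (2 * K k)..2 * K k} + (LBINT s. abs (?zz s) * ?b k s)"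
   by (subst integral_sum2) (auto intro!: zai integrable_mult_right integrable_real_indicator simp: emeasure_lborel_Icc_eq)
  also have "e k * measure lborel {1 / (2 * K k)..2 * K k} <= 1 / K k"
  proof -
   have "1 / (2 * K k) <= 2 * K k" using K[of k] mult_mono[of 1 "2 * K k" 1 "2 * K k"] by (simp add: divide_le_eq)
   hence "measure lborel {1 / (2 * K k)..2 * K k} <= 2 * K k" using K[of k] by (simp add: field_simps)
   hence "e k * measure lborel {1 / (2 * K k)..2 * K k} <= e k * (2 * K k)" using e(1)[of k] by (intro mult_left_mono) auto
   thus ?thesis using e(3)[of k] by linarith
  qed
  finally show ?thesis unfolding ep_def by simp
 qed
 have ae: "AE x in lborel. x ~= (0::real^'n)" by (rule AE_lborel_singleton)
 define En where "En = (%k x. A (norm x) * norm (grad (ps k) x - v x) ^ ?n)"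
 define T where "T = (%k (x::real^'n). (A (norm x) * norm (v x) ^ ?n) * ?b k (x .* x))"
 have gm[measurable]: "grad (ps k) : BM" for k by (rule test_fun_grad_measurable[OF t])
 have Enm[measurable]: "En k : BM" for k unfolding En_def by measurable
 have E': "IB (%x. A (norm x) * norm (v x) ^ ?n)" using E unfolding v_def .
 have Ti: "IB (T k)" for k unfolding T_def
  by (rule ibound[OF E'], measurable) (auto simp: abs_mult split: split_indicator)
 define S where "S = (%k x. 2 ^ ?n * (e k ^ ?n * (ind (an k) x * (A (norm x) * (2 * norm x) ^ ?n)) + T k x))"
 have Si: "IB (S k)" for k unfolding S_def
  by (intro integrable_mult_right integrable_sum2 Ii Ti)
 have EnS: "0 <= En k x & En k x <= S k x" if x: "x ~= 0" for k x
 proof -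
  let ?s = "x .* x"
  have s: "0 < ?s" using x by simp
  let ?d = "2 * norm x * (e k * ind (an k) x)" and ?c = "norm (v x) * ?b k ?s"
  have "grad (ps k) x - v x = (2 * (w k ?s - z ?s)) *R x"
   unfolding g v_def by (simp only: scaleR_diff_left right_diff_distrib)
  hence "norm (grad (ps k) x - v x) = 2 * norm x * abs (w k ?s - z ?s)"
   by (simp only: norm_scaleR abs_mult) simp
  also have "... <= 2 * norm x * (e k * ?a k ?s + abs (z ?s) * ?b k ?s)"
   using wz[OF s, of k] by (intro mult_left_mono) auto
  also have "... = ?d + ?c" by (simp add: v_def an_def indicator_def algebra_simps abs_mult)
  finally have "norm (grad (ps k) x - v x) ^ ?n <= (?d + ?c) ^ ?n" by (intro power_mono) auto
  also have "... <= 2 ^ ?n * (?d ^ ?n + ?c ^ ?n)"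
   using e(1)[of k] by (intro power_add_le mult_nonneg_nonneg) (auto split: split_indicator)
  finally have "En k x <= A (norm x) * (2 ^ ?n * (?d ^ ?n + ?c ^ ?n))"
   unfolding En_def using A0[OF x] by (intro mult_left_mono) auto
  also have "... = S k x" unfolding S_def T_def
   by (cases "x : an k"; cases "?s : {1 / K k..K k}") (simp_all add: power_mult_distrib algebra_simps)
  finally show ?thesis using A0[OF x] by (simp add: En_def)
 qed
 have EnA: "AE x in lborel. 0 <= En k x" for k using ae by eventually_elim (use EnS in blast)
 have EnB: "AE x in lborel. En k x <= S k x" for k using ae by eventually_elim (use EnS in blast)
 have EnC: "AE x in lborel. norm (En k x) <= norm (S k x)" for k using EnA[of k] EnB[of k] by eventually_elim simp
 have Eni: "IB (En k)" for k
  by (rule ibound[OF Si[of k] _ EnC]) measurable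
 have EnL: "(%k. SB (En k)) ----> 0"
 proof (rule tendsto_sandwich[OF _ _ tendsto_const])
  show "EV k. 0 <= SB (En k)"
   by (intro always_eventually allI integral_nonneg_AE EnA)
  have "SB (En k) <= 2 ^ ?n * (1 / K k + SB (T k))" for k
  proof -
   have "SB (En k) <= SB (S k)"
    by (intro integral_mono_AE Eni Si EnB)
   also have "... = 2 ^ ?n * (e k ^ ?n * I k + SB (T k))"
    unfolding S_def I_def using Ii Ti by (simp add: integral_sum2)
   also have "... <= 2 ^ ?n * (1 / K k + SB (T k))" using e(4)[of k] by simp
   finally show ?thesis .
  qed
  thus "EV k. SB (En k) <= 2 ^ ?n * (1 / K k + SB (T k))" by simp
  have "(%k. SB (T k)) ----> (\<integral>x. 0 \<partial>(lborel::(real^'n) measure))"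
  proof (rule integral_dominated_convergence[where w="%x. abs (A (norm x) * norm (v x) ^ ?n)"])
   show "AE x in lborel. (%k. T k x) ----> 0" using ae
   proof eventually_elim
    case (elim x)
    thus ?case unfolding T_def using tendsto_mult_right_zero[OF lim01[of "x .* x"]] by simp
   qed
   show "AE x in lborel. norm (T k x) <= abs (A (norm x) * norm (v x) ^ ?n)" for k
    unfolding T_def by (intro AE_I2) (auto simp: abs_mult split: split_indicator)
  qed (use E' Ti in auto)
  hence "(%k. 2 ^ ?n * (1 / K k + SB (T k))) ----> 2 ^ ?n * (0 + 0)"
   by (intro tendsto_intros KL) simp
  thus "(%k. 2 ^ ?n * (1 / K k + SB (T k))) ----> 0" by simp
 qed
 have leb: "IL (En k)" "SL (En k) = SB (En k)" for k
  using Eni by (auto simp: integrable_completion integral_completion)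
 have ub: "abs (u x) <= (LBINT s. abs (?zz s))" if x: "x ~= 0" for x
 proof -
  have "abs (u x) <= (LBINT t. abs (ind {x .* x<..} t * z t))" unfolding u[OF x] abs_minus_cancel by (rule integral_abs_bound)
  also have "... <= (LBINT s. abs (?zz s))"
  proof (rule integral_mono_AE')
   have s: "0 < x .* x" using x by simp
   show "AE t in lborel. abs (ind {x .* x<..} t * z t) <= abs (?zz t)"
    using less_trans[OF s] by (intro AE_I2) (auto simp: indicator_def)
  qed (use zi in auto)
  finally show ?thesis .
 qed
 have bnd: "IL (%x. iB R x * abs (u x) ^ m)" for R and m :: nat
 proof (rule integrable_cball_bounded(1)[where c="(LBINT s. abs (?zz s)) ^ m"])
  show "abs (abs (u x) ^ m) <= (LBINT s. abs (?zz s)) ^ m" if "x ~= 0" for x using power_mono[OF ub[OF that], of m] by simp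
  show "(%x. abs (u x) ^ m) : BM" by measurable
 qed (auto intro!: zero_le_power integral_nonneg_AE)
 have ul: "locally_integrable u"
 proof (rule locally_integrableI)
  fix R
  have m: "(%x. iB R x *R u x) : LM" by (intro measurable_completion) measurable
  show "IL (%x. iB R x *R u x)"
   by (rule ibound[OF bnd[of R 1] m]) (auto simp: abs_mult)
 qed
 have wgk: "has_weak_gradient (ps k) (grad (ps k))" for k by (rule test_fun_weak_gradient[OF t])
 have psil: "locally_integrable (ps k)" "locally_integrable (grad (ps k))" for k using wgk[of k] by (auto simp: has_weak_gradient_def)
 have vlm: "(%x. grad (ps k) x - v x) : LM" for k by (intro measurable_completion) measurable
 have EnL': "(%k. (LL x. A (norm x) * norm (grad (ps k) x - v x) ^ ?n)) ----> 0"
 proof -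
  have "(%k. SL (En k)) ----> 0" using EnL by (simp only: leb(2))
  thus ?thesis by (simp only: En_def)
 qed
 have L1: "IL (%x. iB R x * norm (grad (ps k) x - v x))"
   "(%k. (LL x. iB R x * norm (grad (ps k) x - v x))) ----> 0" for R k
 proof -
  obtain c where c: "0 < c" "!!r. 0 < r ==> r <= abs R + 1 ==> c <= A r" using Apos[of "abs R + 1"] by fastforce
  have c': "c <= A (norm x)" if "x ~= 0" "norm x <= R" for x :: "real^'n" using that by (intro c(2)) auto
  note L = L1_loc_of_energy[OF c(1) c' vlm A0 leb(1)[unfolded En_def] EnL']
  show "IL (%x. iB R x * norm (grad (ps k) x - v x))" by (rule L(1))
  show "(%k. (LL x. iB R x * norm (grad (ps k) x - v x))) ----> 0" by (rule L(2))
 qed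
 have vl: "locally_integrable v"
 proof (rule locally_integrableI)
  fix R
  have "(%x. iB R x *R (grad (ps 0) x - v x)) : LM" by (intro measurable_completion) measurable
  hence "IL (%x. iB R x *R (grad (ps 0) x - v x))" by (rule ibound[OF L1(1)[of R 0]]) (auto simp: abs_mult)
  from integrable_sub[OF locally_integrableD[OF psil(2)[of 0], of R] this]
  show "IL (%x. iB R x *R v x)" by (simp add: scaleR_diff_right)
 qed
 have psim[measurable]: "(%x. abs (ps k x - u x) ^ m) : BM" for k m
  using test_fun_measurable[OF t] by measurable
 have pb: "abs (abs (ps k x - u x) ^ m) <= ep k ^ m" if "x ~= 0" for k m x using power_mono[OF unif[OF that], of k m] by simp
 have pm: "IL (%x. iB R x * abs (ps k x - u x) ^ m)"
  "(LL x. iB R x * abs (ps k x - u x) ^ m) <= ep k ^ m * measure lborel (cball (0::real^'n) R)" for k m R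
  by (rule integrable_cball_bounded[OF psim pb zero_le_power[OF eps0]]; assumption)+
 have Ldiff: "(%k. (LL x. iB R x * abs (ps k x - u x) ^ m)) ----> 0" if "0 < m" for R m
 proof (rule tendsto_sandwich[OF _ _ tendsto_const])
  show "EV k. 0 <= (LL x. iB R x * abs (ps k x - u x) ^ m)"
   by (intro always_eventually allI integral_nonneg_AE) auto
  show "EV k. (LL x. iB R x * abs (ps k x - u x) ^ m) <= ep k ^ m * measure lborel (cball (0::real^'n) R)" by (intro always_eventually allI pm)
  have "(%k. ep k ^ m * measure lborel (cball (0::real^'n) R)) ----> 0 ^ m * measure lborel (cball (0::real^'n) R)"
   by (intro tendsto_intros eps)
  thus "(%k. ep k ^ m * measure lborel (cball (0::real^'n) R)) ----> 0" using that by (simp add: zero_power)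
 qed
 show WG: "has_weak_gradient u (%x. (2 * z (x .* x)) *R x)"
  unfolding v_def[symmetric]
  by (rule has_weak_gradient_limit[OF ul vl wgk]) (use Ldiff[of 1] L1(2) in auto)
 have Am: "(%x::real^'n. A (norm x)) : LM" by (intro measurable_completion) measurable
 have fin: "finite_energy A h" if h: "has_weak_gradient h q" "IB (%x. A (norm x) * norm (q x) ^ ?n)" and [measurable]: "q : BM"
  for h :: "real^'n => real" and q
  using h weak_energy(1)[OF Am h(1), of ?n] by (auto simp: finite_energy_def weakly_differentiable_def integrable_completion)
 show "u : E_space A"
  unfolding E_space_def
 proof (intro CollectI conjI exI[of _ ps] allI impI t)
  show "u : LN_loc" unfolding LN_loc_def
  proof (intro CollectI conjI allI impI)
   show "u : LM" by (intro measurable_completion) measurable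
   have "locally_integrable (%x. abs (u x) ^ ?n)" by (rule locally_integrableI) (use bnd in simp)
   thus "set_integrable lebesgue X (%x. abs (u x) ^ ?n)" if "compact X" for X using that by (auto simp: locally_integrable_def)
  qed
  show "finite_energy A u" by (rule fin[OF WG E]) (auto simp: v_def[symmetric])
  show "finite_energy A (ps k)" for k
  proof (rule fin[OF wgk])
   show "IB (%x. A (norm x) * norm (grad (ps k) x) ^ ?n)"
   proof (rule integrable_energy_add[OF _ Eni[of k, unfolded En_def] E'])
    have n: "norm (grad (ps k) x) <= norm (grad (ps k) x - v x) + norm (v x)" for x by (metis diff_add_cancel norm_triangle_ineq)
    show "AE x in lborel. 0 <= A (norm x) & norm (grad (ps k) x) <= norm (grad (ps k) x - v x) + norm (v x)"
     by (rule eventually_mono[OF ae]) (use n A0 in auto)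
   qed measurable
  qed auto
  fix X :: "(real^'n) set" assume X: "compact X"
  obtain R where "ALL x:X. norm x <= R" using compact_imp_bounded[OF X] unfolding bounded_iff by blast
  hence R: "X \<subseteq> cball 0 R" by auto
  have Xm[measurable]: "X : sets borel" using X by (rule borel_compact)
  have Xi: "IL (%x. ind X x * abs (ps k x - u x) ^ ?n)" for k
  proof (rule ibound[OF pm(1)[of R k ?n]])
   show "(%x. ind X x * abs (ps k x - u x) ^ ?n) : LM"
    by (intro measurable_completion) measurable
  qed (use R in "intro AE_I2, auto split: split_indicator")
  show "(%k. LINT x:X|lebesgue. abs (ps k x - u x) ^ ?n) ----> 0"
  proof (rule tendsto_sandwich[OF _ _ tendsto_const Ldiff[of ?n R]])
   show "EV k. 0 <= (LINT x:X|lebesgue. abs (ps k x - u x) ^ ?n)"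
    unfolding set_lebesgue_integral_def by (intro always_eventually allI integral_nonneg_AE) auto
   show "EV k. (LINT x:X|lebesgue. abs (ps k x - u x) ^ ?n) <= (LL x. iB R x * abs (ps k x - u x) ^ ?n)"
    unfolding set_lebesgue_integral_def
    using R by (intro always_eventually allI integral_mono) (auto intro!: pm simp: Xi split: split_indicator)
  qed simp
 next
  have "E_norm A (%x. ps k x - u x) = (SB (En k)) powr (1 / real ?n)" for k
   using weak_energy(2)[OF Am has_weak_gradient_diff[OF wgk[of k] WG], of ?n] leb(2)[of k] by (simp add: E_norm_def En_def[abs_def] v_def)
  moreover have "(%k. (SB (En k)) powr (1 / real ?n)) ----> 0 powr (1 / real ?n)"
   by (intro tendsto_powr' EnL tendsto_const disjI2 conjI always_eventually allI integral_nonneg_AE EnA) simp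
  ultimately show "(%k. E_norm A (%x. ps k x - u x)) ----> 0" by simp
 qed
qed

section \<open>A mountain pass theorem in finitely many variables\<close>

text \<open>Tychonoff's theorem for a product of compact intervals. Points are sequences with the
  product topology, so that one type serves all grid sizes.\<close>

lemma compact_coordinate_box:
 fixes R :: "nat => real"
 shows "compact {u::nat => real. ALL i. abs (u i) <= R i}"
proof -
 have "{u::nat => real. ALL i. abs (u i) <= R i} = PiE UNIV (%i. {- R i..R i})"
  by (auto simp: PiE_def Pi_def abs_le_iff minus_le_iff)
 moreover have "compactin (product_topology (%i::nat. euclidean::real topology) UNIV) (PiE UNIV (%i. {- R i..R i}))"
  by (subst compactin_PiE) (auto simp: compactin_euclidean_iff)
 ultimately show ?thesis by (simp add: euclidean_product_topology[symmetric] compactin_euclidean_iff[symmetric])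
qed

text \<open>One step of size at most \<open>s\<close> of a cut-off steepest descent, iterated, would deform the segment
 from \<open>0\<close> to \<open>e\<close> below the barrier. All iterates stay in a fixed compact box because the number of
 steps times the step size is bounded, so uniform continuity of the gradient gives a uniform decrease.\<close>
lemma finite_dim_mountain_pass:
 fixes J E :: "(nat => real) => real" and g :: "(nat => real) => nat => real"
 assumes I: "finite I"
  and der: "!!u d s. (!!i. i ~: I ==> d i = 0) ==>
   ((%s. J (%i. u i + s * d i)) hasd (SUM i:I. g (%i. u i + s * d i) i * d i)) (at s)"
  and Jc: "continuous_on UNIV J" and gc: "!!i. i : I ==> continuous_on UNIV (%u. g u i)"
  and Ec: "continuous_on UNIV E" and barrier: "!!u. (!!i. i ~: I ==> u i = 0) ==> E u = rh ==> a <= J u"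
  and a: "0 < a" and z: "E (%i. 0) < rh" "J (%i. 0) <= a / 2"
  and e: "rh < E e" "J e <= a / 2" "!!i. i ~: I ==> e i = 0"
  and m: "!!t. 0 <= t ==> t <= 1 ==> J (%i. t * e i) <= m"
  and ep: "0 < ep"
 shows "EX u. (ALL i. i ~: I --> u i = 0) & a / 2 <= J u & J u <= m & (ALL i:I. abs (g u i) <= ep)"
proof (rule ccontr)
 assume contr: "~ ?thesis"
 define n where "n = (%u. L2_set (g u) I)"
 have g_le_n: "abs (g u i) <= n u" if "i : I" for u i
  using member_le_L2_set[OF I that, of "%i. abs (g u i)"] by (simp add: n_def L2_set_def)
 have n_ge: "ep < n u" if u: "!!i. i ~: I ==> u i = 0" "a / 2 <= J u" "J u <= m" for u
 proof -
  have "~ (ALL i:I. abs (g u i) <= ep)" using contr u by blast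
  then obtain i where i: "i : I" "ep < abs (g u i)" by (auto simp: not_le)
  have "abs (g u i) <= n u" by (rule g_le_n[OF i(1)])
  with i show ?thesis by simp
 qed
 have nc: "continuous_on UNIV n" unfolding n_def L2_set_def by (intro continuous_intros gc)
 \<comment> \<open>The negative gradient, scaled to length at most 1. The denominator
   \<open>max ep (n u)\<close> keeps the field continuous everywhere and equals \<open>n u\<close>
   at the levels between a/2 and m, where the assumed contradiction makes the gradient
   large.\<close>
 define q where "q = (%u i. if i : I then - g u i / max ep (n u) else 0)"
 have mx: "0 < max ep (n u)" for u using ep by simp
 have q1: "abs (q u i) <= 1" for u i
 proof (cases "i : I")
  case True
  have "abs (g u i) <= n u" by (rule g_le_n[OF True])
  thus ?thesis using True mx[of u] by (auto simp: q_def divide_le_eq)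
 qed (simp add: q_def)
 have qI: "q u i = 0" if "i ~: I" for u i using that by (simp add: q_def)
 have qc: "continuous_on UNIV (%u. q u i)" for i
  unfolding q_def using mx by (cases "i : I") (auto intro!: continuous_intros gc nc simp: less_imp_neq[symmetric])
 define H where "H = (%u s. SUM i:I. g (%i. u i + s * q u i) i * q u i)"
 have H0: "H u 0 <= - ep" if u: "!!i. i ~: I ==> u i = 0" "a / 2 <= J u" "J u <= m" for u
 proof -
  have nu: "ep < n u" by (rule n_ge[OF u])
  have "H u 0 = - (SUM i:I. (g u i)^2) / n u"
   unfolding H_def q_def using nu by (simp add: sum_negf sum_divide_distrib power2_eq_square)
  also have "(SUM i:I. (g u i)^2) = n u * n u" unfolding n_def L2_set_def by (simp add: sum_nonneg)
  also have "- (n u * n u) / n u = - n u" using nu ep by simp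
  finally show ?thesis using nu by simp
 qed
 have Hc: "continuous_on UNIV (%(u, s). H u s)"
 proof -
  have "continuous_on UNIV (%x::(nat => real) \<times> real. g (%i. fst x i + snd x * q (fst x) i) i * q (fst x) i)" if "i : I" for i
  proof (intro continuous_on_mult)
   have q: "continuous_on UNIV (%x::(nat => real) \<times> real. q (fst x) j)" for j
    by (rule continuous_on_compose2[OF qc]) (auto intro: continuous_intros)
   thus "continuous_on UNIV (%x::(nat => real) \<times> real. q (fst x) i)" .
   have f: "continuous_on UNIV (%x::(nat => real) \<times> real. fst x j)" for j
    by (rule continuous_on_compose2[OF continuous_on_product_coordinates[of j]]) (auto intro: continuous_intros)
   have "continuous_on UNIV (%x::(nat => real) \<times> real. (%j. fst x j + snd x * q (fst x) j))"
    by (rule continuous_on_coordinatewise_then_product) (intro continuous_intros f q)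
   thus "continuous_on UNIV (%x::(nat => real) \<times> real. g (%j. fst x j + snd x * q (fst x) j) i)"
    by (rule continuous_on_compose2[OF gc[OF that]]) auto
  qed
  thus ?thesis unfolding H_def case_prod_beta by (rule continuous_on_sum)
 qed
 define B where "B = Max (insert 0 ((%i. abs (e i)) ` I))"
 have B: "abs (e i) <= B" "0 <= B" for i
  using I e(3)[of i] by (cases "i : I"; auto simp: B_def)+
 have m0: "0 < m + a"
 proof -
  have "continuous_on {0..1} (%t. E (%i. t * e i))"
   by (rule continuous_on_compose2[OF Ec]) (auto intro!: continuous_on_coordinatewise_then_product continuous_intros)
  then obtain t where "0 <= t" "t <= 1" "E (%i. t * e i) = rh"
   using IVT'[of "%t. E (%i. t * e i)" 0 rh 1] z e by auto
  hence "a <= J (%i. t * e i)" "J (%i. t * e i) <= m" using e(3) by (auto intro!: barrier m)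
  thus ?thesis using a by linarith
 qed
 \<comment> \<open>Room for k steps of size s from the segment: k s is at most 2 (m + a) / ep + 2
   independently of s, as it must be, since s is chosen only after the box.\<close>
 define R where "R = B + 2 * (m + a) / ep + 2"
 define K where "K = {u::nat => real. ALL i. abs (u i) <= (if i : I then R else 0)}"
 have K: "compact K" unfolding K_def by (rule compact_coordinate_box)
 have KI: "u i = 0" if "u : K" "i ~: I" for u i using that by (auto simp: K_def dest: spec[of _ i])
 have "uniformly_continuous_on (K \<times> {0..1}) (%(u, s). H u s)"
  by (intro compact_uniformly_continuous compact_Times K continuous_on_subset[OF Hc]) auto
 then obtain d0 where d0: "0 < d0" "!!x y. x : K \<times> {0..1} ==> y : K \<times> {0..1} ==> dist y x < d0 ==>
   dist ((%(u, s). H u s) y) ((%(u, s). H u s) x) < ep / 2"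
  unfolding uniformly_continuous_on_def using half_gt_zero[OF ep] by meson
 define s where "s = min (d0 / 2) 1"
 have s: "0 < s" "s <= 1" "s < d0" using d0 by (auto simp: s_def)
 have Hs: "H u t <= - ep / 2" if u: "u : K" "a / 2 <= J u" "J u <= m" and t: "0 <= t" "t <= s" for u t
 proof -
  have "dist (H u t) (H u 0) < ep / 2"
   using d0(2)[of "(u, 0)" "(u, t)"] u t s by (simp add: dist_Pair_Pair)
  moreover have "H u 0 <= - ep" using u KI by (intro H0) auto
  ultimately show ?thesis unfolding dist_real_def by linarith
 qed
 have step: "J (%i. u i + t * q u i) <= J u - t * ep / 2" if u: "u : K" "a / 2 <= J u" "J u <= m" and t: "0 <= t" "t <= s" for u t
 proof (cases "t = 0")
  case False
  hence t0: "0 < t" using t by simp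
  have dd: "((%s. J (%i. u i + s * q u i)) hasd H u x) (at x)" for x
   unfolding H_def by (rule der) (rule qI)
  obtain c where c: "0 < c" "c < t" "J (%i. u i + t * q u i) - J (%i. u i + 0 * q u i) = (t - 0) * H u c"
   using MVT2[OF t0, of "%s. J (%i. u i + s * q u i)" "H u"] dd by blast
  have "H u c <= - ep / 2" using u c t by (intro Hs) auto
  hence "t * H u c <= t * (- ep / 2)" using t0 by (intro mult_left_mono) auto
  with c show ?thesis by simp
 qed simp
 \<comment> \<open>The cutoff freezes points with J <= a/2, in particular both ends of the path, and
   allows full steps from level 3a/4 on.\<close>
 define ct where "ct = (%y::real. min 1 (max 0 ((y - a / 2) / (a / 4))))"
 have ct: "0 <= ct y" "ct y <= 1" for y by (auto simp: ct_def)
 have ct0: "ct y = 0" if "y <= a / 2" for y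
 proof -
  have "(y - a / 2) / (a / 4) <= 0" using that a by (intro divide_nonpos_pos) auto
  thus ?thesis by (simp add: ct_def)
 qed
 have ct1: "ct y = 1" if "3 * a / 4 <= y" for y using that a by (simp add: ct_def field_simps)
 define D where "D = (%u i. u i + (s * ct (J u)) * q u i)"
 have D_app: "D u i = u i + (s * ct (J u)) * q u i" for u i by (simp add: D_def)
 have Dc: "continuous_on UNIV D" unfolding D_def
 proof (rule continuous_on_coordinatewise_then_product)
  fix i
  have "continuous_on UNIV (%u. ct (J u))" unfolding ct_def using a by (intro continuous_intros Jc) auto
  thus "continuous_on UNIV (%u. u i + s * ct (J u) * q u i)" by (intro continuous_intros qc) auto
 qed
 have Dfix: "D u = u" if "J u <= a / 2" for u unfolding D_def using ct0[OF that] by simp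
 have Dle: "J (D u) <= max (3 * a / 4) (J u - s * ep / 2) & J (D u) <= J u" if u: "u : K" "J u <= m" for u
 proof (cases "J u <= a / 2")
  case True
  thus ?thesis using Dfix[OF True] a by simp
 next
  case False
  have "J (D u) <= J u - (s * ct (J u)) * ep / 2"
   unfolding D_def using u False s ct[of "J u"] by (intro step) (auto intro: mult_left_le)
  moreover have "0 <= (s * ct (J u)) * ep / 2" using s ct[of "J u"] ep by simp
  moreover have "J u - (s * ct (J u)) * ep / 2 = J u - s * ep / 2" if "3 * a / 4 <= J u" using ct1[OF that] by simp
  ultimately show ?thesis by (cases "3 * a / 4 <= J u") auto
 qed
 \<comment> \<open>A full step lowers J by at least s ep / 2, so k of them lower it by at least m +
   a, enough to get from m below 3a/4.\<close>
 define k where "k = nat \<lceil>2 * (m + a) / (s * ep)\<rceil>"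
 have k1: "2 * (m + a) / (s * ep) <= real k" unfolding k_def by (rule real_nat_ceiling_ge)
 have k2: "real k <= 2 * (m + a) / (s * ep) + 1"
 proof -
  have "0 <= 2 * (m + a) / (s * ep)" using m0 s ep by simp
  thus ?thesis unfolding k_def by linarith
 qed
 have ks: "real k * s <= 2 * (m + a) / ep + 2"
 proof -
  have "real k * s <= (2 * (m + a) / (s * ep) + 1) * s" using k2 s by (intro mult_right_mono) auto
  also have "... = 2 * (m + a) / ep + s" using s ep by (simp add: field_simps)
  finally show ?thesis using s by linarith
 qed
 have it: "(ALL i. i ~: I --> (D ^^ j) (%i. t * e i) i = 0) & (ALL i. abs ((D ^^ j) (%i. t * e i) i) <= B + real j * s)
   & J ((D ^^ j) (%i. t * e i)) <= m & J ((D ^^ j) (%i. t * e i)) <= max (3 * a / 4) (m - real j * (s * ep / 2))"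
  if t: "0 <= t" "t <= 1" and "j <= k" for t j
  using \<open>j <= k\<close>
 proof (induction j)
  case 0
  have "abs (t * e i) <= 1 * B" for i unfolding abs_mult using t B(1)[of i] B(2) by (intro mult_mono) auto
  thus ?case using m[OF t] e(3) by (auto intro: max.coboundedI2)
 next
  case (Suc j)
  let ?u = "(D ^^ j) (%i. t * e i)"
  have IH: "!!i. i ~: I ==> ?u i = 0" "!!i. abs (?u i) <= B + real j * s" "J ?u <= m" "J ?u <= max (3 * a / 4) (m - real j * (s * ep / 2))"
   using Suc by auto
  have "real j * s <= real k * s" using Suc.prems s by (intro mult_right_mono) auto
  hence "B + real j * s <= R" using ks by (simp add: R_def)
  hence uK: "?u : K" using IH(1,2) by (auto simp: K_def intro: order_trans)
  note d = Dle[OF uK IH(3)]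
  have c: "abs (D ?u i) <= B + real (Suc j) * s" for i
  proof -
   have "abs ((s * ct (J ?u)) * q ?u i) <= s * 1"
    unfolding abs_mult mult.assoc using s ct[of "J ?u"] q1[of ?u i]
    by (intro mult_mono) (auto intro: mult_le_one)
   hence "abs (D ?u i) <= abs (?u i) + s" unfolding D_app[of ?u i] by linarith
   thus ?thesis using IH(2)[of i] by (simp add: algebra_simps)
  qed
  show ?case
  proof (intro conjI allI impI)
   fix i assume "i ~: I"
   thus "(D ^^ Suc j) (%i. t * e i) i = 0" using IH(1) qI by (simp add: D_def)
  next
   show "J ((D ^^ Suc j) (%i. t * e i)) <= max (3 * a / 4) (m - real (Suc j) * (s * ep / 2))"
   proof -
    have "real (Suc j) * (s * ep / 2) = real j * (s * ep / 2) + s * ep / 2" by (simp add: distrib_right)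
    moreover have "0 <= s * ep / 2" using s ep by simp
    ultimately show ?thesis
     using d IH(4) unfolding le_max_iff_disj funpow.simps o_apply by (elim conjE disjE) linarith+
   qed
  qed (use c d IH(3) in auto)
 qed
 have kfin: "J ((D ^^ k) (%i. t * e i)) <= 3 * a / 4" if t: "0 <= t" "t <= 1" for t
 proof -
  define X where "X = real k * (s * ep / 2)"
  have "2 * (m + a) <= real k * (s * ep)" using k1 s ep by (simp add: field_simps)
  also have "... = 2 * X" by (simp add: X_def)
  finally have "m + a <= X" by (rule mult_left_le_imp_le) simp
  hence "m - X <= 3 * a / 4" using a by simp
  hence "m - real k * (s * ep / 2) <= 3 * a / 4" unfolding X_def .
  thus ?thesis using it[OF t order_refl] by auto
 qed
 have Dkc: "continuous_on UNIV (D ^^ j)" for j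
 proof (induction j)
  case 0 thus ?case by (simp add: id_def continuous_on_id)
 next
  case (Suc j) thus ?case by (auto intro: continuous_on_compose2[OF Dc])
 qed
 have fixk: "(D ^^ j) u = u" if "J u <= a / 2" for j u using that by (induction j) (auto simp: Dfix)
 \<comment> \<open>The deformed path has the same ends and still crosses the barrier E = rh; at the
   crossing J would be at least a and at most 3a/4.\<close>
 have "continuous_on {0..1} (%t. E ((D ^^ k) (%i. t * e i)))"
  by (intro continuous_on_compose2[OF Ec] continuous_on_compose2[OF Dkc] continuous_on_coordinatewise_then_product continuous_intros) auto
 moreover have "E ((D ^^ k) (%i. 0 * e i)) <= rh" "rh <= E ((D ^^ k) (%i. 1 * e i))"
  using fixk z e by auto
 ultimately obtain t where t: "0 <= t" "t <= 1" "E ((D ^^ k) (%i. t * e i)) = rh"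
  using IVT'[of "%t. E ((D ^^ k) (%i. t * e i))" 0 rh 1] by auto
 have "a <= J ((D ^^ k) (%i. t * e i))" using it[OF t(1,2) order_refl] t(3) by (intro barrier) auto
 with kfin[OF t(1,2)] a show False by simp
qed

text \<open>Jensen's inequality for x^n with equal weights.\<close>

lemma sum_power_le_power_mean:
 fixes a :: "'a => real"
 assumes "finite S" "!!i. i : S ==> 0 <= a i" "0 < n"
 shows "(SUM i:S. a i) ^ n <= real (card S) ^ (n - 1) * (SUM i:S. a i ^ n)"
proof (cases "S = {}")
 case False
 hence c: "0 < real (card S)" using assms by (simp add: card_gt_0_iff)
 have "convex_on {0::real..} (%x. x ^ n)"
  by (cases "even n") (auto intro: convex_on_subset[OF convex_power_even] convex_power_odd)
 hence "(SUM i:S. (1 / real (card S)) *R a i) ^ n <= (SUM i:S. (1 / real (card S)) * a i ^ n)"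
  using assms(1) False assms(2) c by (intro convex_on_sum) auto
 hence "((SUM i:S. a i) / real (card S)) ^ n <= (SUM i:S. a i ^ n) / real (card S)"
  by (simp add: sum_divide_distrib[symmetric] sum_distrib_left[symmetric])
 hence "(SUM i:S. a i) ^ n / real (card S) ^ n * real (card S) ^ n <= (SUM i:S. a i ^ n) / real (card S) * real (card S) ^ n"
  using c by (intro mult_right_mono) (auto simp: power_divide)
 thus ?thesis using c assms(3) by (simp add: power_eq_if[of "real (card S)" n] mult.commute)
qed (use assms in "simp add: zero_power")

lemma eventually_at_right_0E:
 fixes P :: "real => bool"
 assumes "eventually P (at_right 0)"
 obtains d where "0 < d" "!!t. 0 < t ==> t < d ==> P t"
 using assms unfolding eventually_at_right_field by auto

lemma continuous_pos_bounds:
 fixes h :: "real => real"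
 assumes "continuous_on {0<..} h" "0 < a"
 obtains M where "0 <= M" "!!t. a <= t ==> t <= b ==> abs (h t) <= M"
proof -
 have "compact (h ` {a..b})"
  using assms by (intro compact_continuous_image continuous_on_subset[OF assms(1)]) auto
 from compact_imp_bounded[OF this] obtain M where "ALL y:h ` {a..b}. norm y <= M" unfolding bounded_iff by blast
 thus ?thesis by (intro that[of "abs M"]) (auto intro: order_trans[OF _ abs_ge_self])
qed

section \<open>The nonlinearity f, its primitive F and the quotient F/f\<close>

text \<open>The case b0 >= 0, in which the exponent of (Q') is b0 itself and mu0 disappears. The
  parameter \<open>ty\<close> carries the dimension; \<open>N\<close>, \<open>om\<close> and
  \<open>N'\<close> stand for the dimension as a real number, the measure of the sphere and the
  conjugate exponent.\<close>

locale choquard =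
 fixes A Q f :: "real => real" and A0 l r0 L b0 b al0 p ta C CQ :: real and ty :: "'n::finite itself"
  and N om N' :: real
 assumes N2: "2 <= CARD('n)"
  and cA: "cond_A A A0 l" and cA': "cond_A' A A0 l r0 L" and cQ: "cond_Q CARD('n) Q b0 b"
  and fc: "continuous_on UNIV f" and fd: "ALL t>0. f differentiable (at t)"
  and f0: "cond_f0 f" and f1: "cond_f1 CARD('n) f al0" and f2: "cond_f2 CARD('n) f b l p"
  and f3: "cond_f3 CARD('n) f ta C" and f4: "cond_f4 f"
  and b0: "0 <= b0" and CQ: "0 < CQ" and Q': "Liminf (at_right 0) (%r. ereal (Q r / r powr b0)) = ereal CQ"
  and f5: "cond_f5 CARD('n) (sph TYPE('n)) Q f al0 A0 r0 L b0 CQ"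
  and N_def: "N = real CARD('n)" and om_def: "om = sph TYPE('n)" and N'_def: "N' = N / (N - 1)"
begin

abbreviation F :: "real => real" where "F == primitive f"
abbreviation iN :: real where "iN == 1 / (N - 1)"

lemma N_facts: "2 <= N" "0 < N - 1" "1 < N'" "real (CARD('n) - 1) = N - 1" "1 / N' = (N - 1) / N" "crit_exp CARD('n) = N'"
 using N2 by (auto simp: N_def N'_def crit_exp_def of_nat_diff field_simps)

lemma N_ge: "2 <= N" "0 < N - 1" "0 < N" "N ~= 1" using N_facts by auto

lemma pw_alt: "pw s1 s2 (x::real^'n) = (if norm x <= 1 then norm x powr (s1 - N) else norm x powr (s2 - N))"
 by (simp add: pw_def N_def)

lemma f_pos: "0 < t ==> 0 < f t" and f_zero: "t <= 0 ==> f t = 0" and f_nonneg: "0 <= f t"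
 using f0 unfolding cond_f0_def by (auto intro: less_imp_le) (metis less_imp_le linorder_not_le order_refl)

lemma F_deriv: "(F hasd f s) (at s)"
proof -
 define M where "M = abs s + 1"
 have "((%u. LBINT y=ereal 0..ereal u. f y) has_vector_derivative (f s)) (at s within {-M..M})"
  using fc by (intro interval_integral_FTC2) (auto simp: M_def intro: continuous_on_subset)
 moreover have "at s within {-M..M} = at s" by (intro at_within_interior) (auto simp: M_def)
 ultimately show ?thesis
  by (simp add: has_real_derivative_iff_has_vector_derivative primitive_def[abs_def] zero_ereal_def)
qed

lemma F_cont: "continuous_on UNIV F"
 by (rule DERIV_continuous_on[where D=f]) (rule has_field_derivative_at_within[OF F_deriv])

lemma F_zero: assumes "t <= 0" shows "F t = 0"
proof -
 have F0: "F 0 = 0" by (simp add: primitive_def zero_ereal_def)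
 show ?thesis
 proof (cases "t = 0")
  case False
  have "F 0 = F t"
  proof (rule DERIV_isconst_end[of t 0 F])
   fix x :: real assume "x < 0"
   thus "(F hasd 0) (at x)" using F_deriv[of x] f_zero[of x] by simp
  qed (use assms False in "auto intro!: continuous_on_subset[OF F_cont]")
  thus ?thesis using F0 by simp
 qed (simp add: F0)
qed

lemma F_pos: "0 < t ==> 0 < F t"
 using DERIV_pos_imp_increasing_open[of 0 t F] F_deriv f_pos F_zero[of 0] continuous_on_subset[OF F_cont] by auto

lemma F_nonneg: "0 <= F t"
 using F_pos[of t] F_zero[of t] by (cases "0 < t") auto

lemma f_deriv: "0 < t ==> (f hasd deriv f t) (at t)"
 using fd by (simp add: DERIV_deriv_iff_real_differentiable)

lemma tau: "1 - 2 / N < ta" "ta < 1" "0 < ta" "0 < t ==> ta <= F t * deriv f t / (f t)^2"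
 using f3 N_facts unfolding cond_f3_def by (auto intro: le_less_trans[of 0 "1 - 2 / N"])

lemma f_mono: assumes "x <= y" shows "f x <= f y"
proof (cases "0 < x")
 case True
 have dn: "0 <= deriv f t" if "0 < t" for t
 proof -
  have "0 < F t * deriv f t / (f t)^2" using tau(3) tau(4)[OF that] by linarith
  thus ?thesis using F_pos[OF that] f_pos[OF that] by (auto simp: zero_less_divide_iff zero_less_mult_iff)
 qed
 thus ?thesis
 proof (intro DERIV_nonneg_imp_nondecreasing[OF assms] exI conjI)
  fix z assume "x <= z"
  hence "0 < z" using True by simp
  thus "(f hasd deriv f z) (at z)" "0 <= deriv f z" using f_deriv dn by auto
 qed
next
 case False
 thus ?thesis using f_zero[of x] f_nonneg[of y] by simp
qed

lemma F_le: "F t <= t * f t"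
proof (cases "0 < t")
 case True
 obtain z where "0 < z" "z < t" "F t - F 0 = (t - 0) * f z"
  using MVT2[OF True, of F f] F_deriv by blast
 thus ?thesis using F_zero[of 0] f_mono[of z t] True by (simp add: mult_left_mono)
next
 case False
 thus ?thesis using F_zero[of t] f_zero[of t] by simp
qed

definition ps :: "real => real" where "ps t = F t / f t"

lemma psi_bounds: "0 <= ps t" "ps t <= max 0 t" "t <= 0 ==> ps t = 0" "f t * ps t = F t"
proof -
 show "0 <= ps t" by (simp add: ps_def F_nonneg f_nonneg)
 show z: "ps t = 0" if "t <= 0" using f_zero[OF that] by (simp add: ps_def)
 show "ps t <= max 0 t" "f t * ps t = F t"
  using F_le[of t] f_pos[of t] z F_zero[of t] f_zero[of t] by (cases "0 < t"; simp add: ps_def field_simps)+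
qed

lemma psi_deriv: "0 < t ==> (ps hasd (1 - F t * deriv f t / (f t)^2)) (at t)"
 unfolding ps_def using f_pos[of t]
 by (auto intro!: derivative_eq_intros F_deriv f_deriv simp: field_simps power2_eq_square)

lemma psi_diff_pos:
 assumes "0 < x" "x <= y" "!!t. x <= t ==> 1 - F t * deriv f t / (f t)^2 <= e"
 shows "ps y - ps x <= e * (y - x)"
proof (cases "x = y")
 case False
 hence xy: "x < y" using assms by simp
 have "(ps hasd (1 - F z * deriv f z / (f z)^2)) (at z)" if "x <= z" for z
  using assms(1) that by (intro psi_deriv) simp
 then obtain z where "x < z" "z < y" "ps y - ps x = (y - x) * (1 - F z * deriv f z / (f z)^2)"
  using MVT2[OF xy, of ps "%z. 1 - F z * deriv f z / (f z)^2"] by blast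
 thus ?thesis using assms(3)[of z] assms(2) by (simp add: mult.commute mult_left_mono)
qed simp

text \<open>On positive arguments the derivative 1 - F f'/f^2 of \<open>ps\<close> is at most 1 -
  ta. A left end x <= 0 is reached through small c > 0, where \<open>ps c\<close> <= c.\<close>

lemma psi_diff: assumes "x <= y" shows "ps y - ps x <= (1 - ta) * (y - x)"
proof (cases "0 < x")
 case True
 thus ?thesis using assms tau(4) by (intro psi_diff_pos) (auto dest: less_le_trans)
next
 case False
 have "ps y <= (1 - ta) * y" if "0 < y"
 proof (rule field_le_epsilon)
  fix e :: real assume e: "0 < e"
  define c where "c = min e y"
  have c: "0 < c" "c <= y" "c <= e" using e that by (auto simp: c_def)
  have "ps y - ps c <= (1 - ta) * (y - c)"
   using c tau(4) by (intro psi_diff_pos) (auto dest: less_le_trans)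
  moreover have "(1 - ta) * (y - c) <= (1 - ta) * y" using c tau(2) by (intro mult_left_mono) auto
  ultimately show "ps y <= (1 - ta) * y + e" using psi_bounds(2)[of c] c by simp
 qed
 moreover have "(1 - ta) * y <= (1 - ta) * (y - x)" using False tau(2) by (intro mult_left_mono) auto
 moreover have "0 <= (1 - ta) * (y - x)" using assms tau(2) by simp
 ultimately show ?thesis using psi_bounds(1)[of x] psi_bounds(3)[of y] False by (cases "0 < y") auto
qed

text \<open>By (f4) the derivative of \<open>ps\<close> tends to 0 at infinity.\<close>

lemma psi_diff_large:
 assumes "0 < e"
 obtains T where "0 < T" "!!x y. T <= x ==> x <= y ==> ps y - ps x <= e * (y - x)"
proof -
 have "EVT t. 1 - e < F t * deriv f t / (f t)^2"
  using f4 assms unfolding cond_f4_def by (intro order_tendstoD) auto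
 then obtain T where T: "!!t. T <= t ==> 1 - e < F t * deriv f t / (f t)^2" unfolding eventually_at_top_linorder by blast
 show ?thesis
 proof (rule that[of "max T 1"])
  fix x y assume ab: "max T 1 <= x" "x <= y"
  show "ps y - ps x <= e * (y - x)"
  proof (rule psi_diff_pos)
   fix t assume "x <= t"
   hence "T <= t" using ab by simp
   from T[OF this] show "1 - F t * deriv f t / (f t)^2 <= e" by simp
  qed (use ab in auto)
 qed simp
qed

lemma alpha0: "0 < al0" using f1 by (simp add: cond_f1_def)

text \<open>The second inequality is decay at infinity: \<open>tt\<close> is at most of order
  r^(-l/(N-1)), so Q(r) tt(r)^(p/N') is at most of order r^(b - l p / N), an exponent below
  -N.\<close>

lemma p_facts: "N < p" "N * (b + N) < l * p" "2 < p"
proof -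
 have l: "0 < l" using cA by (simp add: cond_A_def)
 have p: "N < p" "(b - l + N) * (N + 1) / l + N < p" using f2 by (auto simp: cond_f2_def gamma_exp_def N_def)
 thus "N < p" "2 < p" using N_facts by auto
 have 2: "(b - l + N) * (N + 1) + N * l < l * p" using p(2) l by (simp add: field_simps)
 show "N * (b + N) < l * p"
 proof (cases "b + N <= l")
  case True
  hence "N * (b + N) <= l * N" using N_facts by (simp add: mult.commute mult_left_mono)
  also have "... < l * p" using p(1) l by simp
  finally show ?thesis .
 next
  case False
  hence "N * (b + N) <= (b - l + N) * (N + 1) + N * l" by (simp add: algebra_simps)
  thus ?thesis using 2 by linarith
 qed
qed

text \<open>Three ranges: (f2) near 0, continuity in between, (f1) for large t, where t^(p-1) >= 1
  may be inserted.\<close>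

lemma f_growth:
 assumes "al0 < alp"
 obtains K where "0 <= K" "!!t. 0 < t ==> f t <= K * (t powr (p - 1) * exp (alp * t powr N'))"
proof -
 have a: "0 < alp" using alpha0 assms by simp
 have "EVT t. f t * exp (- alp * t powr N') < 1"
  using f1[unfolded cond_f1_def N_facts(6)] assms by (intro order_tendstoD(2)[of _ 0]) auto
 then obtain T where T: "!!t. T <= t ==> f t * exp (- alp * t powr N') < 1" unfolding eventually_at_top_linorder by blast
 have "\<forall>\<^sub>F t in at_right 0. norm (f t) <= 1 * norm (t powr (p - 1))"
  using f2 unfolding cond_f2_def by (intro landau_o.smallD) auto
 then obtain d where d: "0 < d" "!!t. 0 < t ==> t < d ==> norm (f t) <= 1 * norm (t powr (p - 1))"
  by (rule eventually_at_right_0E) blast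
 define T1 where "T1 = max T 1"
 obtain M where M: "0 <= M" "!!t. d <= t ==> t <= T1 ==> abs (f t) <= M"
  using continuous_pos_bounds[OF continuous_on_subset[OF fc subset_UNIV] d(1), of T1] by blast
 define K where "K = 1 + M / d powr (p - 1)"
 have K: "1 <= K" "M <= K * d powr (p - 1)" using M d by (auto simp: K_def field_simps)
 show ?thesis
 proof (rule that[of K])
  fix t :: real assume t: "0 < t"
  have e1: "1 <= exp (alp * t powr N')" using a by simp
  consider "t < d" | "d <= t" "t <= T1" | "T1 <= t" by linarith
  thus "f t <= K * (t powr (p - 1) * exp (alp * t powr N'))"
  proof cases
   case 1
   have "f t <= 1 * (t powr (p - 1) * 1)" using d(2)[OF t 1] by (auto dest: abs_le_D1)
   also have "... <= K * (t powr (p - 1) * exp (alp * t powr N'))" using K e1 by (intro mult_mono) auto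
   finally show ?thesis .
  next
   case 2
   have "f t <= K * (d powr (p - 1) * 1)" using M(2)[OF 2] K by (auto dest: abs_le_D1)
   also have "... <= K * (t powr (p - 1) * exp (alp * t powr N'))"
    using K e1 d 2 p_facts(3) by (intro mult_left_mono mult_mono powr_mono2) auto
   finally show ?thesis .
  next
   case 3
   hence "f t * exp (- alp * t powr N') < 1" by (intro T) (simp add: T1_def)
   hence "f t < exp (alp * t powr N')" by (simp add: exp_minus field_simps)
   also have "... = 1 * (1 * exp (alp * t powr N'))" by simp
   also have "... <= K * (t powr (p - 1) * exp (alp * t powr N'))"
   proof (intro mult_mono order_refl)
    have "1 <= t" using 3 by (simp add: T1_def)
    thus "1 <= t powr (p - 1)" using p_facts(3) by (intro ge_one_powr_ge_zero) simp_all
   qed (use K in simp_all)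
   finally show ?thesis by (rule less_imp_le)
  qed
 qed (use K in simp)
qed


section \<open>The weight A and the change of variable\<close>

lemma w_facts: "0 < om" "0 < A0" "0 < l" "0 < r0" "0 < L"
 using sph_pos[where 'n='n] cA cA' by (auto simp: om_def cond_A_def cond_A'_def)

text \<open>Near the origin A is close to A0, so \<open>wt r\<close> is close to 1 / (ka r) and
  \<open>tt r\<close> grows like ln(1/r) / ka.\<close>

definition ka :: real where "ka = (om * A0) powr iN"

lemma kappa_pos: "0 < ka" using w_facts by (simp add: ka_def)

text \<open>Minus the derivative of \<open>tt\<close>, normalised so that om A(s) s^(N-1)
  wt(s)^(N-1) = 1: the slope of a radial function in the variable \<open>tt\<close> then determines
  its flux through a sphere without any weight.\<close>

definition wt :: "real => real" where "wt s = (om * A s * s ^ (CARD('n) - 1)) powr (- 1 / (N - 1))"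

lemma A_cont: "continuous_on {0<..} A" and A_ge: "0 < s ==> A0 * s powr l <= A s"
 using cA by (auto simp: cond_A_def)

lemma A_pos: "0 < s ==> 0 < A s"
 using A_ge[of s] w_facts by (auto intro: less_le_trans[rotated])

lemma wt_pos: "0 < s ==> 0 < wt s" using A_pos[of s] w_facts by (simp add: wt_def)

lemma wt_cont: "continuous_on {0<..} wt"
proof -
 have "om * A s * s ^ (CARD('n) - 1) ~= 0" if "s : {0<..}" for s
  using A_pos[of s] w_facts(1) that by simp
 thus ?thesis unfolding wt_def
  by (intro continuous_on_powr continuous_on_mult continuous_on_const A_cont continuous_on_power continuous_on_id ballI)
qed

lemma wt_rel: assumes "0 < s" shows "om * A s * s ^ (CARD('n) - 1) * wt s ^ (CARD('n) - 1) = 1"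
proof -
 let ?n = "CARD('n)"
 have X: "0 < om * A s * s ^ (?n - 1)" using assms A_pos w_facts by simp
 have "wt s ^ (?n - 1) = (om * A s * s ^ (?n - 1)) powr (real (?n - 1) * (- 1 / (N - 1)))"
  unfolding wt_def by (rule powr_power[OF less_imp_neq[OF X, symmetric]])
 also have "real (?n - 1) * (- 1 / (N - 1)) = - 1" using N_facts(2) unfolding N_facts(4) by simp
 finally have "wt s ^ (?n - 1) = inverse (om * A s * s ^ (?n - 1))"
  using X by (simp only: powr_minus powr_one)
 thus ?thesis using right_inverse[OF less_imp_neq[OF X, symmetric]] by (simp only:)
qed

lemma powr_N: "0 < s ==> s ^ (CARD('n) - 1) = s powr (N - 1)"
 by (subst powr_realpow[symmetric]) (auto simp: N_facts(4)[simplified])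

lemma wt_le_of_A_ge:
 assumes s: "0 < s" and c: "0 < c" "c <= A s"
 shows "wt s <= (om * c) powr (- 1 / (N - 1)) / s"
proof -
 have "wt s <= (om * c * s ^ (CARD('n) - 1)) powr (- 1 / (N - 1))"
  unfolding wt_def using s c w_facts N_ge by (intro powr_mono2') (auto intro!: mult_right_mono)
 also have "... = (om * c) powr (- 1 / (N - 1)) * (s powr (N - 1)) powr (- 1 / (N - 1))"
  using s by (simp add: powr_mult powr_N[simplified])
 also have "(s powr (N - 1)) powr (- 1 / (N - 1)) = 1 / s"
  using s N_ge by (simp add: powr_powr powr_minus_divide)
 finally show ?thesis by simp
qed

lemma kappa_inv: "(om * A0) powr (- 1 / (N - 1)) = 1 / ka"
 by (simp add: ka_def powr_minus_divide)

lemma wt_le_inf: assumes s: "0 < s" shows "wt s <= s powr (- 1 - l / (N - 1)) / ka"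
proof -
 have "wt s <= (om * (A0 * s powr l)) powr (- 1 / (N - 1)) / s"
  using s w_facts A_ge by (intro wt_le_of_A_ge) auto
 also have "(om * (A0 * s powr l)) powr (- 1 / (N - 1)) = (1 / ka) * s powr (- (l / (N - 1)))"
  using s w_facts unfolding mult.assoc[symmetric] by (subst powr_mult) (auto simp: kappa_inv[simplified] powr_powr)
 also have "... / s = s powr (- 1 - l / (N - 1)) / ka"
  using s by (simp add: powr_diff powr_minus_divide)
 finally show ?thesis .
qed

text \<open>The upper bound comes from A >= A0. For the lower bound, (1 + x)^(-1/(N-1)) >= 1 -
  x/(N-1), a consequence of ln(1 + x) <= x, is used at x = s^L.\<close>

lemma wt_near_0:
 assumes s: "0 < s" "s < r0"
 shows "wt s <= (1 / ka) / s" and "(1 / ka) * (1 / s - s powr (L - 1) / (N - 1)) <= wt s"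
proof -
 have A: "A0 * (1 + s powr l) <= A s" "A s <= A0 * (1 + s powr L)" using cA' s by (auto simp: cond_A'_def)
 have "A0 <= A0 * (1 + s powr l)" using w_facts by simp
 with A(1) have "A0 <= A s" by linarith
 from wt_le_of_A_ge[OF s(1) w_facts(2) this] show "wt s <= (1 / ka) / s" unfolding kappa_inv .
 have X: "0 < 1 + s powr L" by (simp add: add_pos_nonneg)
 have q: "0 < 1 / (N - 1)" using N_ge by simp
 have "(1 / ka) * (1 / s) * (1 - s powr L / (N - 1)) <= (1 / ka) * (1 / s) * ((1 + s powr L) powr (- 1 / (N - 1)))"
 proof (rule mult_left_mono)
  have "ln (1 + s powr L) <= s powr L" using X by (intro order_trans[OF ln_le_minus_one]) auto
  hence "- iN * s powr L <= - iN * ln (1 + s powr L)" using q by (intro mult_left_mono_neg) auto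
  hence "exp (- iN * s powr L) <= (1 + s powr L) powr (- 1 / (N - 1))" using X by (simp add: powr_def)
  moreover have "1 + (- iN * s powr L) <= exp (- iN * s powr L)" by (rule exp_ge_add_one_self)
  ultimately show "1 - s powr L / (N - 1) <= (1 + s powr L) powr (- 1 / (N - 1))" by simp
 qed (use s kappa_pos in simp)
 also have "... = (om * (A0 * (1 + s powr L)) * s ^ (CARD('n) - 1)) powr (- 1 / (N - 1))"
 proof -
  have "(om * (A0 * (1 + s powr L)) * s ^ (CARD('n) - 1)) powr (- 1 / (N - 1)) =
    (om * A0) powr (- 1 / (N - 1)) * (1 + s powr L) powr (- 1 / (N - 1)) * (s powr (N - 1)) powr (- 1 / (N - 1))"
   using s X w_facts by (simp add: powr_mult powr_N[simplified])
  also have "(s powr (N - 1)) powr (- 1 / (N - 1)) = 1 / s" using s N_ge by (simp add: powr_powr powr_minus_divide)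
  finally show ?thesis unfolding kappa_inv by simp
 qed
 also have "... <= wt s" unfolding wt_def
  using s A A_pos[OF s(1)] w_facts N_ge by (intro powr_mono2') (auto intro!: mult_right_mono)
 finally show "(1 / ka) * (1 / s - s powr (L - 1) / (N - 1)) <= wt s"
  using s by (simp add: powr_diff algebra_simps)
qed

text \<open>In the variable \<open>tt r\<close> the energy of a radial function is \<open>\<integral> |u'|^N dt\<close>, without weight.\<close>
definition tt :: "real => real" where "tt r = (LBINT s. ind {r<..} s * wt s)"

lemma wt_measurable: "(%s. ind {0<..} s * wt s) : BM"
 using borel_measurable_continuous_on_indicator[OF _ wt_cont] by simp

lemma tt_powr:
 assumes r: "0 < r"
 shows "IB (%s. ind {r<..} s * wt s)" "tt r <= (N - 1) / l / ka * r powr (- (l / (N - 1)))"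
proof -
 let ?e = "- 1 - l / (N - 1)"
 have e: "?e < - 1" using w_facts N_ge by simp
 have hb: "has_bochner_integral lborel (%s. (ind {r..} s * s powr ?e) / ka) (- (r powr (?e + 1)) / (?e + 1) / ka)"
  using r by (intro has_bochner_integral_divide has_bochner_integral_lborel_nonneg has_integral_powr_to_inf e) (auto simp: kappa_pos)
 have m: "(%s. ind {r<..} s * wt s) : BM"
 proof -
  have "(%s. ind {r<..} s * (ind {0<..} s * wt s)) : BM" using wt_measurable by measurable
  also have "(%s. ind {r<..} s * (ind {0<..} s * wt s)) = (%s. ind {r<..} s * wt s)"
   using r by (auto simp: fun_eq_iff indicator_def)
  finally show ?thesis .
 qed
 have le: "abs (ind {r<..} s * wt s) <= (ind {r..} s * s powr ?e) / ka" for s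
  using wt_le_inf[of s] wt_pos[of s] r by (auto simp: indicator_def less_imp_le)
 show i: "IB (%s. ind {r<..} s * wt s)"
 proof (rule ibound)
  show "IB (%s. (ind {r..} s * s powr ?e) / ka)" using hb by (simp only: has_bochner_integral_iff)
  show "AE s in lborel. norm (ind {r<..} s * wt s) <= norm ((ind {r..} s * s powr ?e) / ka)"
   unfolding real_norm_def by (intro AE_I2 order_trans[OF le abs_ge_self])
 qed (use m in simp)
 have "tt r <= (LBINT s. (ind {r..} s * s powr ?e) / ka)"
  unfolding tt_def
 proof (rule integral_mono[OF i])
  show "IB (%s. (ind {r..} s * s powr ?e) / ka)" using hb by (simp only: has_bochner_integral_iff)
  show "ind {r<..} s * wt s <= (ind {r..} s * s powr ?e) / ka" for s by (rule order_trans[OF abs_ge_self le])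
 qed
 also have "... = - (r powr (?e + 1)) / (?e + 1) / ka" using hb by (simp only: has_bochner_integral_iff)
 finally have "tt r <= - (r powr (?e + 1)) / (?e + 1) / ka" .
 thus "tt r <= (N - 1) / l / ka * r powr (- (l / (N - 1)))" using w_facts N_ge by (simp add: mult.commute)
qed

lemma tt_deriv: assumes r: "0 < r" shows "(tt hasd - wt r) (at r)"
proof -
 have "EX G. ALL x. ereal 0 < ereal x --> ereal x < \<infinity> --> (G has_vector_derivative wt x) (at x)"
  by (intro einterval_antiderivative) (use wt_cont in "auto simp: continuous_on_eq_continuous_at")
 then obtain G where G: "!!x. 0 < x ==> (G has_vector_derivative wt x) (at x)" by auto
 have eq: "tt x = tt 1 + (G 1 - G x)" if x: "0 < x" for x
 proof -
  define m M where "m = min x 1" and "M = max x 1"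
  have mM: "0 < m" "m <= M" using x by (auto simp: m_def M_def)
  have "has_bochner_integral lborel (%s. ind {m..M} s *R wt s) (G M - G m)"
   using mM G by (intro has_bochner_integral_FTC_Icc) (auto intro: has_vector_derivative_at_within continuous_on_subset[OF wt_cont])
  hence "(LBINT s. ind {m..M} s * wt s) = G M - G m" by (auto simp: has_bochner_integral_iff)
  moreover have "tt m - tt M = (LBINT s. ind {m<..} s * wt s - ind {M<..} s * wt s)"
   unfolding tt_def using mM tt_powr(1) by simp
  moreover have "... = (LBINT s. ind {m..M} s * wt s)"
  proof (rule integral_cong_AE)
   show "AE s in lborel. ind {m<..} s * wt s - ind {M<..} s * wt s = ind {m..M} s * wt s"
    using AE_lborel_singleton[of m] by eventually_elim (use mM in "auto simp: indicator_def")
   show "(%s. ind {m<..} s * wt s - ind {M<..} s * wt s) : borel_measurable lborel"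
    using tt_powr(1)[of m] tt_powr(1)[of M] mM by auto
   have "(%s. ind {m..M} s * (ind {0<..} s * wt s)) : BM" using wt_measurable by measurable
   also have "(%s. ind {m..M} s * (ind {0<..} s * wt s)) = (%s. ind {m..M} s * wt s)"
    using mM by (auto simp: fun_eq_iff indicator_def)
   finally show "(%s. ind {m..M} s * wt s) : borel_measurable lborel" by simp
  qed
  ultimately show ?thesis by (cases "x <= 1") (auto simp: m_def M_def min_def max_def)
 qed
 have "(G hasd wt r) (at r)" using G[OF r] by (simp only: has_real_derivative_iff_has_vector_derivative)
 hence "((%x. tt 1 + (G 1 - G x)) hasd 0 + (0 - wt r)) (at r)"
  by (intro DERIV_add DERIV_diff DERIV_const)
 hence "((%x. tt 1 + (G 1 - G x)) hasd - wt r) (at r)" by simp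
 thus ?thesis
 proof (rule has_field_derivative_transform_within_open[where S="{0<..}"])
  show "tt 1 + (G 1 - G x) = tt x" if "x : {0<..}" for x by (rule eq[symmetric]) (use that in simp)
 qed (use r in auto)
qed

lemma tt_less: assumes "0 < r" "r < R" shows "tt R < tt r"
proof (rule DERIV_neg_imp_decreasing[OF assms(2)])
 fix x assume "r <= x"
 hence "0 < x" using assms by simp
 thus "EX y. (tt hasd y) (at x) & y < 0" using tt_deriv wt_pos by (intro exI[of _ "- wt x"]) simp
qed

lemma tt_le: "0 < r ==> r <= R ==> tt R <= tt r"
 using tt_less[of r R] by (cases "r = R") auto

lemma tt_pos: assumes "0 < r" shows "0 < tt r"
proof -
 have "0 <= tt (r + 1)" unfolding tt_def
  by (intro integral_nonneg_AE AE_I2) (use assms wt_pos in "auto simp: indicator_def less_imp_le")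
 thus ?thesis using tt_less[of r "r + 1"] assms by simp
qed

lemma tt_cont: "continuous_on {0<..} tt"
 by (rule DERIV_continuous_on[where D="%r. - wt r"]) (auto intro: has_field_derivative_at_within tt_deriv)

text \<open>On (0, r2] the bound \<open>wt s\<close> <= 1 / (ka s) makes tt + ln / ka nondecreasing;
  between r2 and 1 the function \<open>tt\<close> is bounded.\<close>

lemma tt_log_le:
 obtains c where "!!r. 0 < r ==> r <= 1 ==> tt r <= (1 / ka) * ln (1 / r) + c"
proof -
 define r2 where "r2 = min 1 (r0 / 2)"
 have r2: "0 < r2" "r2 <= 1" "r2 < r0" using w_facts by (auto simp: r2_def)
 show ?thesis
 proof (rule that[of "tt r2 + abs (ln r2) / ka"])
  fix r :: real assume r: "0 < r" "r <= 1"
  show "tt r <= (1 / ka) * ln (1 / r) + (tt r2 + abs (ln r2) / ka)"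
  proof (cases "r <= r2")
   case True
   have "tt r + (1 / ka) * ln r <= tt r2 + (1 / ka) * ln r2"
   proof (rule DERIV_nonneg_imp_nondecreasing[OF True])
    fix x assume x: "r <= x" "x <= r2"
    hence x': "0 < x" "x < r0" using r r2 by auto
    have "((%x. tt x + (1 / ka) * ln x) hasd - wt x + (1 / ka) * (1 / x)) (at x)"
     using x' by (intro DERIV_add tt_deriv DERIV_cmult) (auto intro!: derivative_eq_intros)
    moreover have "0 <= - wt x + (1 / ka) * (1 / x)" using wt_near_0(1)[OF x'] by simp
    ultimately show "EX y. ((%x. tt x + (1 / ka) * ln x) hasd y) (at x) & 0 <= y" by blast
   qed
   moreover have "(1 / ka) * ln r2 <= abs (ln r2) / ka" using kappa_pos by (simp add: divide_right_mono)
   ultimately show ?thesis using r by (simp add: ln_div)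
  next
   case False
   hence "tt r <= tt r2" using r2 by (intro tt_le) auto
   moreover have "0 <= (1 / ka) * ln (1 / r)" "0 <= abs (ln r2) / ka"
    using kappa_pos r by (auto intro!: mult_nonneg_nonneg)
   ultimately show ?thesis by linarith
  qed
 qed
qed

text \<open>The lower bound for \<open>wt\<close>, integrated. The term rh^L / ((N-1) L) dominates
  the integral of the correction s^(L-1) / (N-1); it is the source of the exponential factor in the
  threshold of (f5).\<close>

lemma tt_diff_ge:
 assumes r: "0 < r" "r <= rh" "rh <= r0"
 shows "(1 / ka) * (ln (rh / r) - rh powr L / ((N - 1) * L)) <= tt r - tt rh"
proof (cases "r = rh")
 case True
 thus ?thesis using r w_facts N_ge kappa_pos by simp
next
 case False
 define g where "g = (%s. tt s + (1 / ka) * (ln s - s powr L / ((N - 1) * L)))"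
 have d: "(g hasd - wt s + (1 / ka) * (1 / s - s powr (L - 1) / (N - 1))) (at s)" if s: "0 < s" for s
 proof -
  have "((%s. ln s - s powr L / ((N - 1) * L)) hasd 1 / s - s powr (L - 1) / (N - 1)) (at s)"
   using s w_facts(5) N_ge by (auto intro!: derivative_eq_intros)
  thus ?thesis unfolding g_def using s by (intro DERIV_add tt_deriv DERIV_cmult)
 qed
 have lt: "r < rh" using r False by simp
 have d': "(g hasd - wt s + (1 / ka) * (1 / s - s powr (L - 1) / (N - 1))) (at s)" if "r <= s" "s <= rh" for s
  using r that by (intro d) simp
 obtain z where z: "r < z" "z < rh" "g rh - g r = (rh - r) * (- wt z + (1 / ka) * (1 / z - z powr (L - 1) / (N - 1)))"
  using MVT2[OF lt d'] by blast
 have "- wt z + (1 / ka) * (1 / z - z powr (L - 1) / (N - 1)) <= 0" using wt_near_0(2)[of z] z r by simp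
 from mult_nonneg_nonpos[OF _ this, of "rh - r"] have "g rh <= g r" using z(3) r by simp
 moreover have "0 <= (1 / ka) * (r powr L / ((N - 1) * L))" using kappa_pos w_facts N_ge by simp
 ultimately show ?thesis using r unfolding g_def by (simp add: ln_div algebra_simps)
qed

section \<open>Majorants for Q and f in the new variable\<close>

lemma Q_pos: "0 < r ==> 0 < Q r" and Q_cont: "continuous_on {0<..} Q"
 using cQ by (auto simp: cond_Q_def)

text \<open>The limits superior control Q near 0 and near infinity; continuity fills the compact
  range between, with one constant for both powers.\<close>

lemma Q_bound:
 obtains M where "0 <= M" "!!r. 0 < r ==> r <= 1 ==> Q r <= M * r powr b0" "!!r. 1 <= r ==> Q r <= M * r powr b"
proof -
 have "EX M. \<forall>\<^sub>F x in G. h x < M" if lim: "Limsup G (%x. ereal (h x)) < \<infinity>" for h :: "real => real" and G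
 proof -
  obtain k :: nat where M: "Limsup G (%x. ereal (h x)) < ereal (real k)" using less_PInf_Ex_of_nat[THEN iffD1, OF less_imp_neq[OF lim]] by auto
  hence "\<forall>\<^sub>F x in G. ereal (h x) < ereal (real k)" by (rule Limsup_lessD)
  thus ?thesis by auto
 qed note ex = this
 obtain M1 where "\<forall>\<^sub>F r in at_right 0. Q r / r powr b0 < M1" using ex[of "at_right 0" "%r. Q r / r powr b0"] cQ unfolding cond_Q_def by blast
 then obtain d where d: "0 < d" "!!r. 0 < r ==> r < d ==> Q r / r powr b0 < M1" by (rule eventually_at_right_0E) blast
 obtain M2 where "EVT r. Q r / r powr b < M2" using ex[of at_top "%r. Q r / r powr b"] cQ unfolding cond_Q_def by blast
 then obtain R where R: "!!r. R <= r ==> Q r / r powr b < M2" unfolding eventually_at_top_linorder by blast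
 have c1: "continuous_on {0<..} (%r. Q r / r powr b0)" "continuous_on {0<..} (%r. Q r / r powr b)"
  by (intro continuous_intros Q_cont; simp)+
 obtain M3 where M3: "0 <= M3" "!!r. d <= r ==> r <= 1 ==> abs (Q r / r powr b0) <= M3" by (rule continuous_pos_bounds[OF c1(1) d(1), of 1]) blast
 obtain M4 where M4: "0 <= M4" "!!r. 1 <= r ==> r <= R ==> abs (Q r / r powr b) <= M4" by (rule continuous_pos_bounds[OF c1(2) zero_less_one, of R]) blast
 define M where "M = abs M1 + abs M2 + M3 + M4"
 show ?thesis
 proof (rule that[of M])
  show "0 <= M" using M3 M4 by (simp add: M_def)
  show "Q r <= M * r powr b0" if r: "0 < r" "r <= 1" for r
  proof -
   have "Q r / r powr b0 <= M"
   proof (cases "r < d")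
    case True
    thus ?thesis using d(2)[OF r(1)] M3(1) M4(1) unfolding M_def by linarith
   next
    case False
    thus ?thesis using M3(2)[of r] M4(1) r(2) unfolding M_def by linarith
   qed
   thus ?thesis using r by (simp add: divide_le_eq)
  qed
  show "Q r <= M * r powr b" if r: "1 <= r" for r
  proof -
   have "Q r / r powr b <= M"
   proof (cases "R <= r")
    case True
    thus ?thesis using R[OF True] M3(1) M4(1) unfolding M_def by linarith
   next
    case False
    thus ?thesis using M4(2)[of r] M3(1) r unfolding M_def by linarith
   qed
   thus ?thesis using r by (simp add: divide_le_eq)
  qed
 qed
qed

definition th :: "real^'n => real" where "th x = tt (norm x)"

text \<open>Near the origin exp(et tt) is at most a multiple of r^(-et/ka), and b0 - et/ka > -N. At
  infinity exp(et tt) is bounded and the power of \<open>tt\<close> gives the decay.\<close>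

lemma Q_majorant:
 assumes et: "0 <= et" "et < ka * (b0 + N)" and q: "0 < q"
 obtains sg K where "0 < sg" "0 <= K"
  "!!x. x ~= 0 ==> Q (norm x) * (th x powr q * exp (et * th x)) <= K * pw sg (N + b - l * q / (N - 1)) x"
proof -
 obtain M where M: "0 <= M" "!!r. 0 < r ==> r <= 1 ==> Q r <= M * r powr b0" "!!r. 1 <= r ==> Q r <= M * r powr b"
  by (rule Q_bound) blast
 obtain c where c: "!!r. 0 < r ==> r <= 1 ==> tt r <= (1 / ka) * ln (1 / r) + c" by (rule tt_log_le) blast
 \<comment> \<open>Half of the gap b0 + N - et/ka; the other half is spent on the power of
   \<open>tt\<close>.\<close>
 define sg where "sg = (b0 + N - et / ka) / 2"
 have "et / ka < b0 + N" using et kappa_pos by (simp add: pos_divide_less_eq mult.commute)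
 hence s: "0 < sg" by (simp add: sg_def)
 \<comment> \<open>the polynomial factor is absorbed by a slightly larger exponent\<close>
 define et' where "et' = et + ka * sg"
 have e': "0 < et'" "et' / ka = b0 + N - sg" "et < et'"
 proof -
  show "0 < et'" "et < et'" using et(1) s kappa_pos by (auto simp: et'_def add_nonneg_pos)
  have "et' / ka = et / ka + sg" using kappa_pos by (simp add: et'_def add_divide_distrib)
  moreover have "X + (Y - X) / 2 = Y - (Y - X) / 2" for X Y :: real by (simp add: field_simps)
  ultimately show "et' / ka = b0 + N - sg" unfolding sg_def by simp
 qed
 obtain K1 where K1: "0 <= K1" "!!y. 0 < y ==> y powr q * exp (et * y) <= K1 * exp (et' * y)"
 proof -
  define d where "d = (et' - et) / q"
  have d: "0 < d" using e' q by (simp add: d_def)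
  have "y powr q * exp (et * y) <= (1 / d) powr q * exp (et' * y)" if y: "0 < y" for y
  proof -
   have "d * y <= exp (d * y)" using exp_ge_add_one_self[of "d * y"] by linarith
   hence "y <= (1 / d) * exp (d * y)" using d by (simp add: field_simps)
   hence "y powr q <= ((1 / d) * exp (d * y)) powr q" using y q by (intro powr_mono2) auto
   also have "... = (1 / d) powr q * exp (d * y) powr q" by (rule powr_mult)
   also have "exp (d * y) powr q = exp ((et' - et) * y)" using q by (simp add: powr_def d_def)
   finally have "y powr q * exp (et * y) <= (1 / d) powr q * exp ((et' - et) * y) * exp (et * y)" by (intro mult_right_mono) auto
   also have "... = (1 / d) powr q * (exp ((et' - et) * y) * exp (et * y))" by simp
   also have "exp ((et' - et) * y) * exp (et * y) = exp (et' * y)" by (simp add: exp_add[symmetric] left_diff_distrib)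
   finally show ?thesis .
  qed
  thus ?thesis by (intro that[of "(1 / d) powr q"]) auto
 qed
 define ct where "ct = (N - 1) / l / ka"
 have ct: "0 < ct" using w_facts N_ge kappa_pos by (simp add: ct_def)
 define K where "K = M * K1 * exp (et' * abs c) + M * (ct powr q * exp (et * tt 1))"
 have Kn: "0 <= M * K1 * exp (et' * abs c)" "0 <= M * (ct powr q * exp (et * tt 1))" using M K1 by auto
 let ?e = "exp (et' * abs c)" and ?f = "exp (et * tt 1)" and ?g = "- (b0 + N - sg)" and ?h = "- (l * q / (N - 1))"
 show ?thesis
 proof (rule that[of sg K])
  fix x :: "real^'n" assume x: "x ~= 0"
  define r where "r = norm x"
  have r: "0 < r" using x by (simp add: r_def)
  have T: "th x = tt r" "0 < tt r" using tt_pos[OF r] by (simp_all add: th_def r_def)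
  show "Q (norm x) * (th x powr q * exp (et * th x)) <= K * pw sg (N + b - l * q / (N - 1)) x"
  proof (cases "r <= 1")
   case True
   have "tt r <= (1 / ka) * ln (1 / r) + abs c" using c[OF r True] by linarith
   hence "et' * tt r <= et' * ((1 / ka) * ln (1 / r) + abs c)" using e' by (intro mult_left_mono) auto
   also have "... = - (et' / ka) * ln r + et' * abs c" using r by (simp add: ln_div algebra_simps)
   finally have "exp (et' * tt r) <= ?e * r powr ?g"
    using r unfolding e'(2) by (simp add: powr_def exp_add[symmetric] add.commute)
   hence "K1 * exp (et' * tt r) <= K1 * (?e * r powr ?g)" using K1 by (intro mult_left_mono)
   with K1(2)[OF T(2)] have 2: "tt r powr q * exp (et * tt r) <= K1 * (?e * r powr ?g)" by linarith
   have "Q r * (tt r powr q * exp (et * tt r)) <= (M * r powr b0) * (K1 * (?e * r powr ?g))"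
    by (rule mult_mono[OF M(2)[OF r True] 2]) (use M r in auto)
   also have "... = (M * K1 * ?e) * (r powr b0 * r powr ?g)" by simp
   also have "r powr b0 * r powr ?g = r powr (sg - N)" by (simp add: powr_add[symmetric])
   also have "(M * K1 * ?e) * r powr (sg - N) <= K * r powr (sg - N)" using Kn by (intro mult_right_mono) (auto simp: K_def)
   finally show ?thesis using True by (simp add: T pw_alt r_def[symmetric])
  next
   case False
   have "tt r <= ct * r powr (- (l / (N - 1)))" using tt_powr(2)[OF r] by (simp add: ct_def)
   hence "tt r powr q <= (ct * r powr (- (l / (N - 1)))) powr q" using T q by (intro powr_mono2) auto
   also have "... = ct powr q * r powr ?h" using ct by (simp add: powr_mult powr_powr)
   finally have 1: "tt r powr q <= ct powr q * r powr ?h" .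
   have "tt r <= tt 1" using False by (intro tt_le) auto
   hence "exp (et * tt r) <= ?f" using et by (simp add: mult_left_mono)
   with 1 have 2: "tt r powr q * exp (et * tt r) <= (ct powr q * r powr ?h) * ?f" by (intro mult_mono) auto
   have "Q r * (tt r powr q * exp (et * tt r)) <= (M * r powr b) * ((ct powr q * r powr ?h) * ?f)"
    by (rule mult_mono[OF M(3) 2]) (use M False in auto)
   also have "... = (M * (ct powr q * ?f)) * (r powr b * r powr ?h)" by simp
   also have "r powr b * r powr ?h = r powr (N + b - l * q / (N - 1) - N)" by (simp add: powr_add[symmetric])
   also have "(M * (ct powr q * ?f)) * ... <= K * ..." using Kn by (intro mult_right_mono) (auto simp: K_def)
   finally show ?thesis using False by (simp add: T pw_alt r_def[symmetric])
  qed
 qed (use s Kn in "auto simp: K_def")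
qed


text \<open>Growth of f along arguments c v^(1/N'): the power t^(p-1) becomes v^((p-1)/N'), and
  alpha c^N' becomes \<open>et\<close>.\<close>

abbreviation "gro et v == v powr ((p - 1) / N') * exp (et * v)"

text \<open>The rate al0 c^N' lies strictly below ka (b0 + N), which leaves room for two factors 1 +
  de. One raises al0 to an exponent admissible in (f1); the other absorbs T, since either T is small
  against c tz^(1/N') or v is bounded.\<close>

lemma f_majorant:
 assumes c: "0 <= c" "al0 * c powr N' < ka * (b0 + N)" and T: "0 <= T" and B: "0 <= B"
 obtains et K where "0 <= et" "et < ka * (b0 + N)" "0 <= K"
  "!!tz v. 0 < tz ==> v <= T + c * tz powr (1 / N') ==> v <= B * tz powr (1 / N')
   ==> f v <= K * gro et tz"
proof -
 have N'0: "0 < N'" using N_facts(3) by simp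
 define g where "g = ka * (b0 + N)"
 define r where "r = al0 * c powr N'"
 have r: "0 <= r" "r < g" using alpha0 c by (auto simp: r_def g_def)
 \<comment> \<open>Makes r (1 + de)^2 smaller than g: as de <= 1, the excess over r is at most 3 r
   de.\<close>
 define de where "de = (g - r) / (3 * r + (g - r) + 1)"
 have den: "0 < 3 * r + (g - r) + 1" using r by simp
 have d: "0 < de" "de <= 1" using r den by (auto simp: de_def divide_le_eq)
 have d3: "3 * r * de < g - r"
 proof -
  have "3 * r * (g - r) < (3 * r + (g - r) + 1) * (g - r)" using r by (intro mult_strict_right_mono) auto
  thus ?thesis using den by (simp add: de_def divide_less_eq mult.commute)
 qed
 define et where "et = r * (1 + de)^2"
 have eta: "0 <= et" "et < g"
 proof -
  show "0 <= et" using r by (simp add: et_def)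
  have "r * de^2 <= r * de" using r d by (intro mult_left_mono) (auto simp: power2_eq_square mult_left_le)
  moreover have "et = r + 2 * (r * de) + r * de^2" by (simp add: et_def power2_eq_square algebra_simps)
  moreover have "3 * r * de = 3 * (r * de)" by simp
  ultimately show "et < g" using d3 by linarith
 qed
 define alp where "alp = al0 * (1 + de)"
 have al: "al0 < alp" "0 < alp" using alpha0 d by (auto simp: alp_def)
 obtain K where K: "0 <= K" "!!t. 0 < t ==> f t <= K * (t powr (p - 1) * exp (alp * t powr N'))"
  by (rule f_growth[OF al(1)]) blast
 define e where "e = (1 + de) powr (1 / N') - 1"
 have e: "0 < e" "(1 + e) powr N' = 1 + de"
  using d N'0 by (auto simp: e_def powr_powr intro!: gr_one_powr)
 define M where "M = (T + T / e) powr N'"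
 show ?thesis
 proof (rule that[of et "K * (B powr (p - 1) * exp (alp * M))"])
  fix tz v :: real assume tz: "0 < tz" and v: "v <= T + c * tz powr (1 / N')" "v <= B * tz powr (1 / N')"
  show "f v <= K * (B powr (p - 1) * exp (alp * M)) * gro et tz"
  proof (cases "0 < v")
   case False
   thus ?thesis using f_zero[of v] K by simp
  next
   case True
   let ?y = "c * tz powr (1 / N')"
   have y: "0 <= ?y" "?y powr N' = c powr N' * tz" using c tz N'0 by (auto simp: powr_mult powr_powr)
   have "v powr N' <= (1 + de) * ?y powr N' + M"
   proof (cases "T <= e * ?y")
    case le: True
    have "v <= (1 + e) * ?y" using v(1) le by (simp add: distrib_right)
    hence "v powr N' <= ((1 + e) * ?y) powr N'" using True N'0 by (intro powr_mono2) auto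
    also have "... = (1 + de) * ?y powr N'" using e by (simp add: powr_mult)
    finally show ?thesis by (simp add: M_def add_increasing2)
   next
    case False
    hence "?y <= T / e" using e by (simp add: field_simps)
    hence "v <= T + T / e" using v(1) by linarith
    hence "v powr N' <= M" unfolding M_def using True N'0 by (intro powr_mono2) auto
    thus ?thesis using d by (simp add: add_increasing)
   qed
   hence "alp * v powr N' <= alp * ((1 + de) * (c powr N' * tz) + M)" using al y(2) by (simp add: mult_left_mono)
   also have "... = et * tz + alp * M" by (simp add: et_def r_def alp_def power2_eq_square algebra_simps)
   finally have 1: "exp (alp * v powr N') <= exp (alp * M) * exp (et * tz)" by (simp add: exp_add[symmetric] add.commute)
   have "v powr (p - 1) <= (B * tz powr (1 / N')) powr (p - 1)" using True v(2) p_facts(3) by (intro powr_mono2) auto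
   also have "... = B powr (p - 1) * tz powr ((p - 1) / N')" by (simp add: powr_mult powr_powr)
   finally have "v powr (p - 1) * exp (alp * v powr N') <= (B powr (p - 1) * tz powr ((p - 1) / N')) * (exp (alp * M) * exp (et * tz))"
    using 1 by (intro mult_mono) auto
   from mult_left_mono[OF this K(1)] K(2)[OF True] show ?thesis by (simp add: mult_ac)
  qed
 qed (use eta K in "auto simp: g_def")
qed

text \<open>Keeps the power of the amplitude rh explicit, for small energies in the barrier and
  small values in the positivity argument. The rate al0 + 1 is one admissible choice.\<close>

lemma f_small:
 obtains K where "0 <= K" "!!tz v rh. 0 < tz ==> 0 <= rh ==> v <= rh * tz powr (1 / N')
   ==> f v <= K * rh powr (p - 1) * (tz powr ((p - 1) / N') * exp ((al0 + 1) * rh powr N' * tz))"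
proof -
 have N'0: "0 < N'" using N_facts(3) by simp
 obtain K where K: "0 <= K" "!!t. 0 < t ==> f t <= K * (t powr (p - 1) * exp ((al0 + 1) * t powr N'))"
  by (rule f_growth[of "al0 + 1"]) (simp, blast)
 show ?thesis
 proof (rule that[OF K(1)])
  fix tz v rh :: real assume tz: "0 < tz" and v: "0 <= rh" "v <= rh * tz powr (1 / N')"
  show "f v <= K * rh powr (p - 1) * (tz powr ((p - 1) / N') * exp ((al0 + 1) * rh powr N' * tz))"
  proof (cases "0 < v")
   case False
   thus ?thesis using f_zero[of v] K by simp
  next
   case True
   let ?y = "rh * tz powr (1 / N')"
   have "?y powr N' = rh powr N' * tz" using tz N'0 by (simp add: powr_mult powr_powr)
   moreover have "v powr N' <= ?y powr N'" using True v N'0 by (intro powr_mono2) auto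
   ultimately have 1: "exp ((al0 + 1) * v powr N') <= exp ((al0 + 1) * (rh powr N' * tz))" using alpha0 by (simp add: mult_left_mono)
   have "v powr (p - 1) <= ?y powr (p - 1)" using True v p_facts(3) by (intro powr_mono2) auto
   also have "... = rh powr (p - 1) * tz powr ((p - 1) / N')" by (simp add: powr_mult powr_powr)
   finally have "v powr (p - 1) * exp ((al0 + 1) * v powr N') <= (rh powr (p - 1) * tz powr ((p - 1) / N')) * exp ((al0 + 1) * (rh powr N' * tz))"
    using 1 by (intro mult_mono) auto
   from mult_left_mono[OF this K(1)] K(2)[OF True] show ?thesis by (simp add: mult_ac)
  qed
 qed
qed

section \<open>The critical level and concentrating profiles\<close>

lemma C_N_pos: "0 < C_N CARD('n)"
 by (simp add: C_N_def Gamma_real_pos)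

text \<open>Half of \<open>beta0_crit\<close>, with the constant in the lower bound for Q left as a
  parameter c, because c is CQ / 2 outside the borderline case.\<close>

definition thr :: "real => real => real" where
 "thr c rh = A0 / om * ((b0 + N) ^ (CARD('n) + 2) / (al0 ^ CARD('n) * C_N CARD('n) * c^2 * rh powr (2 * (b0 + N))))
   * exp (2 * (b0 + N) * rh powr L / ((N - 1) * L))"

text \<open>In the borderline case the data are those of (f5). If lam < 1 + N', the factor t^(1 + N'
  - lam) tends to infinity and lifts the product above any threshold; the radius then comes from the
  limit inferior in (Q') with CQ / 2.\<close>

lemma f5_data:
 obtains rQ c be where "0 < rQ" "0 < c" "!!r. 0 < r ==> r < rQ ==> c * r powr b0 <= Q r"
  "thr c (min (1/4) (min r0 rQ)) < be"
  "EVT t. be <= t powr (1 + N') * f t * F t * exp (- 2 * al0 * t powr N')"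
proof -
 let ?h = "%lam t. t powr lam * f t * F t * exp (- 2 * al0 * t powr N')"
 obtain be lam kk where b: "0 < be" "0 < lam" "lam <= 1 + N'" "((%t. ereal (?h lam t)) \<longlongrightarrow> kk) at_top" "ereal be <= kk"
  and bl: "lam = 1 + N' --> (EX rQ>0. (ALL r:{0<..<rQ}. Q r >= CQ * r powr b0) &
       be > beta0_crit CARD('n) om A0 al0 CQ L b0 (min (1/4) (min r0 rQ)))"
  using f5[unfolded cond_f5_def N_facts(6) om_def[symmetric]] by blast
 have ev: "EVT t. y < ?h lam t" if "y < be" for y
 proof -
  have "ereal y < kk" using that b(5) by (meson ereal_less_eq(3) less_ereal.simps(1) order_less_le_trans)
  from order_tendstoD(1)[OF b(4) this] show ?thesis by simp
 qed
 show ?thesis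
 proof (cases "lam = 1 + N'")
  case True
  then obtain rQ where rQ: "0 < rQ" "ALL r:{0<..<rQ}. Q r >= CQ * r powr b0"
    "be > beta0_crit CARD('n) om A0 al0 CQ L b0 (min (1/4) (min r0 rQ))" using bl by blast
  let ?t = "thr CQ (min (1/4) (min r0 rQ))"
  have "beta0_crit CARD('n) om A0 al0 CQ L b0 (min (1/4) (min r0 rQ)) = 2 * ?t"
   unfolding beta0_crit_def thr_def N_def[symmetric] by simp
  moreover have "0 <= ?t" unfolding thr_def using w_facts b0 N_ge alpha0 C_N_pos CQ
   by (intro mult_nonneg_nonneg divide_nonneg_nonneg zero_le_power) auto
  ultimately have t: "?t < be" using rQ(3) by linarith
  show ?thesis
  proof (rule that[OF rQ(1) CQ])
   show "?t < (?t + be) / 2" using t by simp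
   show "EVT t. (?t + be) / 2 <= t powr (1 + N') * f t * F t * exp (- 2 * al0 * t powr N')"
    using ev[of "(?t + be) / 2"] t unfolding True by (auto elim: eventually_mono)
  qed (use rQ in auto)
 next
  case False
  have "ereal (CQ / 2) < Liminf (at_right 0) (%r. ereal (Q r / r powr b0))" unfolding Q' using CQ by simp
  hence "\<forall>\<^sub>F r in at_right 0. ereal (CQ / 2) < ereal (Q r / r powr b0)" by (rule less_LiminfD)
  then obtain rQ where rQ: "0 < rQ" "!!r. 0 < r ==> r < rQ ==> ereal (CQ / 2) < ereal (Q r / r powr b0)"
   by (rule eventually_at_right_0E) blast
  let ?t = "thr (CQ / 2) (min (1/4) (min r0 rQ))"
  show ?thesis
  proof (rule that[OF rQ(1), of "CQ / 2" "?t + 1"])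
   show "CQ / 2 * r powr b0 <= Q r" if "0 < r" "r < rQ" for r
    using rQ(2)[OF that] that by (simp add: less_divide_eq)
   define d where "d = 1 + N' - lam"
   define M where "M = (abs ?t + 1) / (be / 2)"
   have dM: "0 < d" "0 < M" using b(1,3) False by (auto simp: d_def M_def)
   have "M <= t powr d" if "M powr (1 / d) <= t" for t
   proof -
    have "(M powr (1 / d)) powr d <= t powr d" using dM that by (intro powr_mono2) auto
    thus ?thesis using dM by (simp add: powr_powr)
   qed
   hence "EVT t. (abs ?t + 1) / (be / 2) <= t powr (1 + N' - lam)"
    unfolding d_def[symmetric] M_def[symmetric] by (rule eventually_mono[OF eventually_ge_at_top[of "M powr (1 / d)"]])
   moreover have "EVT t. be / 2 < ?h lam t" by (rule ev) (use b in simp)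
   ultimately show "EVT t. ?t + 1 <= t powr (1 + N') * f t * F t * exp (- 2 * al0 * t powr N')"
    using eventually_gt_at_top[of 0]
   proof eventually_elim
    case (elim t)
    have "?t + 1 <= (abs ?t + 1) / (be / 2) * (be / 2)" using b(1) by simp
    also have "... <= t powr (1 + N' - lam) * ?h lam t" using elim b(1) by (intro mult_mono) auto
    also have "... = (t powr (1 + N' - lam) * t powr lam) * (f t * F t * exp (- 2 * al0 * t powr N'))" by simp
    also have "t powr (1 + N' - lam) * t powr lam = t powr (1 + N')" using elim by (simp add: powr_add[symmetric])
    finally show ?case by simp
   qed
  qed (use CQ in auto)
 qed
qed

text \<open>By the mean value theorem F(y) >= f(z) for some z in (y - 1, y), and f(z) >= exp((al0/2)
  z^N') for large z.\<close>

lemma F_superpower: "EVT y. y ^ m <= F y"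
proof -
 have "ALL alp<al0. filterlim (%t. f t * exp (- alp * t powr N')) at_top at_top"
  using f1[unfolded cond_f1_def N_facts(6)] by blast
 from spec[OF this, of "al0 / 2"]
 have "filterlim (%t. f t * exp (- (al0 / 2) * t powr N')) at_top at_top" using alpha0 by simp
 hence "EVT t. 1 <= f t * exp (- (al0 / 2) * t powr N')" by (simp add: filterlim_at_top)
 then obtain T where T: "!!t. T <= t ==> 1 <= f t * exp (- (al0 / 2) * t powr N')" unfolding eventually_at_top_linorder by blast
 have e: "exp (al0 / 2 * (y - 1)) <= F y" if "max T 1 + 1 <= y" for y
 proof -
  obtain z where z: "y - 1 < z" "z < y" "F y - F (y - 1) = (y - (y - 1)) * f z"
   using MVT2[of "y - 1" y F f] F_deriv by auto
  have z1: "1 <= z" "T <= z" using z that by auto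
  have "z powr 1 <= z powr N'" using z1 N_facts(3) by (intro powr_mono) auto
  hence "al0 / 2 * (y - 1) <= al0 / 2 * z powr N'" using z z1 alpha0 by (intro mult_left_mono) auto
  hence "exp (al0 / 2 * (y - 1)) <= exp (al0 / 2 * z powr N')" by simp
  also have "... <= f z" using T[OF z1(2)] by (simp add: exp_minus field_simps)
  also have "... <= F y" using z F_nonneg[of "y - 1"] by simp
  finally show ?thesis .
 qed
 have "((%x::real. x ^ m / exp x) \<longlongrightarrow> 0) at_top" by (rule tendsto_power_div_exp_0)
 moreover have "filterlim (%y. al0 / 2 * y) at_top at_top"
  using alpha0 by (intro filterlim_tendsto_pos_mult_at_top[OF tendsto_const _ filterlim_ident]) auto
 ultimately have "((%y. (al0 / 2 * y) ^ m / exp (al0 / 2 * y)) \<longlongrightarrow> 0) at_top" by (rule filterlim_compose)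
 hence "EVT y. (al0 / 2 * y) ^ m / exp (al0 / 2 * y) < (al0 / 2) ^ m * exp (- (al0 / 2))"
  using alpha0 by (intro order_tendstoD) auto
 with eventually_ge_at_top[of "max T 1 + 1"] show ?thesis
 proof eventually_elim
  case (elim y)
  have "(al0 / 2) ^ m * y ^ m < (al0 / 2) ^ m * (exp (- (al0 / 2)) * exp (al0 / 2 * y))"
   using elim(2) unfolding power_mult_distrib[of "al0 / 2"] divide_less_eq mult.assoc by (simp only: exp_gt_zero if_True)
  hence "y ^ m < exp (- (al0 / 2)) * exp (al0 / 2 * y)" using alpha0 by (simp only: mult_less_cancel_left_pos zero_less_power half_gt_zero)
  also have "... = exp (al0 / 2 * (y - 1))" by (simp add: exp_add[symmetric] right_diff_distrib)
  finally show ?case using e[OF elim(1)] by simp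
 qed
qed

text \<open>The critical level: below it a bounded energy controls the exponential growth integrably at the origin.\<close>
definition mstar :: real where "mstar = (ka * (b0 + N) / al0) ^ (CARD('n) - 1) / N"

lemma mstar_pos: "0 < mstar" unfolding mstar_def using kappa_pos b0 N_ge alpha0 by simp

lemma powr_pow_N: assumes "0 < s" shows "s ^ CARD('n) = (s powr N') ^ (CARD('n) - 1)"
proof -
 have N'0: "N' * (N - 1) = N" using N_ge by (auto simp: N'_def field_simps)
 have "(s powr N') ^ (CARD('n) - 1) = s powr (real (CARD('n) - 1) * N')" using assms by (simp add: powr_power mult.commute)
 also have "real (CARD('n) - 1) * N' = N" using N'0 unfolding N_facts(4) by (simp only: mult.commute)
 also have "s powr N = s ^ CARD('n)" unfolding N_def by (rule powr_realpow[OF assms])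
 finally show ?thesis ..
qed

text \<open>A radius below which \<open>tt\<close> exceeds \<open>tt rh\<close> by at least T,
  obtained by solving the inequality of \<open>tt_diff_ge\<close>.\<close>

definition rstar :: "real => real => real" where
 "rstar rh T = rh * exp (- (rh powr L / ((N - 1) * L) + ka * T))"

text \<open>Upper bound for the functional at a profile of amplitude s. Of the double integral only
  the ball of radius \<open>rstar rh T\<close> is kept: there the profile is s T^(1/N'), the kernel
  is at least ln(1 / (2 rstar)), and the term squared bounds the integral of Q from below.\<close>

definition lev :: "real => real => real => real => real" where
 "lev c rh T s = s ^ CARD('n) / N - C_N CARD('n) / 2 * (ln (1 / (2 * rstar rh T)) *
   (c * om * rstar rh T powr (b0 + N) / (b0 + N))^2) * (F (s * T powr (1 / N')))^2"

text \<open>At an interior maximum in s the derivative vanishes. Put X = s^N'. If X >= X0, then (f5)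
  turns this equation into P exp(2 T al0 (X - X0)) <= X^N. But X^N <= X0^N exp(N (X - X0) / X0) and
  P > X0^N, which is impossible once 2 T al0 >= N / X0. Hence X < X0, that is s^N / N <
  mstar.\<close>

lemma level_estimate:
 assumes c: "0 < c" and rh: "0 < rh" "rh <= 1/4" and be: "thr c rh < be"
  and ev: "EVT t. be <= t powr (1 + N') * f t * F t * exp (- 2 * al0 * t powr N')"
 shows "EX T0. ALL T>T0. 0 < T --> (EX m. 0 < m & m < mstar & (ALL s>=0. lev c rh T s <= m)) & (EX s1>0. ALL s>=s1. lev c rh T s < 0)"
proof -
 let ?c = "C_N CARD('n)" and ?n = "CARD('n)"
 have N'0: "0 < N'" using N_facts(3) by simp
 obtain y0 where y0: "!!t. y0 <= t ==> be <= t powr (1 + N') * f t * F t * exp (- 2 * al0 * t powr N')"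
  using ev unfolding eventually_at_top_linorder by blast
 define X0 where "X0 = ka * (b0 + N) / al0"
 have X0: "0 < X0" unfolding X0_def using kappa_pos b0 N_ge alpha0 by simp
 have mX: "mstar = X0 ^ (?n - 1) / N" by (simp add: mstar_def X0_def)
 define g where "g = (b0 + N) * ka"
 define e where "e = 2 * (b0 + N) * rh powr L / ((N - 1) * L)"
 define W0 where "W0 = (c * om / (b0 + N))^2 * (rh powr (2 * (b0 + N)) * exp (- e))"
 \<comment> \<open>P > X0^N is the condition be > \<open>thr c rh\<close> rewritten. The factor T
   from the logarithm cancels the T in y^N' = X T, and this cancellation accounts for the borderline
   exponent 1 + N' in (f5).\<close>
 define P where "P = ?c * ka * W0 * be"
 have W0: "0 < W0" unfolding W0_def using c w_facts b0 N_ge rh by simp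
 have thr0: "0 < thr c rh" unfolding thr_def using c w_facts b0 N_ge rh alpha0 C_N_pos by (intro mult_pos_pos divide_pos_pos) auto
 have P: "X0 ^ ?n < P"
 proof -
  have "?c * ka * W0 * thr c rh = X0 ^ ?n"
  proof -
   have k: "ka ^ (?n - 1) = om * A0"
   proof -
    have "ka ^ (?n - 1) = (om * A0) powr (real (?n - 1) * iN)"
     unfolding ka_def using w_facts by (intro powr_power) auto
    also have "real (?n - 1) * iN = 1" unfolding N_facts(4) using N_ge by simp
    finally show ?thesis using w_facts by simp
   qed
   have bN: "b0 + N ~= 0" using b0 N_ge by simp
   have nz: "rh powr (2 * (b0 + N)) ~= 0" "c ~= 0" "om ~= 0" "al0 ~= 0" "?c ~= 0" using rh c w_facts alpha0 C_N_pos by auto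
   have alg: "D * k * ((c' * w / B)^2 * (R * x)) * (a0 / w * (B ^ (n + 2) / (al * D * c'^2 * R)) * y) = k * (w * a0) * B ^ n / al * (x * y)"
    if "B ~= 0" "R ~= 0" "c' ~= 0" "w ~= 0" "D ~= 0" for D k c' w B R x a0 al y :: real and n :: nat
   proof -
    have "D * k * ((c' * w / B)^2 * (R * x)) * (a0 / w * (B ^ (n + 2) / (al * D * c'^2 * R)) * y)
     = k * a0 * (x * y) * (D / D) * (R / R) * (c'^2 / c'^2) * (w^2 / w) * (B ^ (n + 2) / B^2) / al"
     by (simp add: power_divide power_mult_distrib mult_ac)
    also have "B ^ (n + 2) / B^2 = B ^ n" using that by (simp add: power_add power2_eq_square)
    also have "w^2 / w = w" using that by (simp add: power2_eq_square)
    finally show ?thesis using that by (simp add: mult_ac)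
   qed
   have "?c * ka * W0 * thr c rh = ka * (om * A0) * (b0 + N) ^ ?n / al0 ^ ?n * (exp (- e) * exp e)"
    unfolding W0_def thr_def e_def[symmetric] by (rule alg) (use bN nz in auto)
   also have "exp (- e) * exp e = 1" by (simp add: exp_minus)
   also have "ka * (om * A0) * (b0 + N) ^ ?n / al0 ^ ?n * 1 = X0 ^ ?n"
    unfolding X0_def k[symmetric] by (simp add: power_divide power_mult_distrib power_eq_if[of ka ?n])
   finally show ?thesis .
  qed
  moreover have "?c * ka * W0 * thr c rh < ?c * ka * W0 * be"
   using be W0 C_N_pos kappa_pos by (intro mult_strict_left_mono) auto
  ultimately show ?thesis by (simp add: P_def)
 qed
 \<comment> \<open>The first entry makes the exponential dominate; the second puts y = s T^(1/N')
   beyond y0, where the bound from (f5) holds.\<close>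
 define T0 where "T0 = Max {N / (2 * al0 * X0), (abs y0 + 1) powr N' / X0, 0}"
 show ?thesis
 proof (intro exI[of _ T0] allI impI)
  fix T assume "T0 < T" "0 < T"
  hence T: "N / (2 * al0 * X0) < T" "(abs y0 + 1) powr N' / X0 < T" "0 < T" by (auto simp: T0_def)
  define T1 where "T1 = T powr (1 / N')"
  have T1: "0 < T1" "T1 powr N' = T" using T N'0 by (auto simp: T1_def powr_powr)
  define rs where "rs = rstar rh T"
  define D where "D = ?c * (ln (1 / (2 * rs)) * (c * om * rs powr (b0 + N) / (b0 + N))^2)"
  have rs: "0 < rs" using rh by (simp add: rs_def rstar_def)
  have lnrs: "ka * T <= ln (1 / (2 * rs))"
  proof -
   have "ln (1 / (2 * rs)) = ln (1 / (2 * rh)) + (rh powr L / ((N - 1) * L) + ka * T)"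
    using rh rs by (simp add: rs_def rstar_def ln_div ln_mult)
   moreover have "0 <= ln (1 / (2 * rh))" using rh by (intro ln_ge_zero) (simp add: field_simps)
   moreover have "0 <= rh powr L / ((N - 1) * L)" using N_ge w_facts by simp
   ultimately show ?thesis by linarith
  qed
  have kT: "0 < ka * T" using kappa_pos T by simp
  have W: "(c * om * rs powr (b0 + N) / (b0 + N))^2 = W0 * exp (- (2 * g * T))"
  proof -
   have "(rs powr (b0 + N))^2 = rs powr (2 * (b0 + N))" using rs by (simp add: powr_power)
   also have "... = rh powr (2 * (b0 + N)) * exp (- e - 2 * g * T)"
    unfolding rs_def rstar_def e_def g_def using rh by (simp add: powr_mult) (simp add: powr_def algebra_simps)
   also have "exp (- e - 2 * g * T) =
    exp (- e) * exp (- (2 * g * T))" by (simp add: exp_add[symmetric])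
   finally show ?thesis unfolding W0_def by (simp add: power_mult_distrib power_divide)
  qed
  have Wpos: "0 < (c * om * rs powr (b0 + N) / (b0 + N))^2" unfolding W using W0 by simp
  have D: "0 < D" unfolding D_def using C_N_pos lnrs kT Wpos by (intro mult_pos_pos) auto
  have DW: "?c * (ka * T * (W0 * exp (- (2 * g * T)))) <= D"
   unfolding D_def W using lnrs C_N_pos W0 by (intro mult_left_mono mult_right_mono) auto
  have levD: "lev c rh T s = s ^ ?n / N - D / 2 * (F (s * T1))^2" for s
   by (simp add: lev_def D_def rs_def T1_def)
  have dlev: "(lev c rh T hasd s ^ (?n - 1) - D * (F (s * T1) * f (s * T1) * T1)) (at s)" for s
  proof -
   have "((%s. F (s * T1)) hasd f (s * T1) * T1) (at s)"
    by (rule DERIV_chain2[OF F_deriv]) (auto intro!: derivative_eq_intros)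
   hence "((%s. s ^ ?n / N - D / 2 * (F (s * T1))^2) hasd
     (N * s ^ (?n - 1)) / N - D / 2 * (2 * (F (s * T1) * (f (s * T1) * T1)))) (at s)"
    by (intro DERIV_diff DERIV_cdivide DERIV_cmult) (auto intro!: derivative_eq_intros simp: N_def)
   thus ?thesis using N_ge unfolding levD by (simp add: mult_ac)
  qed
  have lc: "continuous_on S (lev c rh T)" for S
   by (rule DERIV_continuous_on[OF has_field_derivative_at_within[OF dlev]])
  obtain s1 where s1: "0 < s1" "!!s. s1 <= s ==> lev c rh T s < 0"
  proof -
   have "filterlim (%s. s * T1) at_top at_top" using T1 by (intro filterlim_at_top_mult_tendsto_pos[OF tendsto_const _ filterlim_ident]) auto
   from eventually_compose_filterlim[OF F_superpower[of ?n] this]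
   obtain s2 where s2: "!!s. s2 <= s ==> (s * T1) ^ ?n <= F (s * T1)" unfolding eventually_at_top_linorder by blast
   define s1 where "s1 = Max {s2, 1, 2 / (D * T1 ^ (2 * ?n))} + 1"
   have s1: "s2 <= s1" "1 <= s1" "2 / (D * T1 ^ (2 * ?n)) < s1" by (auto simp: s1_def)
   show ?thesis
   proof (rule that[of s1])
    fix s assume s: "s1 <= s"
    have s': "1 <= s" "2 / (D * T1 ^ (2 * ?n)) < s" using s s1 by auto
    have "s ^ ?n / N <= s ^ ?n * 1" using N_ge s' by (simp add: divide_le_eq mult_le_cancel_left1)
    also have "... < s ^ ?n * (D / 2 * T1 ^ (2 * ?n) * s ^ ?n)"
    proof (rule mult_strict_left_mono)
     have "1 < D / 2 * T1 ^ (2 * ?n) * s" using s'(2) D T1 by (simp add: divide_less_eq mult_ac)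
     also have "... <= D / 2 * T1 ^ (2 * ?n) * s ^ ?n" using s' D T1 by (intro mult_left_mono self_le_power) auto
     finally show "1 < D / 2 * T1 ^ (2 * ?n) * s ^ ?n" .
    qed (use s' in simp)
    also have "... = D / 2 * ((s * T1) ^ ?n)^2" by (simp add: power_mult_distrib power2_eq_square power_mult mult_ac)
    also have "... <= D / 2 * (F (s * T1))^2" using s2[of s] s s1 D T1 by (intro mult_left_mono power_mono) auto
    finally show "lev c rh T s < 0" unfolding levD by simp
   qed (use s1 in simp)
  qed
  have "lev c rh T s < mstar" if s: "0 < s" and d0: "s ^ (?n - 1) - D * (F (s * T1) * f (s * T1) * T1) = 0" for s
  proof -
   define X where "X = s powr N'"
   have X: "0 < X" using s by (simp add: X_def)
   have "X < X0"
   proof (rule ccontr)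
    assume "~ X < X0"
    hence XX: "X0 <= X" by simp
    define y where "y = s * T1"
    have y: "0 < y" "y powr N' = X * T" using s T1 by (auto simp: y_def X_def powr_mult)
    have "(abs y0 + 1) powr N' <= X0 * T" using T X0 by (simp add: divide_less_eq mult.commute)
    also have "... <= y powr N'" unfolding y(2) using XX T by (intro mult_right_mono) auto
    finally have "abs y0 + 1 <= y" using N'0 y powr_mono2[of N' y "abs y0 + 1"] powr_less_mono2[of N' y "abs y0 + 1"] by force
    hence "y0 <= y" by linarith
    note y0[OF this]
    hence "be * (y powr (- N') * exp (2 * al0 * y powr N')) <= (y powr (1 + N') * f y * F y * exp (- 2 * al0 * y powr N')) * (y powr (- N') * exp (2 * al0 * y powr N'))"
     by (intro mult_right_mono) auto
    also have "... = (y powr (1 + N') * y powr (- N')) * (exp (- 2 * al0 * y powr N') * exp (2 * al0 * y powr N')) * (f y * F y)" by (simp add: mult_ac)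
    also have "... = y * (f y * F y)" using y(1) by (simp add: powr_add[symmetric] exp_add[symmetric])
    finally have Ff: "be * (exp (2 * al0 * (X * T)) / (X * T)) <= y * (f y * F y)" using y by (simp add: powr_minus_divide mult.commute)
    have "X ^ (?n - 1) = s ^ ?n" using powr_pow_N[of s] s by (simp add: X_def)
    also have "... = s * s ^ (?n - 1)" by (simp add: power_eq_if)
    also have "... = D * (y * (f y * F y))" using d0 by (simp add: y_def mult_ac)
    finally have "X ^ (?n - 1) >= ?c * (ka * T * (W0 * exp (- (2 * g * T)))) * (be * (exp (2 * al0 * (X * T)) / (X * T)))"
     using mult_mono[OF DW Ff] D thr0 be X T by (simp only: mult_nonneg_nonneg divide_nonneg_nonneg less_imp_le exp_ge_zero mult.commute)
    hence "X * X ^ (?n - 1) >= X * (?c * (ka * T * (W0 * exp (- (2 * g * T)))) * (be * (exp (2 * al0 * (X * T)) / (X * T))))"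
     using X by (intro mult_left_mono) auto
    also have "X * (?c * (ka * T * (W0 * exp (- (2 * g * T)))) * (be * (exp (2 * al0 * (X * T)) / (X * T))))
      = P * (exp (- (2 * g * T)) * exp (2 * al0 * (X * T)))" using X T by (simp add: P_def)
    also have "exp (- (2 * g * T)) * exp (2 * al0 * (X * T)) = exp (2 * T * al0 * (X - X0))"
    proof -
     have "al0 * X0 = g" using alpha0 by (simp add: X0_def g_def)
     hence "2 * g * T = 2 * T * (al0 * X0)" by simp
     hence "- (2 * g * T) + 2 * al0 * (X * T) = 2 * T * al0 * (X - X0)" by (simp only: algebra_simps)
     thus ?thesis unfolding exp_add[symmetric] by simp
    qed
    finally have 1: "P * exp (2 * T * al0 * (X - X0)) <= X ^ ?n" by (simp add: power_eq_if[of X ?n])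
    have "X = X0 * (1 + (X - X0) / X0)" using X0 by (simp add: field_simps)
    also have "... <= X0 * exp ((X - X0) / X0)" using X0 exp_ge_add_one_self[of "(X - X0) / X0"] by (intro mult_left_mono) auto
    finally have "X ^ ?n <= (X0 * exp ((X - X0) / X0)) ^ ?n" using X by (intro power_mono) auto
    also have "... = X0 ^ ?n * exp (N * ((X - X0) / X0))" by (simp add: power_mult_distrib exp_of_nat_mult[symmetric] N_def)
    also have "... <= X0 ^ ?n * exp (2 * T * al0 * (X - X0))"
    proof (intro mult_left_mono iffD2[OF exp_le_cancel_iff])
     have "N / X0 <= 2 * T * al0" using T(1) X0 alpha0 by (simp add: field_simps)
     hence "N / X0 * (X - X0) <= 2 * T * al0 * (X - X0)" using XX by (intro mult_right_mono) auto
     thus "N * ((X - X0) / X0) <= 2 * T * al0 * (X - X0)" by simp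
    qed (use X0 in simp)
    also have "... < P * exp (2 * T * al0 * (X - X0))" using P by (intro mult_strict_right_mono) auto
    finally show False using 1 by simp
   qed
   hence "X ^ (?n - 1) < X0 ^ (?n - 1)" using X N2 by (intro power_strict_mono) auto
   hence "s ^ ?n < X0 ^ (?n - 1)" using powr_pow_N[of s] s by (simp add: X_def)
   hence "s ^ ?n / N < mstar" unfolding mX using N_ge by (intro divide_strict_right_mono) auto
   moreover have "0 <= D / 2 * (F (s * T1))^2" using D by simp
   ultimately show ?thesis unfolding levD by linarith
  qed note crit = this
  obtain sm where sm: "sm : {0..s1}" "!!s. s : {0..s1} ==> lev c rh T s <= lev c rh T sm"
   using continuous_attains_sup[OF compact_Icc _ lc, of 0 s1] s1(1) by auto
  have l0: "lev c rh T 0 = 0" unfolding levD using N2 F_zero[of 0] by (simp add: power_0_left)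
  have smlt: "lev c rh T sm < mstar"
  proof (cases "lev c rh T sm <= 0")
   case True thus ?thesis using mstar_pos by simp
  next
   case False
   have "sm ~= 0" using False l0 by auto
   moreover have "sm ~= s1" using False s1(2)[of s1] by auto
   ultimately have si: "0 < sm" "sm < s1" using sm(1) by auto
   have "sm ^ (?n - 1) - D * (F (sm * T1) * f (sm * T1) * T1) = 0"
   proof (rule DERIV_local_max[OF dlev])
    show "0 < min sm (s1 - sm)" using si by simp
    show "ALL y. abs (sm - y) < min sm (s1 - sm) --> lev c rh T y <= lev c rh T sm" by (auto intro!: sm(2) simp: abs_less_iff)
   qed
   from crit[OF si(1) this] show ?thesis .
  qed
  define m where "m = max (lev c rh T sm) (mstar / 2)"
  have "lev c rh T s <= m" if "0 <= s" for s
  proof (cases "s <= s1")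
   case True thus ?thesis using sm(2)[of s] that by (simp add: m_def)
  next
   case False thus ?thesis using s1(2)[of s] mstar_pos by (simp add: m_def)
  qed
  thus "(EX m. 0 < m & m < mstar & (ALL s>=0. lev c rh T s <= m)) & (EX s1>0. ALL s>=s1. lev c rh T s < 0)"
   using smlt mstar_pos s1 by (intro conjI exI[of _ m] exI[of _ s1]) (auto simp: m_def)
 qed
qed

end

section \<open>The discretised functional and its gradient\<close>

lemma abs_power_deriv:
 assumes "2 <= n"
 shows "((%x::real. abs x ^ n) hasd real n * (x * abs x ^ (n - 2))) (at x)"
proof -
 have n: "n = Suc (Suc (n - 2))" using assms by simp
 have n1: "y ^ (n - Suc 0) = y * y ^ (n - 2)" for y :: real
 proof -
  have "n - Suc 0 = Suc (n - 2)" using assms by simp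
  thus ?thesis by simp
 qed
 consider "0 < x" | "x < 0" | "x = 0" by linarith
 thus ?thesis
 proof cases
  case 1
  have "((%x::real. x ^ n) hasd real n * (x * abs x ^ (n - 2))) (at x)"
   using 1 n1 by (auto intro!: derivative_eq_intros)
  thus ?thesis
   by (rule has_field_derivative_transform_within_open[of _ _ _ "{0<..}"]) (use 1 in auto)
 next
  case 2
  have "((%x::real. (- x) ^ n) hasd real n * (x * abs x ^ (n - 2))) (at x)"
   using 2 n1[of "- x"] by (auto intro!: derivative_eq_intros)
  thus ?thesis
   by (rule has_field_derivative_transform_within_open[of _ _ _ "{..<0}"]) (use 2 in auto)
 next
  case 3
  have "((%h::real. h * abs h ^ (n - 2)) \<longlongrightarrow> 0 * abs 0 ^ (n - 2)) (at 0)" by (intro tendsto_intros)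
  moreover have "(abs (0 + h) ^ n - abs 0 ^ n) / h = h * abs h ^ (n - 2)" for h :: real
  proof -
   have "abs h ^ n = h * h * abs h ^ (n - 2)" by (subst n) simp
   thus ?thesis using assms by (simp add: power_0_left)
  qed
  ultimately show ?thesis unfolding 3 DERIV_def by simp
 qed
qed

text \<open>Telescoping and the power mean inequality: the discrete form of |w(t) - w(s)|^m <= |t -
  s|^(m-1) times the integral of |w'|^m.\<close>

lemma discrete_hoelder:
 fixes w :: "nat => real"
 assumes "0 < dl" "k <= i" "i <= n" "0 < m"
 shows "abs (w i - w k) ^ m <= (dl * real (i - k)) ^ (m - 1) * (dl * (SUM j:{1..n}. abs ((w j - w (j - 1)) / dl) ^ m))"
proof -
 have "w i - w k = (SUM j:{Suc k..i}. w j - w (j - 1))"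
  by (rule sum_telescope''[OF assms(2), symmetric])
 hence "abs (w i - w k) <= (SUM j:{Suc k..i}. abs (w j - w (j - 1)))" by (simp add: sum_abs)
 hence "abs (w i - w k) ^ m <= (SUM j:{Suc k..i}. abs (w j - w (j - 1))) ^ m" by (intro power_mono) auto
 also have "... <= real (card {Suc k..i}) ^ (m - 1) * (SUM j:{Suc k..i}. abs (w j - w (j - 1)) ^ m)"
  using assms by (intro sum_power_le_power_mean) auto
 also have "... <= real (i - k) ^ (m - 1) * (SUM j:{1..n}. abs (w j - w (j - 1)) ^ m)"
  using assms by (auto intro!: mult_left_mono sum_mono2)
 also have "(SUM j:{1..n}. abs (w j - w (j - 1)) ^ m) = dl ^ m * (SUM j:{1..n}. abs ((w j - w (j - 1)) / dl) ^ m)"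
  using assms by (simp add: sum_distrib_left power_divide)
 also have "dl ^ m = dl ^ (m - 1) * dl" using assms by (simp add: power_eq_if)
 finally show ?thesis by (simp add: power_mult_distrib mult_ac)
qed

context choquard
begin

definition Phi :: "real => real" where "Phi x = x * abs x ^ (CARD('n) - 2)"

lemma Phi_mult: "Phi x * x = abs x ^ CARD('n)"
proof -
 have "CARD('n) = Suc (Suc (CARD('n) - 2))" using N2 by simp
 hence "abs x ^ CARD('n) = abs x * abs x * abs x ^ (CARD('n) - 2)" by (metis power_Suc mult.assoc)
 thus ?thesis by (simp add: Phi_def abs_mult[symmetric])
qed

lemma Phi_cont: "continuous_on S Phi" unfolding Phi_def by (intro continuous_intros)

text \<open>\<open>US dl d i\<close> is the value at \<open>i dl\<close> of the profile with slope \<open>d j\<close> on the \<open>j\<close>-th cell of a grid of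
 width \<open>dl\<close> in the variable \<open>tt\<close>.\<close>
definition US :: "real => (nat => real) => nat => real" where "US dl d i = dl * (SUM j:{1..i}. d j)"

definition EE :: "real => nat => (nat => real) => real" where "EE dl n d = dl * (SUM j:{1..n}. abs (d j) ^ CARD('n))"

definition BB :: "real => nat => (nat => nat => real) => (nat => real) => real" where
 "BB dl n K d = (SUM i:{1..n}. SUM m:{1..n}. K i m * (F (US dl d i) * F (US dl d m)))"

definition JJ :: "real => nat => (nat => nat => real) => (nat => real) => real" where
 "JJ dl n K d = EE dl n d / N - C_N CARD('n) / 2 * BB dl n K d"

definition VV :: "real => nat => (nat => nat => real) => (nat => real) => nat => real" where
 "VV dl n K d i = (SUM m:{1..n}. K i m * F (US dl d m))"

text \<open>The partial derivative of \<open>JJ\<close> in the slope d j. This slope enters all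
  values from index j on, hence the sum over i >= j: a discrete flux.\<close>

definition gg :: "real => nat => (nat => nat => real) => (nat => real) => nat => real" where
 "gg dl n K d j = dl * Phi (d j) - C_N CARD('n) * dl * (SUM i:{j..n}. f (US dl d i) * VV dl n K d i)"

lemma US_0: "US dl d 0 = 0" by (simp add: US_def)

lemma US_Suc: "1 <= j ==> US dl d j = US dl d (j - 1) + dl * d j"
 by (cases j) (auto simp: US_def distrib_left)

lemma US_lin: "US dl (%i. u i + s * q i) i = US dl u i + s * US dl q i"
 by (simp add: US_def sum.distrib sum_distrib_left[symmetric] algebra_simps)

lemma BB_alt: "BB dl n K d = (SUM i:{1..n}. F (US dl d i) * VV dl n K d i)"
 unfolding BB_def VV_def by (simp add: sum_distrib_left mult_ac)

text \<open>Summation by parts: exchanging the sums collects the increments h j into the values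
  \<open>US dl h i\<close>.\<close>

lemma gg_pairing:
 "(SUM j:{1..n}. gg dl n K d j * h j) =
   dl * (SUM j:{1..n}. Phi (d j) * h j) - C_N CARD('n) * (SUM i:{1..n}. f (US dl d i) * VV dl n K d i * US dl h i)"
proof -
 define a where "a i = f (US dl d i) * VV dl n K d i" for i
 have "(SUM j:{1..n}. SUM i:{j..n}. a i * h j) = (SUM j:{1..n}. SUM i:{i\<in>{1..n}. j <= i}. a i * h j)"
  by (intro sum.cong refl) auto
 also have "... = (SUM i:{1..n}. SUM j:{j\<in>{1..n}. j <= i}. a i * h j)" by (rule sum.swap_restrict) auto
 also have "... = (SUM i:{1..n}. SUM j:{1..i}. a i * h j)" by (intro sum.cong refl) auto
 finally have "dl * (SUM j:{1..n}. SUM i:{j..n}. a i * h j) = (SUM i:{1..n}. a i * US dl h i)"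
  by (simp add: US_def sum_distrib_left mult_ac)
 moreover have "(SUM j:{1..n}. gg dl n K d j * h j) =
   dl * (SUM j:{1..n}. Phi (d j) * h j) - C_N CARD('n) * (dl * (SUM j:{1..n}. SUM i:{j..n}. a i * h j))"
 proof -
  have "gg dl n K d j * h j = dl * (Phi (d j) * h j) - C_N CARD('n) * (dl * (SUM i:{j..n}. a i * h j))" for j
   unfolding gg_def a_def[symmetric] sum_distrib_right[symmetric] by (simp add: algebra_simps)
  thus ?thesis by (simp only: sum_subtractf sum_distrib_left[symmetric])
 qed
 ultimately show ?thesis unfolding a_def by simp
qed

lemma JJ_deriv:
 assumes "!!i m. K i m = K m i"
 shows "((%s. JJ dl n K (%i. u i + s * q i)) hasd
   (SUM j:{1..n}. gg dl n K (%i. u i + s * q i) j * q j)) (at s)"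
proof -
 let ?v = "%s i. u i + s * q i" and ?U = "%s. US dl (%i. u i + s * q i)"
 have dU: "((%s. F (?U s i)) hasd f (?U s i) * US dl q i) (at s)" for i
  unfolding US_lin by (rule DERIV_chain2[OF F_deriv]) (auto intro!: derivative_eq_intros)
 have dE: "((%s. EE dl n (?v s) / N) hasd (dl * (SUM j:{1..n}. Phi (?v s j) * q j))) (at s)"
 proof -
  have d1: "((%s. abs (?v s j) ^ CARD('n)) hasd (N * Phi (?v s j) * q j)) (at s)" for j
   unfolding Phi_def N_def by (rule DERIV_chain2[OF abs_power_deriv[OF N2]]) (auto intro!: derivative_eq_intros)
  have "((%s. EE dl n (?v s) / N) hasd (dl * (SUM j:{1..n}. N * Phi (?v s j) * q j)) / N) (at s)"
   unfolding EE_def by (intro DERIV_cdivide DERIV_cmult DERIV_sum d1)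
  also have "(dl * (SUM j:{1..n}. N * Phi (?v s j) * q j)) / N = dl * (SUM j:{1..n}. Phi (?v s j) * q j)"
   using N_ge by (simp add: sum_distrib_left[symmetric] mult.assoc)
  finally show ?thesis .
 qed
 have dB: "((%s. BB dl n K (?v s)) hasd 2 * (SUM i:{1..n}. f (?U s i) * VV dl n K (?v s) i * US dl q i)) (at s)"
 proof -
  let ?a = "%i m. K i m * (f (?U s i) * US dl q i * F (?U s m))"
  have "((%s. BB dl n K (?v s)) hasd
    (SUM i:{1..n}. SUM m:{1..n}. K i m * (f (?U s i) * US dl q i * F (?U s m) + f (?U s m) * US dl q m * F (?U s i)))) (at s)"
   unfolding BB_def by (intro DERIV_sum DERIV_cmult DERIV_mult dU)
  also have "(SUM i:{1..n}. SUM m:{1..n}. K i m * (f (?U s i) * US dl q i * F (?U s m) + f (?U s m) * US dl q m * F (?U s i)))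
    = (SUM i:{1..n}. SUM m:{1..n}. ?a i m) + (SUM i:{1..n}. SUM m:{1..n}. ?a m i)"
   using assms by (simp add: distrib_left sum.distrib)
  also have "(SUM i:{1..n}. SUM m:{1..n}. ?a m i) = (SUM i:{1..n}. SUM m:{1..n}. ?a i m)" by (rule sum.swap)
  also have "(SUM i:{1..n}. SUM m:{1..n}. ?a i m) + (SUM i:{1..n}. SUM m:{1..n}. ?a i m)
    = 2 * (SUM i:{1..n}. f (?U s i) * VV dl n K (?v s) i * US dl q i)"
   unfolding VV_def by (simp add: sum_distrib_left sum_distrib_right mult_ac)
  finally show ?thesis .
 qed
 show ?thesis unfolding JJ_def gg_pairing using DERIV_diff[OF dE DERIV_cmult[OF dB, of "C_N CARD('n) / 2"]] by simp
qed

lemma f_cont: "continuous_on S f" using fc continuous_on_subset by blast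

lemma US_cont: "continuous_on UNIV (%d. US dl d i)"
 unfolding US_def by (intro continuous_intros continuous_on_product_coordinates)

lemma EE_cont: "continuous_on UNIV (EE dl n)"
 unfolding EE_def by (intro continuous_intros continuous_on_product_coordinates)

lemma F_US_cont: "continuous_on UNIV (%d. F (US dl d i))" "continuous_on UNIV (%d. f (US dl d i))"
 by (rule continuous_on_compose2[OF F_cont US_cont] continuous_on_compose2[OF f_cont[of UNIV] US_cont], simp)+

lemma JJ_cont: "continuous_on UNIV (JJ dl n K)"
 unfolding JJ_def BB_def using N_ge by (intro continuous_intros F_US_cont EE_cont) auto

lemma gg_cont: "continuous_on UNIV (%d. gg dl n K d j)"
 unfolding gg_def VV_def
 by (intro continuous_intros F_US_cont continuous_on_compose2[OF Phi_cont[of UNIV] continuous_on_product_coordinates]) auto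

text \<open>Since Phi is odd, x <= y may be assumed. Let W be the part of the slope d that lies
  above T. Then \<open>ps\<close> has slope at most (2/N)(d - W) + e W, because 1 - ta < 2/N. The
  constant 2/N is exactly what cancels the terms in d - W; what remains is (1/N - e/2) Phi(d) W >=
  (1/N - e/2) W^N.\<close>

lemma test_pointwise:
 assumes e: "e <= 2 / N" "!!x y. T <= x ==> x <= y ==> ps y - ps x <= e * (y - x)"
  and dl: "0 < dl" and d: "d = (y - x) / dl"
 shows "(1 / N - e / 2) * abs ((max T y - max T x) / dl) ^ CARD('n) <= abs d ^ CARD('n) / N - Phi d * ((ps y - ps x) / dl) / 2"
 using d
proof (induction x y arbitrary: d rule: linorder_wlog)
 let ?n = "CARD('n)"
 case (sym x y)
 have "(1 / N - e / 2) * abs ((max T x - max T y) / dl) ^ ?n <= abs (- d) ^ ?n / N - Phi (- d) * ((ps x - ps y) / dl) / 2"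
  using sym(2) by (intro sym(1)) (simp add: diff_divide_distrib)
 moreover have "Phi (- d) * ((ps x - ps y) / dl) = Phi d * ((ps y - ps x) / dl)"
  by (simp add: Phi_def diff_divide_distrib right_diff_distrib)
 moreover have "abs ((max T y - max T x) / dl) = abs ((max T x - max T y) / dl)" by (simp add: abs_minus_commute)
 ultimately show ?case by (simp only: abs_minus_cancel)
next
 let ?n = "CARD('n)"
 case (le x y)
 define W where "W = (max T y - max T x) / dl"
 have dW: "0 <= W" "W <= d" "0 <= d"
  unfolding W_def le(2) using le(1) dl by (auto intro!: divide_right_mono divide_nonneg_nonneg)
 have "ps y - ps x <= 2 / N * (dl * (d - W)) + e * (dl * W)"
 proof -
  define z where "z = max x (min T y)"
  have z: "x <= z" "z <= y" "dl * W = y - z" "dl * (d - W) = z - x"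
  proof -
   have "dl * W = max T y - max T x" "dl * d = y - x" using dl by (auto simp: W_def le(2))
   thus "x <= z" "z <= y" "dl * W = y - z" "dl * (d - W) = z - x"
    using le(1) unfolding right_diff_distrib by (auto simp: z_def max_def min_def)
  qed
  have "ps z - ps x <= (1 - ta) * (z - x)" by (rule psi_diff[OF z(1)])
  moreover have "(1 - ta) * (z - x) <= 2 / N * (z - x)" using tau(1) z by (intro mult_right_mono) auto
  moreover have "ps y - ps z <= e * (y - z)"
  proof (cases "y <= T")
   case True
   thus ?thesis using le(1) by (simp add: z_def)
  next
   case False
   thus ?thesis using z by (intro e) (auto simp: z_def)
  qed
  ultimately show ?thesis unfolding z(3,4) by linarith
 qed
 also have "c * (dl * a) + e * (dl * w) = (c * a + e * w) * dl" for c a w by (simp add: algebra_simps)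
 finally have "(ps y - ps x) / dl <= 2 / N * (d - W) + e * W" unfolding pos_divide_le_eq[OF dl] .
 moreover have "0 <= Phi d" using dW by (simp add: Phi_def)
 ultimately have 1: "Phi d * ((ps y - ps x) / dl) <= Phi d * (2 / N * (d - W) + e * W)" by (intro mult_left_mono)
 have "W ^ ?n <= Phi d * W"
 proof -
  have "Phi W <= Phi d" unfolding Phi_def using dW by (intro mult_mono power_mono) auto
  hence "Phi W * W <= Phi d * W" using dW by (intro mult_right_mono) auto
  thus ?thesis using dW by (simp add: Phi_mult)
 qed
 hence 2: "(1 / N - e / 2) * W ^ ?n <= (1 / N - e / 2) * (Phi d * W)" using e by (intro mult_left_mono) auto
 have "P * d * i - P * (2 * i * (d - W) + e * W) / 2 = (i - e / 2) * (P * W)" for P i :: real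
  by (simp add: algebra_simps add_divide_distrib diff_divide_distrib)
 from this[of "Phi d" "1 / N"]
 have "abs d ^ ?n / N - Phi d * (2 / N * (d - W) + e * W) / 2 = (1 / N - e / 2) * (Phi d * W)"
  unfolding Phi_mult[symmetric] by (simp only: times_divide_eq_right times_divide_eq_left mult_1_right)
 moreover have "a - y / 2 <= a - x / 2" if "x <= y" for a x y :: real using that by simp
 note this[OF 1, of "abs d ^ ?n / N"]
 ultimately show ?case using 2 unfolding W_def[symmetric] abs_of_nonneg[OF dW(1)] by (simp only:)
qed

text \<open>The gradient is paired with the slopes of \<open>ps\<close> composed with the profile.
  As f ps = F, the nonlocal part of the pairing is C_N \<open>BB\<close>, so subtracting half of the
  pairing from \<open>JJ\<close> removes the nonlocal term.\<close>

lemma test_energy: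
 assumes e: "e <= 2 / N" "!!x y. T <= x ==> x <= y ==> ps y - ps x <= e * (y - x)"
  and dl: "0 < dl" and g: "!!j. j : {1..n} ==> abs (gg dl n K d j) <= ep" and ep: "0 <= ep"
 shows "(1 / N - e / 2) * (dl * (SUM j:{1..n}. abs ((max T (US dl d j) - max T (US dl d (j - 1))) / dl) ^ CARD('n)))
   <= JJ dl n K d + ep * real n * (SUM j:{1..n}. abs (d j))"
proof -
 define h where "h j = (ps (US dl d j) - ps (US dl d (j - 1))) / dl" for j
 define S where "S = (SUM j:{1..n}. abs (d j))"
 have Uh: "US dl h i = ps (US dl d i)" for i
 proof (induction i)
  case (Suc i)
  have "US dl h (Suc i) = US dl h i + dl * h (Suc i)" using US_Suc[of "Suc i" dl h] by simp
  also have "dl * h (Suc i) = ps (US dl d (Suc i)) - ps (US dl d i)" using dl by (simp add: h_def)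
  finally show ?case using Suc by simp
 qed (simp add: US_0 psi_bounds)
 have U: "abs (US dl d i) <= dl * S" if "i <= n" for i
 proof -
  have "abs (SUM j:{1..i}. d j) <= (SUM j:{1..i}. abs (d j))" by (rule sum_abs)
  also have "... <= S" unfolding S_def using that by (intro sum_mono2) auto
  finally show ?thesis using dl by (simp add: US_def abs_mult)
 qed
 have hS: "abs (h j) <= S" if "j : {1..n}" for j
 proof -
  have "0 <= ps (US dl d i) & ps (US dl d i) <= dl * S" if "i <= n" for i
   using psi_bounds(1,2)[of "US dl d i"] U[OF that] by auto
  from this[of j] this[of "j - 1"] that have "0 <= ps (US dl d j)" "ps (US dl d j) <= dl * S"
   "0 <= ps (US dl d (j - 1))" "ps (US dl d (j - 1)) <= dl * S" by auto
  hence "abs (ps (US dl d j) - ps (US dl d (j - 1))) <= dl * S" by linarith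
  thus ?thesis using dl by (simp add: h_def divide_le_eq mult.commute)
 qed
 have p: "(SUM j:{1..n}. gg dl n K d j * h j) = dl * (SUM j:{1..n}. Phi (d j) * h j) - C_N CARD('n) * BB dl n K d"
  unfolding gg_pairing Uh BB_alt psi_bounds(4)[symmetric] by (simp add: mult_ac)
 have "abs (SUM j:{1..n}. gg dl n K d j * h j) <= (SUM j:{1..n}. ep * S)"
  using g hS ep by (intro order_trans[OF sum_abs] sum_mono) (auto simp: abs_mult intro!: mult_mono)
 hence gh: "abs (SUM j:{1..n}. gg dl n K d j * h j) <= ep * real n * S" by (simp add: mult_ac)
 have "(1 / N - e / 2) * (dl * (SUM j:{1..n}. abs ((max T (US dl d j) - max T (US dl d (j - 1))) / dl) ^ CARD('n)))
  = dl * (SUM j:{1..n}. (1 / N - e / 2) * abs ((max T (US dl d j) - max T (US dl d (j - 1))) / dl) ^ CARD('n))"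
  by (simp add: sum_distrib_left mult_ac)
 also have "... <= dl * (SUM j:{1..n}. abs (d j) ^ CARD('n) / N - Phi (d j) * h j / 2)"
  using dl US_Suc[of _ dl d] unfolding h_def by (intro mult_left_mono sum_mono test_pointwise e) auto
 also have "... = EE dl n d / N - dl * (SUM j:{1..n}. Phi (d j) * h j) / 2"
  by (simp add: EE_def sum_subtractf sum_divide_distrib[symmetric] right_diff_distrib)
 also have "... = JJ dl n K d - (SUM j:{1..n}. gg dl n K d j * h j) / 2"
  unfolding p JJ_def by (simp add: diff_divide_distrib)
 also have "... <= JJ dl n K d + ep * real n * S" using gh by (simp only: abs_le_iff) linarith
 finally show ?thesis unfolding S_def .
qed

text \<open>With T below all values of the profile the truncation changes nothing, and e = 1 - ta is
  admissible for every T.\<close>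

lemma EE_bound:
 assumes dl: "0 < dl" and g: "!!j. j : {1..n} ==> abs (gg dl n K d j) <= ep" and ep: "0 <= ep"
 shows "(1 / N - (1 - ta) / 2) * EE dl n d <= JJ dl n K d + ep * real n * (SUM j:{1..n}. abs (d j))"
proof -
 define T where "T = Min (US dl d ` {0..n})"
 have T: "T <= US dl d i" if "i <= n" for i unfolding T_def using that by (intro Min_le) auto
 have "(SUM j:{1..n}. abs ((max T (US dl d j) - max T (US dl d (j - 1))) / dl) ^ CARD('n)) = (SUM j:{1..n}. abs (d j) ^ CARD('n))"
 proof (intro sum.cong refl)
  fix j assume "j : {1..n}"
  hence "T <= US dl d j" "T <= US dl d (j - 1)" "US dl d j = US dl d (j - 1) + dl * d j"
   using T[of j] T[of "j - 1"] US_Suc[of j dl d] by auto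
  thus "abs ((max T (US dl d j) - max T (US dl d (j - 1))) / dl) ^ CARD('n) = abs (d j) ^ CARD('n)"
   using dl by (simp add: max_absorb2)
 qed
 moreover have "1 - ta <= 2 / N" using tau(1) by simp
 ultimately show ?thesis using test_energy[of "1 - ta" T dl n K d ep, OF _ psi_diff dl g ep] unfolding EE_def by simp
qed

end

section \<open>The logarithmic form on dominated densities\<close>

lemma log_potential_dominated:
 assumes "0 < s1" "s2 < 0" "0 < ep"
 obtains M where "0 <= M"
  "!!h K x. h : BM ==> (!!y::real^'n. abs (h y) <= K * pw s1 s2 y) ==>
    IB (%y. lk x y * h y) &
    (LBINT y. abs (lk x y * h y)) <= K * M * (1 + norm x) powr ep &
    abs (log_conv h x) <= K * M * (1 + norm x) powr ep"
proof -
 obtain M where M: "0 <= M"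
  "!!x::real^'n. IB (%y. abs (lk x y) * pw s1 s2 y)"
  "!!x::real^'n. (LBINT y. abs (lk x y) * pw s1 s2 y) <= M * (1 + norm x) powr ep"
  by (rule log_potential_bound[OF assms]) blast
 show ?thesis
 proof (rule that[OF M(1)])
  fix h :: "real^'n => real" and K and x :: "real^'n"
  assume h[measurable]: "h : BM" and hK: "!!y. abs (h y) <= K * pw s1 s2 y"
  have le: "abs (lk x y * h y) <= K * (abs (lk x y) * pw s1 s2 y)" for y
   using mult_left_mono[OF hK, of "abs (lk x y)" y] by (simp add: abs_mult mult_ac)
  \<comment> \<open>At a unit vector the weight is 1, so the assumed bound forces K >= 0.\<close>
  have "K * pw s1 s2 (axis undefined 1 :: real^'n) >= 0" using hK[of "axis undefined 1"] by linarith
  hence K: "0 <= K" by (simp add: pw_def)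
  have i: "IB (%y. K * (abs (lk x y) * pw s1 s2 y))" by (intro integrable_mult_right M(2))
  have int: "IB (%y. lk x y * h y)"
   by (rule ibound[OF i]) (use le in "auto intro!: AE_I2 order_trans[OF le]")
  have "(LBINT y. abs (lk x y * h y)) <= (LBINT y. K * (abs (lk x y) * pw s1 s2 y))"
   by (intro integral_mono integrable_abs int i le)
  also have "... <= K * (M * (1 + norm x) powr ep)" using K M(3) by (simp add: mult_left_mono)
  finally have b: "(LBINT y. abs (lk x y * h y)) <= K * M * (1 + norm x) powr ep" by (simp add: mult_ac)
  have "abs (log_conv h x) <= (LBINT y. abs (lk x y * h y))"
   unfolding log_conv_lborel[OF h] by (rule integral_abs_bound)
  with int b show "IB (%y. lk x y * h y) &
    (LBINT y. abs (lk x y * h y)) <= K * M * (1 + norm x) powr ep &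
    abs (log_conv h x) <= K * M * (1 + norm x) powr ep" by auto
 qed
qed

text \<open>Half of the decay -s2 pays for the growth of the potential. The double integral then
  converges absolutely, and Fubini's theorem gives the symmetry.\<close>

lemma log_form:
 assumes s: "0 < s1" "s2 < 0"
 obtains M where "0 <= M"
  "!!h1 h2 K1 K2. h1 : BM ==> h2 : BM ==>
    (!!y::real^'n. abs (h1 y) <= K1 * pw s1 s2 y) ==> (!!y. abs (h2 y) <= K2 * pw s1 s2 y) ==>
    IB (%x. log_conv h1 x * h2 x) &
    abs (LBINT x. log_conv h1 x * h2 x) <= K1 * K2 * M &
    (LBINT x. log_conv h1 x * h2 x) = (LBINT x. log_conv h2 x * h1 x)"
proof -
 define e where "e = - s2 / 2"
 have e: "0 < e" "s2 + e < 0" using s by (auto simp: e_def)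
 obtain M where M: "0 <= M"
  "!!h K x. h : BM ==> (!!y::real^'n. abs (h y) <= K * pw s1 s2 y) ==>
    IB (%y. lk x y * h y) &
    (LBINT y. abs (lk x y * h y)) <= K * M * (1 + norm x) powr e &
    abs (log_conv h x) <= K * M * (1 + norm x) powr e"
  by (rule log_potential_dominated[OF s e(1)]) blast
 define I where "I = (LBINT x. pw s1 (s2 + e) (x::real^'n))"
 have pwi: "IB (pw s1 (s2 + e) :: real^'n => real)" by (rule integrable_pw[OF s(1) e(2)])
 show ?thesis
 proof (rule that[of "M * 2 powr e * I"])
  show "0 <= M * 2 powr e * I" using M(1) by (simp add: I_def)
  fix h1 h2 :: "real^'n => real" and K1 K2
  assume [measurable]: "h1 : BM" "h2 : BM"
   and K1: "!!y. abs (h1 y) <= K1 * pw s1 s2 y" and K2: "!!y. abs (h2 y) <= K2 * pw s1 s2 y"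
  let ?C = "K1 * K2 * M * 2 powr e"
  have K0: "0 <= K" if "!!y::real^'n. abs (h y) <= K * pw s1 s2 y" for h K
  proof -
   have "K * pw s1 s2 (axis undefined 1 :: real^'n) >= 0" using that[of "axis undefined 1"] by linarith
   thus ?thesis by (simp add: pw_def)
  qed
  have K: "0 <= K1" "0 <= K2" by (rule K0[OF K1], rule K0[OF K2])
  note M1 = M(2)[of h1 K1, OF _ K1] and M2 = M(2)[of h2 K2, OF _ K2]
  have b: "K1 * M * (1 + norm x) powr e * abs (h2 x) <= ?C * pw s1 (s2 + e) x" for x :: "real^'n"
  proof -
   have "K1 * M * (1 + norm x) powr e * abs (h2 x) <= K1 * M * (1 + norm x) powr e * (K2 * pw s1 s2 x)"
    using K M(1) K2 by (intro mult_left_mono) auto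
   also have "... = (K1 * K2 * M) * ((1 + norm x) powr e * pw s1 s2 x)" by (simp add: mult_ac)
   also have "... <= (K1 * K2 * M) * (2 powr e * pw s1 (s2 + e) x)" using K M(1) e by (intro mult_left_mono pw_mult_powr_le) auto
   finally show ?thesis by (simp add: mult_ac)
  qed
  have le: "abs (log_conv h1 x * h2 x) <= ?C * pw s1 (s2 + e) x" for x
   unfolding abs_mult using M1[of x] by (intro order_trans[OF mult_right_mono b]) auto
  have int: "IB (%x. log_conv h1 x * h2 x)"
  proof (rule ibound[OF integrable_mult_right[OF pwi, of "?C"]])
   show "AE x in lborel. norm (log_conv h1 x * h2 x) <= norm (?C * pw s1 (s2 + e) x)"
    unfolding real_norm_def by (rule AE_I2) (rule order_trans[OF le abs_ge_self])
  qed measurable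
  have "abs (LBINT x. log_conv h1 x * h2 x) <= (LBINT x. abs (log_conv h1 x * h2 x))" by (rule integral_abs_bound)
  also have "... <= (LBINT x. ?C * pw s1 (s2 + e) (x::real^'n))"
   by (intro integral_mono integrable_abs int integrable_mult_right pwi le)
  finally have bd: "abs (LBINT x. log_conv h1 x * h2 x) <= K1 * K2 * (M * 2 powr e * I)" by (simp add: I_def mult_ac)
  let ?P = "%x y. lk x y * h1 y * h2 x"
  have "integrable (lborel \<Otimes>\<^sub>M lborel) (%(x, y). ?P x y)"
  proof (rule lborel_pair.Fubini_integrable)
   show "(%(x, y). ?P x y) : borel_measurable (lborel \<Otimes>\<^sub>M (lborel :: (real^'n) measure))" by measurable
   have eq: "(LBINT y. norm (?P x y)) = (LBINT y. abs (lk x y * h1 y)) * abs (h2 x)" for x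
    by (simp add: abs_mult)
   show "IB (%x. (LBINT y. norm (case (x, y) of (x, y) => ?P x y)))"
    unfolding case_prod_conv eq
   proof (rule ibound[OF integrable_mult_right[OF pwi, of "?C"]])
    show "AE x in lborel. norm ((LBINT y. abs (lk x y * h1 y)) * abs (h2 x)) <= norm (?C * pw s1 (s2 + e) x)"
    proof (rule AE_I2)
     fix x :: "real^'n"
     have "(LBINT y. abs (lk x y * h1 y)) * abs (h2 x) <= ?C * pw s1 (s2 + e) x"
      using M1[of x] by (intro order_trans[OF mult_right_mono b]) auto
     thus "norm ((LBINT y. abs (lk x y * h1 y)) * abs (h2 x)) <= norm (?C * pw s1 (s2 + e) x)"
      using K M(1) by (simp add: abs_mult)
    qed
   qed measurable
   show "AE x in lborel. IB (%y. case (x, y) of (x, y) => ?P x y)"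
    using M1 by (auto intro!: AE_I2 integrable_mult_left)
  qed
  hence "(LBINT y. (LBINT x. ?P x y)) = (LBINT x. (LBINT y. ?P x y))"
   by (rule lborel_pair.Fubini_integral)
  moreover have i1: "(LBINT y. ?P x y) = log_conv h1 x * h2 x" for x by (simp add: log_conv_lborel)
  moreover have "(LBINT x. ?P x y) = log_conv h2 y * h1 y" for y
  proof -
   have "(%x. ?P x y) = (%x. h1 y * (ln (1 / norm (y - x)) * h2 x))"
    by (simp add: fun_eq_iff norm_minus_commute[of _ y])
   thus ?thesis by (simp only: log_conv_lborel[OF \<open>h2 : BM\<close>] integral_mult_right_zero mult.commute)
  qed
  ultimately show "IB (%x. log_conv h1 x * h2 x) &
    abs (LBINT x. log_conv h1 x * h2 x) <= K1 * K2 * (M * 2 powr e * I) &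
    (LBINT x. log_conv h1 x * h2 x) = (LBINT x. log_conv h2 x * h1 x)"
   using int bd by (simp only:)
 qed
qed

section \<open>Step profiles as functions on space\<close>

context choquard
begin

text \<open>Exponents at infinity, shifted by N, in the majorants of Q f(u) (\<open>e1\<close>) and
  of Q F(u) and Q f(u) u (\<open>e2\<close>). While \<open>e2\<close> is negative, \<open>e1\<close>
  exceeds it by l/N and may be positive, so the majorant of Q f(u) need not be integrable at
  infinity.\<close>

definition e1 :: real where "e1 = N + b - l * (p - 1) / N"
definition e2 :: real where "e2 = N + b - l * p / N"

lemma e2_neg: "e2 < 0" using p_facts(2) N_ge by (simp add: e2_def field_simps)

lemma e1_e2: "e1 = e2 + l / N" by (simp add: e1_def e2_def field_simps add_divide_distrib diff_divide_distrib)

text \<open>The value 0 at the origin agrees with that of \<open>pw\<close>, where powers of 0 are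
  0; majorants then hold at every point and not only off the origin.\<close>

definition Q0 :: "real^'n => real" where "Q0 x = (if x = 0 then 0 else Q (norm x))"

lemma Q0_meas [measurable]: "Q0 : BM"
proof -
 have [measurable]: "(%x::real^'n. Q (norm x)) : BM" by (rule borel_measurable_restrict_pos[OF Q_cont])
 show ?thesis unfolding Q0_def by measurable
qed

lemma Q0_nonneg [simp]: "0 <= Q0 x" using Q_pos[of "norm x"] by (auto simp: Q0_def intro: less_imp_le)

lemma theta_pos: "x ~= 0 ==> 0 < th (x::real^'n)" by (simp add: th_def tt_pos)

lemma theta_meas [measurable]: "(th :: real^'n => real) : BM"
 unfolding th_def[abs_def] by (rule borel_measurable_restrict_pos[OF tt_cont])

lemma Q0_maj:
 assumes "0 <= et" "et < ka * (b0 + N)"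
 obtains sg K where "0 < sg" "0 <= K" "!!x. Q0 x * gro et (th x) <= K * pw sg e1 x"
  "!!x. Q0 x * (th x powr (p / N') * exp (et * th x)) <= K * pw sg e2 x"
proof -
 have q: "0 < (p - 1) / N'" "0 < p / N'" using p_facts N_facts(3) by auto
 have e: "N + b - l * ((p - 1) / N') / (N - 1) = e1" "N + b - l * (p / N') / (N - 1) = e2"
  unfolding e1_def e2_def N'_def using N_ge by auto
 obtain s1 K1 where 1: "0 < s1" "0 <= K1" "!!x::real^'n. x ~= 0 ==> Q (norm x) * gro et (th x) <= K1 * pw s1 e1 x"
  using Q_majorant[OF assms q(1)] unfolding e by blast
 obtain s2 K2 where 2: "0 < s2" "0 <= K2" "!!x::real^'n. x ~= 0 ==> Q (norm x) * (th x powr (p / N') * exp (et * th x)) <= K2 * pw s2 e2 x"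
  using Q_majorant[OF assms q(2)] unfolding e by blast
 show ?thesis
 proof (rule that[of "min s1 s2" "max K1 K2"])
  fix x :: "real^'n"
  have "K1 * pw s1 e1 x <= max K1 K2 * pw (min s1 s2) e1 x" "K2 * pw s2 e2 x <= max K1 K2 * pw (min s1 s2) e2 x"
   using 1 2 by (intro mult_mono pw_mono; simp)+
  thus "Q0 x * gro et (th x) <= max K1 K2 * pw (min s1 s2) e1 x"
   "Q0 x * (th x powr (p / N') * exp (et * th x)) <= max K1 K2 * pw (min s1 s2) e2 x"
   using 1(2) 1(3)[of x] 2(3)[of x] by (auto simp: Q0_def pw_nonneg intro!: mult_nonneg_nonneg max.coboundedI1)
 qed (use 1 2 in auto)
qed

text \<open>F(v) <= v f(v) for v > 0, and the factor v <= B tz^(1/N') raises the power (p-1)/N' to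
  p/N'.\<close>

lemma F_majorant:
 assumes "0 < tz" "0 <= B" "v <= B * tz powr (1 / N')" "f v <= K * (tz powr ((p - 1) / N') * y)"
 shows "F v <= B * K * (tz powr (p / N') * y)" and "abs (f v * v) <= B * K * (tz powr (p / N') * y)"
proof -
 have e: "(tz powr (1 / N')) * (tz powr ((p - 1) / N')) = tz powr (p / N')"
  by (simp add: powr_add[symmetric] add_divide_distrib[symmetric])
 have "max 0 v * f v <= (B * tz powr (1 / N')) * (K * (tz powr ((p - 1) / N') * y))"
  using assms f_nonneg[of v] by (intro mult_mono) auto
 also have "... = B * K * (((tz powr (1 / N')) * (tz powr ((p - 1) / N'))) * y)" by (simp add: mult_ac)
 finally have 1: "max 0 v * f v <= B * K * (tz powr (p / N') * y)" unfolding e .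
 moreover have "F v <= max 0 v * f v" using F_le[of v] F_zero[of v] by (cases "0 < v") auto
 ultimately show "F v <= B * K * (tz powr (p / N') * y)" by linarith
 have "abs (f v * v) = max 0 v * f v" using f_nonneg[of v] f_zero[of v] by (cases "0 < v") (auto simp: abs_mult)
 with 1 show "abs (f v * v) <= B * K * (tz powr (p / N') * y)" by simp
qed

text \<open>Cells are numbered from infinity inwards: cell 0 is a neighbourhood of infinity, and the
  cap n makes profiles constant near the origin, where \<open>th\<close> is unbounded.\<close>

definition ix :: "real => nat => real^'n => nat" where "ix dl n x = min n (nat \<lfloor>th x / dl\<rfloor>)"

text \<open>Shell 0 is dropped: profiles vanish there, and Q itself need not be integrable at
  infinity.\<close>

definition qc :: "real => nat => nat => real^'n => real" where "qc dl n i x = (if ix dl n x = i & 1 <= i then Q0 x else 0)"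

definition Km :: "real => nat => nat => nat => real" where
 "Km dl n i m = (LBINT x. log_conv (qc dl n m) x * qc dl n i x)"

definition uu :: "real => nat => (nat => real) => real^'n => real" where "uu dl n d x = US dl d (ix dl n x)"

definition HH :: "real => nat => (nat => real) => real^'n => real" where "HH dl n d x = Q0 x * F (uu dl n d x)"

lemma ix_meas [measurable]: "ix dl n : measurable borel (count_space UNIV)"
 unfolding ix_def[abs_def] by measurable

lemma qc_meas [measurable]: "qc dl n i : BM"
 unfolding qc_def[abs_def] by measurable

lemma uu_meas [measurable]: "uu dl n d : BM"
 unfolding uu_def[abs_def] by measurable

lemma F_meas [measurable]: "F : BM" and f_meas [measurable]: "f : BM"
 using F_cont fc by (auto intro: borel_measurable_continuous_onI)

lemma HH_meas [measurable]: "HH dl n d : BM"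
 unfolding HH_def[abs_def] by measurable

lemma ix_le: assumes "0 < dl" "x ~= 0" shows "dl * real (ix dl n x) <= th x" "ix dl n x <= n"
proof -
 have "0 <= th x / dl" using theta_pos[OF assms(2)] assms(1) by simp
 hence "real (ix dl n x) <= th x / dl" unfolding ix_def by linarith
 thus "dl * real (ix dl n x) <= th x" using assms(1) by (simp add: field_simps)
qed (simp add: ix_def)

text \<open>On the shells i >= 1 one has th >= dl, so the factor th^(p/N') of the integrable
  majorant can be divided out, at the price of a constant depending on dl.\<close>

lemma qc_bound:
 assumes "0 < dl"
 obtains sg K where "0 < sg" "0 <= K" "!!i x. abs (qc dl n i x) <= K * pw sg e2 x"
proof -
 have k: "0 < ka * (b0 + N)" using kappa_pos b0 N_ge by simp
 obtain sg K where K: "0 < sg" "0 <= K" "!!x. Q0 x * (th x powr (p / N') * exp (0 * th x)) <= K * pw sg e2 x"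
  by (rule Q0_maj[OF order_refl k]) blast
 show ?thesis
 proof (rule that[OF K(1), of "K / dl powr (p / N')"])
  fix i and x :: "real^'n"
  show "abs (qc dl n i x) <= K / dl powr (p / N') * pw sg e2 x"
  proof (cases "ix dl n x = i & 1 <= i & x ~= 0")
   case True
   hence "dl * real i <= th x" using ix_le[OF assms, of x n] by auto
   moreover have "dl * 1 <= dl * real i" using True assms by (intro mult_left_mono) auto
   ultimately have "dl <= th x" by (simp only: mult_1_right)
   hence "dl powr (p / N') <= th x powr (p / N')" using assms p_facts N_facts(3) by (intro powr_mono2) auto
   hence "Q0 x * dl powr (p / N') <= Q0 x * th x powr (p / N')" by (intro mult_left_mono) auto
   hence "Q0 x * dl powr (p / N') <= K * pw sg e2 x" using K(3)[of x] by simp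
   thus ?thesis using True assms by (simp add: qc_def le_divide_eq)
  next
   case False
   hence "qc dl n i x = 0" by (auto simp: qc_def Q0_def)
   thus ?thesis using K by simp
  qed
 qed (use K in simp)
qed

lemma step_sum:
 assumes "G 0 = 0" "1 <= j"
 shows "(SUM i:{j..n}. G (US dl d i) * qc dl n i x) = (if j <= ix dl n x then Q0 x * G (uu dl n d x) else 0)"
proof -
 have "(SUM i:{j..n}. G (US dl d i) * qc dl n i x) = (SUM i:{j..n}. if i = ix dl n x then G (US dl d i) * Q0 x else 0)"
  using assms by (intro sum.cong) (auto simp: qc_def)
 also have "... = (if ix dl n x : {j..n} then G (US dl d (ix dl n x)) * Q0 x else 0)" by (subst sum.delta) auto
 also have "ix dl n x : {j..n} \<longleftrightarrow> j <= ix dl n x" by (auto simp: ix_def)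
 finally show ?thesis by (simp add: uu_def mult.commute)
qed

lemma HH_sum: "HH dl n d x = (SUM i:{1..n}. F (US dl d i) * qc dl n i x)"
 using step_sum[of F 1 dl d n x] F_zero[of 0] by (cases "ix dl n x = 0") (auto simp: HH_def uu_def US_0)

lemma Km_sym: assumes "0 < dl" shows "Km dl n i m = Km dl n m i"
proof -
 obtain sg K where K: "0 < sg" "0 <= K" "!!i x. abs (qc dl n i x) <= K * pw sg e2 x" by (rule qc_bound[OF assms, of n]) blast
 show ?thesis unfolding Km_def by (rule log_form[OF K(1) e2_neg]) (use K(3) qc_meas in blast)
qed

lemma log_conv_HH:
 assumes "0 < dl"
 shows "log_conv (HH dl n d) x = (SUM i:{1..n}. F (US dl d i) * log_conv (qc dl n i) x)"
proof -
 obtain sg K where K: "0 < sg" "0 <= K" "!!i x. abs (qc dl n i x) <= K * pw sg e2 x" by (rule qc_bound[OF assms, of n]) blast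
 have i: "IB (%y. lk x y * qc dl n i y)" for i
  by (rule log_potential_dominated[OF K(1) e2_neg, of 1]) (use K(3) qc_meas in "simp, blast")
 have "lk x y * HH dl n d y = (SUM i:{1..n}. F (US dl d i) * (lk x y * qc dl n i y))" for y
  unfolding HH_sum sum_distrib_left by (simp add: mult_ac)
 thus ?thesis using i by (simp add: log_conv_lborel)
qed

text \<open>Shells are disjoint, so double sums against \<open>Km\<close> are integrals of step
  functions. It serves with G = F for the functional, G = f for the flux and G(v) = f(v) v for the
  pairing with the slopes.\<close>

lemma step_VV_sum:
 assumes dl: "0 < dl" and G: "G 0 = 0" "1 <= j"
 shows "(SUM i:{j..n}. G (US dl d i) * VV dl n (Km dl n) d i) =
   (LBINT x. log_conv (HH dl n d) x * (if j <= ix dl n x then Q0 x * G (uu dl n d x) else 0))"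
proof -
 obtain sg K where K: "0 < sg" "0 <= K" "!!i x. abs (qc dl n i x) <= K * pw sg e2 x" by (rule qc_bound[OF dl, of n]) blast
 have int: "IB (%x. log_conv (qc dl n m) x * qc dl n i x)" for i m
  by (rule log_form[OF K(1) e2_neg]) (use K(3) qc_meas in blast)
 have "(LBINT x. log_conv (HH dl n d) x * (if j <= ix dl n x then Q0 x * G (uu dl n d x) else 0))
  = (LBINT x. (SUM i:{j..n}. SUM m:{1..n}. (G (US dl d i) * F (US dl d m)) * (log_conv (qc dl n m) x * qc dl n i x)))"
  unfolding step_sum[of G j dl d n, OF G, symmetric] log_conv_HH[OF dl] sum_product
  by (subst sum.swap) (simp add: mult_ac)
 also have "... = (SUM i:{j..n}. SUM m:{1..n}. (G (US dl d i) * F (US dl d m)) * Km dl n i m)"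
  unfolding Km_def using int by simp
 finally show ?thesis by (simp add: VV_def sum_distrib_left mult_ac)
qed

lemma step_BB:
 assumes dl: "0 < dl"
 shows "BB dl n (Km dl n) d = (LBINT x. log_conv (HH dl n d) x * HH dl n d x)"
proof -
 have "(if 1 <= ix dl n x then Q0 x * F (uu dl n d x) else 0) = HH dl n d x" for x
  using F_zero[of 0] by (cases "ix dl n x = 0") (auto simp: HH_def uu_def US_0)
 thus ?thesis unfolding BB_alt using step_VV_sum[OF dl, where G=F and j=1 and n=n and d=d] F_zero[of 0] by simp
qed

text \<open>The N-th root of a Hoelder estimate, by (t^(1/N'))^N = t^(N-1).\<close>

lemma root_bound:
 assumes "0 <= t" "0 <= B" "abs w ^ CARD('n) <= t ^ (CARD('n) - 1) * B ^ CARD('n)"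
 shows "abs w <= B * t powr (1 / N')"
proof -
 let ?n = "CARD('n)"
 have "(t powr (1 / N')) ^ ?n = t ^ (?n - 1)"
 proof (cases "t = 0")
  case True thus ?thesis using N2 by (simp add: power_0_left)
 next
  case False
  hence "(t powr (1 / N')) ^ ?n = t powr (N * ((N - 1) / N))"
   using assms by (simp add: N_facts(5)[unfolded N_def] powr_power N_def)
  also have "N * ((N - 1) / N) = real (?n - 1)" using N_ge N_facts(4) by simp
  also have "t powr real (?n - 1) = t ^ (?n - 1)" using False assms(1) by (intro powr_realpow) simp
  finally show ?thesis .
 qed
 hence "abs w ^ ?n <= (B * t powr (1 / N')) ^ ?n" using assms(3) by (simp add: power_mult_distrib mult.commute)
 thus ?thesis using assms(2) N2 by (subst (asm) power_mono_iff) auto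
qed

lemma step_diff_bound:
 assumes "0 < dl" "k <= i" "i <= n" "EE dl n d <= B ^ CARD('n)" "0 <= B"
 shows "abs (US dl d i - US dl d k) <= B * (dl * real (i - k)) powr (1 / N')"
proof (rule root_bound)
 let ?n = "CARD('n)"
 have "abs (US dl d i - US dl d k) ^ ?n <= (dl * real (i - k)) ^ (?n - 1) * (dl * (SUM j:{1..n}. abs ((US dl d j - US dl d (j - 1)) / dl) ^ ?n))"
  using assms by (intro discrete_hoelder) auto
 also have "(SUM j:{1..n}. abs ((US dl d j - US dl d (j - 1)) / dl) ^ ?n) = (SUM j:{1..n}. abs (d j) ^ ?n)"
  using US_Suc[of _ dl d] assms(1) by (intro sum.cong) auto
 also have "(dl * real (i - k)) ^ (?n - 1) * (dl * (SUM j:{1..n}. abs (d j) ^ ?n)) <= (dl * real (i - k)) ^ (?n - 1) * B ^ ?n"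
  using assms by (intro mult_left_mono) (auto simp: EE_def)
 finally show "abs (US dl d i - US dl d k) ^ ?n <= (dl * real (i - k)) ^ (?n - 1) * B ^ ?n" .
qed (use assms in auto)

lemma uu_bound:
 assumes "0 < dl" "EE dl n d <= B ^ CARD('n)" "0 <= B" "x ~= 0"
 shows "abs (uu dl n d x) <= B * th x powr (1 / N')"
proof -
 have "abs (US dl d (ix dl n x) - US dl d 0) <= B * (dl * real (ix dl n x - 0)) powr (1 / N')"
  using assms ix_le(2)[OF assms(1,4)] by (intro step_diff_bound) auto
 also have "... <= B * th x powr (1 / N')"
  using assms ix_le(1)[OF assms(1,4), of n] N_facts(3) by (intro mult_left_mono powr_mono2) auto
 finally show ?thesis by (simp add: uu_def US_0)
qed

text \<open>On energy rh^N the values of F are at most of order rh^p times a fixed majorant, so the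
  double integral is of order rh^(2p), small against rh^N because p > N. No constant depends on the
  grid.\<close>

lemma barrier:
 obtains a rh where "0 < a" "0 < rh" "!!dl n d. 0 < dl ==> EE dl n d = rh ^ CARD('n) ==> a <= JJ dl n (Km dl n) d"
proof -
 let ?c = "C_N CARD('n)" and ?n = "CARD('n)"
 have k: "0 < ka * (b0 + N)" using kappa_pos b0 N_ge by simp
 define et where "et = ka * (b0 + N) / 2"
 have eta: "0 <= et" "et < ka * (b0 + N)" "0 < et" using k unfolding et_def by linarith+
 obtain sg K1 where K1: "0 < sg" "0 <= K1" "!!x. Q0 x * (th x powr (p / N') * exp (et * th x)) <= K1 * pw sg e2 x"
  by (rule Q0_maj[OF eta(1,2)]) blast
 obtain K where K: "0 <= K" "!!tz v rh. 0 < tz ==> 0 <= rh ==> v <= rh * tz powr (1 / N')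
   ==> f v <= K * rh powr (p - 1) * (tz powr ((p - 1) / N') * exp ((al0 + 1) * rh powr N' * tz))"
  by (rule f_small) blast
 obtain M where M: "0 <= M" "!!h1 h2 K1 K2. h1 : BM ==> h2 : BM ==>
    (!!y::real^'n. abs (h1 y) <= K1 * pw sg e2 y) ==> (!!y. abs (h2 y) <= K2 * pw sg e2 y) ==>
    IB (%x. log_conv h1 x * h2 x) &
    abs (LBINT x. log_conv h1 x * h2 x) <= K1 * K2 * M &
    (LBINT x. log_conv h1 x * h2 x) = (LBINT x. log_conv h2 x * h1 x)"
  by (rule log_form[OF K1(1) e2_neg]) blast
 define c where "c = ?c / 2 * (K * K1)^2 * M + 1"
 have c: "1 <= c" using C_N_pos M(1) by (simp add: c_def)
 \<comment> \<open>The first bound keeps the exponential rate below et; the last makes c rh^(2p) at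
   most half of rh^N / N.\<close>
 define rh where "rh = min ((et / (al0 + 1)) powr (1 / N')) (min 1 ((1 / (2 * N * c)) powr (1 / N)))"
 have r: "0 < rh" "rh <= 1" "rh <= (et / (al0 + 1)) powr (1 / N')" "rh <= (1 / (2 * N * c)) powr (1 / N)"
  using eta alpha0 N_ge c by (auto simp: rh_def)
 have N'0: "0 < N'" using N_facts(3) by simp
 have re: "(al0 + 1) * rh powr N' <= et"
 proof -
  have "rh powr N' <= ((et / (al0 + 1)) powr (1 / N')) powr N'" using r N'0 by (intro powr_mono2) auto
  also have "... = et / (al0 + 1)" using eta alpha0 N'0 by (simp add: powr_powr)
  finally show ?thesis using alpha0 by (simp add: field_simps)
 qed
 have rc: "c * rh powr (2 * p) <= rh ^ ?n / (2 * N)"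
 proof -
  have "rh powr N <= ((1 / (2 * N * c)) powr (1 / N)) powr N" using r N_ge by (intro powr_mono2) auto
  also have "... = 1 / (2 * N * c)" using N_ge c by (simp add: powr_powr)
  finally have 1: "c * rh powr N <= 1 / (2 * N)" using N_ge c by (simp add: field_simps)
  have "rh powr (2 * p) <= rh powr (N + N)" using r p_facts(1) by (intro powr_mono') auto
  hence "c * rh powr (2 * p) <= c * (rh powr N * rh powr N)" unfolding powr_add using c by (intro mult_left_mono) auto
  also have "... = (c * rh powr N) * rh powr N" by simp
  also have "... <= 1 / (2 * N) * rh powr N" using 1 by (intro mult_right_mono) auto
  also have "rh powr N = rh ^ ?n" unfolding N_def using r(1) by (rule powr_realpow)
  finally show ?thesis by simp
 qed
 show ?thesis
 proof (rule that[of "rh ^ ?n / (2 * N)" rh])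
  fix dl n d assume dl: "0 < dl" and E: "EE dl n d = rh ^ ?n"
  have H: "abs (HH dl n d x) <= (K * rh powr p * K1) * pw sg e2 x" for x
  proof (cases "x = 0")
   case True thus ?thesis using K K1 by (simp add: HH_def Q0_def)
  next
   case False
   let ?tz = "th x" and ?v = "uu dl n d x"
   have tz: "0 < ?tz" by (rule theta_pos[OF False])
   have v: "?v <= rh * ?tz powr (1 / N')" using uu_bound[OF dl _ _ False, of n d rh] E r by auto
   have "f ?v <= K * rh powr (p - 1) * (?tz powr ((p - 1) / N') * exp ((al0 + 1) * rh powr N' * ?tz))"
    using K(2)[OF tz _ v] r by simp
   also have "... <= K * rh powr (p - 1) * (?tz powr ((p - 1) / N') * exp (et * ?tz))"
    using re tz K by (intro mult_left_mono iffD2[OF exp_le_cancel_iff] mult_right_mono) auto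
   finally have "F ?v <= rh * (K * rh powr (p - 1)) * (?tz powr (p / N') * exp (et * ?tz))"
    using F_majorant(1)[OF tz _ v] r by simp
   also have "rh * (K * rh powr (p - 1)) = K * rh powr p" using r powr_mult_base[of rh "p - 1"] by (simp add: mult_ac)
   finally have "Q0 x * F ?v <= Q0 x * (K * rh powr p * (?tz powr (p / N') * exp (et * ?tz)))" by (intro mult_left_mono) auto
   also have "... = K * rh powr p * (Q0 x * (?tz powr (p / N') * exp (et * ?tz)))" by (simp add: mult_ac)
   also have "... <= K * rh powr p * (K1 * pw sg e2 x)" using K K1 by (intro mult_left_mono) auto
   finally show ?thesis using F_nonneg by (simp add: HH_def abs_mult mult_ac)
  qed
  have "BB dl n (Km dl n) d <= (K * rh powr p * K1) * (K * rh powr p * K1) * M"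
   unfolding step_BB[OF dl] using M(2)[OF HH_meas HH_meas H H] by (auto dest: abs_le_D1)
  also have "... = (K * K1)^2 * M * rh powr (2 * p)"
   by (simp add: power2_eq_square powr_add[symmetric] mult_ac)
  finally have "?c / 2 * BB dl n (Km dl n) d <= ?c / 2 * ((K * K1)^2 * M * rh powr (2 * p))"
   using C_N_pos by (intro mult_left_mono) auto
  also have "... = (c - 1) * rh powr (2 * p)" by (simp add: c_def)
  also have "... <= c * rh powr (2 * p)" by (intro mult_right_mono) auto
  finally have "?c / 2 * BB dl n (Km dl n) d <= rh ^ ?n / (2 * N)" using rc by linarith
  thus "rh ^ ?n / (2 * N) <= JJ dl n (Km dl n) d" unfolding JJ_def E by simp
 qed (use r N_ge in auto)
qed


section \<open>Moser profiles and the level of the mountain pass\<close>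

text \<open>Slopes of the profile that is zero on k cells, then linear over a length T, then
  constant; T^(-1/N) normalises its energy to 1.\<close>

definition moser :: "real => nat => nat => nat => real" where
 "moser T k j i = (if k < i & i <= k + k * j then T powr (- 1 / N) else 0)"

lemma moser_facts:
 assumes k: "1 <= k" and j: "1 <= j" and ta0: "0 < ta0" and T: "T = real j * ta0" and s: "0 <= s" and dl: "dl = ta0 / real k"
 shows "k + k * j <= n ==> EE dl n (%i. s * moser T k j i) = s ^ CARD('n)"
  and "i <= k ==> US dl (%i. s * moser T k j i) i = 0"
  and "k + k * j <= i ==> US dl (%i. s * moser T k j i) i = s * T powr (1 / N')"
proof -
 let ?n = "CARD('n)"
 have T0: "0 < T" "dl * real (k * j) = T" using assms by auto
 have set: "{i : {1..m}. k < i & i <= k + k * j} = {k + 1..k + k * j}" if "k + k * j <= m" for m using that by auto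
 have sums: "(SUM i:{1..m}. if k < i & i <= k + k * j then y else 0) = real (k * j) * y" if "k + k * j <= m" for m and y :: real
  by (subst sum.inter_filter[symmetric]) (simp_all only: set[OF that] finite_atLeastAtMost, simp)
 have N': "- 1 / N + 1 = 1 / N'" using N_facts(5) N_ge by (simp add: field_simps)
 show "EE dl n (%i. s * moser T k j i) = s ^ ?n" if "k + k * j <= n"
 proof -
  have "(T powr (- 1 / N)) ^ ?n = T powr (- 1)" using T0 N_ge by (simp add: powr_power N_def)
  also have "... = 1 / T" using T0 by (simp add: powr_minus_divide)
  finally have "abs (s * moser T k j i) ^ ?n = (if k < i & i <= k + k * j then s ^ ?n / T else 0)" for i
   using s N2 by (simp add: moser_def power_mult_distrib power_0_left)
  hence "EE dl n (%i. s * moser T k j i) = dl * (real (k * j) * (s ^ ?n / T))" unfolding EE_def sums[OF that, symmetric] by simp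
  also have "... = (dl * real (k * j)) * (s ^ ?n / T)" by (simp only: mult.assoc)
  finally show ?thesis unfolding T0(2) using T0(1) by simp
 qed
 show "US dl (%i. s * moser T k j i) i = 0" if "i <= k" using that by (simp add: US_def moser_def)
 show "US dl (%i. s * moser T k j i) i = s * T powr (1 / N')" if "k + k * j <= i"
 proof -
  have "s * moser T k j i = (if k < i & i <= k + k * j then s * T powr (- 1 / N) else 0)" for i by (simp add: moser_def)
  hence "US dl (%i. s * moser T k j i) i = dl * (real (k * j) * (s * T powr (- 1 / N)))" unfolding US_def using sums[OF that] by simp
  also have "... = (dl * real (k * j)) * (s * T powr (- 1 / N))" by (simp only: mult.assoc)
  also have "... = s * (T * T powr (- 1 / N))" unfolding T0(2) by simp
  also have "T * T powr (- 1 / N) = T powr (1 / N')" using T0(1) powr_mult_base[of T "- 1 / N"] unfolding N'[symmetric] by (simp add: add.commute)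
  finally show ?thesis .
 qed
qed

lemma rstar_facts:
 assumes "0 < rh" "rh <= 1/4" "rh <= r0" "0 < T"
 shows "0 < rstar rh T" "rstar rh T <= rh" "0 < r ==> r <= rstar rh T ==> tt rh + T <= tt r"
proof -
 define E where "E = rh powr L / ((N - 1) * L) + ka * T"
 have E: "0 <= E" "rstar rh T = rh * exp (- E)"
  using N_ge w_facts kappa_pos assms by (auto simp: E_def rstar_def intro!: add_nonneg_nonneg divide_nonneg_nonneg mult_nonneg_nonneg)
 show r: "0 < rstar rh T" "rstar rh T <= rh" using E assms by (auto simp: mult_le_cancel_left1)
 assume r0: "0 < r" "r <= rstar rh T"
 have "ln r <= ln (rh * exp (- E))" using r0 E by simp
 also have "... = ln rh - E" using assms by (simp add: ln_mult)
 finally have "E <= ln (rh / r)" using assms r0 by (simp add: ln_div)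
 hence "ka * T <= ln (rh / r) - rh powr L / ((N - 1) * L)" unfolding E_def by linarith
 hence "(1 / ka) * (ka * T) <= (1 / ka) * (ln (rh / r) - rh powr L / ((N - 1) * L))" using kappa_pos by (intro mult_left_mono) auto
 also have "... <= tt r - tt rh" using r r0 assms by (intro tt_diff_ge) auto
 finally show "tt rh + T <= tt r" using kappa_pos by simp
qed

lemma Q0_ball:
 assumes c: "0 < c" "!!r. 0 < r ==> r < rQ ==> c * r powr b0 <= Q r" and r: "0 < r" "r < rQ" "r <= 1"
 shows "IB (%x. iB r x * Q0 x)"
  and "c * om * r powr (b0 + N) / (b0 + N) <= (LBINT x. iB r x * Q0 x)"
proof -
 obtain M where M: "0 <= M" "!!r. 0 < r ==> r <= 1 ==> Q r <= M * r powr b0" by (rule Q_bound) blast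
 have bN: "0 < b0 + N" using b0 N_ge by simp
 have i: "IB (%x::real^'n. iB r x * norm x powr b0)"
  and e: "(LBINT x. iB r x * norm (x::real^'n) powr b0) = om * r powr (b0 + N) / (b0 + N)"
  using integrable_powr_cball[OF bN less_imp_le[OF r(1)], where 'n='n] integral_powr_cball[OF bN less_imp_le[OF r(1)], where 'n='n]
  by (simp_all add: N_def om_def)
 show 1: "IB (%x. iB r x * Q0 x)"
 proof (rule ibound[OF integrable_mult_right[OF i, of M]])
  show "AE x in lborel. norm (iB r x * Q0 x) <= norm (M * (iB r x * norm x powr b0))"
   using M r by (auto intro!: AE_I2 simp: indicator_def Q0_def abs_mult abs_of_pos[OF Q_pos])
 qed (intro borel_measurable_times borel_measurable_indicator; simp)
 have "c * (om * r powr (b0 + N) / (b0 + N)) = (LBINT x. c * (iB r x * norm (x::real^'n) powr b0))"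
  using e by simp
 also have "... <= (LBINT x. iB r x * Q0 x)"
  using c r by (intro integral_mono 1 integrable_mult_right i) (auto simp: indicator_def Q0_def)
 finally show "c * om * r powr (b0 + N) / (b0 + N) <= (LBINT x. iB r x * Q0 x)" by (simp add: mult.assoc)
qed

text \<open>As rh <= 1/4, the profile is supported in a ball of radius 1/4; distances inside it are
  at most 1/2 and the kernel is nonnegative there, so everything outside the plateau can be
  discarded.\<close>

lemma moser_level:
 assumes rh: "0 < rh" "rh <= 1/4" "rh <= r0" and c: "0 < c" "!!r. 0 < r ==> r < rQ ==> c * r powr b0 <= Q r" "rh <= rQ"
  and k: "1 <= k" and j: "1 <= j" and T: "T = real j * tt rh" and s: "0 <= s" and dl: "dl = tt rh / real k" and n: "k + k * j <= n"
 shows "JJ dl n (Km dl n) (%i. s * moser T k j i) <= lev c rh T s"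
proof -
 have ta0: "0 < tt rh" using tt_pos rh by simp
 have T0: "0 < T" and dl0: "0 < dl" using T j ta0 dl k by auto
 note mf = moser_facts[OF k j ta0 T s dl]
 note rf = rstar_facts[OF rh T0]
 define r where "r = rstar rh T"
 have r: "0 < r" "r <= rh" "r < rh" using rf unfolding r_def
 proof -
  have "0 < rh powr L / ((N - 1) * L) + ka * T" using N_ge w_facts kappa_pos T0 rh by (intro add_pos_pos) auto
  thus "rstar rh T < rh" using rh by (simp add: rstar_def)
 qed auto
 let ?d = "%i. s * moser T k j i"
 define H where "H = HH dl n ?d"
 define Fs where "Fs = F (s * T powr (1 / N'))"
 define lg where "lg = ln (1 / (2 * r))"
 have lg: "0 <= lg" using r rh by (auto simp: lg_def intro!: ln_ge_zero simp: field_simps)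
 have [measurable]: "H : BM" by (simp add: H_def)
 have H0: "0 <= H x" for x by (simp add: H_def HH_def F_nonneg)
 have supp: "norm x <= 1/4" if "H x ~= 0" for x
 proof (rule ccontr)
  assume "~ norm x <= 1/4"
  hence x: "rh <= norm x" "x ~= 0" using rh by auto
  have "th x <= tt rh" unfolding th_def by (rule tt_le[OF rh(1) x(1)])
  hence "dl * real (ix dl n x) <= tt rh" using ix_le(1)[OF dl0 x(2), of n] by linarith
  hence "tt rh * real (ix dl n x) <= tt rh * real k" using k by (simp add: dl field_simps)
  hence "ix dl n x <= k" using ta0 by simp
  hence "uu dl n ?d x = 0" unfolding uu_def by (rule mf(2))
  thus False using that F_zero[of 0] by (simp add: H_def HH_def)
 qed
 have plateau: "H x = Fs * Q0 x" if "norm x <= r" for x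
 proof (cases "x = 0")
  case True thus ?thesis by (simp add: H_def HH_def Q0_def)
 next
  case False
  hence "tt rh + T <= th x" unfolding th_def using that r by (intro rf(3)) (auto simp: r_def)
  moreover have "tt rh + T = real (k + k * j) * dl" using k by (simp add: T dl field_simps)
  ultimately have "real (k + k * j) <= th x / dl" using dl0 by (simp only: le_divide_eq if_True)
  hence "k + k * j <= ix dl n x" unfolding ix_def using n by linarith
  hence "uu dl n ?d x = s * T powr (1 / N')" unfolding uu_def by (rule mf(3))
  thus ?thesis by (simp add: H_def HH_def Fs_def)
 qed
 let ?w = "c * om * r powr (b0 + N) / (b0 + N)"
 define W where "W = (LBINT x. iB r x * Q0 x)"
 have Wi: "IB (%x. iB r x * Q0 x)" and W: "?w <= W"
  using Q0_ball[where rQ=rQ and r=r, OF c(1,2)] r rh c(3) unfolding W_def by auto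
 have W0: "0 <= ?w" using c w_facts b0 N_ge by simp
 have Fs0: "0 <= Fs" by (simp add: Fs_def F_nonneg)
 obtain sg K where K: "0 < sg" "0 <= K" "!!i x. abs (qc dl n i x) <= K * pw sg e2 x" by (rule qc_bound[OF dl0, of n]) blast
 define K' where "K' = (SUM i:{1..n}. F (US dl ?d i) * K)"
 have HK: "abs (H x) <= K' * pw sg e2 x" for x
 proof -
  have "abs (H x) <= (SUM i:{1..n}. F (US dl ?d i) * abs (qc dl n i x))"
   unfolding H_def HH_sum using F_nonneg by (intro order_trans[OF sum_abs]) (simp add: abs_mult)
  also have "... <= (SUM i:{1..n}. F (US dl ?d i) * (K * pw sg e2 x))" using K F_nonneg by (intro sum_mono mult_left_mono) auto
  finally show ?thesis unfolding K'_def sum_distrib_right by (simp add: mult.assoc)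
 qed
 have ip: "IB (%y. lk x y * H y)" for x
  by (rule log_potential_dominated[OF K(1) e2_neg, of 1]) (use HK in \<open>simp, blast intro: \<open>H : BM\<close>\<close>)
 have iH: "IB (%x. log_conv H x * H x)"
  by (rule log_form[OF K(1) e2_neg]) (use HK \<open>H : BM\<close> in blast)
 have ln0: "0 <= lk x y * H y" if "norm x <= 1/4" for x y
 proof (cases "H y = 0 | x = y")
  case False
  hence "norm (x - y) <= 1" "0 < norm (x - y)" using supp[of y] that norm_triangle_ineq4[of x y] by auto
  thus ?thesis using H0[of y] by (intro mult_nonneg_nonneg ln_ge_zero) auto
 qed auto
 have conv: "lg * Fs * W <= log_conv H x" if x: "norm x <= r" for x
 proof -
  have "lg * Fs * W = (LBINT y. lg * Fs * (iB r y * Q0 y))" by (simp add: W_def)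
  also have "... <= (LBINT y. lk x y * H y)"
  proof (rule integral_mono_AE[OF integrable_mult_right[OF Wi] ip])
   have "AE y in lborel. y ~= x" by (rule AE_lborel_singleton)
   thus "AE y in lborel. lg * Fs * (iB r y * Q0 y) <= lk x y * H y"
   proof eventually_elim
    case (elim y)
    show ?case
    proof (cases "norm y <= r")
     case True
     have "norm (x - y) <= 2 * r" using norm_triangle_ineq4[of x y] x True by simp
     hence "lg <= lk x y" unfolding lg_def using r elim by (intro ln_mono) (auto simp: field_simps)
     hence "lg * (Fs * Q0 y) <= lk x y * (Fs * Q0 y)" using Fs0 by (intro mult_right_mono) auto
     thus ?thesis using True plateau[OF True] by (simp add: mult_ac)
    next
     case False
     thus ?thesis using ln0[of x y] x r rh by simp
    qed
   qed
  qed
  finally show ?thesis by (simp add: log_conv_lborel)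
 qed
 have "lg * ?w^2 * Fs^2 <= lg * W^2 * Fs^2"
  using lg W W0 by (intro mult_right_mono mult_left_mono power_mono) auto
 also have "... = (LBINT x. (lg * Fs * W) * Fs * (iB r x * Q0 x))"
  by (simp add: W_def power2_eq_square)
 also have "... <= (LBINT x. log_conv H x * H x)"
 proof (rule integral_mono[OF integrable_mult_right[OF Wi] iH])
  fix x
  show "(lg * Fs * W) * Fs * (iB r x * Q0 x) <= log_conv H x * H x"
  proof (cases "norm x <= r")
   case True
   have "(lg * Fs * W) * (Fs * Q0 x) <= log_conv H x * (Fs * Q0 x)" using conv[OF True] Fs0 by (intro mult_right_mono) auto
   thus ?thesis using True plateau[OF True] by simp
  next
   case False
   have "0 <= log_conv H x * H x"
   proof (cases "H x = 0")
    case False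
    hence "0 <= log_conv H x" using ln0[OF supp[OF False]] by (simp add: log_conv_lborel)
    thus ?thesis using H0 by simp
   qed simp
   thus ?thesis using False by simp
  qed
 qed
 also have "... = BB dl n (Km dl n) ?d" unfolding H_def step_BB[OF dl0] ..
 finally have "C_N CARD('n) / 2 * (lg * ?w^2 * Fs^2) <= C_N CARD('n) / 2 * BB dl n (Km dl n) ?d"
  using C_N_pos by (intro mult_left_mono) auto
 thus ?thesis unfolding JJ_def mf(1)[OF n] lev_def r_def[symmetric] lg_def[symmetric] Fs_def[symmetric] by (simp only: mult.assoc diff_left_mono)
qed

text \<open>The bounds a and m must be the same for all grids. Therefore T is taken as a multiple of
  t0 = \<open>tt rh\<close>, so that the Moser profile is exactly representable with width t0 / k
  for every k. With n = k (k + j + 1) the grid contains the profile and reaches t0 (k + j + 1),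
  which exhausts the half-line.\<close>

lemma mountain_pass_solution:
 obtains a m t0 j where "0 < a" "m < mstar" "0 < t0"
  "!!k ep dl n. 1 <= k ==> 0 < ep ==> dl = t0 / real k ==> n = k * (k + j + 1) ==>
   EX d. a <= JJ dl n (Km dl n) d & JJ dl n (Km dl n) d <= m & (ALL i:{1..n}. abs (gg dl n (Km dl n) d i) <= ep)"
proof -
 obtain rQ c be where c: "0 < rQ" "0 < c" "!!r. 0 < r ==> r < rQ ==> c * r powr b0 <= Q r"
  "thr c (min (1/4) (min r0 rQ)) < be"
  "EVT t. be <= t powr (1 + N') * f t * F t * exp (- 2 * al0 * t powr N')" by (rule f5_data) blast
 define rh where "rh = min (1/4) (min r0 rQ)"
 have rh: "0 < rh" "rh <= 1/4" "rh <= r0" "rh <= rQ" using c w_facts by (auto simp: rh_def)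
 obtain T0 where T0: "!!T. T0 < T ==> 0 < T ==> (EX m. 0 < m & m < mstar & (ALL s>=0. lev c rh T s <= m)) & (EX s1>0. ALL s>=s1. lev c rh T s < 0)"
  using level_estimate[OF c(2) rh(1,2) c(4)[folded rh_def] c(5)] by blast
 define t0 where "t0 = tt rh"
 have t0: "0 < t0" using tt_pos rh by (simp add: t0_def)
 obtain j0 :: nat where j0: "T0 / t0 < real j0" using reals_Archimedean2 by blast
 define j where "j = j0 + 1"
 define T where "T = real j * t0"
 have "T0 < real j0 * t0" using j0 t0 by (simp add: divide_less_eq)
 hence T: "T0 < T" "0 < T" using t0 by (auto simp: T_def j_def distrib_right intro: add_pos_nonneg)
 from T0[OF this] obtain m s1 where m: "0 < m" "m < mstar" "!!s. 0 <= s ==> lev c rh T s <= m" and s1: "0 < s1" "!!s. s1 <= s ==> lev c rh T s < 0" by blast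
 obtain a rh1 where a: "0 < a" "0 < rh1" "!!dl n d. 0 < dl ==> EE dl n d = rh1 ^ CARD('n) ==> a <= JJ dl n (Km dl n) d" by (rule barrier) blast
 \<comment> \<open>Large enough for the level to be negative and for the energy to lie beyond the
   barrier.\<close>
 define S where "S = max s1 (rh1 + 1)"
 have S: "s1 <= S" "rh1 < S" "0 < S" using s1 by (auto simp: S_def)
 show ?thesis
 proof (rule that[of "a / 2" m t0 j])
  fix k :: nat and ep dl :: real and n
  assume k: "1 <= k" and ep: "0 < ep" and dl: "dl = t0 / real k" and n: "n = k * (k + j + 1)"
  have dl0: "0 < dl" using dl t0 k by simp
  have nk: "k + k * j <= n" using k by (simp add: n algebra_simps)
  have j1: "1 <= j" by (simp add: j_def)
  note lv = moser_level[OF rh(1-3) c(2,3) rh(4) k j1 T_def[unfolded t0_def] _ dl[unfolded t0_def] nk]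
  have E: "EE dl n (%i. S * moser T k j i) = S ^ CARD('n)"
   using S t0 by (intro moser_facts(1)[OF k j1 t0 T_def _ dl nk]) auto
  have EJ0: "EE dl n (%i. 0) = 0" "JJ dl n (Km dl n) (%i. 0) = 0"
   using N2 F_zero[of 0] by (auto simp: EE_def JJ_def BB_def US_def power_0_left)
  have "EX u. (ALL i. i ~: {1..n} --> u i = 0) & a / 2 <= JJ dl n (Km dl n) u & JJ dl n (Km dl n) u <= m & (ALL i:{1..n}. abs (gg dl n (Km dl n) u i) <= ep)"
  proof (rule finite_dim_mountain_pass[where E="EE dl n" and rh="rh1 ^ CARD('n)" and e="%i. S * moser T k j i"])
   show "((%s. JJ dl n (Km dl n) (%i. u i + s * d i)) hasd
    (SUM i:{1..n}. gg dl n (Km dl n) (%i. u i + s * d i) i * d i)) (at s)" for u d s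
    by (rule JJ_deriv) (rule Km_sym[OF dl0])
   show "rh1 ^ CARD('n) < EE dl n (%i. S * moser T k j i)" unfolding E using S a N2 by (intro power_strict_mono) auto
   show "JJ dl n (Km dl n) (%i. S * moser T k j i) <= a / 2" using lv[of S] s1(2)[of S] S a by simp
   show "S * moser T k j i = 0" if "i ~: {1..n}" for i using that nk by (auto simp: moser_def)
   show "JJ dl n (Km dl n) (%i. t * (S * moser T k j i)) <= m" if "0 <= t" "t <= 1" for t
    using lv[of "t * S"] m(3)[of "t * S"] S that by (simp add: mult.assoc)
  qed (use a EJ0 ep JJ_cont gg_cont EE_cont dl0 in auto)
  thus "EX d. a / 2 <= JJ dl n (Km dl n) d & JJ dl n (Km dl n) d <= m & (ALL i:{1..n}. abs (gg dl n (Km dl n) d i) <= ep)" by blast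
 qed (use a m t0 in auto)
qed

section \<open>Approximate critical points with a common growth bound\<close>

lemma approximate_solutions:
 obtains a B et Kf dl n d where "0 < a" "0 <= B" "0 <= et" "et < ka * (b0 + N)" "0 <= Kf"
  "!!k. 0 < dl k" "dl ----> 0" "filterlim (%k. dl k * real (n k)) at_top sequentially"
  "!!k. EE (dl k) (n k) (d k) <= B ^ CARD('n)" "!!k. a <= JJ (dl k) (n k) (Km (dl k) (n k)) (d k)"
  "!!k j. j : {1..n k} ==> abs (gg (dl k) (n k) (Km (dl k) (n k)) (d k) j) <= dl k / (real k + 1)"
  "!!k. (SUM j:{1..n k}. abs (gg (dl k) (n k) (Km (dl k) (n k)) (d k) j * d k j)) <= (1 + B ^ CARD('n)) / (real k + 1)"
  "!!k x. x ~= 0 ==> f (uu (dl k) (n k) (d k) x) <= Kf * gro et (th x)"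
proof -
 let ?n = "CARD('n)"
 obtain a m t0 j where a: "0 < a" "m < mstar" "0 < t0"
  and ex: "!!k ep dl n. 1 <= k ==> 0 < ep ==> dl = t0 / real k ==> n = k * (k + j + 1) ==>
   EX d. a <= JJ dl n (Km dl n) d & JJ dl n (Km dl n) d <= m & (ALL i:{1..n}. abs (gg dl n (Km dl n) d i) <= ep)"
  by (rule mountain_pass_solution) blast
 obtain d1 where "a <= JJ (t0 / real 1) (1 * (1 + j + 1)) (Km (t0 / real 1) (1 * (1 + j + 1))) d1" "JJ (t0 / real 1) (1 * (1 + j + 1)) (Km (t0 / real 1) (1 * (1 + j + 1))) d1 <= m"
  using ex[OF order_refl zero_less_one refl refl] by blast
 hence m0: "0 < m" using a by linarith
 \<comment> \<open>Positive because ta > 1 - 2/N; this is the constant by which the level controls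
   the whole energy.\<close>
 define q where "q = 1 / N - (1 - ta) / 2"
 have q: "0 < q" using tau(1) N_ge by (simp add: q_def)
 define D where "D = 2 * (m + 1) / q"
 define m' where "m' = (m + mstar) / 2"
 have m': "m < m'" "m' < mstar" "0 < m'" using a(2) m0 by (auto simp: m'_def)
 \<comment> \<open>Makes 1/N - e/2 equal to (m + m') / (2 N m'), so that the bound (m + m')/2, the
   level plus small errors, gives a truncated energy of at most N m'.\<close>
 define e where "e = (m' - m) / (N * m')"
 have e: "0 < e" "e <= 2 / N" "1 / N - e / 2 = (m + m') / 2 / (N * m')"
  using m' m0 N_ge by (auto simp: e_def divide_le_eq field_simps)
 obtain T where T: "0 < T" "!!x y. T <= x ==> x <= y ==> ps y - ps x <= e * (y - x)" by (rule psi_diff_large[OF e(1)]) blast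
 obtain k0 :: nat where k0: "max (2 / q) ((1 + D) / ((m' - m) / 2)) < real k0" using reals_Archimedean2 by blast
 define kk where "kk k = k + k0 + 1" for k
 define dl where "dl k = t0 / real (kk k)" for k
 define n where "n k = kk k * (kk k + j + 1)" for k
 \<comment> \<open>The factor n^2 pays for the sum over n cells and for bounding the sum of the
   slopes; the minimum with \<open>dl k\<close> makes the error small even after division by the
   cell width.\<close>
 define ep where "ep k = min (dl k) 1 / (real (kk k) * (real (n k))^2)" for k
 let ?J = "%k. JJ (dl k) (n k) (Km (dl k) (n k))" and ?g = "%k. gg (dl k) (n k) (Km (dl k) (n k))"
 have dl: "0 < dl k" for k using a by (simp add: dl_def kk_def)
 have n1: "1 <= n k" for k by (simp add: n_def kk_def)
 have n1': "1 <= real (n k)" for k using n1[of k] by linarith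
 have eps: "0 < ep k" for k using dl[of k] n1[of k] by (simp add: ep_def kk_def)
 have "ALL k. EX d. a <= ?J k d & ?J k d <= m & (ALL i:{1..n k}. abs (?g k d i) <= ep k)"
 proof
  fix k show "EX d. a <= ?J k d & ?J k d <= m & (ALL i:{1..n k}. abs (?g k d i) <= ep k)"
   by (rule ex[of "kk k"]) (auto simp: kk_def dl_def n_def eps)
 qed
 from choice[OF this] obtain d where d: "!!k. a <= ?J k (d k)" "!!k. ?J k (d k) <= m"
   "!!k i. i : {1..n k} ==> abs (?g k (d k) i) <= ep k" by blast
 have E0: "0 <= EE (dl k) (n k) (d k)" for k using dl[of k] by (simp add: EE_def sum_nonneg)
 have small: "ep k * real (n k) * (SUM j:{1..n k}. abs (d k j)) <= (1 + EE (dl k) (n k) (d k)) / real (kk k)" for k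
 proof -
  have "(SUM j:{1..n k}. abs (d k j)) <= (SUM j:{1..n k}. 1 + abs (d k j) ^ ?n)"
  proof (rule sum_mono)
   fix i
   show "abs (d k i) <= 1 + abs (d k i) ^ ?n"
    using self_le_power[of "abs (d k i)" ?n] N2 by (cases "1 <= abs (d k i)") (auto intro: add_increasing2)
  qed
  also have "... = real (n k) + EE (dl k) (n k) (d k) / dl k" using dl[of k] by (simp add: sum.distrib EE_def)
  finally have "ep k * real (n k) * (SUM j:{1..n k}. abs (d k j)) <= ep k * real (n k) * (real (n k) + EE (dl k) (n k) (d k) / dl k)"
   using eps[of k] by (intro mult_left_mono) auto
  also have "... = ep k * (real (n k))^2 + (ep k * real (n k) / dl k) * EE (dl k) (n k) (d k)"
   by (simp add: power2_eq_square distrib_left)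
  also have "... <= 1 / real (kk k) + 1 / real (kk k) * EE (dl k) (n k) (d k)"
  proof (intro add_mono mult_right_mono E0)
   have "ep k * (real (n k))^2 = min (dl k) 1 / real (kk k)" using n1'[of k] by (simp add: ep_def)
   also have "... <= 1 / real (kk k)" by (intro divide_right_mono) auto
   finally show 1: "ep k * (real (n k))^2 <= 1 / real (kk k)" .
   have "ep k * real (n k) <= ep k * (real (n k))^2" using n1'[of k] eps[of k] by (intro mult_left_mono) (auto simp: power2_eq_square)
   also have "... = min (dl k) 1 / real (kk k)" using n1'[of k] by (simp add: ep_def)
   also have "... <= dl k / real (kk k)" by (intro divide_right_mono) auto
   finally show "ep k * real (n k) / dl k <= 1 / real (kk k)" using dl[of k] by (simp add: divide_le_eq mult.commute)
  qed
  finally show ?thesis by (simp add: add_divide_distrib)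
 qed
 have kq: "1 / real (kk k) <= q / 2" "(1 + D) / real (kk k) <= (m' - m) / 2" for k
 proof -
  have kk: "max (2 / q) ((1 + D) / ((m' - m) / 2)) <= real (kk k)" "0 < real (kk k)" using k0 by (auto simp: kk_def)
  hence "2 / q <= real (kk k)" "(1 + D) / ((m' - m) / 2) <= real (kk k)" by auto
  thus "1 / real (kk k) <= q / 2" "(1 + D) / real (kk k) <= (m' - m) / 2" using q m' kk(2) by (auto simp: field_simps)
 qed
 have ED: "EE (dl k) (n k) (d k) <= D" for k
 proof -
  define X where "X = EE (dl k) (n k) (d k)"
  have "q * X <= m + (1 + X) / real (kk k)"
   using EE_bound[where ep="ep k" and n="n k" and d="d k", OF dl[of k] d(3)] eps[of k] d(2)[of k] small[of k] unfolding q_def X_def by linarith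
  moreover have "(1 + X) / real (kk k) <= q / 2 + q * X / 2"
  proof -
   have "1 / real (kk k) * (1 + X) <= q / 2 * (1 + X)" using kq(1)[of k] E0[of k] by (intro mult_right_mono) (auto simp: X_def)
   moreover have "q / 2 * (1 + X) = q / 2 + q * X / 2" by (simp add: algebra_simps add_divide_distrib)
   ultimately show ?thesis by (simp only: times_divide_eq_left mult_1_left)
  qed
  moreover have "q <= 1"
  proof -
   have "1 / N <= 1" using N_ge by simp
   moreover have "q <= 1 / N" unfolding q_def using tau(2) by simp
   ultimately show ?thesis by (rule order_trans[rotated])
  qed
  moreover have "Y <= 2 * (m + 1)" if "Y <= m + Z" "Z <= q / 2 + Y / 2" "q <= 1" for Y Z :: real using that by (auto simp: field_simps)
  ultimately have "q * X <= 2 * (m + 1)" by blast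
  thus ?thesis unfolding X_def[symmetric] D_def using q by (simp add: le_divide_eq mult.commute)
 qed
 have D0: "0 <= D" using m0 q by (simp add: D_def)
 define B where "B = root ?n D"
 have B: "0 <= B" "B ^ ?n = D" using D0 N2 by (auto simp: B_def real_root_pow_pos2)
 define c where "c = root ?n (N * m')"
 have c: "0 <= c" "c ^ ?n = N * m'" using m' N_ge N2 by (auto simp: c_def real_root_pow_pos2)
 have c0: "0 < c" using c m' N_ge N2 by (cases "c = 0") (auto simp: power_0_left)
 \<comment> \<open>The growth condition is m' < mstar, rewritten with c^N = N m' and c^N =
   (c^N')^(N-1).\<close>
 have cc: "al0 * c powr N' < ka * (b0 + N)"
 proof -
  have "(c powr N') ^ (?n - 1) = N * m'" using powr_pow_N[OF c0] c by simp
  also have "... < N * mstar" using m' N_ge by simp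
  also have "... = (ka * (b0 + N) / al0) ^ (?n - 1)" using N_ge by (simp add: mstar_def)
  finally have "c powr N' < ka * (b0 + N) / al0" by (rule power_less_imp_less_base) (use kappa_pos b0 N_ge alpha0 in simp)
  thus ?thesis using alpha0 by (simp add: field_simps)
 qed
 obtain et Kf where eta: "0 <= et" "et < ka * (b0 + N)" "0 <= Kf"
  and Kf: "!!tz v. 0 < tz ==> v <= T + c * tz powr (1 / N') ==> v <= B * tz powr (1 / N')
   ==> f v <= Kf * gro et tz"
  by (rule f_majorant[OF c(1) cc less_imp_le[OF T(1)] B(1)]) blast
 \<comment> \<open>Hoelder's inequality applied to max T U, which starts at T and whose energy is at
   most c^N.\<close>
 have up: "uu (dl k) (n k) (d k) x <= T + c * th x powr (1 / N')" if x: "x ~= 0" for k x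
 proof -
  define i where "i = ix (dl k) (n k) x"
  have i: "dl k * real i <= th x" "i <= n k" using ix_le[OF dl x] by (auto simp: i_def)
  let ?w = "%j. max T (US (dl k) (d k) j)"
  have "abs (?w i - ?w 0) <= c * (dl k * real (i - 0)) powr (1 / N')"
  proof (rule root_bound)
   define W where "W = dl k * (SUM j:{1..n k}. abs ((?w j - ?w (j - 1)) / dl k) ^ ?n)"
   have "(1 / N - e / 2) * W <= m + (1 + EE (dl k) (n k) (d k)) / real (kk k)"
    using test_energy[where ep="ep k" and n="n k" and d="d k" and T=T, OF e(2) T(2) dl[of k] d(3)] eps[of k] d(2)[of k] small[of k] unfolding W_def by linarith
   also have "... <= m + (1 + D) / real (kk k)" using ED[of k] by (intro add_left_mono divide_right_mono) auto
   also have "... <= (m + m') / 2" using kq(2)[of k] by simp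
   finally have "(m + m') / 2 * (W / (N * m')) <= (m + m') / 2 * 1" unfolding e(3) by simp
   hence "W / (N * m') <= 1" using m' m0 by (subst (asm) mult_le_cancel_left_pos) auto
   hence "W <= c ^ ?n" using m' N_ge unfolding c by (simp add: divide_le_eq)
   hence "(dl k * real (i - 0)) ^ (?n - 1) * W <= (dl k * real (i - 0)) ^ (?n - 1) * c ^ ?n"
    using dl[of k] by (intro mult_left_mono) auto
   with discrete_hoelder[OF dl[of k] le0 i(2), of ?n ?w]
   show "abs (?w i - ?w 0) ^ ?n <= (dl k * real (i - 0)) ^ (?n - 1) * c ^ ?n"
    unfolding W_def by simp
  qed (use dl[of k] c in auto)
  also have "... <= c * th x powr (1 / N')" using i dl[of k] c N_facts(3) by (intro mult_left_mono powr_mono2) auto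
  finally show ?thesis using T(1) by (simp add: uu_def i_def[symmetric] US_0)
 qed
 have nt: "real (n k) * dl k = t0 * real (kk k + j + 1)" for k
 proof -
  have "real (kk k) ~= 0" by (simp add: kk_def)
  thus ?thesis unfolding n_def dl_def of_nat_mult by simp
 qed
 show ?thesis
 proof (rule that[OF a(1) B(1) eta, of dl n d])
  show "dl ----> 0" unfolding dl_def kk_def
   using LIMSEQ_ignore_initial_segment[OF lim_const_over_n[of t0], of "k0 + 1"] by (simp add: add.assoc)
  show "filterlim (%k. dl k * real (n k)) at_top sequentially"
   unfolding filterlim_at_top
  proof
   fix Z
   obtain k1 :: nat where "Z / t0 < real k1" using reals_Archimedean2 by blast
   hence k1: "Z <= t0 * real k1" using a by (simp add: field_simps)
   have "Z <= dl k * real (n k)" if "k1 <= k" for k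
   proof -
    have "t0 * real k1 <= t0 * real (kk k + j + 1)" using that a by (intro mult_left_mono) (auto simp: kk_def)
    thus ?thesis using k1 nt[of k] by (simp add: mult.commute)
   qed
   thus "EV k. Z <= dl k * real (n k)" by (auto simp: eventually_sequentially)
  qed
  fix k
  have kk: "real k + 1 <= real (kk k)" by (simp add: kk_def)
  show "EE (dl k) (n k) (d k) <= B ^ ?n" using ED B by simp
  have le1: "ep k <= dl k / (real k + 1)"
  proof -
   have "real k + 1 <= real (kk k) * (real (n k))^2" using mult_mono[OF kk, of 1 "(real (n k))^2"] n1'[of k] by simp
   thus ?thesis unfolding ep_def using dl[of k] by (intro frac_le) auto
  qed
  show "abs (?g k (d k) j) <= dl k / (real k + 1)" if "j : {1..n k}" for j
   using d(3)[OF that] le1 by linarith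
  have "(SUM j:{1..n k}. abs (?g k (d k) j * d k j)) <= (SUM j:{1..n k}. ep k * abs (d k j))"
   using d(3)[of _ k] by (intro sum_mono) (auto simp: abs_mult intro!: mult_right_mono)
  also have "... = ep k * 1 * (SUM j:{1..n k}. abs (d k j))" by (simp add: sum_distrib_left)
  also have "... <= ep k * real (n k) * (SUM j:{1..n k}. abs (d k j))" using eps[of k] n1'[of k] by (intro mult_right_mono mult_left_mono) (auto intro: sum_nonneg)
  also have "... <= (1 + EE (dl k) (n k) (d k)) / real (kk k)" by (rule small)
  also have "... <= (1 + B ^ ?n) / (real k + 1)" using ED[of k] E0[of k] kk B by (intro frac_le) auto
  finally show "(SUM j:{1..n k}. abs (?g k (d k) j * d k j)) <= (1 + B ^ ?n) / (real k + 1)" .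
  fix x :: "real^'n" assume x: "x ~= 0"
  show "f (uu (dl k) (n k) (d k) x) <= Kf * gro et (th x)"
   using uu_bound[OF dl[of k] _ B(1) x, of "n k" "d k"] ED[of k] B(2) by (intro Kf theta_pos[OF x] up[OF x]) auto
 qed (use dl d in auto)
qed

end

lemma AE_norm_neq: "AE x in lborel. norm (x::'a::euclidean_space) ~= r"
proof -
 have "negligible {x::'a. norm x = r}" using negligible_sphere[of 0 r] by (simp add: sphere_def)
 hence "AE x in lebesgue. norm (x::'a) ~= r"
  unfolding negligible_iff_null_sets by (rule AE_I') auto
 thus ?thesis by (simp add: AE_completion_iff)
qed

section \<open>Limits of step profiles\<close>

context choquard
begin

definition Ut :: "real => nat => (nat => real) => real => real" where "Ut dl n d t = US dl d (min n (nat \<lfloor>t / dl\<rfloor>))"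

lemma uu_Ut: "uu dl n d x = Ut dl n d (th x)" by (simp add: uu_def ix_def Ut_def)

text \<open>Inverse of x |x|^(N-2); it recovers the slope from the flux.\<close>

definition Pinv :: "real => real" where "Pinv y = sgn y * abs y powr iN"

lemma Pinv_Phi: "Pinv (Phi x) = x" and Phi_Pinv: "Phi (Pinv y) = y"
proof -
 have p: "real (CARD('n) - 2) = N - 2" using N2 by (simp add: N_def of_nat_diff)
 have ap: "abs z * abs z ^ (CARD('n) - 2) = abs z powr (N - 1)" if "z ~= 0" for z
 proof -
  have "abs z * abs z ^ (CARD('n) - 2) = abs z powr 1 * abs z powr real (CARD('n) - 2)" using that by (simp add: powr_realpow)
  thus ?thesis unfolding p powr_add[symmetric] by simp
 qed
 have a: "abs (Phi z) = abs z powr (N - 1)" "sgn (Phi z) = sgn z" if "z ~= 0" for z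
 proof -
  have c: "0 < abs z ^ (CARD('n) - 2)" using that by simp
  show "abs (Phi z) = abs z powr (N - 1)" using ap[OF that] by (simp add: Phi_def abs_mult)
  show "sgn (Phi z) = sgn z" unfolding Phi_def sgn_mult sgn_pos[OF c] by simp
 qed
 show "Pinv (Phi x) = x"
  using a[of x] N_ge by (cases "x = 0") (auto simp: Phi_def Pinv_def powr_powr sgn_mult_abs)
 show "Phi (Pinv y) = y"
 proof (cases "y = 0")
  case False
  hence "abs (Pinv y) = abs y powr iN" "sgn (Pinv y) = sgn y" "Pinv y ~= 0"
   by (auto simp: Pinv_def abs_mult sgn_mult abs_sgn_eq sgn_zero_iff)
  thus ?thesis using a[of "Pinv y"] False N_ge sgn_mult_abs[of "Phi (Pinv y)"] by (simp add: powr_powr sgn_mult_abs)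
 qed (simp add: Pinv_def Phi_def)
qed

lemma Pinv_cont: "continuous_on UNIV Pinv"
proof -
 have N1: "0 < 1 / (N - 1)" using N_ge by simp
 have "continuous_on {0..} (%y. y powr iN)" "continuous_on {..0} (%y. - ((- y) powr iN))"
  using N1 by (intro continuous_on_minus continuous_on_powr' continuous_on_id continuous_on_const; simp)+
 hence c: "continuous_on {0..} Pinv" "continuous_on {..0} Pinv"
  by (auto elim!: continuous_on_eq simp: Pinv_def sgn_if)
 have "continuous_on ({0..} Un {..0}) Pinv" using c by (intro continuous_on_closed_Un) auto
 moreover have "{0..} Un {..0} = (UNIV :: real set)" by auto
 ultimately show ?thesis by simp
qed

lemma tt_small: assumes "0 < t" obtains R where "0 < R" "!!x::real^'n. x ~= 0 ==> t <= th x ==> norm x <= R"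
proof -
 define C where "C = (N - 1) / l / ka"
 have C: "0 < C" using N_ge w_facts kappa_pos by (simp add: C_def)
 have inv: "1 / (l / (N - 1)) * - (l / (N - 1)) = - 1" using w_facts N_ge by simp
 define R where "R = (2 * C / t) powr (1 / (l / (N - 1)))"
 have R: "0 < R" using C assms by (simp add: R_def)
 have "tt R <= C * R powr (- (l / (N - 1)))" unfolding C_def by (rule tt_powr(2)[OF R])
 also have "R powr (- (l / (N - 1))) = 1 / (2 * C / t)"
  unfolding R_def powr_powr inv using C assms by (simp add: powr_minus_divide)
 also have "C * (1 / (2 * C / t)) = t / 2" using C assms by simp
 finally have tR: "tt R < t" using assms by simp
 show ?thesis
 proof (rule that[OF R])
  fix x :: "real^'n" assume "x ~= 0" "t <= th x"
  thus "norm x <= R" using tR tt_le[OF R, of "norm x"] by (cases "R <= norm x") (auto simp: th_def)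
 qed
qed

text \<open>Exponent at infinity for the whole right-hand side: the potential grows at most like
  |x|^(-e2/2), which adds to \<open>e1\<close>. It is raised to a positive number, as integrals over
  balls require; staying below l/N is what later makes the energy finite at infinity.\<close>

definition ee :: real where "ee = max (e1 - e2 / 2) (l / N / 2)"

lemma ee_facts: "0 < ee" "e1 - e2 / 2 <= ee" "ee < l / N"
proof -
 define y where "y = l / N"
 have y: "0 < y" "e1 = e2 + y" using w_facts N_ge e1_e2 by (auto simp: y_def)
 show "0 < ee" using y unfolding ee_def y_def[symmetric] less_max_iff_disj by linarith
 show "e1 - e2 / 2 <= ee" by (simp add: ee_def)
 show "ee < l / N" unfolding ee_def y_def[symmetric] max_less_iff_conj using e2_neg y by (intro conjI; linarith)
qed

text \<open>The indices of s and t differ by at most |t - s| / dl + 1, so step profiles of bounded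
  energy are Hoelder continuous up to the grid width.\<close>

lemma step_modulus:
 assumes dl: "0 < dl" and E: "EE dl n d <= B ^ CARD('n)" and B: "0 <= B" and st: "0 < s" "0 < t"
 shows "abs (Ut dl n d t - Ut dl n d s) <= B * (abs (t - s) + dl) powr (1 / N')" and "abs (Ut dl n d t) <= B * t powr (1 / N')"
proof -
 have main: "abs (Ut dl n d t - Ut dl n d s) <= B * (abs (t - s) + dl) powr (1 / N')" if "s <= t" "0 < s" for s t
 proof -
  let ?i = "%t. min n (nat \<lfloor>t / dl\<rfloor>)"
  have le: "?i s <= ?i t" using that dl by (intro min.mono nat_mono floor_mono divide_right_mono) auto
  have q0: "0 <= s / dl" "0 <= t / dl" using that dl by auto
  have "real (?i t - ?i s) <= real (nat \<lfloor>t / dl\<rfloor>) - real (nat \<lfloor>s / dl\<rfloor>)"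
  proof -
   have "nat \<lfloor>s / dl\<rfloor> <= nat \<lfloor>t / dl\<rfloor>" using that dl by (intro nat_mono floor_mono divide_right_mono) auto
   hence "?i t - ?i s <= nat \<lfloor>t / dl\<rfloor> - nat \<lfloor>s / dl\<rfloor>" "nat \<lfloor>s / dl\<rfloor> <= nat \<lfloor>t / dl\<rfloor>" by (auto simp: min_def)
   thus ?thesis by (metis of_nat_diff of_nat_mono)
  qed
  also have "... <= t / dl - (s / dl - 1)" using q0 by linarith
  finally have "dl * real (?i t - ?i s) <= dl * (t / dl - (s / dl - 1))" using dl by (intro mult_left_mono) auto
  also have "... = abs (t - s) + dl" using that dl by (simp add: right_diff_distrib)
  finally have "B * (dl * real (?i t - ?i s)) powr (1 / N') <= B * (abs (t - s) + dl) powr (1 / N')"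
   using B dl N_facts(3) by (intro mult_left_mono powr_mono2) auto
  moreover have "abs (Ut dl n d t - Ut dl n d s) <= B * (dl * real (?i t - ?i s)) powr (1 / N')"
   unfolding Ut_def by (rule step_diff_bound[OF dl le _ E B]) simp
  ultimately show ?thesis by simp
 qed
 thus "abs (Ut dl n d t - Ut dl n d s) <= B * (abs (t - s) + dl) powr (1 / N')"
  using main[of s t] main[of t s] st by (cases "s <= t") (auto simp: abs_minus_commute)
 let ?i = "min n (nat \<lfloor>t / dl\<rfloor>)"
 have "0 <= t / dl" using st dl by simp
 hence "real ?i <= t / dl" by linarith
 hence "dl * real ?i <= t" using dl by (simp add: field_simps)
 hence "B * (dl * real (?i - 0)) powr (1 / N') <= B * t powr (1 / N')" using B dl N_facts(3) by (intro mult_left_mono powr_mono2) auto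
 moreover have "abs (US dl d ?i - US dl d 0) <= B * (dl * real (?i - 0)) powr (1 / N')" by (rule step_diff_bound[OF dl _ _ E B]) auto
 ultimately show "abs (Ut dl n d t) <= B * t powr (1 / N')" by (simp add: Ut_def US_0)
qed

text \<open>Values at positive rationals lie in a compact box, so a subsequence converges at all of
  them; the common modulus, with dl tending to 0, extends the convergence to every t > 0.\<close>

lemma step_limit:
 fixes dl :: "nat => real"
 assumes dl: "!!k. 0 < dl k" "dl ----> 0" and E: "!!k. EE (dl k) (n k) (d k) <= B ^ CARD('n)" and B: "0 <= B"
 obtains r U where "strict_mono (r :: nat => nat)" "!!t. 0 < t ==> (%k. Ut (dl (r k)) (n (r k)) (d (r k)) t) ----> U t"
proof -
 define S where "S = (\<rat> Int {0<..} :: real set)"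
 have "countable S" by (simp add: S_def countable_rat)
 moreover have "1 : S" by (simp add: S_def)
 ultimately have S: "range (from_nat_into S) = S" by (intro range_from_nat_into) auto
 let ?x = "%k i. Ut (dl k) (n k) (d k) (from_nat_into S i)"
 have p: "0 < from_nat_into S i" for i using S rangeI[of "from_nat_into S" i] by (auto simp: S_def)
 have "?x k : {u. ALL i. abs (u i) <= B * from_nat_into S i powr (1 / N')}" for k
  using step_modulus(2)[OF dl(1) E B p p] by auto
 moreover have "seq_compact {u. ALL i. abs (u i) <= B * from_nat_into S i powr (1 / N')}"
  by (intro compact_imp_seq_compact compact_coordinate_box)
 ultimately obtain v r where r: "strict_mono r" "(?x \<circ> r) ----> v" by (auto elim!: seq_compactE)
 have cv: "(%k. Ut (dl (r k)) (n (r k)) (d (r k)) s) ----> v i" if "s = from_nat_into S i" for s i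
 proof -
  have "isCont (%u::nat => real. u i) v"
   using continuous_on_product_coordinates[of i, where 'b=real] unfolding continuous_on_eq_continuous_at[OF open_UNIV] by blast
  from isCont_tendsto_compose[OF this r(2)] show ?thesis by (simp add: o_def that)
 qed
 have "convergent (%k. Ut (dl (r k)) (n (r k)) (d (r k)) t)" if t: "0 < t" for t
 proof (rule Cauchy_convergent, rule metric_CauchyI)
  fix e :: real assume e: "0 < e"
  define h where "h = (e / (4 * (B + 1))) powr N'"
  have h: "0 < h" "B * h powr (1 / N') <= e / 4"
  proof -
   show "0 < h" using e B by (simp add: h_def)
   have "h powr (1 / N') = e / (4 * (B + 1))" using e B N_facts(3) by (simp add: h_def powr_powr)
   moreover have "B * (e / (4 * (B + 1))) <= (B + 1) * (e / (4 * (B + 1)))" using e B by (intro mult_right_mono) auto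
   moreover have "(B + 1) * (e / (4 * (B + 1))) = e / 4"
   proof -
    have "B + 1 ~= 0" using B by simp
    thus ?thesis by (metis mult.commute nonzero_mult_div_cancel_left times_divide_eq_right divide_divide_eq_left)
   qed
   ultimately show "B * h powr (1 / N') <= e / 4" by (simp only:)
  qed
  obtain s where s: "s : \<rat>" "max (t / 2) (t - h / 2) < s" "s < t" using Rats_dense_in_real[of "max (t / 2) (t - h / 2)" t] t h by auto
  hence "s : S" using t by (auto simp: S_def)
  then obtain i where i: "s = from_nat_into S i" using S by (metis imageE)
  have s0: "0 < s" "abs (t - s) <= h / 2" using s t by auto
  obtain M1 where M1: "!!k. M1 <= k ==> abs (Ut (dl (r k)) (n (r k)) (d (r k)) s - v i) < e / 4"
   using LIMSEQ_D[OF cv[OF i], of "e / 4"] e by auto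
  obtain M2 where M2: "!!k. M2 <= k ==> dl (r k) < h / 2"
  proof -
   have "(%k. dl (r k)) ----> 0" using LIMSEQ_subseq_LIMSEQ[OF dl(2) r(1)] by (simp add: o_def)
   hence "EV k. dl (r k) < h / 2" using h by (intro order_tendstoD) auto
   thus ?thesis using that unfolding eventually_sequentially by blast
  qed
  have close: "abs (Ut (dl (r k)) (n (r k)) (d (r k)) t - v i) < e / 2" if k: "max M1 M2 <= k" for k
  proof -
   have "abs (Ut (dl (r k)) (n (r k)) (d (r k)) t - Ut (dl (r k)) (n (r k)) (d (r k)) s) <= B * (abs (t - s) + dl (r k)) powr (1 / N')"
    by (rule step_modulus(1)[OF dl(1) E B s0(1) t])
   also have "... <= B * h powr (1 / N')" using s0 M2[of k] k dl(1)[of "r k"] B N_facts(3) by (intro mult_left_mono powr_mono2) auto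
   finally show ?thesis using h(2) M1[of k] k by linarith
  qed
  show "EX M. ALL m>=M. ALL n'>=M. dist (Ut (dl (r m)) (n (r m)) (d (r m)) t) (Ut (dl (r n')) (n (r n')) (d (r n')) t) < e"
  proof (intro exI[of _ "max M1 M2"] allI impI)
   fix m n' assume "max M1 M2 <= m" "max M1 M2 <= n'"
   from close[OF this(1)] close[OF this(2)]
   show "dist (Ut (dl (r m)) (n (r m)) (d (r m)) t) (Ut (dl (r n')) (n (r n')) (d (r n')) t) < e" unfolding dist_real_def by linarith
  qed
 qed
 thus ?thesis using that[OF r(1), of "%t. lim (%k. Ut (dl (r k)) (n (r k)) (d (r k)) t)"] by (simp add: convergent_LIMSEQ_iff)
qed

end

section \<open>The limit profile and its equation\<close>

text \<open>Approximate critical points on refining grids that converge pointwise, with majorants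
  independent of k. The bound \<open>g\<close> is small relative to dl, since division by dl
  produces the discrete Euler equation; \<open>gd\<close> permits testing with the slopes and with
  their truncations.\<close>

locale choquard_limit = choquard A Q f A0 l r0 L b0 b al0 p ta C CQ ty N om N'
 for A Q f :: "real => real" and A0 l r0 L b0 b al0 p ta C CQ :: real and ty :: "'n::finite itself"
  and N om N' :: real +
 fixes a B et Kf sg K :: real and dl :: "nat => real" and n :: "nat => nat" and d :: "nat => nat => real" and U :: "real => real"
 assumes a: "0 < a" and B: "0 <= B" and Kf: "0 <= Kf" and sg: "0 < sg" and K: "0 <= K"
  and dl: "!!k. 0 < dl k" "dl ----> 0" "filterlim (%k. dl k * real (n k)) at_top sequentially"
  and E: "!!k. EE (dl k) (n k) (d k) <= B ^ CARD('n)" and Ja: "!!k. a <= JJ (dl k) (n k) (Km (dl k) (n k)) (d k)"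
  and g: "!!k j. j : {1..n k} ==> abs (gg (dl k) (n k) (Km (dl k) (n k)) (d k) j) <= dl k / (real k + 1)"
  and gd: "(%k. SUM j:{1..n k}. abs (gg (dl k) (n k) (Km (dl k) (n k)) (d k) j * d k j)) ----> 0"
  and fb: "!!k x. x ~= 0 ==> f (uu (dl k) (n k) (d k) x) <= Kf * gro et (th x)"
  and maj: "!!x. Q0 x * gro et (th x) <= K * pw sg e1 x"
   "!!x. Q0 x * (th x powr (p / N') * exp (et * th x)) <= K * pw sg e2 x"
  and Ulim: "!!t. 0 < t ==> (%k. Ut (dl k) (n k) (d k) t) ----> U t"
begin

abbreviation "uk k == uu (dl k) (n k) (d k)"
abbreviation "Hk k == HH (dl k) (n k) (d k)"
abbreviation "u x == U (th x)"
definition H :: "real^'n => real" where "H x = Q0 x * F (u x)"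
definition Y :: "real^'n => real" where "Y x = log_conv H x * (Q0 x * f (u x))"
definition Yk :: "nat => real^'n => real" where "Yk k x = log_conv (Hk k) x * (Q0 x * f (uk k x))"
definition q :: "real => real" where "q t = C_N CARD('n) * (LBINT x. (if t <= th x then Y x else 0))"

lemma U_bound: "0 < t ==> abs (U t) <= B * t powr (1 / N')"
 by (rule LIMSEQ_le_const2[OF tendsto_rabs[OF Ulim]]) (use step_modulus(2)[OF dl(1) E B] in blast)+

lemma uk_lim: "x ~= 0 ==> (%k. uk k x) ----> u x" unfolding uu_Ut by (rule Ulim[OF theta_pos])

lemma fu: assumes "x ~= 0" shows "(%k. f (uk k x)) ----> f (u x)" "f (u x) <= Kf * gro et (th x)"
proof -
 have "isCont f (u x)" using fc by (simp add: continuous_on_eq_continuous_at)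
 from isCont_tendsto_compose[OF this uk_lim[OF assms]] show 1: "(%k. f (uk k x)) ----> f (u x)" .
 show "f (u x) <= Kf * gro et (th x)" by (rule LIMSEQ_le_const2[OF 1]) (use fb[OF assms] in blast)
qed

lemma density_bounds:
 assumes "x = 0 | abs v <= B * th x powr (1 / N') & f v <= Kf * gro et (th x)"
 shows "abs (Q0 x * f v) <= Kf * K * pw sg e1 x" "abs (Q0 x * F v) <= B * Kf * K * pw sg e2 x" "abs (Q0 x * (f v * v)) <= B * Kf * K * pw sg e2 x"
proof -
 have "abs (Q0 x * f v) <= Kf * K * pw sg e1 x & abs (Q0 x * F v) <= B * Kf * K * pw sg e2 x & abs (Q0 x * (f v * v)) <= B * Kf * K * pw sg e2 x"
 proof (cases "x = 0")
  case True thus ?thesis using B Kf K by (simp add: Q0_def)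
 next
  case False
  hence v: "v <= B * th x powr (1 / N')" "f v <= Kf * gro et (th x)" using assms by auto
  note FM = F_majorant[OF theta_pos[OF False] B v]
  have "Q0 x * f v <= Kf * (Q0 x * gro et (th x))"
   using mult_left_mono[OF v(2), of "Q0 x"] by (simp add: mult_ac)
  also have "... <= Kf * (K * pw sg e1 x)" using Kf maj by (intro mult_left_mono) auto
  finally have 1: "abs (Q0 x * f v) <= Kf * K * pw sg e1 x" using f_nonneg[of v] by (simp add: mult.assoc)
  have 2: "Q0 x * z <= B * Kf * K * pw sg e2 x" if "z <= B * Kf * (th x powr (p / N') * exp (et * th x))" for z
  proof -
   have "Q0 x * z <= B * Kf * (Q0 x * (th x powr (p / N') * exp (et * th x)))"
    using mult_left_mono[OF that, of "Q0 x"] by (simp add: mult_ac)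
   also have "... <= B * Kf * (K * pw sg e2 x)" using B Kf maj by (intro mult_left_mono) auto
   finally show ?thesis by (simp add: mult.assoc)
  qed
  show ?thesis using 1 2[OF FM(1)] 2[OF FM(2)] F_nonneg[of v] by (simp add: abs_mult)
 qed
 thus "abs (Q0 x * f v) <= Kf * K * pw sg e1 x" "abs (Q0 x * F v) <= B * Kf * K * pw sg e2 x" "abs (Q0 x * (f v * v)) <= B * Kf * K * pw sg e2 x" by auto
qed

lemma uk_growth: "x = 0 | abs (uk k x) <= B * th x powr (1 / N') & f (uk k x) <= Kf * gro et (th x)"
 using uu_bound[OF dl(1) E B] fb by blast

lemma u_growth: "x = 0 | abs (u x) <= B * th x powr (1 / N') & f (u x) <= Kf * gro et (th x)"
 using U_bound[OF theta_pos] fu(2) by blast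

lemmas uk_bounds = density_bounds[OF uk_growth] and u_bounds = density_bounds[OF u_growth]

lemma U_meas: "u : BM"
proof -
 have "(%x::real^'n. if x = 0 then 0 else u x) : BM"
 proof (rule borel_measurable_LIMSEQ_real)
  fix x :: "real^'n" show "(%k. if x = 0 then 0 else uk k x) ----> (if x = 0 then 0 else u x)" using uk_lim by auto
 qed measurable
 hence "(%x::real^'n. if x = 0 then u 0 else (if x = 0 then 0 else u x)) : BM" by measurable
 thus ?thesis by (rule measurable_cong[THEN iffD1, rotated]) auto
qed

lemma H_meas [measurable]: "H : BM" and Q0f_meas [measurable]: "(%x. Q0 x * f (u x)) : BM"
 using U_meas unfolding H_def[abs_def] by measurable

lemma Y_meas [measurable]: "Y : BM" "Yk k : BM"
 unfolding Y_def[abs_def] Yk_def[abs_def] by measurable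

lemma H_bound: "abs (H x) <= B * Kf * K * pw sg e2 x" "abs (Hk k x) <= B * Kf * K * pw sg e2 x"
 unfolding H_def HH_def by (rule u_bounds uk_bounds)+

lemma pot_bound:
 obtains M where "0 <= M" "!!(h :: real^'n => real) x. h : BM ==> (!!y. abs (h y) <= B * Kf * K * pw sg e2 y) ==>
  IB (%y. lk x y * h y) & abs (log_conv h x) <= M * (1 + norm x) powr (- e2 / 2)"
proof -
 have e: "0 < - e2 / 2" using e2_neg by simp
 obtain M where M: "0 <= M"
  "!!h K x. h : BM ==> (!!y::real^'n. abs (h y) <= K * pw sg e2 y) ==>
    IB (%y. lk x y * h y) &
    (LBINT y. abs (lk x y * h y)) <= K * M * (1 + norm x) powr (- e2 / 2) &
    abs (log_conv h x) <= K * M * (1 + norm x) powr (- e2 / 2)"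
  by (rule log_potential_dominated[OF sg e2_neg e]) blast
 show ?thesis by (rule that[of "B * Kf * K * M"]) (use M(1) M(2)[of _ "B * Kf * K"] B Kf K in auto)
qed

lemma V_lim: "(%k. log_conv (Hk k) x) ----> log_conv H x"
proof -
 obtain M where M: "!!(h :: real^'n => real) x. h : BM ==> (!!y. abs (h y) <= B * Kf * K * pw sg e2 y) ==>
  IB (%y. lk x y * h y) & abs (log_conv h x) <= M * (1 + norm x) powr (- e2 / 2)" by (rule pot_bound) blast
 have B0: "0 <= B * Kf * K" using B Kf K by simp
 have i: "IB (%y. abs (lk x y * (B * Kf * K * pw sg e2 y)))"
 proof (rule integrable_abs)
  have "abs (B * Kf * K * pw sg e2 y) <= B * Kf * K * pw sg e2 y" for y :: "real^'n"
   using mult_nonneg_nonneg[OF B0 pw_nonneg] by (rule abs_of_nonneg[THEN eq_refl])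
  with M show "IB (%y. lk x y * (B * Kf * K * pw sg e2 y))" by (simp del: abs_mult)
 qed
 have "(%k. (LBINT y. lk x y * Hk k y)) ----> (LBINT y. lk x y * H y)"
 proof (rule integral_dominated_convergence[OF _ _ i])
  show "AE y in lborel. norm (lk x y * Hk k y) <= abs (lk x y * (B * Kf * K * pw sg e2 y))" for k
   unfolding real_norm_def abs_mult[of "lk x y" for y]
   by (intro AE_I2 mult_left_mono order_trans[OF H_bound(2) abs_ge_self] abs_ge_zero)
  have "(%k. Hk k y) ----> H y" for y
  proof (cases "y = 0")
   case False
   have "isCont F (u y)" using F_cont by (simp add: continuous_on_eq_continuous_at)
   from isCont_tendsto_compose[OF this uk_lim[OF False]] show ?thesis unfolding H_def HH_def by (intro tendsto_intros)
  qed (simp add: H_def HH_def Q0_def)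
  thus "AE y in lborel. (%k. lk x y * Hk k y) ----> lk x y * H y"
   by (intro AE_I2 tendsto_intros)
 qed measurable
 thus ?thesis by (simp add: log_conv_lborel)
qed

lemma Yk_lim: "(%k. Yk k x) ----> Y x"
 using fu(1)[of x] V_lim[of x] unfolding Yk_def Y_def by (cases "x = 0") (auto simp: Q0_def intro!: tendsto_intros)

text \<open>The growth -e2/2 of the potential adds to the exponents \<open>e1\<close> and
  \<open>e2\<close> of the densities, which gives \<open>ee\<close> and the still negative
  e2/2.\<close>

lemma Y_bound:
 obtains D where "0 <= D" "!!x. abs (Y x) <= D * pw sg ee x" "!!k x. abs (Yk k x) <= D * pw sg ee x"
  "!!x. abs (log_conv H x) <= D * (1 + norm x) powr (- e2 / 2)" "!!k x. abs (log_conv (Hk k) x * (Q0 x * (f (uk k x) * uk k x))) <= D * pw sg (e2 / 2) x"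
  "!!k x. abs (log_conv (Hk k) x * Hk k x) <= D * pw sg (e2 / 2) x" "!!x. abs (log_conv H x * H x) <= D * pw sg (e2 / 2) x"
proof -
 obtain M where M: "0 <= M" "!!(h :: real^'n => real) x. h : BM ==> (!!y. abs (h y) <= B * Kf * K * pw sg e2 y) ==>
  IB (%y. lk x y * h y) & abs (log_conv h x) <= M * (1 + norm x) powr (- e2 / 2)" by (rule pot_bound) blast
 define c where "c = Kf * K + B * Kf * K"
 define D where "D = M * c * 2 powr (- e2 / 2) + M"
 have c: "0 <= c" "Kf * K <= c" "B * Kf * K <= c" using B Kf K by (auto simp: c_def)
 have D: "M * c * 2 powr (- e2 / 2) <= D" "M <= D" "0 <= D" using c M(1) by (auto simp: D_def)
 have prod: "abs (V * z) <= D * pw sg s' x"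
  if V: "abs V <= M * (1 + norm x) powr (- e2 / 2)" and z: "abs z <= c' * pw sg s x" and "c' <= c" and s: "s - e2 / 2 <= s'" for V z c' s s' and x :: "real^'n"
 proof -
  have "abs z <= c * pw sg s x" using z \<open>c' <= c\<close> by (rule order_trans[OF _ mult_right_mono]) simp
  hence "abs (V * z) <= (M * (1 + norm x) powr (- e2 / 2)) * (c * pw sg s x)" unfolding abs_mult using V M(1) by (intro mult_mono) auto
  also have "... = M * c * ((1 + norm x) powr (- e2 / 2) * pw sg s x)" by (simp add: mult_ac)
  also have "... <= M * c * (2 powr (- e2 / 2) * pw sg (s + - e2 / 2) x)" using M(1) c e2_neg by (intro mult_left_mono pw_mult_powr_le) auto
  also have "... <= M * c * (2 powr (- e2 / 2) * pw sg s' x)" using M(1) c s by (intro mult_left_mono pw_mono) auto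
  also have "... = M * c * 2 powr (- e2 / 2) * pw sg s' x" by (simp add: mult_ac)
  also have "... <= D * pw sg s' x" using D(1) by (intro mult_right_mono) auto
  finally show ?thesis .
 qed
 have V: "abs (log_conv H x) <= M * (1 + norm x) powr (- e2 / 2)" "abs (log_conv (Hk k) x) <= M * (1 + norm x) powr (- e2 / 2)" for k x
  using M(2)[OF H_meas H_bound(1)] M(2)[OF HH_meas H_bound(2)] by auto
 show ?thesis
 proof (rule that[OF D(3)])
  show "abs (log_conv H x) <= D * (1 + norm x) powr (- e2 / 2)" for x using V(1)[of x] D(2) by (rule order_trans[OF _ mult_right_mono]) simp
  show "abs (Y x) <= D * pw sg ee x" "abs (Yk k x) <= D * pw sg ee x" for k x
   unfolding Y_def Yk_def by (rule prod[OF V(1) u_bounds(1) c(2) ee_facts(2)], rule prod[OF V(2) uk_bounds(1) c(2) ee_facts(2)])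
  show "abs (log_conv (Hk k) x * (Q0 x * (f (uk k x) * uk k x))) <= D * pw sg (e2 / 2) x"
   "abs (log_conv (Hk k) x * Hk k x) <= D * pw sg (e2 / 2) x" "abs (log_conv H x * H x) <= D * pw sg (e2 / 2) x" for k x
   by (rule prod[OF V(2) uk_bounds(3) c(3)] prod[OF V(2) H_bound(2) c(3)] prod[OF V(1) H_bound(1) c(3)]; simp)+
 qed
qed

text \<open>If U <= 0, the limits of F(u) and of the potential vanish and \<open>BB\<close> tends to
  0. Pairing the gradient with the slopes forces the energy to 0 too, so the level would tend to 0
  although it is at least a > 0.\<close>

lemma nontrivial: "EX t>0. 0 < U t"
proof (rule ccontr)
 assume "~ ?thesis"
 hence U0: "U t <= 0" if "0 < t" for t using that by (meson not_less)
 obtain D where D: "0 <= D" "!!k x. abs (log_conv (Hk k) x * (Q0 x * (f (uk k x) * uk k x))) <= D * pw sg (e2 / 2) x"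
  "!!k x. abs (log_conv (Hk k) x * Hk k x) <= D * pw sg (e2 / 2) x" by (rule Y_bound) blast
 have H0: "H x = 0" for x using F_zero[OF U0[OF theta_pos[of x]]] by (cases "x = 0") (auto simp: H_def Q0_def)
 hence V0: "log_conv H x = 0" for x by (simp add: log_conv_def)
 have pwi: "IB (%x. D * pw sg (e2 / 2) (x::real^'n))" using e2_neg sg by (intro integrable_mult_right integrable_pw) auto
 have lim: "(%k. (LBINT x. log_conv (Hk k) x * (Q0 x * G (uk k x)))) ----> 0"
  if G: "continuous_on UNIV G" "!!k x. abs (log_conv (Hk k) x * (Q0 x * G (uk k x))) <= D * pw sg (e2 / 2) x" for G
 proof -
  have [measurable]: "G : BM" by (rule borel_measurable_continuous_onI[OF G(1)])
  have "(%k. (LBINT x. log_conv (Hk k) x * (Q0 x * G (uk k x)))) ----> (\<integral>x. 0 \<partial>(lborel :: (real^'n) measure))"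
  proof (rule integral_dominated_convergence[OF _ _ pwi])
   show "AE x in lborel. norm (log_conv (Hk k) x * (Q0 x * G (uk k x))) <= D * pw sg (e2 / 2) x" for k using G(2) by simp
   have "(%k. log_conv (Hk k) x * (Q0 x * G (uk k x))) ----> 0" for x
   proof (cases "x = 0")
    case False
    have "isCont G (u x)" using G(1) by (simp add: continuous_on_eq_continuous_at)
    from tendsto_mult[OF V_lim tendsto_mult[OF tendsto_const isCont_tendsto_compose[OF this uk_lim[OF False]]]]
    show ?thesis by (simp add: V0)
   qed (simp add: Q0_def)
   thus "AE x in lborel. (%k. log_conv (Hk k) x * (Q0 x * G (uk k x))) ----> 0" by simp
  qed measurable
  thus ?thesis by simp
 qed
 have BB0: "(%k. BB (dl k) (n k) (Km (dl k) (n k)) (d k)) ----> 0"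
  using lim[OF F_cont] D(3) unfolding step_BB[OF dl(1)] HH_def by simp
 have "(%k. (LBINT x. log_conv (Hk k) x * (Q0 x * (f (uk k x) * uk k x)))) ----> 0"
  using lim[of "%v. f v * v"] D(2) fc by (simp add: continuous_intros)
 moreover have "(LBINT x. log_conv (Hk k) x * (Q0 x * (f (uk k x) * uk k x))) =
   (SUM i:{1..n k}. f (US (dl k) (d k) i) * VV (dl k) (n k) (Km (dl k) (n k)) (d k) i * US (dl k) (d k) i)" for k
 proof -
  have "(if 1 <= ix (dl k) (n k) x then Q0 x * (f (uk k x) * uk k x) else 0) = Q0 x * (f (uk k x) * uk k x)" for x
   by (cases "ix (dl k) (n k) x = 0") (auto simp: uu_def US_0)
  thus ?thesis using step_VV_sum[OF dl(1)[of k], where G="%v. f v * v" and j=1 and n="n k" and d="d k"] by (simp add: mult_ac)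
 qed
 moreover have "(%k. SUM j:{1..n k}. gg (dl k) (n k) (Km (dl k) (n k)) (d k) j * d k j) ----> 0"
  by (rule Lim_null_comparison[OF _ gd]) (simp add: sum_abs)
 ultimately have "(%k. (SUM j:{1..n k}. gg (dl k) (n k) (Km (dl k) (n k)) (d k) j * d k j) +
   C_N CARD('n) * (SUM i:{1..n k}. f (US (dl k) (d k) i) * VV (dl k) (n k) (Km (dl k) (n k)) (d k) i * US (dl k) (d k) i)) ----> 0 + C_N CARD('n) * 0"
  by (intro tendsto_add tendsto_mult tendsto_const) simp_all
 hence EE0: "(%k. EE (dl k) (n k) (d k)) ----> 0" unfolding gg_pairing EE_def Phi_mult by simp
 have "(%k. JJ (dl k) (n k) (Km (dl k) (n k)) (d k)) ----> 0 / N - C_N CARD('n) / 2 * 0"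
  unfolding JJ_def using N_ge by (intro tendsto_intros EE0 BB0) auto
 hence "a <= 0" using Ja by (intro LIMSEQ_le_const) auto
 thus False using a by simp
qed

lemma cut_integrable:
 assumes "0 < t"
 shows "IB (%x::real^'n. if t <= th x then pw sg ee x else 0)"
proof -
 obtain R where R: "0 < R" "!!x::real^'n. x ~= 0 ==> t <= th x ==> norm x <= R" by (rule tt_small[OF assms]) blast
 have "IB (%x::real^'n. iB R x * pw sg ee x)"
  by (rule integral_pw_cball_le(1)[OF sg ee_facts(1)]) (use R in simp)
 thus ?thesis
 proof (rule ibound)
  show "AE x::real^'n in lborel. norm (if t <= th x then pw sg ee x else 0) <= norm (iB R x * pw sg ee x)"
   using R by (intro AE_I2) (auto simp: indicator_def pw_def)
 qed measurable
qed

text \<open>Dominated convergence: the shells shrink to the set th x = t, which up to the origin is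
  a sphere or empty.\<close>

lemma ring_small:
 assumes t: "0 < t" and e: "0 < e"
 obtains h where "0 < h" "h <= t / 2" "(LBINT x. (if (abs (th x - t)) <= h then pw sg ee (x::real^'n) else 0)) < e"
proof -
 define h where "h i = t / 2 / (real i + 1)" for i
 have h: "0 < h i" "h i <= t / 2" for i using t by (auto simp: h_def divide_le_eq mult_le_cancel_left1)
 have h0: "h ----> 0" unfolding h_def using LIMSEQ_ignore_initial_segment[OF lim_const_over_n[of "t / 2"], of 1] by (simp add: add.commute)
 have "(%i. (LBINT x. (if (abs (th x - t)) <= h i then pw sg ee (x::real^'n) else 0))) ----> (\<integral>x. 0 \<partial>(lborel :: (real^'n) measure))"
 proof (rule integral_dominated_convergence[OF _ _ cut_integrable[of "t / 2"]])
  show "AE x::real^'n in lborel. norm (if (abs (th x - t)) <= h i then pw sg ee x else 0) <= (if t / 2 <= th x then pw sg ee x else 0)" for i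
   using h(2)[of i] by (intro AE_I2) auto
  have "AE x::real^'n in lborel. th x ~= t"
  proof (cases "EX r>0. tt r = t")
   case True
   then obtain r where r: "0 < r" "tt r = t" by blast
   have ne: "th x ~= t" if "norm x ~= r" "norm x ~= 0" for x :: "real^'n"
    using tt_less[of r "norm x"] tt_less[of "norm x" r] that r by (cases "norm x < r") (auto simp: th_def)
   show ?thesis using AE_norm_neq[of r, where 'a="real^'n"] AE_norm_neq[of 0, where 'a="real^'n"] by eventually_elim (rule ne)
  next
   case False
   hence "th x ~= t" if "norm x ~= 0" for x :: "real^'n" using that by (auto simp: th_def)
   thus ?thesis using AE_norm_neq[of 0, where 'a="real^'n"] by (auto elim: eventually_mono)
  qed
  thus "AE x::real^'n in lborel. (%i. if abs (th x - t) <= h i then pw sg ee x else 0) ----> 0"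
  proof eventually_elim
   case (elim x)
   have ev: "EV i. h i < abs (th x - t)" using elim by (intro order_tendstoD(2)[OF h0]) simp
   show ?case by (intro tendsto_eventually eventually_mono[OF ev]) auto
  qed
 qed (use t in simp_all, measurable)
 hence "EV i. (LBINT x. (if (abs (th x - t)) <= h i then pw sg ee (x::real^'n) else 0)) < e"
  using e by (intro order_tendstoD(2)) auto
 then obtain i where "(LBINT x. (if (abs (th x - t)) <= h i then pw sg ee (x::real^'n) else 0)) < e" unfolding eventually_sequentially by blast
 thus ?thesis using that[of "h i"] h by blast
qed

text \<open>One modulus for all densities under the same majorant, so that it applies to the limit
  and to every \<open>Yk k\<close> simultaneously.\<close>

lemma flux_modulus:
 assumes t: "0 < t" and e: "0 < e" and D: "0 <= D"
 obtains h where "0 < h" "h <= t / 2" "!!g s. g : BM ==> (!!x::real^'n. abs (g x) <= D * pw sg ee x) ==> abs (s - t) <= h ==>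
  abs (C_N CARD('n) * (LBINT x. (if s <= th x then g x else 0)) - C_N CARD('n) * (LBINT x. (if t <= th x then g x else 0))) < e"
proof -
 let ?c = "C_N CARD('n)"
 define C where "C = ?c * D + 1"
 have C: "0 < C" using C_N_pos D by (simp add: C_def add_nonneg_pos)
 let ?r = "%h (x::real^'n). if (abs (th x - t)) <= h then pw sg ee x else 0"
 obtain h where h: "0 < h" "h <= t / 2" "(LBINT x. ?r h x) < e / C"
  by (rule ring_small[OF t, of "e / C"]) (use e C in auto)
 let ?c = "C_N CARD('n)"
 show ?thesis
 proof (rule that[OF h(1,2)])
  fix g s assume [measurable]: "g : BM" and b: "!!x::real^'n. abs (g x) <= D * pw sg ee x" and s: "abs (s - t) <= h"
  have ci: "IB (%x. if s <= th x then g x else 0)" if "0 < s" for s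
   by (rule ibound[OF integrable_mult_right[OF cut_integrable[OF that], of D]]) (use D in "auto simp: abs_mult intro!: AE_I2 order_trans[OF b]")
  have s0: "0 < s" using s h t by linarith
  have ih: "IB (%x. D * ?r h x)"
  proof (rule integrable_mult_right, rule ibound[OF cut_integrable[OF half_gt_zero[OF t]]])
   show "AE x::real^'n in lborel. norm (?r h x) <= norm (if t / 2 <= th x then pw sg ee x else 0)"
    using h by (intro AE_I2) auto
  qed measurable
  let ?g = "%x. (if s <= th x then g x else 0) - (if t <= th x then g x else 0)"
  have I0: "0 <= (LBINT x. ?r h x)" by (intro integral_nonneg_AE AE_I2) auto
  have "abs (LBINT x. ?g x) <= (LBINT x. D * ?r h x)"
   by (rule order_trans[OF integral_abs_bound], intro integral_mono integrable_abs ih integrable_sub ci s0 t) (use s b D in auto)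
  hence "?c * abs (LBINT x. ?g x) <= ?c * (D * (LBINT x. ?r h x))" using C_N_pos by (intro mult_left_mono) auto
  also have "... <= C * (LBINT x. ?r h x)" using I0 by (simp add: C_def distrib_right)
  also have "... < C * (e / C)" using h(3) C by (intro mult_strict_left_mono) auto
  finally show "abs (?c * (LBINT x. (if s <= th x then g x else 0)) - ?c * (LBINT x. (if t <= th x then g x else 0))) < e"
   using ci[OF s0] ci[OF t] C C_N_pos by (simp add: right_diff_distrib[symmetric] abs_mult)
 qed
qed

text \<open>After division by dl the gradient bound says that Phi of the j-th slope is the discrete
  flux at dl j, up to 1/(k + 1). For grid points near t and large k these fluxes are all close to q
  t, hence the slopes to \<open>Pinv (q t)\<close>; summing them over the cells between two points
  and letting k grow gives the derivative.\<close>

lemma U_deriv: assumes t: "0 < t" shows "(U hasd Pinv (q t)) (at t)"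
proof -
 obtain D where D: "0 <= D" "!!x. abs (Y x) <= D * pw sg ee x" "!!k x. abs (Yk k x) <= D * pw sg ee x" by (rule Y_bound) blast
 define qk where "qk k s = C_N CARD('n) * (LBINT x. (if s <= th x then Yk k x else 0))" for k s
 have qlim: "(%k. qk k t) ----> q t"
  unfolding qk_def q_def
 proof (intro tendsto_mult tendsto_const integral_dominated_convergence[OF _ _ integrable_mult_right[OF cut_integrable[OF t], of D]])
  show "AE x in lborel. (%k. if t <= th x then Yk k x else 0) ----> (if t <= th x then Y x else 0)"
   using Yk_lim by (intro AE_I2) auto
  show "AE x in lborel. norm (if t <= th x then Yk k x else 0) <= D * (if t <= th x then pw sg ee x else 0)" for k
   using D by (intro AE_I2) auto
 qed measurable
 have flux: "abs (Phi (d k j) - qk k (dl k * real j)) <= 1 / (real k + 1)" if j: "j : {1..n k}" for k j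
 proof -
  have eq: "(if j <= ix (dl k) (n k) x then Q0 x * f (uk k x) else 0) = (if dl k * real j <= th x then Q0 x * f (uk k x) else 0)" for x :: "real^'n"
  proof (cases "x = 0")
   case False
   have "j <= ix (dl k) (n k) x \<longleftrightarrow> real j <= th x / dl k"
   proof -
    have "0 <= th x / dl k" using theta_pos[OF False] dl(1)[of k] by simp
    thus ?thesis using j unfolding ix_def by (simp add: le_nat_iff le_floor_iff)
   qed
   thus ?thesis using dl(1)[of k] by (simp add: le_divide_eq mult.commute)
  qed (simp add: Q0_def)
  have "gg (dl k) (n k) (Km (dl k) (n k)) (d k) j = dl k * (Phi (d k j) - qk k (dl k * real j))"
  proof -
   have e: "log_conv (Hk k) x * (if b then Q0 x * f (uk k x) else 0) = (if b then Yk k x else 0)" for b x by (simp add: Yk_def)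
   show ?thesis unfolding gg_def qk_def using step_VV_sum[OF dl(1)[of k], where G=f and j=j and n="n k" and d="d k"] f_zero[of 0] j
    by (simp add: eq e right_diff_distrib)
  qed
  hence "dl k * abs (Phi (d k j) - qk k (dl k * real j)) <= dl k * (1 / (real k + 1))" using g[OF j] dl(1)[of k] by (simp add: abs_mult)
  thus ?thesis using dl(1)[of k] by (simp only: mult_le_cancel_left_pos)
 qed
 define c where "c = Pinv (q t)"
 have "EX de>0. ALL y. norm (y - t) < de --> norm (U y - U t - (y - t) * c) <= e * norm (y - t)" if e: "0 < e" for e
 proof -
  have "isCont Pinv (q t)" using Pinv_cont by (simp add: continuous_on_eq_continuous_at)
  then obtain z where z: "0 < z" "!!y. abs (y - q t) < z ==> abs (Pinv y - c) < e"
   unfolding continuous_at_eps_delta dist_real_def c_def using e by blast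
  obtain h where h: "0 < h" "h <= t / 2" and R: "!!g s. g : BM ==> (!!x. abs (g x) <= D * pw sg ee x) ==> abs (s - t) <= h ==>
   abs (C_N CARD('n) * (LBINT x. (if s <= th x then g x else 0)) - C_N CARD('n) * (LBINT x. (if t <= th x then g x else 0))) < z / 3"
   by (rule flux_modulus[OF t _ D(1), of "z / 3"]) (use z in auto)
  have ring: "abs (qk k s - qk k t) < z / 3" if s: "abs (s - t) <= h" for k s
   unfolding qk_def by (rule R[OF _ D(3) s]) measurable
  have "EV k. abs (qk k t - q t) < z / 3 & 1 / (real k + 1) < z / 3"
  proof (rule eventually_conj)
   show "EV k. abs (qk k t - q t) < z / 3" using tendstoD[OF qlim, of "z / 3"] z by (simp add: dist_real_def)
   show "EV k. 1 / (real k + 1) < z / 3"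
    using LIMSEQ_inverse_real_of_nat z order_tendstoD(2)[of "%k. inverse (real (Suc k))" 0 sequentially "z / 3"] by (simp add: inverse_eq_divide add.commute)
  qed
  hence slope: "EV k. ALL j:{1..n k}. abs (dl k * real j - t) <= h --> abs (d k j - c) < e"
  proof eventually_elim
   case (elim k)
   show ?case
   proof (intro ballI impI)
    fix j assume j: "j : {1..n k}" "abs (dl k * real j - t) <= h"
    have "abs (Phi (d k j) - q t) < z" using flux[OF j(1)] ring[OF j(2), of k] elim by linarith
    from z(2)[OF this] show "abs (d k j - c) < e" by (simp add: Pinv_Phi)
   qed
  qed
  \<comment> \<open>The increment minus its linear prediction telescopes over the cells between s
    and y, each of which contributes at most e times its width.\<close>
  have two: "abs (U y - U s - (y - s) * c) <= e * (y - s)" if sy: "t - h < s" "s <= y" "y < t + h" for s y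
  proof -
   have s0: "0 < s" "0 < y" using sy h t by auto
   let ?i = "%k w. min (n k) (nat \<lfloor>w / dl k\<rfloor>)"
   have ilim: "(%k. dl k * real (?i k w)) ----> w" if "0 < w" for w
   proof (rule tendsto_sandwich[OF _ _ _ tendsto_const])
    show "EV k. dl k * real (?i k w) <= w"
    proof (intro always_eventually allI)
     fix k
     have "0 <= w / dl k" using that dl(1)[of k] by simp
     hence "real (?i k w) <= w / dl k" by linarith
     thus "dl k * real (?i k w) <= w" using dl(1)[of k] by (simp add: le_divide_eq mult.commute)
    qed
    have "EV k. w <= dl k * real (n k)" using dl(3) by (simp add: filterlim_at_top)
    thus "EV k. w - dl k <= dl k * real (?i k w)"
    proof eventually_elim
     case (elim k)
     have "w / dl k <= real (n k)" using elim dl(1)[of k] by (simp add: divide_le_eq mult.commute)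
     hence "w / dl k - 1 <= real (?i k w)" by linarith
     hence "dl k * (w / dl k - 1) <= dl k * real (?i k w)" using dl(1)[of k] by (intro mult_left_mono) auto
     thus ?case using dl(1)[of k] by (simp add: right_diff_distrib)
    qed
    show "(%k. w - dl k) ----> w" using tendsto_diff[OF tendsto_const dl(2), of w] by simp
   qed
   have "EV k. abs (Ut (dl k) (n k) (d k) y - Ut (dl k) (n k) (d k) s - (dl k * real (?i k y) - dl k * real (?i k s)) * c)
     <= e * (dl k * real (?i k y) - dl k * real (?i k s))"
    using slope
   proof eventually_elim
    case (elim k)
    define i1 where "i1 = ?i k s"
    define i2 where "i2 = ?i k y"
    have le: "i1 <= i2" unfolding i1_def i2_def using sy dl(1)[of k] by (intro min.mono nat_mono floor_mono divide_right_mono) auto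
    have "Ut (dl k) (n k) (d k) y - Ut (dl k) (n k) (d k) s - (dl k * real i2 - dl k * real i1) * c
     = (SUM j:{Suc i1..i2}. (US (dl k) (d k) j - c * (dl k * real j)) - (US (dl k) (d k) (j - 1) - c * (dl k * real (j - 1))))"
     unfolding sum_telescope''[OF le, of "%j. US (dl k) (d k) j - c * (dl k * real j)"] unfolding Ut_def i1_def i2_def by (simp add: algebra_simps)
    also have "... = (SUM j:{Suc i1..i2}. dl k * (d k j - c))"
     using US_Suc[of _ "dl k" "d k"] by (intro sum.cong refl) (auto simp: of_nat_diff algebra_simps)
    also have "abs (...) <= (SUM j:{Suc i1..i2}. dl k * e)"
    proof (intro order_trans[OF sum_abs] sum_mono)
     fix j assume j: "j : {Suc i1..i2}"
     have y0: "0 <= y / dl k" using s0 dl(1)[of k] by simp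
     have jn: "j : {1..n k}" using j by (auto simp: i2_def)
     have "real j <= y / dl k" using j y0 unfolding i2_def by (auto simp: le_nat_iff le_floor_iff)
     moreover have "s / dl k <= real j"
     proof -
      have "i1 < n k" using j jn by auto
      hence "i1 = nat \<lfloor>s / dl k\<rfloor>" by (auto simp: i1_def)
      thus ?thesis using j by (simp add: Suc_le_eq) linarith
     qed
     ultimately have "s <= dl k * real j" "dl k * real j <= y" using dl(1)[of k] by (simp_all add: le_divide_eq divide_le_eq mult.commute)
     hence "abs (dl k * real j - t) <= h" using sy by linarith
     hence "abs (d k j - c) <= e" using elim jn by auto
     thus "abs (dl k * (d k j - c)) <= dl k * e" using dl(1)[of k] by (simp add: abs_mult)
    qed
    also have "... = e * (dl k * real i2 - dl k * real i1)" using le by (simp add: of_nat_diff algebra_simps)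
    finally show ?case unfolding i1_def i2_def .
   qed
   moreover have "(%k. abs (Ut (dl k) (n k) (d k) y - Ut (dl k) (n k) (d k) s - (dl k * real (?i k y) - dl k * real (?i k s)) * c)) ----> abs (U y - U s - (y - s) * c)"
    by (intro tendsto_intros Ulim ilim s0)
   moreover have "(%k. e * (dl k * real (?i k y) - dl k * real (?i k s))) ----> e * (y - s)" by (intro tendsto_intros ilim s0)
   ultimately show ?thesis by (intro tendsto_le[OF trivial_limit_sequentially])
  qed
  show ?thesis
  proof (intro exI[of _ h] conjI allI impI)
   fix y assume y: "norm (y - t) < h"
   have "abs (U y - U t - (y - t) * c) <= e * abs (y - t)"
   proof (cases "t <= y")
    case True
    thus ?thesis using two[of t y] y h by simp
   next
    case False
    hence "abs (U t - U y - (t - y) * c) <= e * (t - y)" using y h by (intro two) auto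
    moreover have "U y - U t - (y - t) * c = - (U t - U y - (t - y) * c)" by (simp add: algebra_simps)
    moreover have "abs (y - t) = t - y" using False by simp
    ultimately show ?thesis by (simp only: abs_minus_cancel)
   qed
   thus "norm (U y - U t - (y - t) * c) <= e * norm (y - t)" by simp
  qed (rule h)
 qed
 hence "(U has_derivative (%x. x * c)) (at t)" unfolding has_derivative_at_alt by (auto simp: bounded_linear_mult_left)
 thus ?thesis unfolding c_def has_field_derivative_def by (simp add: mult.commute[of _ "Pinv (q t)"])
qed


section \<open>Sign and positivity of the limit profile\<close>

text \<open>Testing with the slopes of min 0 U: f vanishes at nonpositive arguments, so the nonlocal
  term disappears, and the energy of the negative part is bounded by a pairing that tends to
  0.\<close>

lemma U_nonneg: assumes t: "0 < t" shows "0 <= U t"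
proof -
 let ?n = "CARD('n)"
 let ?g = "%k. gg (dl k) (n k) (Km (dl k) (n k)) (d k)"
 define W where "W k = (SUM j:{1..n k}. abs (?g k j * d k j))" for k
 define w where "w k j = min 0 (US (dl k) (d k) j)" for k j
 have EW: "dl k * (SUM j:{1..n k}. abs ((w k j - w k (j - 1)) / dl k) ^ ?n) <= W k" for k
 proof -
  define h where "h j = (w k j - w k (j - 1)) / dl k" for j
  have Uh: "US (dl k) h i = w k i" for i
  proof (induction i)
   case (Suc i)
   have "US (dl k) h (Suc i) = US (dl k) h i + dl k * h (Suc i)" using US_Suc[of "Suc i" "dl k" h] by simp
   also have "dl k * h (Suc i) = w k (Suc i) - w k i" using dl(1)[of k] by (simp add: h_def)
   finally show ?case using Suc by simp
  qed (simp add: US_0 w_def)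
  have fw: "f (US (dl k) (d k) i) * w k i = 0" for i using f_zero by (simp add: w_def min_def)
  have hd: "abs (h j) <= abs (d k j) & abs (h j) ^ ?n <= Phi (d k j) * h j" if j: "j : {1..n k}" for j
  proof -
   define X where "X = US (dl k) (d k) (j - 1)"
   have dj: "d k j = (US (dl k) (d k) j - X) / dl k" using US_Suc[of j "dl k" "d k"] j dl(1)[of k] by (simp add: X_def)
   have "0 <= h j & h j <= d k j | d k j <= h j & h j <= 0"
   proof (cases "X <= US (dl k) (d k) j")
    case True
    thus ?thesis unfolding h_def w_def X_def[symmetric] dj using dl(1)[of k]
     by (intro disjI1 conjI divide_nonneg_nonneg divide_right_mono) auto
   next
    case False
    thus ?thesis unfolding h_def w_def X_def[symmetric] dj using dl(1)[of k]
     by (intro disjI2 conjI divide_nonpos_pos divide_right_mono) auto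
   qed
   hence s: "abs (h j) <= abs (d k j)" "0 <= d k j * h j" by (auto simp: zero_le_mult_iff)
   have "abs (h j) ^ ?n = abs (Phi (h j)) * abs (h j)" unfolding abs_mult[symmetric] Phi_mult by simp
   also have "... <= abs (Phi (d k j)) * abs (h j)"
    unfolding Phi_def abs_mult power_abs abs_abs using s(1) by (intro mult_right_mono mult_mono power_mono) auto
   also have "... = Phi (d k j) * h j"
    unfolding abs_mult[symmetric] using s(2) mult_nonneg_nonneg[OF s(2), of "abs (d k j) ^ (?n - 2)"] by (simp add: Phi_def mult_ac)
   finally show ?thesis using s(1) by simp
  qed
  have "dl k * (SUM j:{1..n k}. abs (h j) ^ ?n) <= dl k * (SUM j:{1..n k}. Phi (d k j) * h j)"
   using hd dl(1)[of k] by (intro mult_left_mono sum_mono) auto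
  also have "... = (SUM j:{1..n k}. ?g k j * h j)"
  proof -
   have "(SUM i:{1..n k}. f (US (dl k) (d k) i) * VV (dl k) (n k) (Km (dl k) (n k)) (d k) i * w k i) = 0"
    using fw by (intro sum.neutral) auto
   thus ?thesis unfolding gg_pairing Uh by simp
  qed
  also have "... <= W k" unfolding W_def
  proof (rule sum_mono)
   fix j assume "j : {1..n k}"
   hence "abs (?g k j) * abs (h j) <= abs (?g k j) * abs (d k j)" using hd by (intro mult_left_mono) auto
   thus "?g k j * h j <= abs (?g k j * d k j)" unfolding abs_mult[symmetric] by linarith
  qed
  finally show ?thesis unfolding h_def .
 qed
 have "abs (min 0 (Ut (dl k) (n k) (d k) t)) ^ ?n <= t ^ (?n - 1) * W k" for k
 proof -
  let ?i = "min (n k) (nat \<lfloor>t / dl k\<rfloor>)"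
  have "0 <= t / dl k" using t dl(1)[of k] by simp
  hence "real ?i <= t / dl k" by linarith
  hence it: "dl k * real (?i - 0) <= t" using dl(1)[of k] by (simp add: le_divide_eq mult.commute)
  have "abs (w k ?i - w k 0) ^ ?n <= (dl k * real (?i - 0)) ^ (?n - 1) * (dl k * (SUM j:{1..n k}. abs ((w k j - w k (j - 1)) / dl k) ^ ?n))"
   by (rule discrete_hoelder[OF dl(1)]) auto
  also have "... <= t ^ (?n - 1) * W k"
   using it EW[of k] dl(1)[of k] t by (intro mult_mono power_mono mult_nonneg_nonneg sum_nonneg) auto
  finally show ?thesis by (simp add: w_def US_0 Ut_def)
 qed
 moreover have "(%k. abs (min 0 (Ut (dl k) (n k) (d k) t)) ^ ?n) ----> abs (min 0 (U t)) ^ ?n"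
  by (intro tendsto_intros Ulim t)
 moreover have "(%k. t ^ (?n - 1) * W k) ----> t ^ (?n - 1) * 0" unfolding W_def by (intro tendsto_intros gd)
 ultimately have "abs (min 0 (U t)) ^ ?n <= 0" by (intro tendsto_le[OF trivial_limit_sequentially, of "%k. t ^ (?n - 1) * W k"]) auto
 hence "abs (min 0 (U t)) ^ ?n = 0" by (intro antisym) auto
 hence "min 0 (U t) = 0" using N2 by simp
 thus ?thesis by (simp add: min_def split: if_splits)
qed

lemma ball_cut:
 assumes "0 < r" shows "AE x in lborel. (if tt r <= th x then G x else 0) = iB r x * (G x :: real)"
proof -
 have "(if tt r <= th x then G x else 0) = iB r x * G x" if "norm x ~= 0" for x :: "real^'n"
 proof (cases "norm x <= r")
  case True
  thus ?thesis using tt_le[of "norm x" r] that by (simp add: th_def)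
 next
  case False
  thus ?thesis using tt_less[OF assms, of "norm x"] by (simp add: th_def)
 qed
 thus ?thesis by (rule eventually_mono[OF AE_norm_neq[of 0]])
qed

text \<open>Mass of |Y| in balls. It bounds the flux and, unlike the flux, is monotone in the
  radius.\<close>

definition Mb :: "real => real" where "Mb r = (LBINT x. iB r x * abs (Y x))"

lemma Y_ball: assumes "0 < r" shows "IB (%x. iB r x * abs (Y x))" "IB (%x. iB r x * Y x)"
proof -
 obtain D where D: "0 <= D" "!!x. abs (Y x) <= D * pw sg ee x" by (rule Y_bound) blast
 have i: "IB (%x::real^'n. D * (iB r x * pw sg ee x))"
  using assms by (intro integrable_mult_right integral_pw_cball_le(1)[OF sg ee_facts(1)]) simp
 have b: "norm (iB r x * Y x) <= norm (D * (iB r x * pw sg ee x))" for x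
  using D(2)[of x] D(1) by (simp add: indicator_def)
 show "IB (%x. iB r x * Y x)"
  by (rule ibound[OF i _ AE_I2[OF b]]) (intro borel_measurable_times borel_measurable_indicator; simp)
 from integrable_abs[OF this] show "IB (%x. iB r x * abs (Y x))" by (simp add: abs_mult)
qed

lemma q_tt: assumes "0 < r" shows "q (tt r) = C_N CARD('n) * (LBINT x. iB r x * Y x)" "abs (q (tt r)) <= C_N CARD('n) * Mb r"
proof -
 have im: "(%x. iB r x * Y x) : borel_measurable lborel" using Y_ball(2)[OF assms] by (rule borel_measurable_integrable)
 have m: "(%x. if tt r <= th x then Y x else 0) : borel_measurable lborel" by measurable
 show e: "q (tt r) = C_N CARD('n) * (LBINT x. iB r x * Y x)"
  unfolding q_def integral_cong_AE[OF m im ball_cut[OF assms]] ..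
 have "abs (LBINT x. iB r x * Y x) <= Mb r"
  unfolding Mb_def using integral_abs_bound[of lborel "%x. iB r x * Y x"] by (simp add: abs_mult)
 thus "abs (q (tt r)) <= C_N CARD('n) * Mb r" unfolding e abs_mult using C_N_pos by (simp add: mult_left_mono)
qed

lemma Mb_bound: obtains Cm where "0 <= Cm" "!!r. 0 < r ==> 0 <= Mb r & Mb r <= Cm * (if r <= 1 then r powr sg else r powr ee)"
proof -
 obtain D where D: "0 <= D" "!!x. abs (Y x) <= D * pw sg ee x" by (rule Y_bound) blast
 define Cm where "Cm = D * (om * (1 / sg + 1 / ee))"
 have s: "0 < om" "0 <= 1 / sg" "0 <= 1 / ee" using w_facts sg ee_facts by auto
 show ?thesis
 proof (rule that[of Cm])
  show "0 <= Cm" unfolding Cm_def using D s by simp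
  fix r :: real assume r: "0 < r"
  have "Mb r <= (LBINT x. D * (iB r x * pw sg ee (x::real^'n)))"
   unfolding Mb_def using D r
   by (intro integral_mono Y_ball integrable_mult_right integral_pw_cball_le(1)[OF sg ee_facts(1)]) (auto simp: indicator_def)
  also have "... = D * (LBINT x. iB r x * pw sg ee (x::real^'n))" by simp
  also have "... <= D * (if r <= 1 then om * r powr sg / sg else om * (1 / sg + 1 / ee) * r powr ee)"
   unfolding om_def using D r by (intro mult_left_mono integral_pw_cball_le(2)[OF sg ee_facts(1)]) auto
  also have "... <= D * ((om * (1 / sg + 1 / ee)) * (if r <= 1 then r powr sg else r powr ee))"
  proof (rule mult_left_mono[OF _ D(1)])
   have "om * r powr sg * (1 / sg) <= om * r powr sg * (1 / sg + 1 / ee)" using s by (intro mult_left_mono) auto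
   thus "(if r <= 1 then om * r powr sg / sg else om * (1 / sg + 1 / ee) * r powr ee) <= (om * (1 / sg + 1 / ee)) * (if r <= 1 then r powr sg else r powr ee)"
    by (simp add: mult_ac)
  qed
  finally have "Mb r <= Cm * (if r <= 1 then r powr sg else r powr ee)" by (simp only: Cm_def mult.assoc)
  moreover have "0 <= Mb r" unfolding Mb_def by (intro integral_nonneg_AE AE_I2) (simp add: indicator_def)
  ultimately show "0 <= Mb r & Mb r <= Cm * (if r <= 1 then r powr sg else r powr ee)" by simp
 qed
qed

lemma q_cont: "continuous_on {0<..} q"
proof -
 obtain D where D: "0 <= D" "!!x. abs (Y x) <= D * pw sg ee x" by (rule Y_bound) blast
 have "EX h>0. ALL s. abs (s - t) < h --> abs (q s - q t) < e" if te: "0 < t" "0 < e" for t e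
 proof -
  obtain h where h: "0 < h" "!!g s. g : BM ==> (!!x. abs (g x) <= D * pw sg ee x) ==> abs (s - t) <= h ==>
   abs (C_N CARD('n) * (LBINT x. (if s <= th x then g x else 0)) - C_N CARD('n) * (LBINT x. (if t <= th x then g x else 0))) < e"
   by (rule flux_modulus[OF te D(1)]) auto
  have "abs (q s - q t) < e" if "abs (s - t) < h" for s
   unfolding q_def by (rule h(2)[OF Y_meas(1) D(2) less_imp_le[OF that]])
  thus ?thesis using h(1) by blast
 qed
 thus ?thesis unfolding continuous_on_iff dist_real_def by (metis greaterThan_iff)
qed

lemma U_cont: "0 < t ==> isCont U t" by (rule DERIV_isCont[OF U_deriv])

text \<open>The zero set is closed in the half-line; it must be open as well. At a zero t1 the slope
  vanishes, so q t1 = 0. With m the maximum of U near t1, the flux nearby is at most C m^(p-1),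
  since only a thin shell contributes, and the slope at most a multiple of m^((p-1)/(N-1)) <= m, as
  p > N and m <= 1. On a short interval this yields m <= m/2.\<close>

lemma U_pos: assumes "0 < t0" shows "0 < U t0"
proof (rule ccontr)
 let ?c = "C_N CARD('n)"
 define Z where "Z = {t. 0 < t & U t = 0}"
 assume "~ 0 < U t0"
 hence Z0: "t0 : Z" using U_nonneg[OF assms] assms by (auto simp: Z_def)
 have c: "continuous_on {0<..} U" by (simp add: continuous_on_eq_continuous_at U_cont)
 have "open {t. 0 < t & U t ~= 0}"
 proof -
  have "open (U -` (- {0}) Int {0<..})" by (rule continuous_on_open_vimage[THEN iffD1, rule_format, OF _ c]) auto
  moreover have "U -` (- {0}) Int {0<..} = {t. 0 < t & U t ~= 0}" by auto
  ultimately show ?thesis by simp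
 qed
 moreover have "open Z" unfolding open_dist
 proof
  fix t1 assume "t1 : Z"
  hence t1: "0 < t1" "U t1 = 0" by (auto simp: Z_def)
  obtain K1 where K1: "0 <= K1" "!!tz v rh. 0 < tz ==> 0 <= rh ==> v <= rh * tz powr (1 / N')
   ==> f v <= K1 * rh powr (p - 1) * (tz powr ((p - 1) / N') * exp ((al0 + 1) * rh powr N' * tz))" by (rule f_small) blast
  define K2 where "K2 = K1 * exp (al0 + 1)"
  have fK: "f v <= K2 * m powr (p - 1)" if "v <= m" "0 <= m" "m <= 1" for v m
  proof -
   have "f v <= K1 * m powr (p - 1) * (1 powr ((p - 1) / N') * exp ((al0 + 1) * m powr N' * 1))" using that by (intro K1(2)) auto
   also have "... <= K1 * m powr (p - 1) * (1 * exp ((al0 + 1) * 1))"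
    using that K1 alpha0 N_facts(3) powr_le1[of N' m] by (intro mult_left_mono iffD2[OF exp_le_cancel_iff] mult_mono) (auto simp: mult_le_cancel_left1)
   finally show ?thesis by (simp add: K2_def mult_ac)
  qed
  obtain D where D: "0 <= D" "!!x. abs (log_conv H x) <= D * (1 + norm x) powr (- e2 / 2)" by (rule Y_bound) blast
  obtain R where R: "0 < R" "!!x::real^'n. x ~= 0 ==> t1 / 2 <= th x ==> norm x <= R" by (rule tt_small[OF half_gt_zero[OF t1(1)]]) blast
  obtain M where M: "0 <= M" "!!r. 0 < r ==> r <= 1 ==> Q r <= M * r powr b0" "!!r. 1 <= r ==> Q r <= M * r powr b" by (rule Q_bound) blast
  define Mq where "Mq = M * (1 + R) powr (abs b)"
  have Mq: "Q0 x <= Mq" if "norm x <= R" for x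
  proof (cases "x = 0")
   case False
   have R1: "1 <= (1 + R) powr (abs b)" using R by (simp add: ge_one_powr_ge_zero)
   show ?thesis
   proof (cases "norm x <= 1")
    case True
    have "norm x powr b0 <= 1" using True False b0 by (simp add: powr_le1)
    hence "M * norm x powr b0 <= M * (1 + R) powr (abs b)" using R1 M(1) by (intro mult_left_mono) auto
    thus ?thesis using M(2)[of "norm x"] False True by (simp add: Q0_def Mq_def)
   next
    case f: False
    have "norm x powr b <= norm x powr (abs b)" using f by (intro powr_mono) auto
    also have "... <= (1 + R) powr (abs b)" using that by (intro powr_mono2) auto
    finally have "M * norm x powr b <= M * (1 + R) powr (abs b)" using M(1) by (intro mult_left_mono) auto
    thus ?thesis using M(3)[of "norm x"] False f by (simp add: Q0_def Mq_def)
   qed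
  qed (use M(1) R in "simp add: Q0_def Mq_def")
  define G where "G = D * (1 + R) powr (- e2 / 2) * Mq * K2"
  define C where "C = ?c * ((G) * measure lborel (cball 0 R :: (real^'n) set)) + 1"
  have C0: "0 <= G" using D M K1 by (simp add: G_def Mq_def K2_def)
  have C: "1 <= C" using C0 C_N_pos by (simp add: C_def)
  \<comment> \<open>Short enough that the slope bound times the length is at most m/2.\<close>
  define h where "h = min (t1 / 2) (1 / (2 * C powr iN))"
  have h: "0 < h" "h <= t1 / 2" "h * C powr iN <= 1 / 2"
  proof -
   have c: "0 < C powr iN" using C by simp
   show "0 < h" "h <= t1 / 2" using t1 c by (auto simp: h_def)
   have "h * C powr iN <= 1 / (2 * C powr iN) * C powr iN" using c by (intro mult_right_mono) (auto simp: h_def)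
   thus "h * C powr iN <= 1 / 2" using c by simp
  qed
  obtain h1 where h1: "0 < h1" "!!t. abs (t - t1) < h1 ==> U t < 1"
  proof -
   have "isCont U t1" by (rule U_cont[OF t1(1)])
   then obtain h1 where "0 < h1" "!!t. abs (t - t1) < h1 ==> abs (U t - U t1) < 1" unfolding continuous_at_eps_delta dist_real_def using zero_less_one by blast
   thus ?thesis using that t1(2) by (metis abs_ge_self diff_zero le_less_trans)
  qed
  define h2 where "h2 = min h (h1 / 2)"
  have h2: "0 < h2" "h2 <= h" "h2 < h1" using h h1 by (auto simp: h2_def)
  have pos: "0 < t" if "abs (t - t1) <= h2" for t using that h h2 t1 by linarith
  have "continuous_on {t1 - h2..t1 + h2} U" by (rule continuous_on_subset[OF c]) (use h h2 t1 in auto)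
  then obtain ts where ts: "ts : {t1 - h2..t1 + h2}" "!!t. t : {t1 - h2..t1 + h2} ==> U t <= U ts"
   using continuous_attains_sup[of "{t1 - h2..t1 + h2}" U] h2 by auto
  have ts': "abs (ts - t1) <= h2" using ts(1) by auto
  define m where "m = U ts"
  have m: "0 <= m" "m <= 1" "!!t. abs (t - t1) <= h2 ==> U t <= m"
   using U_nonneg[OF pos[OF ts']] h1(2)[of ts] ts' h2 ts(2) by (auto simp: m_def abs_le_iff)
  have q0: "q t1 = 0"
  proof -
   have "ALL y. abs (t1 - y) < t1 --> U t1 <= U y" using U_nonneg t1 by (auto simp: abs_less_iff)
   hence "Pinv (q t1) = 0" by (rule DERIV_local_min[OF U_deriv[OF t1(1)] t1(1)])
   thus ?thesis using Phi_Pinv[of "q t1"] by (simp add: Phi_def)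
  qed
  have qs: "abs (q t) <= C * m powr (p - 1)" if t: "abs (t - t1) <= h2" for t
  proof -
   obtain D' where D': "0 <= D'" "!!x. abs (Y x) <= D' * pw sg ee x" by (rule Y_bound) blast
   have ci: "IB (%x. if s <= th x then Y x else 0)" if "0 < s" for s
    by (rule ibound[OF integrable_mult_right[OF cut_integrable[OF that], of D']]) (use D' in "auto simp: abs_mult intro!: AE_I2 order_trans[OF D'(2)]")
   let ?G = "%x. (if t <= th x then Y x else 0) - (if t1 <= th x then Y x else 0)"
   define c where "c = G * m powr (p - 1)"
   have "abs (?G x) <= c * iB R x" if "norm x ~= 0" for x
   proof (cases "abs (th x - t1) <= h2")
    case True
    hence "t1 / 2 <= th x" using h h2 by linarith
    hence xR: "norm x <= R" using that by (intro R(2)) auto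
    have "abs (log_conv H x) <= D * (1 + R) powr (- e2 / 2)"
     using D(1) e2_neg xR by (intro order_trans[OF D(2)] mult_left_mono powr_mono2) auto
    moreover have "Q0 x * f (u x) <= Mq * (K2 * m powr (p - 1))"
     using Mq[OF xR] fK[OF m(3)[OF True] m(1,2)] f_nonneg[of "u x"] M(1) by (intro mult_mono) (auto simp: Mq_def)
    ultimately have "abs (Y x) <= (D * (1 + R) powr (- e2 / 2)) * (Mq * (K2 * m powr (p - 1)))"
     unfolding Y_def abs_mult[of "log_conv H x"] using D(1) f_nonneg[of "u x"] by (intro mult_mono) auto
    moreover have "abs (?G x) <= abs (Y x)" by auto
    ultimately show ?thesis using xR by (simp add: c_def G_def mult.assoc)
   next
    case False
    hence "?G x = 0" using t by auto
    thus ?thesis using C0 by (simp add: c_def)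
   qed
   hence ae: "AE x in lborel. abs (?G x) <= c * iB R x"
    by (rule eventually_mono[OF AE_norm_neq[of 0]])
   have fin: "emeasure lborel (cball 0 R :: (real^'n) set) < \<infinity>" by (rule emeasure_bounded_finite) simp
   have "q t = q t - q t1" using q0 by simp
   also have "... = ?c * (LBINT x. ?G x)" unfolding q_def using ci[OF pos[OF t]] ci[OF t1(1)] by (simp add: right_diff_distrib)
   finally have "abs (q t) = ?c * abs (LBINT x. ?G x)" using C_N_pos by (simp add: abs_mult)
   also have "... <= ?c * (\<integral>x. c * iB R x \<partial>(lborel :: (real^'n) measure))"
    using C_N_pos fin pos[OF t] t1 by (intro mult_left_mono order_trans[OF integral_abs_bound] integral_mono_AE ae integrable_abs integrable_sub ci integrable_mult_right integrable_real_indicator) auto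
   also have "... = (C - 1) * m powr (p - 1)" by (simp add: c_def C_def)
   also have "... <= C * m powr (p - 1)" by (intro mult_right_mono) auto
   finally show ?thesis .
  qed
  have sl: "abs (Pinv (q t)) <= C powr iN * m" if "abs (t - t1) <= h2" for t
  proof -
   have N1: "0 < 1 / (N - 1)" using N_ge by simp
   have "abs (Pinv (q t)) <= abs (q t) powr iN" by (simp add: Pinv_def abs_mult abs_sgn_eq)
   also have "... <= (C * m powr (p - 1)) powr iN" using qs[OF that] N1 by (intro powr_mono2) auto
   also have "... = C powr iN * m powr ((p - 1) / (N - 1))" using C by (simp add: powr_mult powr_powr)
   also have "m powr ((p - 1) / (N - 1)) <= m powr 1"
    by (rule powr_mono'[OF _ m(1,2)]) (use p_facts(1) N_ge in simp)
   finally show ?thesis using C m by (simp add: mult_left_mono)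
  qed
  have "norm (U ts - U t1) <= C powr iN * m * norm (ts - t1)"
  proof (rule field_differentiable_bound[where S="{t1 - h2..t1 + h2}" and f'="%t. Pinv (q t)"])
   show "(U has_field_derivative Pinv (q z)) (at z within {t1 - h2..t1 + h2})" if "z : {t1 - h2..t1 + h2}" for z
    by (rule has_field_derivative_at_within, rule U_deriv, rule pos) (use that in auto)
   show "norm (Pinv (q z)) <= C powr iN * m" if "z : {t1 - h2..t1 + h2}" for z
    unfolding real_norm_def by (rule sl) (use that in auto)
  qed (use ts(1) h2(1) in auto)
  hence "abs (U ts - U t1) <= C powr iN * m * abs (ts - t1)" by simp
  also have "... <= C powr iN * m * h" using ts' h2 m by (intro mult_left_mono) auto
  also have "... = (h * C powr iN) * m" by (simp add: mult_ac)
  also have "... <= 1 / 2 * m" using h m by (intro mult_right_mono) auto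
  finally have "m = 0" using m t1 by (simp add: m_def)
  hence "y : Z" if "dist y t1 < h2" for y using m(3)[of y] U_nonneg[OF pos[of y]] pos[of y] that by (auto simp: Z_def dist_real_def)
  thus "EX e>0. ALL y. dist y t1 < e --> y : Z" using h2(1) by blast
 qed
 ultimately have "Z Int {0<..} = {} | {t. 0 < t & U t ~= 0} Int {0<..} = {}"
  by (intro connectedD[of "{0<..}"]) (auto simp: Z_def)
 moreover have "t0 : Z Int {0<..}" using Z0 assms by simp
 moreover obtain t where "0 < t" "0 < U t" using nontrivial by blast
 hence "t : {t. 0 < t & U t ~= 0} Int {0<..}" by simp
 ultimately show False by blast
qed

end

section \<open>Limits under a singular weight\<close>

lemmas AE_nz = AE_completion[OF AE_norm_neq[of 0]]

text \<open>Local L^1 convergence says nothing where W is unbounded, which may happen at the origin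
  and at infinity. On an annulus W is bounded, so the approximant \<open>ph m\<close> in the Cauchy
  estimate can be replaced by the limit; Fatou's lemma then exhausts the space by annuli.\<close>

lemma nn_integral_weight_limit:
 fixes W :: "real^'n => real" and ph :: "nat => real^'n => real"
 assumes [measurable]: "W : LM" "!!k. ph k : LM" "ph0 : LM"
  and W0: "!!x. 0 <= W x" and Wb: "!!j::nat. EX C. ALL x. 1 / (real j + 1) <= norm x & norm x <= real j + 1 --> W x <= C"
  and loc: "!!R k. 0 < R ==> IL (%x. iB R x * abs (ph k x - ph0 x))"
   "!!R. 0 < R ==> (%k. (LL x. iB R x * abs (ph k x - ph0 x))) ----> 0"
  and e: "!!m. (NL x. ennreal (W x * abs (ph k x - ph m x))) <= ennreal (e + c m)" and c: "c ----> 0" "0 <= e" "!!m. 0 <= c m"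
 shows "(NL x. ennreal (W x * abs (ph k x - ph0 x))) <= ennreal e"
proof -
 define K where "K j = {x::real^'n. 1 / (real j + 1) <= norm x & norm x <= real j + 1}" for j :: nat
 have [measurable]: "K j : sets lebesgue" for j
 proof -
  have "K j : sets borel" unfolding K_def by measurable
  thus ?thesis by simp
 qed
 have Kb: "(NL x. ennreal (ind (K j) x * (W x * abs (ph k x - ph0 x)))) <= ennreal e" for j
 proof -
  obtain C where C: "!!x. x : K j ==> W x <= C" using Wb[of j] by (auto simp: K_def)
  define R where "R = real j + 1"
  define a where "a m = (LL x. iB R x * abs (ph m x - ph0 x))" for m
  have R: "0 < R" by (simp add: R_def)
  have "(NL x. ennreal (ind (K j) x * (W x * abs (ph k x - ph0 x)))) <= ennreal (e + c m + abs C * a m)" for m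
  proof -
   have [measurable]: "(%x. iB R x * abs (ph m x - ph0 x)) : LM" using loc(1)[OF R] by (rule borel_measurable_integrable)
   have "(NL x. ennreal (ind (K j) x * (W x * abs (ph k x - ph0 x))))
    <= (NL x. ennreal (W x * abs (ph k x - ph m x)) + ennreal (abs C * (iB R x * abs (ph m x - ph0 x))))"
   proof (rule nn_integral_mono)
    fix x
    show "ennreal (ind (K j) x * (W x * abs (ph k x - ph0 x))) <= ennreal (W x * abs (ph k x - ph m x)) + ennreal (abs C * (iB R x * abs (ph m x - ph0 x)))"
    proof (cases "x : K j")
     case True
     have "W x * abs (ph k x - ph0 x) <= W x * abs (ph k x - ph m x) + W x * abs (ph m x - ph0 x)"
      unfolding distrib_left[symmetric] using W0 by (intro mult_left_mono) auto
     also have "W x * abs (ph m x - ph0 x) <= abs C * abs (ph m x - ph0 x)" using C[OF True] by (intro mult_right_mono) auto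
     finally have le: "W x * abs (ph k x - ph0 x) <= W x * abs (ph k x - ph m x) + abs C * abs (ph m x - ph0 x)" by simp
     have "x : cball 0 R" using True by (simp add: K_def R_def)
     thus ?thesis using True le W0[of x] by (simp add: ennreal_plus[symmetric] del: ennreal_plus)
    qed (use W0 in simp)
   qed
   also have "... = (NL x. ennreal (W x * abs (ph k x - ph m x))) + (NL x. ennreal (abs C * (iB R x * abs (ph m x - ph0 x))))"
    by (rule nn_integral_add) measurable
   also have "(NL x. ennreal (abs C * (iB R x * abs (ph m x - ph0 x)))) = ennreal (abs C * a m)"
    unfolding a_def by (subst nn_integral_eq_integral) (auto intro!: integrable_mult_right loc(1) R)
   also have "(NL x. ennreal (W x * abs (ph k x - ph m x))) + ennreal (abs C * a m) <= ennreal (e + c m) + ennreal (abs C * a m)"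
    by (rule add_right_mono[OF e])
   also have "... = ennreal (e + c m + abs C * a m)"
    using c(2) c(3)[of m] by (subst ennreal_plus) (auto simp: a_def intro!: mult_nonneg_nonneg integral_nonneg_AE)
   finally show ?thesis .
  qed
  moreover have "(%m. ennreal (e + c m + abs C * a m)) ----> ennreal (e + 0 + abs C * 0)"
   unfolding a_def by (intro tendsto_ennrealI tendsto_intros c loc(2) R)
  ultimately show ?thesis by (intro LIMSEQ_le_const) auto
 qed
 have "(NL x. ennreal (W x * abs (ph k x - ph0 x))) <= (NL x. liminf (%j. ennreal (ind (K j) x * (W x * abs (ph k x - ph0 x)))))"
 proof (rule nn_integral_mono_AE, rule eventually_mono[OF AE_nz])
  fix x :: "real^'n" assume x: "norm x ~= 0"
  obtain j0 :: nat where "max (norm x) (1 / norm x) < real j0" using reals_Archimedean2 by blast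
  hence j0: "norm x <= real j0" "1 / norm x <= real j0" by auto
  have "x : K j" if "j0 <= j" for j
  proof -
   have "real j0 <= real j" using that by simp
   hence "norm x <= real j + 1" "1 / norm x <= real j + 1" using j0 by linarith+
   moreover have "1 / (real j + 1) <= norm x" using calculation(2) x by (simp add: field_simps)
   ultimately show ?thesis by (simp add: K_def)
  qed
  hence "(%j. ennreal (ind (K j) x * (W x * abs (ph k x - ph0 x)))) ----> ennreal (W x * abs (ph k x - ph0 x))"
   by (intro tendsto_eventually) (auto simp: eventually_sequentially intro!: exI[of _ j0])
  from lim_imp_Liminf[OF _ this] show "ennreal (W x * abs (ph k x - ph0 x)) <= liminf (%j. ennreal (ind (K j) x * (W x * abs (ph k x - ph0 x))))" by simp
 qed
 also have "... <= liminf (%j. (NL x. ennreal (ind (K j) x * (W x * abs (ph k x - ph0 x)))))"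
  by (rule nn_integral_liminf) measurable
 also have "... <= ennreal e" by (rule Liminf_le) (use Kb in auto)
 finally show ?thesis .
qed

section \<open>The radial solution and its energy\<close>

context choquard
begin

lemma wt_bound: obtains Cw where "0 <= Cw" "!!r. 0 < r ==> r <= 1 ==> wt r <= Cw * r powr (- 1)" "!!r. 1 <= r ==> wt r <= Cw * r powr (- 1 - l / (N - 1))"
proof -
 define c where "c = l / (N - 1)"
 have c: "0 < c" using w_facts N_ge by (simp add: c_def)
 define m where "m = min r0 1"
 have m: "0 < m" "m <= 1" "m <= r0" using w_facts by (auto simp: m_def)
 have mc: "1 <= m powr (- c)" using m c powr_mono2'[of "- c" m 1] by simp
 show ?thesis
 proof (rule that[of "m powr (- c) / ka"])
  fix r :: real assume r: "0 < r" "r <= 1"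
  show "wt r <= m powr (- c) / ka * r powr (- 1)"
  proof (cases "r < r0")
   case True
   have "wt r <= 1 * (r powr (- 1) / ka)" using wt_near_0(1)[OF r(1) True] r by (simp add: powr_minus_divide mult.commute)
   also have "... <= m powr (- c) * (r powr (- 1) / ka)" using mc kappa_pos by (intro mult_right_mono) auto
   finally show ?thesis by (simp add: mult.commute)
  next
   case False
   have "r powr (- 1) * r powr (- c) = r powr (- 1 - l / (N - 1))" unfolding powr_add[symmetric] c_def by (simp only: add_uminus_conv_diff)
   hence "wt r <= r powr (- 1) * r powr (- c) / ka" using wt_le_inf[OF r(1)] by (simp only:)
   also have "... <= r powr (- 1) * m powr (- c) / ka" using False m c kappa_pos by (intro divide_right_mono mult_left_mono powr_mono2') auto
   finally show ?thesis by (simp only: times_divide_eq_left times_divide_eq_right mult.commute)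
  qed
 next
  fix r :: real assume r: "1 <= r"
  have "wt r <= 1 * (r powr (- 1 - l / (N - 1)) / ka)" using wt_le_inf[of r] r by simp
  also have "... <= m powr (- c) * (r powr (- 1 - l / (N - 1)) / ka)" using mc kappa_pos by (intro mult_right_mono) auto
  finally show "wt r <= m powr (- c) / ka * r powr (- 1 - l / (N - 1))" by simp
 qed (use kappa_pos in simp)
qed

lemma Phi_times: "Phi (x * y) = Phi x * Phi y" by (simp add: Phi_def abs_mult power_mult_distrib)

lemma Phi_pos: "0 <= x ==> Phi x = x ^ (CARD('n) - 1)"
proof -
 assume "0 <= x"
 moreover have "CARD('n) - 1 = Suc (CARD('n) - 2)" using N2 by simp
 ultimately show ?thesis by (simp add: Phi_def)
qed

lemma A_Phi_wt: "0 < r ==> A r * Phi (wt r) = 1 / (om * r ^ (CARD('n) - 1))"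
 using wt_rel[of r] w_facts wt_pos[of r] by (simp add: Phi_pos field_simps)

end

context choquard_limit
begin

text \<open>\<open>yd\<close> is the derivative of U(tt r) in r, and \<open>zd\<close> that of U(tt
  (sqrt s)) in s, the parameter used for radial approximation.\<close>

definition yd :: "real => real" where "yd r = - (Pinv (q (tt r)) * wt r)"
definition zd :: "real => real" where "zd s = yd (sqrt s) / (2 * sqrt s)"
text \<open>The mass inside the ball spread over its sphere; up to C_N it bounds A |grad
  u|^(N-1).\<close>

definition hw :: "real => real" where "hw r = Mb r / (om * r ^ (CARD('n) - 1))"
text \<open>Energy density of the radial field whose flux is \<open>Mb\<close>: \<open>hw\<close>
  times its slope. It dominates the energy density of the solution and is the dual term in Young's
  inequality.\<close>

definition Ew :: "real => real" where "Ew r = hw r * (Mb r powr iN * wt r)"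
text \<open>The limit profile says nothing about the origin; a positive value there keeps positivity
  pointwise without changing the class.\<close>

definition sol :: "real^'n => real" where "sol x = (if x = 0 then 1 else u x)"
definition gs :: "real^'n => real^'n" where "gs x = (2 * zd (x .* x)) *R x"

lemma Mb_nonneg: "0 <= Mb r" unfolding Mb_def by (intro integral_nonneg_AE AE_I2) (simp add: indicator_def)

lemma hw_nonneg: "0 < r ==> 0 <= hw r" using w_facts Mb_nonneg by (simp add: hw_def)

lemma abs_Pinv: "abs (Pinv y) = abs y powr iN" by (simp add: Pinv_def abs_mult abs_sgn_eq)

lemma yd_bound: "0 < r ==> abs (yd r) <= C_N CARD('n) powr iN * (Mb r powr iN * wt r)"
proof -
 assume r: "0 < r"
 have "abs (q (tt r)) powr iN <= (C_N CARD('n) * Mb r) powr iN"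
  using q_tt(2)[OF r] N_ge by (intro powr_mono2) auto
 also have "... = C_N CARD('n) powr iN * Mb r powr iN" using C_N_pos Mb_nonneg by (simp add: powr_mult)
 finally have "abs (Pinv (q (tt r))) * wt r <= C_N CARD('n) powr iN * Mb r powr iN * wt r"
  unfolding abs_Pinv using wt_pos[OF r] by (intro mult_right_mono) auto
 thus ?thesis using wt_pos[OF r] by (simp add: yd_def abs_mult mult.assoc)
qed

lemma A_Phi_yd: "0 < r ==> A r * Phi (yd r) = - (q (tt r) / (om * r ^ (CARD('n) - 1)))"
proof -
 assume r: "0 < r"
 have "Phi (yd r) = - (Phi (Pinv (q (tt r))) * Phi (wt r))"
  unfolding yd_def Phi_times[symmetric] by (simp add: Phi_def)
 hence "A r * Phi (yd r) = - (q (tt r) * (A r * Phi (wt r)))" unfolding Phi_Pinv by simp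
 thus ?thesis unfolding A_Phi_wt[OF r] by simp
qed

text \<open>Power bounds for \<open>Mb\<close> and \<open>wt\<close> combined. The exponents for
  \<open>Ew\<close> are sg N' > 0 at the origin and (N ee - l) / (N - 1) at infinity, the latter
  negative because ee < l/N.\<close>

lemma slope_weight_bounds:
 obtains Cs where "0 <= Cs" "!!r. 0 < r ==> Mb r powr iN * wt r <= Cs * (if r <= 1 then r powr (sg / (N - 1) - 1) else r powr ((ee - l) / (N - 1) - 1))"
  "!!x::real^'n. x ~= 0 ==> Ew (norm x) <= Cs * pw (sg * N') ((N * ee - l) / (N - 1)) x"
proof -
 obtain Cm where Cm: "0 <= Cm" "!!r. 0 < r ==> 0 <= Mb r & Mb r <= Cm * (if r <= 1 then r powr sg else r powr ee)" by (rule Mb_bound) blast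
 obtain Cw where Cw: "0 <= Cw" "!!r. 0 < r ==> r <= 1 ==> wt r <= Cw * r powr (- 1)" "!!r. 1 <= r ==> wt r <= Cw * r powr (- 1 - l / (N - 1))" by (rule wt_bound) blast
 define n1 where "n1 = 1 / (N - 1)"
 have n1: "0 < n1" using N_ge by (simp add: n1_def)
 define C1 where "C1 = Cm powr n1 * Cw"
 have C1: "0 <= C1" using Cw by (simp add: C1_def)
 have s: "Mb r powr n1 * wt r <= C1 * (if r <= 1 then r powr (sg * n1 - 1) else r powr ((ee - l) * n1 - 1))" if r: "0 < r" for r
 proof -
  define X where "X = (if r <= 1 then r powr sg else r powr ee)"
  have "Mb r powr n1 <= (Cm * X) powr n1" using Cm(2)[OF r] n1 by (intro powr_mono2) (auto simp: X_def)
  also have "... = Cm powr n1 * X powr n1" using Cm(1) by (simp add: powr_mult X_def)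
  finally have 1: "Mb r powr n1 <= Cm powr n1 * X powr n1" .
  have 2: "wt r <= Cw * (if r <= 1 then r powr (- 1) else r powr (- 1 - l * n1))"
   using Cw(2)[OF r] Cw(3)[of r] by (simp add: n1_def)
  have "Mb r powr n1 * wt r <= (Cm powr n1 * X powr n1) * (Cw * (if r <= 1 then r powr (- 1) else r powr (- 1 - l * n1)))"
   using 1 2 wt_pos[OF r] by (intro mult_mono) auto
  also have "... = C1 * (if r <= 1 then r powr (sg * n1 - 1) else r powr ((ee - l) * n1 - 1))"
  proof -
   have "sg * n1 - 1 = sg * n1 + - 1" "(ee - l) * n1 - 1 = ee * n1 + (- 1 - l * n1)" by (auto simp: left_diff_distrib)
   thus ?thesis unfolding X_def C1_def by (simp only: powr_add powr_powr mult_ac if_distrib split: if_splits) (simp add: powr_powr powr_add mult_ac)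
  qed
  finally show ?thesis .
 qed
 define C2 where "C2 = Cm / om * C1"
 have C2: "0 <= C2" using Cm C1 w_facts by (simp add: C2_def)
 show ?thesis
 proof (rule that[of "max C1 C2"])
  fix r :: real assume r: "0 < r"
  have "Mb r powr n1 * wt r <= max C1 C2 * (if r <= 1 then r powr (sg * n1 - 1) else r powr ((ee - l) * n1 - 1))"
   by (rule order_trans[OF s[OF r]], rule mult_right_mono) auto
  thus "Mb r powr iN * wt r <= max C1 C2 * (if r <= 1 then r powr (sg / (N - 1) - 1) else r powr ((ee - l) / (N - 1) - 1))"
   by (simp only: n1_def times_divide_eq_right mult_1_right)
 next
  fix x :: "real^'n" assume "x ~= 0"
  hence r: "0 < norm x" by simp
  define r where "r = norm x"
  have r0: "0 < r" using r by (simp add: r_def)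
  have e: "sg * N' - N = sg + (1 - N) + (sg * n1 - 1)" "(N * ee - l) * n1 - N = ee + (1 - N) + ((ee - l) * n1 - 1)"
  proof -
   have N'1: "N' = 1 + n1" using N_ge by (simp add: N'_def n1_def field_simps)
   show "sg * N' - N = sg + (1 - N) + (sg * n1 - 1)" unfolding N'1 by (simp add: algebra_simps)
   have "N * n1 = 1 + n1" using N_ge by (simp add: n1_def field_simps)
   hence "ee * (N * n1) = ee * (1 + n1)" by simp
   thus "(N * ee - l) * n1 - N = ee + (1 - N) + ((ee - l) * n1 - 1)" by (simp add: algebra_simps)
  qed
  have "hw r <= Cm / om * ((if r <= 1 then r powr sg else r powr ee) * r powr (1 - N))"
  proof -
   have "r powr (1 - N) = 1 / r ^ (CARD('n) - 1)" unfolding powr_N[OF r0] using powr_minus_divide[of r "N - 1"] by simp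
   hence "hw r = Mb r * (1 / om) * r powr (1 - N)" by (simp add: hw_def)
   also have "... <= (Cm * (if r <= 1 then r powr sg else r powr ee)) * (1 / om) * r powr (1 - N)"
    using Cm(2)[OF r0] w_facts by (intro mult_right_mono) auto
   finally show ?thesis by simp
  qed
  hence "Ew r <= (Cm / om * ((if r <= 1 then r powr sg else r powr ee) * r powr (1 - N))) * (C1 * (if r <= 1 then r powr (sg * n1 - 1) else r powr ((ee - l) * n1 - 1)))"
   unfolding Ew_def n1_def[symmetric] using hw_nonneg[OF r0] wt_pos[OF r0] Cm(1) w_facts
   by (intro mult_mono[OF _ s[OF r0]]) (auto intro!: mult_nonneg_nonneg)
  also have "... = C2 * (if r <= 1 then r powr (sg * N' - N) else r powr ((N * ee - l) * n1 - N))"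
   unfolding e C2_def powr_add by simp
  also have "... = C2 * pw (sg * N') ((N * ee - l) * n1) x" by (simp add: pw_alt r_def)
  also have "... <= max C1 C2 * pw (sg * N') ((N * ee - l) * n1) x" by (intro mult_right_mono) auto
  finally show "Ew (norm x) <= max C1 C2 * pw (sg * N') ((N * ee - l) / (N - 1)) x" by (simp add: r_def n1_def)
 qed (use C1 in simp)
qed

lemma Mb_measurable: "(%x::real^'n. hw (norm x)) : BM" "(%x::real^'n. Ew (norm x)) : BM"
proof -
 have "mono Mb"
 proof (rule monoI)
  fix r s :: real assume rs: "r <= s"
  show "Mb r <= Mb s"
  proof (cases "0 < r")
   case True
   thus ?thesis unfolding Mb_def using rs by (intro integral_mono Y_ball) (auto simp: indicator_def)
  next
   case False
   have "Mb r = 0"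
   proof -
    have "AE x in lborel. iB r x * abs (Y x) = 0"
    proof (rule eventually_mono[OF AE_norm_neq[of 0]])
     fix x :: "real^'n" assume "norm x ~= 0"
     hence "~ norm x <= r" using False norm_ge_zero[of x] by linarith
     thus "iB r x * abs (Y x) = 0" by simp
    qed
    thus ?thesis unfolding Mb_def by (rule integral_eq_zero_AE)
   qed
   thus ?thesis using Mb_nonneg by simp
  qed
 qed
 hence [measurable]: "Mb : BM" by (rule borel_measurable_mono)
 have [measurable]: "(%x::real^'n. wt (norm x)) : BM" by (rule borel_measurable_restrict_pos[OF wt_cont])
 show "(%x::real^'n. hw (norm x)) : BM" "(%x::real^'n. Ew (norm x)) : BM"
  unfolding Ew_def hw_def by measurable
qed

lemma Ew_integrable: "IB (%x::real^'n. Ew (norm x))"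
proof -
 obtain Cs where Cs: "0 <= Cs" "!!x::real^'n. x ~= 0 ==> Ew (norm x) <= Cs * pw (sg * N') ((N * ee - l) / (N - 1)) x" by (rule slope_weight_bounds) blast
 have "N * ee < l" using ee_facts(3) N_ge by (simp add: less_divide_eq mult.commute)
 hence "IB (%x::real^'n. Cs * pw (sg * N') ((N * ee - l) / (N - 1)) x)"
  using sg N_facts(2,3) by (intro integrable_mult_right integrable_pw) (auto simp: divide_less_0_iff)
 thus ?thesis
 proof (rule ibound)
  have "norm (Ew (norm x)) <= norm (Cs * pw (sg * N') ((N * ee - l) / (N - 1)) x)" if "norm x ~= 0" for x :: "real^'n"
   using Cs(2)[of x] that hw_nonneg[of "norm x"] wt_pos[of "norm x"] Cs(1) by (simp add: Ew_def)
  thus "AE x::real^'n in lborel. norm (Ew (norm x)) <= norm (Cs * pw (sg * N') ((N * ee - l) / (N - 1)) x)"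
   by (rule eventually_mono[OF AE_norm_neq[of 0]])
 qed (use Mb_measurable in simp)
qed

text \<open>Young's inequality, by comparing t = v/e with the slope that carries the flux
  \<open>Mb\<close>: below it the product is at most \<open>Ew\<close>, above it at most A
  t^N.\<close>

lemma young_weight:
 assumes r: "0 < r" and v: "0 <= v" and e: "0 < e"
 shows "hw r * v <= e * (A r * (v / e) ^ CARD('n)) + e * Ew r"
proof -
 let ?n = "CARD('n)"
 define t where "t = v / e"
 have t: "0 <= t" "v = e * t" using v e by (auto simp: t_def)
 have Ar: "0 < A r" by (rule A_pos[OF r])
 have E0: "0 <= Ew r" using hw_nonneg[OF r] wt_pos[OF r] by (simp add: Ew_def)
 have tn: "t ^ ?n = t * t ^ (?n - 1)" using N2 by (simp add: power_eq_if)
 have "hw r * t <= A r * t ^ ?n + Ew r"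
 proof (cases "hw r <= A r * t ^ (?n - 1)")
  case True
  from mult_right_mono[OF this t(1)] show ?thesis using E0 by (simp add: tn mult_ac)
 next
  case False
  have "hw r = A r * wt r ^ (?n - 1) * Mb r" using A_Phi_wt[OF r] wt_pos[OF r] by (simp add: hw_def Phi_pos)
  moreover have "Mb r = (Mb r powr iN) ^ (?n - 1)"
  proof (cases "Mb r = 0")
   case True thus ?thesis using N2 by (simp add: power_0_left)
  next
   case False
   hence m: "0 < Mb r" using Mb_nonneg[of r] by simp
   hence "(Mb r powr iN) ^ (?n - 1) = Mb r powr (1 / (N - 1) * real (?n - 1))" by (simp add: powr_power)
   also have "1 / (N - 1) * real (?n - 1) = 1" unfolding N_facts(4) using N_ge by simp
   finally show ?thesis using m by simp
  qed
  ultimately have "hw r = A r * (Mb r powr iN * wt r) ^ (?n - 1)" by (simp add: power_mult_distrib mult_ac)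
  hence "t ^ (?n - 1) < (Mb r powr iN * wt r) ^ (?n - 1)" using False Ar by simp
  hence "t <= Mb r powr iN * wt r" using wt_pos[OF r] by (intro less_imp_le power_less_imp_less_base[of t "?n - 1"] mult_nonneg_nonneg powr_ge_zero) auto
  hence "hw r * t <= Ew r" unfolding Ew_def using hw_nonneg[OF r] by (rule mult_left_mono)
  thus ?thesis using Ar t by (simp add: add_increasing)
 qed
 from mult_left_mono[OF this, of e] show ?thesis using e unfolding t_def[symmetric] by (simp add: t(2) distrib_left mult_ac)
qed

lemma energy_density: assumes "0 < r" shows "A r * abs (yd r) ^ CARD('n) <= C_N CARD('n) * C_N CARD('n) powr iN * Ew r"
proof -
 have "A r * abs (yd r) ^ CARD('n) = abs (A r * Phi (yd r)) * abs (yd r)"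
  unfolding Phi_mult[symmetric] abs_mult[symmetric] using A_pos[OF assms] by (simp add: abs_mult mult.assoc Phi_mult[symmetric] flip: abs_mult) (simp add: Phi_mult)
 also have "abs (A r * Phi (yd r)) <= C_N CARD('n) * hw r"
  unfolding A_Phi_yd[OF assms] hw_def using q_tt(2)[OF assms] w_facts assms by (simp add: abs_divide divide_right_mono)
 finally have "A r * abs (yd r) ^ CARD('n) <= (C_N CARD('n) * hw r) * (C_N CARD('n) powr iN * (Mb r powr iN * wt r))"
  using yd_bound[OF assms] C_N_pos hw_nonneg[OF assms] by (meson mult_mono mult_nonneg_nonneg abs_ge_zero less_imp_le order_trans mult_left_mono mult_right_mono)
 thus ?thesis by (simp add: Ew_def mult_ac)
qed


lemma zd_deriv: "0 < s ==> ((%s. U (tt (sqrt s))) hasd zd s) (at s)"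
proof -
 assume s: "0 < s"
 have "((%s. U (tt (sqrt s))) hasd Pinv (q (tt (sqrt s))) * (- wt (sqrt s) * (inverse (sqrt s) / 2))) (at s)"
  using s by (intro DERIV_chain2[where f=U and g="%s. tt (sqrt s)"] DERIV_chain2[where f=tt and g=sqrt] U_deriv tt_deriv tt_pos DERIV_real_sqrt) auto
 thus ?thesis by (simp add: zd_def yd_def field_simps)
qed

lemma zd_cont: "continuous_on {0<..} zd"
proof -
 have s: "continuous_on {0::real<..} sqrt" by (intro continuous_intros)
 have t: "continuous_on {0<..} (%s. tt (sqrt s))" by (rule continuous_on_compose2[OF tt_cont s]) auto
 have "continuous_on {0<..} (%s. Pinv (q (tt (sqrt s))))"
  by (rule continuous_on_compose2[OF Pinv_cont continuous_on_compose2[OF q_cont t]]) (auto simp: tt_pos)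
 moreover have "continuous_on {0<..} (%s. wt (sqrt s))" by (rule continuous_on_compose2[OF wt_cont s]) auto
 ultimately show ?thesis unfolding zd_def yd_def by (intro continuous_intros) auto
qed

text \<open>With r = sqrt s the slope bounds become powers a1 - 1 and a2 - 1 of s, where a1 > 0 >
  a2; they are integrated as a radial weight on space.\<close>

lemma zd_integrable: "IB (%s. ind {0<..} s * zd s)"
proof -
 let ?n = "CARD('n)"
 obtain Cs where Cs: "0 <= Cs" "!!r. 0 < r ==> Mb r powr iN * wt r <= Cs * (if r <= 1 then r powr (sg / (N - 1) - 1) else r powr ((ee - l) / (N - 1) - 1))"
  by (rule slope_weight_bounds) blast
 define b1 where "b1 = sg / (N - 1)"
 define b2 where "b2 = (ee - l) / (N - 1)"
 define a1 where "a1 = b1 / 2"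
 define a2 where "a2 = b2 / 2"
 have a: "0 < a1" "a2 < 0"
 proof -
  have "l / N <= l" using N_ge w_facts by (simp add: divide_le_eq mult_le_cancel_left1)
  hence "ee - l < 0" using ee_facts(3) by linarith
  thus "0 < a1" "a2 < 0" using sg N_facts(2) by (auto simp: a1_def a2_def b1_def b2_def divide_less_0_iff)
 qed
 define g where "g r = (if r <= 1 then r powr (a1 - N) else r powr (a2 - N))" for r
 have [measurable]: "g : BM" unfolding g_def by measurable
 have "IB (%x::real^'n. g (norm x))"
  using integrable_pw[OF a, where 'n='n] unfolding g_def pw_alt[abs_def] .
 hence i: "IB (%r. ind {0..} r * (sph TYPE('n) * r ^ (?n - 1) * g r))"
  by (subst (asm) integrable_radial) auto
 define c where "c = C_N ?n powr iN * Cs / om"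
 have m: "(%s. ind {0<..} s * zd s) : BM"
  using borel_measurable_continuous_on_indicator[OF _ zd_cont] by simp
 show ?thesis
 proof (rule ibound[OF integrable_mult_right[OF i, of c]], use m in simp, rule AE_I2)
  fix s :: real
  show "norm (ind {0<..} s * zd s) <= norm (c * (ind {0..} s * (sph TYPE('n) * s ^ (?n - 1) * g s)))"
  proof (cases "0 < s")
   case True
   define r where "r = sqrt s"
   have r: "0 < r" "s = r^2" using True by (auto simp: r_def)
   have p: "(r^2) powr (x - 1) = r powr (2 * x - 1) / r" for x
   proof -
    have "r powr 2 = r^2" using powr_realpow[OF r(1), of 2] by (simp only: of_nat_numeral)
    hence "(r^2) powr (x - 1) = (r powr 2) powr (x - 1)" by (simp only:)
    also have "... = r powr ((2 * x - 1) - 1)" by (simp add: powr_powr algebra_simps)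
    also have "... = r powr (2 * x - 1) / r" using r(1) by (simp add: powr_diff power2_eq_square)
    finally show ?thesis .
   qed
   have "abs (zd s) <= abs (yd r) / r" using r(1) unfolding zd_def r_def[symmetric] by (simp add: abs_divide divide_le_eq mult_le_cancel_left1 field_simps)
   also have "... <= C_N ?n powr iN * (Cs * (if r <= 1 then r powr (2 * a1 - 1) else r powr (2 * a2 - 1))) / r"
    using Cs(2)[OF r(1), folded b1_def b2_def] r(1) by (intro divide_right_mono order_trans[OF yd_bound] mult_left_mono) (auto simp: a1_def a2_def)
   also have "... = C_N ?n powr iN * Cs * (if s <= 1 then s powr (a1 - 1) else s powr (a2 - 1))"
    unfolding r(2) p using r(1) by (simp add: power_le_one_iff)
   also have "(if s <= 1 then s powr (a1 - 1) else s powr (a2 - 1)) = s ^ (?n - 1) * g s"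
    unfolding powr_N[OF True] g_def by (simp add: powr_add[symmetric])
   finally have "abs (zd s) <= c * (om * s ^ (?n - 1) * g s)" using w_facts(1) by (simp add: c_def mult.assoc)
   thus ?thesis using True unfolding om_def by (simp add: indicator_def)
  qed simp
 qed
qed

text \<open>The fundamental theorem of calculus on [s0, y]; as y grows, \<open>tt\<close> tends to 0
  and U with it, by |U(t)| <= B t^(1/N').\<close>

lemma zd_repr: assumes a: "0 < s0" shows "U (tt (sqrt s0)) = - (LBINT s. ind {s0<..} s * zd s)"
proof -
 have i: "IB (%s. ind {s0<..} s * zd s)"
 proof (rule ibound[OF zd_integrable])
  have "continuous_on {s0<..} zd" by (rule continuous_on_subset[OF zd_cont]) (use a in auto)
  thus "(%s. ind {s0<..} s * zd s) : borel_measurable lborel"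
   using borel_measurable_continuous_on_indicator[of "{s0<..}" zd] by simp
 qed (use a in "auto intro!: AE_I2 simp: indicator_def")
 have L1: "((%y. (LBINT s. ind {..y} s *R (ind {s0<..} s * zd s))) \<longlongrightarrow> (LBINT s. ind {s0<..} s * zd s)) at_top"
  by (rule tendsto_integral_at_top[OF _ i]) simp
 have L2: "EVT y. (LBINT s. ind {..y} s *R (ind {s0<..} s * zd s)) = U (tt (sqrt y)) - U (tt (sqrt s0))"
  using eventually_gt_at_top[of s0]
 proof eventually_elim
  case (elim y)
  define z' where "z' s = zd (max s0 s)" for s
  have "(LBINT s. ind {..y} s *R (ind {s0<..} s * zd s)) = (LBINT s. z' s * ind {s0..y} s)"
  proof (rule integral_cong_AE)
   have "AE s in lborel. s ~= s0" by (rule AE_lborel_singleton)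
   thus "AE s in lborel. ind {..y} s *R (ind {s0<..} s * zd s) = z' s * ind {s0..y} s"
    by eventually_elim (auto simp: indicator_def z'_def max_def)
   have "continuous_on UNIV z'" unfolding z'_def by (rule continuous_on_compose2[OF zd_cont]) (use a in "auto intro!: continuous_intros")
   hence [measurable]: "z' : BM" by (rule borel_measurable_continuous_onI)
   show "(%s. z' s * ind {s0..y} s) : borel_measurable lborel" by measurable
  qed (use borel_measurable_integrable[OF i] in measurable)
  also have "... = U (tt (sqrt y)) - U (tt (sqrt s0))"
  proof (rule integral_FTC_Icc_real)
   show "s0 <= y" using elim by simp
   show "((%s. U (tt (sqrt s))) hasd z' s) (at s)" if "s0 <= s" for s using zd_deriv[of s] that a by (simp add: z'_def max_def)
   have "continuous_on UNIV z'" unfolding z'_def by (rule continuous_on_compose2[OF zd_cont]) (use a in "auto intro!: continuous_intros")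
   thus "isCont z' s" for s by (simp add: continuous_on_eq_continuous_at)
  qed
  finally show ?case .
 qed
 have L3: "((%y. U (tt (sqrt y))) \<longlongrightarrow> 0) at_top"
 proof -
  define c where "c = (N - 1) / l / ka"
  define k where "k = l / (N - 1)"
  have c: "0 < k" "0 < c" "0 < 1 / N'" using w_facts N_ge kappa_pos N_facts(3) by (auto simp: c_def k_def)
  have "((%y. c * sqrt y powr (- k)) \<longlongrightarrow> c * 0) at_top" by (intro tendsto_mult tendsto_const tendsto_neg_powr sqrt_at_top) (use c in simp)
  hence "((%y. B * (c * sqrt y powr (- k)) powr (1 / N')) \<longlongrightarrow> B * 0 powr (1 / N')) at_top"
   by (intro tendsto_mult tendsto_const tendsto_powr') (use c in auto)
  hence T0: "((%y. B * (c * sqrt y powr (- k)) powr (1 / N')) \<longlongrightarrow> 0) at_top" using c by simp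
  show ?thesis
  proof (rule Lim_null_comparison[OF _ T0])
   show "EVT y. norm (U (tt (sqrt y))) <= B * (c * sqrt y powr (- k)) powr (1 / N')"
    using eventually_gt_at_top[of 0]
   proof eventually_elim
    case (elim y)
    have "tt (sqrt y) <= c * sqrt y powr (- k)" unfolding c_def k_def using elim by (intro tt_powr(2)) simp
    hence "tt (sqrt y) powr (1 / N') <= (c * sqrt y powr (- k)) powr (1 / N')" using tt_pos[of "sqrt y"] elim c by (intro powr_mono2) auto
    hence "B * tt (sqrt y) powr (1 / N') <= B * (c * sqrt y powr (- k)) powr (1 / N')" using B by (rule mult_left_mono)
    thus ?case using U_bound[OF tt_pos, of "sqrt y"] elim by simp
   qed
  qed
 qed
 have "(LBINT s. ind {s0<..} s * zd s) = 0 - U (tt (sqrt s0))"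
  by (rule tendsto_unique[OF trivial_limit_at_top_linorder Lim_transform_eventually[OF L1 L2] tendsto_diff[OF L3 tendsto_const]])
 thus ?thesis by simp
qed

lemma gs_eq: "x ~= 0 ==> gs x = (yd (norm x) / norm x) *R x" "x ~= 0 ==> norm (gs x) = abs (yd (norm x))"
 by (simp_all add: gs_def zd_def norm_eq_sqrt_inner[symmetric])

lemma sol_meas [measurable]: "sol : BM"
 using U_meas unfolding sol_def[abs_def] by measurable

lemma zd_meas [measurable]: "(%x::real^'n. zd (x .* x)) : BM" by (rule borel_measurable_inner_self[OF zd_cont])

lemma gs_meas [measurable]: "gs : BM" unfolding gs_def[abs_def] by measurable

lemma A_meas [measurable]: "(%x::real^'n. A (norm x)) : BM" by (rule borel_measurable_restrict_pos[OF A_cont])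

lemma sol_E: "has_weak_gradient sol gs" "sol : E_space A"
proof -
 let ?c = "C_N CARD('n)"
 have E: "IB (%x::real^'n. A (norm x) * norm ((2 * zd (x .* x)) *R x) ^ CARD('n))"
 proof (rule ibound[OF integrable_mult_right[OF Ew_integrable, of "?c * ?c powr iN"]])
  have "norm (A (norm x) * norm ((2 * zd (x .* x)) *R x) ^ CARD('n)) <= norm (?c * ?c powr iN * Ew (norm x))"
   if x: "norm x ~= 0" for x :: "real^'n"
  proof -
   have "A (norm x) * norm (gs x) ^ CARD('n) <= ?c * ?c powr iN * Ew (norm x)"
    using energy_density[of "norm x"] gs_eq(2)[of x] x by simp
   moreover have "0 <= A (norm x) * norm (gs x) ^ CARD('n)" using A_pos[of "norm x"] x by (intro mult_nonneg_nonneg) auto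
   ultimately show ?thesis unfolding gs_def[symmetric] real_norm_def by linarith
  qed
  thus "AE x::real^'n in lborel. norm (A (norm x) * norm ((2 * zd (x .* x)) *R x) ^ CARD('n)) <= norm (?c * ?c powr iN * Ew (norm x))"
   by (rule eventually_mono[OF AE_norm_neq[of 0]])
 qed measurable
 have Ap: "EX c>0. ALL r:{0<..R}. c <= A r" if "0 < R" for R
 proof -
  define m where "m = min r0 1 / 2"
  have m: "0 < m" "m < r0" using w_facts by (auto simp: m_def)
  have "A0 * min 1 (m powr l) <= A r" if "0 < r" for r
  proof (cases "r < r0")
   case True
   have "A0 * min 1 (m powr l) <= A0 * 1" using w_facts by (intro mult_left_mono) auto
   also have "... <= A0 * (1 + r powr l)" using w_facts by (intro mult_left_mono) auto
   also have "... <= A r" using cA' True that by (auto simp: cond_A'_def)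
   finally show ?thesis .
  next
   case False
   have "m powr l <= r powr l" using False m w_facts by (intro powr_mono2) auto
   hence "A0 * min 1 (m powr l) <= A0 * r powr l" using w_facts by (intro mult_left_mono) auto
   thus ?thesis using A_ge[OF that] by linarith
  qed
  thus ?thesis using m w_facts by (intro exI[of _ "A0 * min 1 (m powr l)"]) auto
 qed
 have r: "sol x = - (LBINT s. ind {x .* x<..} s * zd s)" if "x ~= 0" for x
  using zd_repr[of "x .* x"] that by (simp add: sol_def th_def norm_eq_sqrt_inner)
 note R = radial_function_in_E_space[OF A_cont Ap zd_cont zd_integrable r sol_meas E]
 show "has_weak_gradient sol gs" unfolding gs_def[abs_def] by (rule R(1))
 show "sol : E_space A" by (rule R(2))
qed

definition flow :: "real^'n => real^'n => real" where
 "flow x v = A (norm x) * norm (gs x) ^ (CARD('n) - 2) * (gs x .* v)"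

lemma flow_eq: assumes x: "x ~= 0"
 shows "flow x v = - (q (tt (norm x)) / (om * norm x ^ CARD('n)) * (x .* v))" "abs (flow x v) <= C_N CARD('n) * (hw (norm x) * norm v)"
proof -
 let ?n = "CARD('n)"
 define r where "r = norm x"
 have r: "0 < r" using x by (simp add: r_def)
 have rn: "r ^ ?n = r ^ (?n - 1) * r" using N2 by (simp add: power_eq_if)
 have "flow x v = A r * (yd r * abs (yd r) ^ (?n - 2)) / r * (x .* v)"
  unfolding flow_def gs_eq(2)[OF x] gs_eq(1)[OF x] r_def by simp
 also have "... = (A r * Phi (yd r)) / r * (x .* v)" by (simp add: Phi_def)
 also have "... = - (q (tt r) / (om * r ^ ?n) * (x .* v))" unfolding A_Phi_yd[OF r] rn by simp
 finally show eq: "flow x v = - (q (tt (norm x)) / (om * norm x ^ ?n) * (x .* v))" by (simp add: r_def)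
 have "abs (flow x v) = abs (q (tt r)) / (om * r ^ ?n) * abs (x .* v)" unfolding eq r_def[symmetric] using w_facts(1) r by (simp add: abs_mult)
 also have "... <= (C_N ?n * Mb r) / (om * r ^ ?n) * (r * norm v)"
  using q_tt(2)[OF r] Cauchy_Schwarz_ineq2[of x v] w_facts(1) r C_N_pos Mb_nonneg by (intro mult_mono divide_right_mono) (auto simp: r_def)
 also have "... = C_N ?n * (hw r * norm v)" unfolding hw_def rn using r by simp
 finally show "abs (flow x v) <= C_N ?n * (hw (norm x) * norm v)" by (simp add: r_def)
qed

lemma Y_radial: "norm x = norm y ==> Y x = Y y"
proof -
 assume n: "norm x = norm y"
 have e: "u a = u b" "Q0 a = Q0 b" if "norm a = norm b" for a b :: "real^'n" using that by (auto simp: th_def Q0_def)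
 have "H a = H b" if "norm a = norm b" for a b using e[OF that] by (simp only: H_def)
 hence "log_conv H x = log_conv H y" by (rule log_conv_radial[OF H_meas _ n])
 thus ?thesis unfolding Y_def using e[OF n] by (simp only:)
qed

lemma lebesgue_meas [measurable]: "(%x::real^'n. A (norm x)) : LM" "gs : LM"
  "(%x::real^'n. hw (norm x)) : LM" "Y : LM"
 by (rule measurable_completion, use Mb_measurable(1) in simp)+

section \<open>The weak equation\<close>

lemma flow_meas:
 assumes [measurable]: "v : LM"
 shows "(%x. flow x (v x)) : LM"
 unfolding flow_def by measurable

text \<open>The ray identities, with G the radial profile of Y and g the derivative of ph in the
  direction of the position: the integrals of Y over balls are, up to C_N, the fluxes q, and these
  express \<open>flow\<close>.\<close>

lemma test_fun_identity:
 assumes t: "test_fun ph" and hi: "IB (%x. hw (norm x) * norm (grad ph x))"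
 shows "IB (%x. abs (Y x) * abs (ph x))" "(LBINT x. abs (Y x) * abs (ph x)) <= (LBINT x. hw (norm x) * norm (grad ph x))"
  "C_N CARD('n) * (LBINT x. Y x * ph x) = (LBINT x. flow x (grad ph x))"
proof -
 let ?c = "C_N CARD('n)" and ?n = "CARD('n)"
 \<comment> \<open>A fixed unit vector, along which the profile of the radial function Y is read
   off.\<close>
 define e :: "real^'n" where "e = axis undefined 1"
 define G where "G r = Y (r *R e)" for r
 have G: "G (norm x) = Y x" for x unfolding G_def by (rule Y_radial) (simp add: e_def)
 have Gm: "G : BM" unfolding G_def by measurable
 define g where "g y = grad ph y .* y" for y
 have [measurable]: "grad ph : BM" by (rule test_fun_grad_measurable[OF t])
 have gm[measurable]: "g : BM" unfolding g_def by measurable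
 have g0: "g 0 = 0" by (simp add: g_def)
 have Mb: "(LBINT x. iB (norm y) x * abs (G (norm (x::real^'n)))) = Mb (norm y)" for y :: "real^'n"
  by (simp add: G Mb_def)
 have le: "abs (g y) * Mb (norm y) / (om * norm y ^ ?n) <= hw (norm y) * norm (grad ph y)" for y
 proof (cases "y = 0")
  case True
  thus ?thesis using w_facts Mb_nonneg N2 by (simp add: g_def hw_def power_0_left)
 next
  case False
  define r where "r = norm y"
  have r: "0 < r" using False by (simp add: r_def)
  have "abs (g y) * Mb r / (om * r ^ ?n) <= (norm (grad ph y) * r) * Mb r / (om * r ^ ?n)"
   unfolding g_def r_def using Cauchy_Schwarz_ineq2[of "grad ph y" y] Mb_nonneg w_facts by (intro divide_right_mono mult_right_mono) auto
  also have "... = hw r * norm (grad ph y)" unfolding hw_def using N2 r by (simp add: power_eq_if[of r ?n] mult_ac)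
  finally show ?thesis by (simp add: r_def)
 qed
 have [measurable]: "(%x::real^'n. hw (norm x)) : BM" by (rule Mb_measurable)
 have Mm: "(%y::real^'n. Mb (norm y)) : BM"
 proof -
  have "(%y::real^'n. hw (norm y) * (om * norm y ^ (?n - 1))) : BM" by measurable
  moreover have "Mb (norm y) = (if y = 0 then Mb 0 else hw (norm y) * (om * norm y ^ (?n - 1)))" for y :: "real^'n" using w_facts by (simp add: hw_def)
  ultimately show ?thesis by simp
 qed
 have int: "IB (%y. abs (g y) * (LBINT x. iB (norm y) x * abs (G (norm (x::real^'n)))) / (om * norm y ^ ?n))"
  unfolding Mb
 proof (rule ibound[OF hi])
  have "norm (abs (g y) * Mb (norm y) / (om * norm y ^ ?n)) <= norm (hw (norm y) * norm (grad ph y))" for y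
  proof -
   have "norm (abs (g y) * Mb (norm y) / (om * norm y ^ ?n)) = abs (g y) * Mb (norm y) / (om * norm y ^ ?n)"
    using Mb_nonneg[of "norm y"] w_facts(1) by (simp add: abs_mult)
   thus ?thesis using order_trans[OF le[of y] abs_ge_self] by (simp only: real_norm_def)
  qed
  thus "AE y in lborel. norm (abs (g y) * Mb (norm y) / (om * norm y ^ ?n)) <= norm (hw (norm y) * norm (grad ph y))" by simp
 qed (use Mm in measurable)
 have Gl: "IB (%x::real^'n. iB R x * abs (G (norm x)))" if "0 < R" for R using Y_ball(1)[OF that] by (simp add: G)
 note ray = N2 Gm gm g0 test_fun_measurable[OF t] test_fun_ray(1)[OF t, folded g_def] test_fun_ray(2)[OF t, folded g_def] Gl int[unfolded om_def]
 have "IB (%x. abs (G (norm x)) * abs (ph x))" by (rule ray_integrable[OF ray])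
 thus 1: "IB (%x. abs (Y x) * abs (ph x))" by (simp only: G)
 have "(LBINT x. abs (G (norm x)) * abs (ph x))
   <= (LBINT y. abs (g y) * (LBINT x. iB (norm y) x * abs (G (norm (x::real^'n)))) / (om * norm y ^ ?n))"
  unfolding om_def by (rule ray_bound[OF ray])
 also have "... <= (LBINT x. hw (norm x) * norm (grad ph x))"
  using int le unfolding Mb by (intro integral_mono hi) auto
 finally show "(LBINT x. abs (Y x) * abs (ph x)) <= (LBINT x. hw (norm x) * norm (grad ph x))" by (simp only: G)
 define R where "R y = g y * (LBINT x. iB (norm y) x * G (norm (x::real^'n))) / (om * norm y ^ ?n)" for y :: "real^'n"
 have "(LBINT x. G (norm x) * ph x) = - (LBINT y. R y)" unfolding R_def om_def by (rule ray_identity[OF ray])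
 hence "?c * (LBINT x. Y x * ph x) = (LBINT y. - ?c * R y)" by (simp add: G)
 also have "... = (LBINT x. flow x (grad ph x))"
 proof (rule Bochner_Integration.integral_cong[OF refl])
  fix y :: "real^'n"
  show "- ?c * R y = flow y (grad ph y)"
  proof (cases "y = 0")
   case True thus ?thesis by (simp add: R_def g_def flow_def gs_def)
  next
   case False
   thus ?thesis unfolding flow_eq(1)[OF False] R_def using q_tt(1)[of "norm y"] False by (simp add: G g_def inner_commute mult_ac)
  qed
 qed
 finally show "?c * (LBINT x. Y x * ph x) = (LBINT x. flow x (grad ph x))" .
qed

definition eng :: "(real^'n => real^'n) => real^'n => real" where "eng v x = A (norm x) * norm (v x) ^ CARD('n)"

lemma young_integral:
 assumes [measurable]: "v : LM" and i: "IL (eng v)"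
 shows "IL (%x. hw (norm x) * norm (v x))"
  and "0 < e ==> (LL x. hw (norm x) * norm (v x)) <= e * (LL x. eng v x) / e ^ CARD('n) + e * (\<integral>x. Ew (norm x) \<partial>(lebesgue :: (real^'n) measure))"
proof -
 have Ei: "IL (%x::real^'n. Ew (norm x))" using Ew_integrable Mb_measurable(2) by (subst integrable_completion) auto
 define b where "b e x = e * (eng v x / e ^ CARD('n)) + e * Ew (norm x)" for e x
 have bi: "IL (b e)" for e unfolding b_def[abs_def] by (intro integrable_sum2 integrable_mult_right integrable_divide i Ei)
 have le: "0 <= hw (norm x) * norm (v x) & hw (norm x) * norm (v x) <= b e x" if "norm x ~= 0" "0 < e" for e x
  using young_weight[of "norm x" "norm (v x)" e] hw_nonneg[of "norm x"] that by (simp add: b_def eng_def power_divide)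
 have ae: "AE x in lebesgue. 0 <= hw (norm x) * norm (v x) & hw (norm x) * norm (v x) <= b e x" if "0 < e" for e
  by (rule eventually_mono[OF AE_nz]) (rule le[OF _ that])
 show 1: "IL (%x. hw (norm x) * norm (v x))"
 proof (rule ibound[OF bi[of 1]])
  show "AE x in lebesgue. norm (hw (norm x) * norm (v x)) <= norm (b 1 x)"
   using ae[OF zero_less_one] by (rule eventually_mono) auto
 qed measurable
 assume e: "0 < e"
 have "(LL x. hw (norm x) * norm (v x)) <= (LL x. b e x)"
  by (rule integral_mono_AE[OF 1 bi]) (rule eventually_mono[OF ae[OF e]], simp)
 also have "... = e * (LL x. eng v x) / e ^ CARD('n) + e * (\<integral>x. Ew (norm x) \<partial>(lebesgue :: (real^'n) measure))"
  unfolding b_def using i Ei by simp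
 finally show "(LL x. hw (norm x) * norm (v x)) <= e * (LL x. eng v x) / e ^ CARD('n) + e * (\<integral>x. Ew (norm x) \<partial>(lebesgue :: (real^'n) measure))" .
qed

text \<open>The parameter of Young's inequality is fixed first, making the multiple of the integral
  of \<open>Ew\<close> small; then k, making the energy term small.\<close>

lemma young_limit:
 assumes m: "!!k. v k : LM" and i: "!!k. IL (eng (v k))"
  and lim: "(%k. (LL x. eng (v k) x)) ----> 0"
 shows "(%k. (LL x. hw (norm x) * norm (v k x))) ----> 0"
proof (rule LIMSEQ_I)
 fix ep :: real assume e: "0 < ep"
 define W where "W = abs (\<integral>x. Ew (norm x) \<partial>(lebesgue :: (real^'n) measure)) + 1"
 define d where "d = ep / (2 * W)"
 have d: "0 < d" "d * (\<integral>x. Ew (norm x) \<partial>(lebesgue :: (real^'n) measure)) <= ep / 2"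
 proof -
  have W: "0 < W" by (simp add: W_def)
  show d: "0 < d" using e W by (simp add: d_def)
  have "d * (\<integral>x. Ew (norm x) \<partial>(lebesgue :: (real^'n) measure)) <= d * W" using d by (intro mult_left_mono) (auto simp: W_def)
  also have "... = ep / 2" using W by (simp add: d_def)
  finally show "d * (\<integral>x. Ew (norm x) \<partial>(lebesgue :: (real^'n) measure)) <= ep / 2" .
 qed
 have "(%k. d * (LL x. eng (v k) x) / d ^ CARD('n)) ----> d * 0 / d ^ CARD('n)" using d(1) by (intro tendsto_intros lim) auto
 hence "EV k. d * (LL x. eng (v k) x) / d ^ CARD('n) < ep / 2" using e by (intro order_tendstoD(2)) auto
 then obtain k0 where k0: "!!k. k0 <= k ==> d * (LL x. eng (v k) x) / d ^ CARD('n) < ep / 2" unfolding eventually_sequentially by blast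
 have "norm ((LL x. hw (norm x) * norm (v k x)) - 0) < ep" if "k0 <= k" for k
 proof -
  have "0 <= (LL x. hw (norm x) * norm (v k x))"
   by (intro integral_nonneg_AE eventually_mono[OF AE_nz] mult_nonneg_nonneg hw_nonneg) auto
  moreover have "(LL x. hw (norm x) * norm (v k x)) < ep / 2 + ep / 2"
   by (rule le_less_trans[OF young_integral(2)[OF m i d(1)] add_less_le_mono[OF k0[OF that] d(2)]])
  ultimately show ?thesis by simp
 qed
 thus "EX no. ALL k>=no. norm ((LL x. hw (norm x) * norm (v k x)) - 0) < ep" by blast
qed

text \<open>By density of test functions. Convergence in energy yields, through Young's inequality,
  convergence of the gradients with weight \<open>hw\<close>, which is what the left side needs. On
  the right, products of Y with the approximants are Cauchy in L^1 by the bound for test functions,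
  and local L^1 convergence identifies their limit as Y ph.\<close>

lemma weak_form:
 assumes ph: "ph : E_space A" and G: "has_weak_gradient ph G"
 shows "IL (%x. flow x (G x))" "IL (%x. Y x * ph x)"
  "(LL x. flow x (G x)) = C_N CARD('n) * (LL x. Y x * ph x)"
proof -
 let ?c = "C_N CARD('n)" and ?n = "CARD('n)"
 obtain Ph where t: "!!k. test_fun (Ph k)" "!!k. finite_energy A (Ph k)"
  and LN: "!!K. compact K ==> (%k. LINT x:K|lebesgue. abs (Ph k x - ph x) ^ ?n) ----> 0"
  and En: "(%k. E_norm A (%x. Ph k x - ph x)) ----> 0" and fe: "finite_energy A ph" and Lp: "ph : LN_loc"
  using ph unfolding E_space_def by blast
 have Gm[measurable]: "G : LM" and pm[measurable]: "ph : LM"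
  using G unfolding has_weak_gradient_def by (auto intro: locally_integrable_measurable)
 have gm: "grad (Ph k) : LM" "Ph k : LM" for k
  by (rule measurable_completion, use test_fun_grad_measurable[OF t(1)] test_fun_measurable[OF t(1)] in simp)+
 have Am: "(%x::real^'n. A (norm x)) : LM" by measurable
 have iG: "IL (eng G)" using fe weak_energy(1)[OF Am G] by (simp add: finite_energy_def eng_def[abs_def])
 have ig: "IL (eng (grad (Ph k)))" for k
  using t(2)[of k] weak_energy(1)[OF Am test_fun_weak_gradient[OF t(1)]] by (simp add: finite_energy_def eng_def[abs_def])
 define v where "v k x = grad (Ph k) x - G x" for k x
 have vm: "v k : LM" for k unfolding v_def[abs_def] using gm(1)[of k] by measurable
 have iv: "IL (eng (v k))" for k unfolding eng_def[abs_def]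
 proof (rule integrable_energy_add[OF _ ig[of k, unfolded eng_def[abs_def]] iG[unfolded eng_def[abs_def]]])
  show "AE x in lebesgue. 0 <= A (norm x) & norm (v k x) <= norm (grad (Ph k) x) + norm (G x)"
  proof (rule eventually_mono[OF AE_nz])
   fix x :: "real^'n" assume "norm x ~= 0"
   hence "0 <= A (norm x)" using A_pos[of "norm x"] by simp
   thus "0 <= A (norm x) & norm (v k x) <= norm (grad (Ph k) x) + norm (G x)" using norm_triangle_ineq4[of "grad (Ph k) x" "G x"] by (simp add: v_def)
  qed
 qed (use vm in measurable)
 have e0: "0 <= (LL x. eng w x)" for w
  unfolding eng_def
  by (intro integral_nonneg_AE eventually_mono[OF AE_nz] mult_nonneg_nonneg less_imp_le[OF A_pos]) auto
 have lim_e: "(%k. (LL x. eng (v k) x)) ----> 0"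
 proof -
  have d: "has_weak_gradient (%x. Ph k x - ph x) (v k)" for k unfolding v_def[abs_def] by (rule has_weak_gradient_diff[OF test_fun_weak_gradient[OF t(1)] G])
  have "E_norm A (%x. Ph k x - ph x) ^ ?n = (LL x. eng (v k) x)" for k
  proof -
   have "E_norm A (%x. Ph k x - ph x) = (LL x. eng (v k) x) powr (1 / real ?n)"
    unfolding E_norm_def using weak_energy(2)[OF Am d] by (simp add: eng_def)
   thus ?thesis using e0[of "v k"] by (cases "(LL x. eng (v k) x) = 0") (auto simp: powr_power zero_power)
  qed
  thus ?thesis using tendsto_power[OF En, of ?n] by (simp add: zero_power)
 qed
 define I where "I k = (LL x. hw (norm x) * norm (v k x))" for k
 have I0: "I ----> 0" unfolding I_def by (rule young_limit[OF vm iv lim_e])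
 have Ip: "0 <= I k" for k unfolding I_def
  by (intro integral_nonneg_AE eventually_mono[OF AE_nz] mult_nonneg_nonneg hw_nonneg) auto
 have hv: "IL (%x. hw (norm x) * norm (v k x))" for k by (rule young_integral(1)[OF vm iv])
 have hwm: "(%x::real^'n. hw (norm x)) : BM" by (rule Mb_measurable)
 have tI: "IB (%x. hw (norm x) * norm (grad xx x))" "IL (%x. abs (Y x) * abs (xx x))"
  "(LL x. abs (Y x) * abs (xx x)) <= (LL x. hw (norm x) * norm (grad xx x))"
  "?c * (LL x. Y x * xx x) = (LL x. flow x (grad xx x))"
  if xx: "test_fun xx" and i: "IL (%x. hw (norm x) * norm (grad xx x))" for xx
 proof -
  have [measurable]: "grad xx : BM" "xx : BM" using test_fun_grad_measurable[OF xx] test_fun_measurable[OF xx] by auto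
  have hm: "(%x. hw (norm x) * norm (grad xx x)) : borel_measurable lborel" using hwm by measurable
  have fm: "(%x. flow x (grad xx x)) : borel_measurable lborel" unfolding flow_def by measurable
  show l: "IB (%x. hw (norm x) * norm (grad xx x))" using i by (subst (asm) integrable_completion[OF hm])
  note T = test_fun_identity[OF xx l]
  show "IL (%x. abs (Y x) * abs (xx x))" using T(1) by (subst integrable_completion) auto
  show "(LL x. abs (Y x) * abs (xx x)) <= (LL x. hw (norm x) * norm (grad xx x))"
   using T(2) by (subst (1 2) integral_completion) (use hm in auto)
  show "?c * (LL x. Y x * xx x) = (LL x. flow x (grad xx x))"
   using T(3) by (subst (1 2) integral_completion) (use fm in auto)
 qed
 have hg: "IL (%x. hw (norm x) * norm (grad (Ph k) x))" for k by (rule young_integral(1)[OF gm(1) ig])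
 have hG: "IL (%x. hw (norm x) * norm (G x))" by (rule young_integral(1)[OF Gm iG])
 \<comment> \<open>The difference of two approximants is again a test function, so the bound with
   weight |Y| applies to it.\<close>
 have cauchy: "(NL x. ennreal (abs (Y x) * abs (Ph k x - Ph m x))) <= ennreal (I k + I m)" for k m
 proof -
  have dt: "test_fun (%x. Ph k x - Ph m x)" by (rule test_fun_diff[OF t(1) t(1)])
  have b: "norm (hw (norm x) * norm (grad (%x. Ph k x - Ph m x) x)) <= hw (norm x) * norm (v k x) + hw (norm x) * norm (v m x)" if "norm x ~= 0" for x
  proof -
   have "norm (grad (%x. Ph k x - Ph m x) x) <= norm (v k x) + norm (v m x)"
    unfolding grad_diff[OF t(1) t(1)] v_def using norm_triangle_ineq4[of "grad (Ph k) x - G x" "grad (Ph m) x - G x"] by simp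
   hence "hw (norm x) * norm (grad (%x. Ph k x - Ph m x) x) <= hw (norm x) * (norm (v k x) + norm (v m x))" using that by (intro mult_left_mono hw_nonneg) auto
   thus ?thesis using hw_nonneg[of "norm x"] that by (simp add: distrib_left abs_mult)
  qed
  have si: "IL (%x. hw (norm x) * norm (v k x) + hw (norm x) * norm (v m x))" by (intro integrable_sum2 hv)
  have gdm: "(%x. hw (norm x) * norm (grad (%x. Ph k x - Ph m x) x)) : LM"
   using gm(1)[of k] gm(1)[of m] unfolding grad_diff[OF t(1) t(1)] by measurable
  have i: "IL (%x. hw (norm x) * norm (grad (%x. Ph k x - Ph m x) x))"
   by (rule ibound[OF si gdm], rule eventually_mono[OF AE_nz]) (use b in "auto intro: order_trans[OF _ abs_ge_self]")
  have nn: "(NL x. ennreal (abs (Y x) * abs (Ph k x - Ph m x))) = ennreal (LL x. abs (Y x) * abs (Ph k x - Ph m x))"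
   by (rule nn_integral_eq_integral[OF tI(2)[OF dt i]]) simp
  have "(LL x. abs (Y x) * abs (Ph k x - Ph m x)) <= (LL x. hw (norm x) * norm (grad (%x. Ph k x - Ph m x) x))" by (rule tI(3)[OF dt i])
  also have "... <= (LL x. hw (norm x) * norm (v k x) + hw (norm x) * norm (v m x))"
   by (rule integral_mono_AE[OF i si], rule eventually_mono[OF AE_nz]) (use b in "auto intro: order_trans[OF abs_ge_self]")
  also have "... = I k + I m" unfolding I_def by (intro integral_sum2 hv)
  finally show ?thesis unfolding nn by (rule ennreal_leI)
 qed
 have YW: "EX C. ALL x. 1 / (real j + 1) <= norm x & norm x <= real j + 1 --> abs (Y x) <= C" for j :: nat
 proof -
  obtain D where D: "0 <= D" "!!x. abs (Y x) <= D * pw sg ee x" by (rule Y_bound) blast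
  define J where "J = real j + 1"
  have J: "1 <= J" by (simp add: J_def)
  have "abs (Y x) <= D * J powr (abs (sg - N) + abs (ee - N))" if x: "1 / J <= norm x" "norm x <= J" for x
  proof -
   have *: "norm x powr s <= J powr (abs s)" for s
   proof (cases "0 <= s")
    case True thus ?thesis using x by (simp add: powr_mono2)
   next
    case False
    have "norm x powr s <= (1 / J) powr s" using False x J by (intro powr_mono2') auto
    also have "... = J powr (abs s)" using False J by (simp add: powr_divide powr_minus_divide)
    finally show ?thesis .
   qed
   have "pw sg ee x <= J powr (abs (sg - N) + abs (ee - N))"
    unfolding pw_alt using J by (auto intro!: order_trans[OF *] powr_mono)
   thus ?thesis using D by (intro order_trans[OF D(2)] mult_left_mono) auto
  qed
  thus ?thesis unfolding J_def by blast
 qed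
 \<comment> \<open>Scalars are written as multiples of a unit vector, so that the estimate for
   vector fields applies, with weight 1 on the ball.\<close>
 define a where "a k x = (Ph k x - ph x) *R (axis undefined 1 :: real^'n)" for k x
 have na: "norm (a k x) = abs (Ph k x - ph x)" for k x by (simp add: a_def)
 have loc: "IL (%x. iB R x * abs (Ph k x - ph x))"
  "(%k. (LL x. iB R x * abs (Ph k x - ph x))) ----> 0" for R k
 proof -
  have am: "a k : LM" for k unfolding a_def[abs_def] using gm(2)[of k] by measurable
  have s: "(LINT x:cball 0 R|lebesgue. abs (Ph k x - ph x) ^ ?n) = (LL x. iB R x * norm (a k x) ^ ?n)" for k
   by (simp add: set_lebesgue_integral_def na)
  have i: "IL (%x. iB R x * norm (a k x) ^ ?n)" for k
  proof (rule integrable_energy_add)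
   show "IL (%x. iB R x * norm (ph x) ^ ?n)" using Lp unfolding LN_loc_def set_integrable_def by auto
   show "IL (%x. iB R x * norm (Ph k x) ^ ?n)"
    using locally_integrableD[OF locally_integrable_continuous, of "%x. abs (Ph k x) ^ ?n" R] test_fun_continuous[OF t(1), of k] by (simp add: continuous_intros)
   show "(%x. iB R x * norm (a k x) ^ ?n) : LM" using am[of k]
    by (intro borel_measurable_times borel_measurable_indicator borel_measurable_power borel_measurable_norm; simp)
  qed (auto simp: na)
  note L = L1_loc_of_energy[where B="iB R" and c=1 and R=R and w=a, OF zero_less_one _ am _ i]
  show "IL (%x. iB R x * abs (Ph k x - ph x))" "(%k. (LL x. iB R x * abs (Ph k x - ph x))) ----> 0"
   unfolding na[symmetric] by (rule L; use LN[OF compact_cball, of 0 R] in "simp add: s")+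
 qed
 have wl: "(NL x. ennreal (abs (Y x) * abs (Ph k x - ph x))) <= ennreal (I k)" for k
  by (rule nn_integral_weight_limit[where c=I]) (use gm(2) YW loc cauchy I0 Ip in auto)
 have Yd: "IL (%x. Y x * (Ph k x - ph x))" "abs (LL x. Y x * (Ph k x - ph x)) <= I k" for k
 proof -
  have [measurable]: "Ph k : LM" by (rule gm)
  have b: "(NL x. ennreal (norm (Y x * (Ph k x - ph x)))) <= ennreal (I k)" using wl[of k] by (simp add: abs_mult)
  show i: "IL (%x. Y x * (Ph k x - ph x))"
   by (rule integrableI_bounded) (use b in "auto intro: le_less_trans")
  have "ennreal (abs (LL x. Y x * (Ph k x - ph x))) <= ennreal (I k)"
   using integral_norm_bound_ennreal[OF i] b by simp
  thus "abs (LL x. Y x * (Ph k x - ph x)) <= I k" using Ip by simp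
 qed
 have YP: "IL (%x. Y x * Ph k x)" for k
  using tI(2)[OF t(1) hg] gm(2)[of k] by (intro integrable_abs_cancel[of _ "%x. Y x * Ph k x"]) (auto simp: abs_mult)
 have "(%x. Y x * Ph 0 x - Y x * (Ph 0 x - ph x)) = (%x. Y x * ph x)" by (simp add: algebra_simps fun_eq_iff)
 thus Yi: "IL (%x. Y x * ph x)" using integrable_sub[OF YP[of 0] Yd(1)[of 0]] by simp
 have fi: "IL (%x. flow x (w x))" "abs (LL x. flow x (w x)) <= ?c * (LL x. hw (norm x) * norm (w x))"
  if wm: "w : LM" and wi: "IL (%x. hw (norm x) * norm (w x))" for w
 proof -
  have b: "AE x in lebesgue. norm (flow x (w x)) <= ?c * (hw (norm x) * norm (w x))"
   by (rule eventually_mono[OF AE_nz]) (use flow_eq(2) in auto)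
  have ci: "IL (%x. ?c * (hw (norm x) * norm (w x)))" using wi by (rule integrable_mult_right)
  show i: "IL (%x. flow x (w x))"
   by (rule ibound[OF ci flow_meas[OF wm]], rule eventually_mono[OF b]) (auto intro: order_trans[OF _ abs_ge_self])
  show "abs (LL x. flow x (w x)) <= ?c * (LL x. hw (norm x) * norm (w x))"
   using order_trans[OF integral_abs_bound integral_mono_AE[OF integrable_abs[OF i] ci]] b by simp
 qed
 show "IL (%x. flow x (G x))" by (rule fi(1)[OF Gm hG])
 have "abs ((LL x. flow x (G x)) - ?c * (LL x. Y x * ph x)) <= 2 * ?c * I k" for k
 proof -
  have "(LL x. flow x (grad (Ph k) x)) - (LL x. flow x (G x)) = (LL x. flow x (grad (Ph k) x) - flow x (G x))"
   by (rule integral_sub[symmetric]) (rule fi(1)[OF gm(1) hg], rule fi(1)[OF Gm hG])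
  also have "... = (LL x. flow x (v k x))" by (simp add: flow_def v_def inner_diff_right right_diff_distrib)
  finally have 1: "abs ((LL x. flow x (grad (Ph k) x)) - (LL x. flow x (G x))) <= ?c * I k"
   using fi(2)[OF vm[of k] hv[of k]] by (simp add: I_def)
  have "(LL x. Y x * Ph k x) - (LL x. Y x * ph x) = (LL x. Y x * (Ph k x - ph x))"
   using integral_sub[OF YP[of k] Yi] by (simp add: right_diff_distrib)
  hence "abs (?c * (LL x. Y x * Ph k x) - ?c * (LL x. Y x * ph x)) <= ?c * I k"
   using Yd(2)[of k] C_N_pos by (simp add: right_diff_distrib[symmetric] abs_mult)
  thus ?thesis using 1 tI(4)[OF t(1) hg[of k]] by linarith
 qed
 moreover have "(%k. 2 * ?c * I k) ----> 2 * ?c * 0" by (intro tendsto_intros I0)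
 ultimately have "abs ((LL x. flow x (G x)) - ?c * (LL x. Y x * ph x)) <= 0" by (intro LIMSEQ_le_const) auto
 thus "(LL x. flow x (G x)) = ?c * (LL x. Y x * ph x)" by simp
qed


text \<open>Passing from Q0 and u to Q and \<open>sol\<close> changes the integrands at the origin
  only.\<close>

lemma solution:
 "sol : E_rad A & (ALL x. sol x > 0) & weak_solution A Q f sol &
  log_conv_exists (%x. Q (norm x) * F (sol x)) &
  IL (%x. log_conv (%y. Q (norm y) * F (sol y)) x * (Q (norm x) * F (sol x)))"
proof -
 define h where "h y = Q (norm y) * F (sol y)" for y
 have [measurable]: "(%x::real^'n. Q (norm x)) : BM" by (rule borel_measurable_restrict_pos[OF Q_cont])
 have hm[measurable]: "h : BM" unfolding h_def[abs_def] by measurable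
 have nz: "AE x in lebesgue. norm (x::real^'n) ~= 0" by (rule AE_completion[OF AE_norm_neq])
 have hH: "h y = H y" "Q (norm y) * f (sol y) = Q0 y * f (u y)" if "norm y ~= 0" for y using that by (auto simp: h_def H_def sol_def Q0_def)
 have lm: "(%y. lk x y * k y) : LM" if [measurable]: "k : BM" for k and x :: "real^'n"
  by (rule measurable_completion) measurable
 have lae: "AE y in lebesgue. lk x y * H y = lk x y * h y" for x :: "real^'n"
  by (rule eventually_mono[OF nz]) (simp add: hH(1))
 have lc: "log_conv h = log_conv H"
  unfolding log_conv_def by (intro ext integral_cong_AE[symmetric] lm hm H_meas lae)
 have ex: "log_conv_exists h"
  unfolding log_conv_exists_def
 proof (rule AE_I2)
  fix x :: "real^'n"
  have "IB (%y. lk x y * H y)" using pot_bound[of thesis for thesis] H_meas H_bound(1) by blast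
  hence "IL (%y. lk x y * H y)" by (subst integrable_completion) auto
  thus "IL (%y. lk x y * h y)" by (rule integrable_cong_AE_imp[OF _ lm[OF hm] lae])
 qed
 have w: "weak_solution A Q f sol"
 proof -
  have sm: "weak_gradient sol : LM"
   using weak_gradient_works[of sol] sol_E(1) by (auto simp: weakly_differentiable_def has_weak_gradient_def intro: locally_integrable_measurable)
  have main: "IL (%x. A (norm x) * norm (weak_gradient sol x) ^ (CARD('n) - 2) * (weak_gradient sol x .* weak_gradient ph x)) &
   IL (%x. log_conv h x * Q (norm x) * f (sol x) * ph x) &
   (LL x. A (norm x) * norm (weak_gradient sol x) ^ (CARD('n) - 2) * (weak_gradient sol x .* weak_gradient ph x))
    = C_N CARD('n) * (LL x. log_conv h x * Q (norm x) * f (sol x) * ph x)" if p: "ph : E_space A" for ph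
  proof -
   have wg: "has_weak_gradient ph (weak_gradient ph)" using p by (intro weak_gradient_works) (simp add: E_space_def finite_energy_def)
   hence gm[measurable]: "weak_gradient ph : LM" and pm[measurable]: "ph : LM"
    by (auto simp: has_weak_gradient_def intro: locally_integrable_measurable)
   note wf = weak_form[OF p wg]
   have l: "AE x in lebesgue. flow x (weak_gradient ph x) = A (norm x) * norm (weak_gradient sol x) ^ (CARD('n) - 2) * (weak_gradient sol x .* weak_gradient ph x)"
    using weak_gradient_AE[OF sol_E(1)] by (rule eventually_mono) (simp add: flow_def)
   have r: "AE x in lebesgue. Y x * ph x = log_conv h x * Q (norm x) * f (sol x) * ph x"
    by (rule eventually_mono[OF nz]) (simp add: Y_def lc hH(2)[symmetric] mult.assoc)
   have lmm: "(%x. A (norm x) * norm (weak_gradient sol x) ^ (CARD('n) - 2) * (weak_gradient sol x .* weak_gradient ph x)) : LM"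
    using sm by measurable
   have bm: "(%x. log_conv h x * Q (norm x) * f (sol x)) : LM" by (rule measurable_completion) measurable
   have rm: "(%x. log_conv h x * Q (norm x) * f (sol x) * ph x) : LM" by (rule borel_measurable_times[OF bm pm])
   show ?thesis
    using integrable_cong_AE_imp[OF wf(1) lmm l] integrable_cong_AE_imp[OF wf(2) rm r] wf(3)
     integral_cong_AE[OF flow_meas[OF gm] lmm l] integral_cong_AE[OF borel_measurable_integrable[OF wf(2)] rm r] by simp
  qed
  show ?thesis unfolding weak_solution_def Let_def using sol_E(2) ex main unfolding h_def by blast
 qed
 have "IL (%x. log_conv h x * h x)"
 proof -
  have "IB (%x. log_conv H x * H x)"
   by (rule log_form[OF sg e2_neg]) (use H_meas H_bound(1) in blast)
  hence i: "IL (%x. log_conv H x * H x)" by (subst integrable_completion) auto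
  have m: "(%x. log_conv h x * h x) : LM" by (rule measurable_completion) measurable
  have "AE x in lebesgue. log_conv H x * H x = log_conv h x * h x" by (rule eventually_mono[OF nz]) (simp add: lc hH(1))
  thus ?thesis by (rule integrable_cong_AE_imp[OF i m])
 qed
 moreover have "sol : E_rad A" using sol_E(2) by (auto simp: E_rad_def sol_def th_def)
 moreover have "sol x > 0" for x using U_pos[OF theta_pos] by (simp add: sol_def)
 ultimately show ?thesis using w ex unfolding h_def by blast
qed

end

section \<open>Existence and the choice of mu-bar\<close>

lemma (in choquard) existence:
 "EX u :: real^'n => real. u : E_rad A & (ALL x. u x > 0) & weak_solution A Q f u &
  log_conv_exists (%x. Q (norm x) * F (u x)) &
  IL (%x. log_conv (%y. Q (norm y) * F (u y)) x * (Q (norm x) * F (u x)))"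
proof -
 let ?n = "CARD('n)"
 obtain a B et Kf dl n d where P: "0 < a" "0 <= B" "0 <= et" "et < ka * (b0 + N)" "0 <= Kf"
  "!!k. 0 < dl k" "dl ----> 0" "filterlim (%k. dl k * real (n k)) at_top sequentially"
  "!!k. EE (dl k) (n k) (d k) <= B ^ ?n" "!!k. a <= JJ (dl k) (n k) (Km (dl k) (n k)) (d k)"
  "!!k j. j : {1..n k} ==> abs (gg (dl k) (n k) (Km (dl k) (n k)) (d k) j) <= dl k / (real k + 1)"
  "!!k. (SUM j:{1..n k}. abs (gg (dl k) (n k) (Km (dl k) (n k)) (d k) j * d k j)) <= (1 + B ^ ?n) / (real k + 1)"
  "!!k x. x ~= 0 ==> f (uu (dl k) (n k) (d k) x) <= Kf * gro et (th x)"
  by (rule approximate_solutions) blast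
 obtain sg K where K: "0 < sg" "0 <= K" "!!x. Q0 x * gro et (th x) <= K * pw sg e1 x"
  "!!x. Q0 x * (th x powr (p / N') * exp (et * th x)) <= K * pw sg e2 x" by (rule Q0_maj[OF P(3,4)]) blast
 obtain r U where r: "strict_mono (r :: nat => nat)" "!!t. 0 < t ==> (%k. Ut (dl (r k)) (n (r k)) (d (r k)) t) ----> U t"
  by (rule step_limit[of dl n d B, OF P(6,7,9,2)]) blast
 let ?g = "%k. gg (dl (r k)) (n (r k)) (Km (dl (r k)) (n (r k))) (d (r k))"
 \<comment> \<open>Along the subsequence the tolerances 1/(r k + 1) only improve, since r k >=
   k.\<close>
 have rk: "real k + 1 <= real (r k) + 1" for k using seq_suble[OF r(1), of k] by simp
 interpret choquard_limit A Q f A0 l r0 L b0 b al0 p ta C CQ ty N om N' a B et Kf sg K "%k. dl (r k)" "%k. n (r k)" "%k. d (r k)" U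
 proof unfold_locales
  show "(%k. dl (r k)) ----> 0" using LIMSEQ_subseq_LIMSEQ[OF P(7) r(1)] by (simp add: o_def)
  show "filterlim (%k. dl (r k) * real (n (r k))) at_top sequentially"
   by (rule filterlim_compose[OF P(8) filterlim_subseq[OF r(1)]])
  show "abs (?g k j) <= dl (r k) / (real k + 1)" if "j : {1..n (r k)}" for k j
   by (rule order_trans[OF P(11)[OF that] divide_left_mono[OF rk]]) (use P(6)[of "r k"] in auto)
  show "(%k. SUM j:{1..n (r k)}. abs (?g k j * d (r k) j)) ----> 0"
  proof (rule Lim_null_comparison)
   show "EV k. norm (SUM j:{1..n (r k)}. abs (?g k j * d (r k) j)) <= (1 + B ^ ?n) / (real k + 1)"
   proof (intro always_eventually allI)
    fix k
    have "(1 + B ^ ?n) / (real (r k) + 1) <= (1 + B ^ ?n) / (real k + 1)"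
     by (rule divide_left_mono[OF rk]) (use P(2) in auto)
    thus "norm (SUM j:{1..n (r k)}. abs (?g k j * d (r k) j)) <= (1 + B ^ ?n) / (real k + 1)"
     using P(12)[of "r k"] by (simp add: sum_nonneg)
   qed
   show "(%k. (1 + B ^ ?n) / (real k + 1)) ----> 0"
    using LIMSEQ_ignore_initial_segment[OF lim_const_over_n[of "1 + B ^ ?n"], of 1] by (simp add: add.commute)
  qed
 qed (use P K r in auto)
 show ?thesis using solution by blast
qed

text \<open>For \<open>b0 < 0\<close> the exponent \<open>b0_tilde\<close> is strictly increasing in \<open>\<mu>0\<close>, so by this lemma condition
 \<open>cond_Q'\<close> holds for at most one \<open>\<mu>0\<close>, and any smaller \<open>\<mu>bar\<close> makes the statement vacuous.\<close>
lemma Liminf_powr_exponent_unique: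
 fixes Q :: "real => real"
 assumes 1: "Liminf (at_right 0) (%r. ereal (Q r / r powr s)) = ereal C1" "0 < C1"
  and 2: "Liminf (at_right 0) (%r. ereal (Q r / r powr t)) = ereal C2"
 shows "t <= s"
proof (rule ccontr)
 assume "~ t <= s"
 hence st: "0 < t - s" by simp
 define y where "y = (abs C2 + 1) / (C1 / 2)"
 have y: "0 < y" using 1(2) by (simp add: y_def add_nonneg_pos)
 have "\<forall>\<^sub>F r in at_right 0. ereal (C1 / 2) < ereal (Q r / r powr s)"
  by (rule less_LiminfD) (use 1 in simp)
 moreover have "\<forall>\<^sub>F r in at_right 0. r < y powr (- 1 / (t - s))" by (rule eventually_mono[OF eventually_at_right_real[of 0 "y powr (- 1 / (t - s))"]]) (use y in auto)
 ultimately have "\<forall>\<^sub>F r in at_right 0. ereal (C2 + 1) <= ereal (Q r / r powr t)"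
  using eventually_at_right_less[of 0]
 proof eventually_elim
  case (elim r)
  have "(y powr (- 1 / (t - s))) powr (s - t) <= r powr (s - t)" using elim st by (intro powr_mono2') auto
  moreover have "(y powr (- 1 / (t - s))) powr (s - t) = y"
  proof -
   have "- 1 / (t - s) * (s - t) = 1" using st by (simp add: field_simps)
   thus ?thesis using y by (simp add: powr_powr)
  qed
  ultimately have "y <= r powr (s - t)" by simp
  moreover have q: "C1 / 2 <= Q r / r powr s" using elim(1) by simp
  moreover have "0 <= Q r / r powr s" using 1(2) by (intro order_trans[OF _ q]) simp
  ultimately have "C1 / 2 * y <= Q r / r powr s * r powr (s - t)" using y by (intro mult_mono) auto
  also have "... = Q r / r powr t" using elim(3) by (simp add: powr_diff)
  finally have "C1 / 2 * y <= Q r / r powr t" .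
  moreover have "C1 / 2 * y = abs C2 + 1" using 1(2) by (simp add: y_def)
  ultimately show ?case unfolding ereal_less_eq by linarith
 qed
 hence "ereal (C2 + 1) <= Liminf (at_right 0) (%r. ereal (Q r / r powr t))" by (rule Liminf_bounded)
 thus False unfolding 2 by simp
qed

theorem theorem1p1:
  fixes A Q f :: "real \<Rightarrow> real"
    and A0 l r0 L b0 b \<alpha>0 p \<tau> C :: real
  assumes "CARD('n::finite) \<ge> 2"
    and "cond_A A A0 l"
    and "cond_A' A A0 l r0 L"
    and "cond_Q CARD('n) Q b0 b"
    and "continuous_on UNIV f" and "\<forall>t>0. f differentiable (at t)"
    and "cond_f0 f"
    and "cond_f1 CARD('n) f \<alpha>0"
    and "cond_f2 CARD('n) f b l p"
    and "cond_f3 CARD('n) f \<tau> C"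
    and "cond_f4 f"
  shows "\<exists>\<mu>bar. 0 < \<mu>bar \<and> \<mu>bar \<le> 1 \<and>
    (\<forall>\<mu>0 CQ. 0 < \<mu>0 \<and> \<mu>0 < \<mu>bar \<longrightarrow>
       cond_Q' CARD('n) Q b0 \<mu>0 CQ \<longrightarrow>
       cond_f5 CARD('n) (sphere_measure (sphere (0 :: real^'n) 1)) Q f \<alpha>0 A0 r0 L
         (b0_tilde CARD('n) b0 \<mu>0) CQ \<longrightarrow>
       (\<exists>u :: real^'n \<Rightarrow> real.
          u \<in> E_rad A \<and> (\<forall>x. u x > 0) \<and> weak_solution A Q f u \<and>
          log_conv_exists (\<lambda>x. Q (norm x) * primitive f (u x)) \<and>
          integrable lebesgue (\<lambda>x. log_conv (\<lambda>y. Q (norm y) * primitive f (u y)) x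
                                   * (Q (norm x) * primitive f (u x)))))"
proof (cases "0 \<le> b0")
  case True
  have "\<exists>u :: real^'n \<Rightarrow> real.
          u \<in> E_rad A \<and> (\<forall>x. u x > 0) \<and> weak_solution A Q f u \<and>
          log_conv_exists (\<lambda>x. Q (norm x) * primitive f (u x)) \<and>
          integrable lebesgue (\<lambda>x. log_conv (\<lambda>y. Q (norm y) * primitive f (u y)) x
                                   * (Q (norm x) * primitive f (u x)))"
    if \<mu>: "0 < \<mu>0" and Q': "cond_Q' CARD('n) Q b0 \<mu>0 CQ"
      and f5: "cond_f5 CARD('n) (sphere_measure (sphere (0 :: real^'n) 1)) Q f \<alpha>0 A0 r0 L (b0_tilde CARD('n) b0 \<mu>0) CQ"
    for \<mu>0 CQ
  proof -
    have "b0 * (1 - \<mu>0 / (2 * real CARD('n))) \<le> b0 * 1" using True \<mu> by (intro mult_left_mono) auto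
    then have bt: "b0_tilde CARD('n) b0 \<mu>0 = b0" by (simp add: b0_tilde_def)
    interpret choquard A Q f A0 l r0 L b0 b \<alpha>0 p \<tau> C CQ "TYPE('n)" "real CARD('n)" "sph TYPE('n)" "real CARD('n) / (real CARD('n) - 1)"
      by unfold_locales (use assms True Q' f5 in \<open>auto simp: bt cond_Q'_def sphere_measure_eq_sph\<close>)
    show ?thesis by (rule existence)
  qed
  then show ?thesis by (intro exI[of _ 1]) auto
next
  case False
  have mono: "b0_tilde CARD('n) b0 \<mu>1 < b0_tilde CARD('n) b0 \<mu>2" if "0 < \<mu>1" "\<mu>1 < \<mu>2" for \<mu>1 \<mu>2
  proof -
    have N: "0 < 2 * real CARD('n)" by simp
    have "b0_tilde CARD('n) b0 \<mu> = b0 + - b0 * (\<mu> / (2 * real CARD('n)))" if "0 < \<mu>" for \<mu>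
    proof -
      have "0 \<le> - b0 * (\<mu> / (2 * real CARD('n)))" using False that N by (intro mult_nonneg_nonneg) auto
      then show ?thesis by (simp add: b0_tilde_def max_def right_diff_distrib)
    qed
    moreover have "- b0 * (\<mu>1 / (2 * real CARD('n))) < - b0 * (\<mu>2 / (2 * real CARD('n)))"
      using False that N by (intro mult_strict_left_mono divide_strict_right_mono) auto
    ultimately show ?thesis using that by simp
  qed
  show ?thesis
  proof (cases "\<exists>\<mu>1 CQ. 0 < \<mu>1 \<and> cond_Q' CARD('n) Q b0 \<mu>1 CQ")
    case True
    then obtain \<mu>1 C1 where 1: "0 < \<mu>1" "cond_Q' CARD('n) Q b0 \<mu>1 C1" by blast
    have "\<not> cond_Q' CARD('n) Q b0 \<mu>0 C0" if "0 < \<mu>0" "\<mu>0 < min 1 \<mu>1" for \<mu>0 C0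
    proof
      assume "cond_Q' CARD('n) Q b0 \<mu>0 C0"
      then have "b0_tilde CARD('n) b0 \<mu>1 \<le> b0_tilde CARD('n) b0 \<mu>0"
        using 1(2) Liminf_powr_exponent_unique unfolding cond_Q'_def by blast
      then show False using mono[of \<mu>0 \<mu>1] that by simp
    qed
    then show ?thesis using 1(1) by (intro exI[of _ "min 1 \<mu>1"]) auto
  next
    case False
    then show ?thesis by (intro exI[of _ 1]) auto
  qed
qed

end
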